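(* Let $d$ be a positive integer, let $\tau\in\mathbb{T}^d$ and let $\varphi\in\mathcal{SA}_d$ be such that $\tau$ is a carapoint for $\varphi$. Then there exists a desingularized model $(\mathcal{M},u,I)$ of $\varphi$ relative to $\tau$. Furthermore, $I$ can be expressed in the form $$I(\lambda)=1_{\mathcal{M}}-\left(\frac{\mathbf{1}}{\mathbf{1}-\overline{\tau}\lambda}\right)_Y^{-1}\quad\text{for }\lambda\in\mathbb{D}^d,$$ for some $d$-tuple $Y=(Y_1,\dots,Y_d)$ of positive contractions on $\mathcal{M}$ such that $\sum_{j=1}^d Y_j=1_{\mathcal{M}}$. At every point $\lambda\in\mathbb{T}^d$ such that $\lambda_j\neq\tau_j$ for $j=1,\dots,d$, $I$ extends analytically to $\lambda$ and $\|I(\lambda)\|_{\mathcal{B}(\mathcal{M})}=1$.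
   Context: $\mathbb{D}$ is the open unit disc, $\mathbb{T}$ the unit circle, $\|\lambda\|_\infty=\max_j|\lambda_j|$ on $\mathbb{C}^d$. $\mathcal{B}(\mathcal{M})$ is the algebra of bounded linear operators on the Hilbert space $\mathcal{M}$ with the operator norm; "positive" means positive semidefinite. Schur-Agler class: $\mathcal{SA}_d$ is the set of analytic $\varphi:\mathbb{D}^d\to\mathbb{C}$ such that $\sup_{0<r<1}\|\varphi(rT_1,\dots,rT_d)\|\le 1$ for every commuting $d$-tuple $(T_1,\dots,T_d)$ of contractions on any complex Hilbert space. Carapoints: $\tau$ is a carapoint for $\varphi$ if $\liminf_{\lambda\to\tau,\lambda\in\mathbb{D}^d}\frac{1-|\varphi(\lambda)|}{1-\|\lambda\|_\infty}<\infty$. For a contractive operator-valued analytic function $I$ on $\mathbb{D}^d$, $\tau$ is a carapoint for $I$ if $\liminf_{\lambda\to\tau}\frac{1-\|I(\lambda)\|}{1-\|\lambda\|_\infty}<\infty$. Non-tangential approach: a set $S\subseteq\mathbb{D}^d$ with $\tau\in\overline{S}$ approaches $\tau$ non-tangentially if there is $c>0$ with $\|\lambda-\tau\|_\infty\le c(1-\|\lambda\|_\infty)$ for all $\lambda\in S$. A limit as $\lambda\to\tau$ non-tangentially (written $\lambda\overset{nt}{\to}\tau$) means the limit as $\lambda\to\tau$ within $S$, for every $S$ approaching $\tau$ non-tangentially. Generalized model: a triple $(\mathcal{M},u,I)$ where $\mathcal{M}$ is a separable complex Hilbert space, $u:\mathbb{D}^d\to\mathcal{M}$ is analytic, $I:\mathbb{D}^d\to\mathcal{B}(\mathcal{M})$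 is analytic with $\|I(\lambda)\|<1$ for all $\lambda\in\mathbb{D}^d$, and $1-\overline{\varphi(\mu)}\varphi(\lambda)=\langle(1_{\mathcal{M}}-I(\mu)^*I(\lambda))u(\lambda),u(\mu)\rangle_{\mathcal{M}}$ for all $\lambda,\mu\in\mathbb{D}^d$. $\tau$ is a $C$-point of $(\mathcal{M},u,I)$ if, for every $S\subseteq\mathbb{D}^d$ approaching $\tau$ non-tangentially, $u$ extends continuously to $S\cup\{\tau\}$ with respect to the norm of $\mathcal{M}$. $I:\mathbb{D}^d\to\mathcal{B}(\mathcal{M})$ (analytic) is inner if for almost every $\lambda\in\mathbb{T}^d$ (Lebesgue measure) the radial limit $\lim_{r\to1^-}I(r\lambda)$ exists in the strong operator topology and is an isometry. A desingularized model of $\varphi$ relative to $\tau$ is a generalized model $(\mathcal{M},u,I)$ of $\varphi$ such that: (1) $\tau$ is a $C$-point for $(\mathcal{M},u,I)$; (2) $\tau$ is a carapoint for $I$ and $\lim_{\lambda\overset{nt}{\to}\tau}I(\lambda)=1_{\mathcal{M}}$; (3) $I$ is inner. Notation: operations on $\mathbb{C}^d$ are coordinatewise with $\mathbf{1}=(1,\dots,1)$. For $z\in\mathbb{C}^d$ and operators $Y=(Y_1,\dots,Y_d)$, $z_Y=\sum_j z_jY_j$. Hence $\left(\frac{\mathbf{1}}{\mathbf{1}-\overline{\tau}\lambda}\right)_Y^{-1}=\left(\sum_{j=1}^d\frac{1}{1-\overline{\tau_j}\lambda_j}Y_j\right)^{-1}$. $I$ extends analytically to $\lambda\in\mathbb{T}^d$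 if there are an open neighbourhood $U$ of $\lambda$ and an analytic $\mathcal{B}(\mathcal{M})$-valued function $F$ on $U$ agreeing with $I$ on $U\cap\mathbb{D}^d$; $I(\lambda)$ then denotes $F(\lambda)$. *)

theory Defs
  imports "HOL-Analysis.Analysis"
begin

section \<open>Complex normed spaces and complex Hilbert spaces\<close>

class complex_normed_vector = real_normed_vector +
  fixes scaleC :: "complex \<Rightarrow> 'a \<Rightarrow> 'a" (infixr \<open>*\<^sub>C\<close> 75)
  assumes scaleC_add_right: "c *\<^sub>C (x + y) = c *\<^sub>C x + c *\<^sub>C y"
    and scaleC_add_left: "(b + c) *\<^sub>C x = b *\<^sub>C x + c *\<^sub>C x"
    and scaleC_scaleC: "b *\<^sub>C c *\<^sub>C x = (b * c) *\<^sub>C x"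
    and scaleR_scaleC: "r *\<^sub>R x = complex_of_real r *\<^sub>C x"
    and norm_scaleC: "norm (c *\<^sub>C x) = cmod c * norm x"

instantiation complex :: complex_normed_vector
begin

definition scaleC_complex :: "complex \<Rightarrow> complex \<Rightarrow> complex"
  where "scaleC_complex c z = c * z"

instance
  by standard (auto simp: scaleC_complex_def algebra_simps norm_mult scaleR_conv_of_real)

end

lemma bounded_linear_scaleC: "bounded_linear (\<lambda>x::'a::complex_normed_vector. c *\<^sub>C x)"
proof (rule bounded_linear_intro)
  show "c *\<^sub>C (r *\<^sub>R x) = r *\<^sub>R (c *\<^sub>C x)" for r and x :: 'a
    by (simp add: scaleR_scaleC scaleC_scaleC mult.commute)
  show "norm (c *\<^sub>C x) \<le> norm x * cmod c" for x :: 'a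
    by (simp add: norm_scaleC mult.commute)
qed (simp add: scaleC_add_right)

instantiation blinfun :: (real_normed_vector, complex_normed_vector) complex_normed_vector
begin

lift_definition scaleC_blinfun :: "complex \<Rightarrow> 'a \<Rightarrow>\<^sub>L 'b \<Rightarrow> 'a \<Rightarrow>\<^sub>L 'b"
  is "\<lambda>c A x. c *\<^sub>C A x"
  by (rule bounded_linear_compose[OF bounded_linear_scaleC])

instance
proof
  fix b c :: complex and r :: real and A B :: "'a \<Rightarrow>\<^sub>L 'b"
  show "c *\<^sub>C (A + B) = c *\<^sub>C A + c *\<^sub>C B"
    by transfer (simp add: scaleC_add_right)
  show "(b + c) *\<^sub>C A = b *\<^sub>C A + c *\<^sub>C A"
    by transfer (simp add: scaleC_add_left)
  show "b *\<^sub>C c *\<^sub>C A = (b * c) *\<^sub>C A"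
    by transfer (simp add: scaleC_scaleC)
  show "r *\<^sub>R A = complex_of_real r *\<^sub>C A"
    by transfer (simp add: scaleR_scaleC)
  have le: "norm (c *\<^sub>C A) \<le> cmod c * norm A" for c and A :: "'a \<Rightarrow>\<^sub>L 'b"
  proof (rule norm_blinfun_bound)
    fix x
    have "norm (blinfun_apply (c *\<^sub>C A) x) = cmod c * norm (blinfun_apply A x)"
      by (simp add: scaleC_blinfun.rep_eq norm_scaleC)
    also have "\<dots> \<le> cmod c * (norm A * norm x)"
      by (intro mult_left_mono norm_blinfun) auto
    finally show "norm (blinfun_apply (c *\<^sub>C A) x) \<le> cmod c * norm A * norm x"
      by (simp add: mult.assoc)
  qed simp
  show "norm (c *\<^sub>C A) = cmod c * norm A"
  proof (cases "c = 0")
    case True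
    then show ?thesis using le[of c A] by simp
  next
    case False
    have one: "1 *\<^sub>C y = y" for y :: 'b
      using scaleR_scaleC[of 1 y] by simp
    have "A = inverse c *\<^sub>C (c *\<^sub>C A)"
      using False by (intro blinfun_eqI) (simp add: scaleC_blinfun.rep_eq scaleC_scaleC one)
    then have "norm A \<le> cmod (inverse c) * norm (c *\<^sub>C A)"
      using le[of "inverse c" "c *\<^sub>C A"] by simp
    then have "norm A \<le> norm (c *\<^sub>C A) / cmod c"
      by (simp only: norm_inverse divide_inverse mult.commute)
    then have "cmod c * norm A \<le> norm (c *\<^sub>C A)"
      using False by (simp add: pos_le_divide_eq mult.commute)
    with le[of c A] show ?thesis by simp
  qed
qed

end

text \<open>The inner product is linear in the first and conjugate linear in the second argument.\<close>

class complex_hilbert = complex_normed_vector + real_inner + banach +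
  fixes cinner :: "'a \<Rightarrow> 'a \<Rightarrow> complex"
  assumes cinner_add_left: "cinner (x + y) z = cinner x z + cinner y z"
    and cinner_scaleC_left: "cinner (c *\<^sub>C x) y = c * cinner x y"
    and cinner_commute: "cinner x y = cnj (cinner y x)"
    and inner_eq_Re_cinner: "inner x y = Re (cinner x y)"


section \<open>The Hilbert space of square-summable sequences\<close>

typedef ell2 = "{x :: nat \<Rightarrow> complex. summable (\<lambda>n. (cmod (x n))\<^sup>2)}"
  morphisms ell2_nth Abs_ell2
  by (rule exI[of _ "\<lambda>_. 0"]) simp

setup_lifting type_definition_ell2

lemma ell2_nth_summable: "summable (\<lambda>n. (cmod (ell2_nth x n))\<^sup>2)"
  using ell2_nth[of x] by simp

lemma ell2_eqI: "(\<And>n. ell2_nth x n = ell2_nth y n) \<Longrightarrow> x = y"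
  by transfer auto

lemma summable_sq_add:
  fixes x y :: "nat \<Rightarrow> complex"
  assumes "summable (\<lambda>n. (cmod (x n))\<^sup>2)" "summable (\<lambda>n. (cmod (y n))\<^sup>2)"
  shows "summable (\<lambda>n. (cmod (x n + y n))\<^sup>2)"
proof (rule summable_comparison_test')
  show "summable (\<lambda>n. 2 * (cmod (x n))\<^sup>2 + 2 * (cmod (y n))\<^sup>2)"
    using assms by (intro summable_add summable_mult)
  fix n :: nat
  have "(cmod (x n + y n))\<^sup>2 \<le> (cmod (x n) + cmod (y n))\<^sup>2"
    by (intro power_mono norm_triangle_ineq) simp
  also have "\<dots> \<le> 2 * (cmod (x n))\<^sup>2 + 2 * (cmod (y n))\<^sup>2"
    using sum_squares_bound[of "cmod (x n)" "cmod (y n)"] by (simp add: power2_sum)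
  finally show "norm ((cmod (x n + y n))\<^sup>2) \<le> 2 * (cmod (x n))\<^sup>2 + 2 * (cmod (y n))\<^sup>2"
    by simp
qed

lemma summable_sq_mult:
  fixes x :: "nat \<Rightarrow> complex"
  assumes "summable (\<lambda>n. (cmod (x n))\<^sup>2)"
  shows "summable (\<lambda>n. (cmod (c * x n))\<^sup>2)"
  using summable_mult[OF assms, of "(cmod c)\<^sup>2"] by (simp add: norm_mult power_mult_distrib)

lemma ell2_cinner_summable: "summable (\<lambda>n. ell2_nth x n * cnj (ell2_nth y n))"
proof (rule summable_comparison_test')
  show "summable (\<lambda>n. (cmod (ell2_nth x n))\<^sup>2 + (cmod (ell2_nth y n))\<^sup>2)"
    by (intro summable_add ell2_nth_summable)
  show "norm (ell2_nth x n * cnj (ell2_nth y n)) \<le> (cmod (ell2_nth x n))\<^sup>2 + (cmod (ell2_nth y n))\<^sup>2"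
    for n
  proof -
    have "0 \<le> cmod (ell2_nth x n) * cmod (ell2_nth y n)" by simp
    then show ?thesis
      using sum_squares_bound[of "cmod (ell2_nth x n)" "cmod (ell2_nth y n)"]
      unfolding norm_mult complex_mod_cnj by linarith
  qed
qed

instantiation ell2 :: real_vector
begin

lift_definition zero_ell2 :: ell2 is "\<lambda>_. 0" by simp
lift_definition plus_ell2 :: "ell2 \<Rightarrow> ell2 \<Rightarrow> ell2" is "\<lambda>x y n. x n + y n"
  by (rule summable_sq_add)
lift_definition uminus_ell2 :: "ell2 \<Rightarrow> ell2" is "\<lambda>x n. - x n" by simp
lift_definition minus_ell2 :: "ell2 \<Rightarrow> ell2 \<Rightarrow> ell2" is "\<lambda>x y n. x n - y n"
  using summable_sq_add[where y = "\<lambda>n. - y n" for y] by simp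
lift_definition scaleR_ell2 :: "real \<Rightarrow> ell2 \<Rightarrow> ell2" is "\<lambda>r x n. complex_of_real r * x n"
  by (rule summable_sq_mult)

instance
  by standard (transfer, auto simp: algebra_simps)+

end

instantiation ell2 :: real_inner
begin

definition inner_ell2 :: "ell2 \<Rightarrow> ell2 \<Rightarrow> real"
  where "inner_ell2 x y = Re (\<Sum>n. ell2_nth x n * cnj (ell2_nth y n))"
definition norm_ell2 :: "ell2 \<Rightarrow> real"
  where "norm_ell2 x = sqrt (inner x x)"
definition dist_ell2 :: "ell2 \<Rightarrow> ell2 \<Rightarrow> real"
  where "dist_ell2 x y = norm (x - y)"
definition sgn_ell2 :: "ell2 \<Rightarrow> ell2"
  where "sgn_ell2 x = inverse (norm x) *\<^sub>R x"
definition uniformity_ell2 :: "(ell2 \<times> ell2) filter"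
  where "uniformity_ell2 = (INF e\<in>{0<..}. principal {(x, y). dist x y < e})"
definition open_ell2 :: "ell2 set \<Rightarrow> bool"
  where "open_ell2 U = (\<forall>x\<in>U. eventually (\<lambda>(x', y). x' = x \<longrightarrow> y \<in> U) uniformity)"

lemma inner_ell2_alt: "inner x y = (\<Sum>n. Re (ell2_nth x n * cnj (ell2_nth y n)))" for x y :: ell2
  unfolding inner_ell2_def
  by (rule bounded_linear.suminf[OF bounded_linear_Re ell2_cinner_summable])

lemma inner_ell2_self: "inner x x = (\<Sum>n. (cmod (ell2_nth x n))\<^sup>2)" for x :: ell2
  unfolding inner_ell2_alt by (simp add: complex_mult_cnj cmod_power2)

instance
proof
  fix x y z :: ell2 and r :: real
  have sR: "summable (\<lambda>n. Re (ell2_nth x n * cnj (ell2_nth y n)))" for x y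
    by (rule bounded_linear.summable[OF bounded_linear_Re ell2_cinner_summable])
  show "inner x y = inner y x"
    unfolding inner_ell2_alt by (simp add: algebra_simps)
  show "inner (x + y) z = inner x z + inner y z"
    unfolding inner_ell2_alt suminf_add[OF sR sR]
    by (simp add: plus_ell2.rep_eq distrib_right)
  show "inner (r *\<^sub>R x) y = r * inner x y"
    unfolding inner_ell2_alt suminf_mult[OF sR, symmetric]
    by (simp add: scaleR_ell2.rep_eq algebra_simps)
  show "0 \<le> inner x x"
    unfolding inner_ell2_self by (intro suminf_nonneg ell2_nth_summable) simp
  show "(inner x x = 0) = (x = 0)"
    unfolding inner_ell2_self
    by (subst suminf_eq_zero_iff[OF ell2_nth_summable])
       (auto intro: ell2_eqI simp: zero_ell2.rep_eq)
qed (simp_all add: norm_ell2_def dist_ell2_def sgn_ell2_def uniformity_ell2_def open_ell2_def)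

end

lemma norm_ell2_sq: "(norm x)\<^sup>2 = (\<Sum>n. (cmod (ell2_nth x n))\<^sup>2)" for x :: ell2
  by (simp add: power2_norm_eq_inner inner_ell2_self)

lemma ell2_sum_le_norm_sq: "(\<Sum>n<N. (cmod (ell2_nth x n))\<^sup>2) \<le> (norm x)\<^sup>2"
  unfolding norm_ell2_sq by (rule sum_le_suminf[OF ell2_nth_summable]) auto

lemma cmod_ell2_nth_le: "cmod (ell2_nth x n) \<le> norm x"
proof (rule power2_le_imp_le)
  have "(cmod (ell2_nth x n))\<^sup>2 \<le> (\<Sum>k<Suc n. (cmod (ell2_nth x k))\<^sup>2)"
    by (intro member_le_sum) auto
  then show "(cmod (ell2_nth x n))\<^sup>2 \<le> (norm x)\<^sup>2"
    using ell2_sum_le_norm_sq[of x "Suc n"] by linarith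
qed simp

instance ell2 :: banach
proof
  fix X :: "nat \<Rightarrow> ell2"
  assume X: "Cauchy X"
  define y where "y n = lim (\<lambda>m. ell2_nth (X m) n)" for n
  have lim: "(\<lambda>m. ell2_nth (X m) n) \<longlonglongrightarrow> y n" for n
  proof -
    have "Cauchy (\<lambda>m. ell2_nth (X m) n)"
    proof (rule metric_CauchyI)
      fix e :: real assume "e > 0"
      then obtain M where M: "\<And>i j. i \<ge> M \<Longrightarrow> j \<ge> M \<Longrightarrow> dist (X i) (X j) < e"
        using X unfolding Cauchy_def by blast
      have "dist (ell2_nth (X i) n) (ell2_nth (X j) n) \<le> dist (X i) (X j)" for i j
        using cmod_ell2_nth_le[of "X i - X j" n] by (simp add: dist_norm minus_ell2.rep_eq)
      then show "\<exists>M. \<forall>i\<ge>M. \<forall>j\<ge>M. dist (ell2_nth (X i) n) (ell2_nth (X j) n) < e"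
        using M by (meson le_less_trans)
    qed
    then show ?thesis
      unfolding y_def by (simp add: Cauchy_convergent_iff convergent_LIMSEQ_iff)
  qed
  have tail: "\<exists>M. \<forall>i\<ge>M. \<forall>N. (\<Sum>n<N. (cmod (ell2_nth (X i) n - y n))\<^sup>2) \<le> e\<^sup>2" if "e > 0" for e
  proof -
    obtain M where M: "\<And>i j. i \<ge> M \<Longrightarrow> j \<ge> M \<Longrightarrow> dist (X i) (X j) < e"
      using X \<open>e > 0\<close> unfolding Cauchy_def by blast
    have "(\<Sum>n<N. (cmod (ell2_nth (X i) n - y n))\<^sup>2) \<le> e\<^sup>2" if "i \<ge> M" for i N
    proof (rule tendsto_upperbound)
      show "(\<lambda>j. \<Sum>n<N. (cmod (ell2_nth (X i) n - ell2_nth (X j) n))\<^sup>2)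
          \<longlonglongrightarrow> (\<Sum>n<N. (cmod (ell2_nth (X i) n - y n))\<^sup>2)"
        by (intro tendsto_intros lim)
      show "\<forall>\<^sub>F j in sequentially. (\<Sum>n<N. (cmod (ell2_nth (X i) n - ell2_nth (X j) n))\<^sup>2) \<le> e\<^sup>2"
        using eventually_ge_at_top[of M]
      proof eventually_elim
        case (elim j)
        have "(norm (X i - X j))\<^sup>2 \<le> e\<^sup>2"
          using M[OF that elim] by (intro power_mono) (auto simp: dist_norm)
        then show ?case
          using ell2_sum_le_norm_sq[of "X i - X j" N] by (simp add: minus_ell2.rep_eq)
      qed
    qed simp
    then show ?thesis by blast
  qed
  obtain i0 where i0: "\<And>N. (\<Sum>n<N. (cmod (ell2_nth (X i0) n - y n))\<^sup>2) \<le> 1\<^sup>2"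
    using tail[of 1] by auto
  have "summable (\<lambda>n. (cmod (ell2_nth (X i0) n - y n))\<^sup>2)"
    by (rule bounded_imp_summable[where B = "1\<^sup>2"])
       (use i0 in \<open>auto simp: lessThan_Suc_atMost[symmetric] simp del: sum.lessThan_Suc\<close>)
  then have "summable (\<lambda>n. (cmod (- ell2_nth (X i0) n + y n))\<^sup>2)"
    by (simp add: norm_minus_commute)
  from summable_sq_add[OF ell2_nth_summable[of "X i0"] this]
  have ysum: "summable (\<lambda>n. (cmod (y n))\<^sup>2)" by simp
  define Y where "Y = Abs_ell2 y"
  have Y: "ell2_nth Y = y" unfolding Y_def using ysum by (simp add: Abs_ell2_inverse)
  have "X \<longlonglongrightarrow> Y"
  proof (rule metric_LIMSEQ_I)
    fix e :: real assume "e > 0"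
    then obtain M where M: "\<And>i N. i \<ge> M \<Longrightarrow> (\<Sum>n<N. (cmod (ell2_nth (X i) n - y n))\<^sup>2) \<le> (e/2)\<^sup>2"
      using tail[of "e/2"] by auto
    have "dist (X i) Y < e" if "i \<ge> M" for i
    proof -
      have "(norm (X i - Y))\<^sup>2 \<le> (e/2)\<^sup>2"
        unfolding norm_ell2_sq
        by (intro suminf_le_const ell2_nth_summable) (use M[OF that] in \<open>simp add: minus_ell2.rep_eq Y\<close>)
      then have "norm (X i - Y) \<le> e/2"
        using \<open>e > 0\<close> by (intro power2_le_imp_le[of "norm (X i - Y)" "e/2"]) auto
      then show ?thesis using \<open>e > 0\<close> by (simp add: dist_norm)
    qed
    then show "\<exists>M. \<forall>i\<ge>M. dist (X i) Y < e" by blast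
  qed
  then show "convergent X" by (auto simp: convergent_def)
qed

instantiation ell2 :: complex_hilbert
begin

lift_definition scaleC_ell2 :: "complex \<Rightarrow> ell2 \<Rightarrow> ell2" is "\<lambda>c x n. c * x n"
  by (rule summable_sq_mult)

definition cinner_ell2 :: "ell2 \<Rightarrow> ell2 \<Rightarrow> complex"
  where "cinner_ell2 x y = (\<Sum>n. ell2_nth x n * cnj (ell2_nth y n))"

instance
proof
  fix x y z :: ell2 and b c :: complex and r :: real
  show "c *\<^sub>C (x + y) = c *\<^sub>C x + c *\<^sub>C y"
    by transfer (simp add: algebra_simps)
  show "(b + c) *\<^sub>C x = b *\<^sub>C x + c *\<^sub>C x"
    by transfer (simp add: algebra_simps)
  show "b *\<^sub>C c *\<^sub>C x = (b * c) *\<^sub>C x"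
    by transfer (simp add: algebra_simps)
  show "r *\<^sub>R x = complex_of_real r *\<^sub>C x"
    by transfer simp
  have "(norm (c *\<^sub>C x))\<^sup>2 = (cmod c * norm x)\<^sup>2"
    unfolding power_mult_distrib norm_ell2_sq suminf_mult[OF ell2_nth_summable, symmetric]
    by (simp add: scaleC_ell2.rep_eq norm_mult power_mult_distrib)
  then show "norm (c *\<^sub>C x) = cmod c * norm x"
    by (simp add: power2_eq_iff_nonneg)
  show "cinner (x + y) z = cinner x z + cinner y z"
    unfolding cinner_ell2_def suminf_add[OF ell2_cinner_summable ell2_cinner_summable]
    by (simp add: plus_ell2.rep_eq distrib_right)
  show "cinner (c *\<^sub>C x) y = c * cinner x y"
    unfolding cinner_ell2_def suminf_mult[OF ell2_cinner_summable, symmetric]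
    by (simp add: scaleC_ell2.rep_eq mult.assoc)
  have "cnj (\<Sum>n. ell2_nth y n * cnj (ell2_nth x n)) = (\<Sum>n. cnj (ell2_nth y n * cnj (ell2_nth x n)))"
    by (rule bounded_linear.suminf[OF bounded_linear_cnj ell2_cinner_summable])
  then show "cinner x y = cnj (cinner y x)"
    unfolding cinner_ell2_def by (simp add: mult.commute)
  show "inner x y = Re (cinner x y)"
    by (simp add: inner_ell2_def cinner_ell2_def)
qed

end


section \<open>Hilbert spaces as closed subspaces, and their bounded operators\<close>

text \<open>A Hilbert space \<open>M\<close> is a closed complex subspace of an ambient Hilbert space type, so that
  Hilbert spaces can be quantified over. With ambient type \<^typ>\<open>ell2\<close> this covers, up to
  unitary equivalence, exactly the separable complex Hilbert spaces, the finite-dimensional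
  ones included.\<close>

definition hilbert_subspace :: "'h::complex_hilbert set \<Rightarrow> bool"
  where "hilbert_subspace M \<longleftrightarrow>
    closed M \<and> subspace M \<and> (\<forall>c. \<forall>x\<in>M. c *\<^sub>C x \<in> M)"

text \<open>A bounded operator on \<open>M\<close> is represented by its extension by \<open>0\<close> on the orthogonal
  complement of \<open>M\<close>. This is an isometric embedding of the algebra of bounded operators on \<open>M\<close>
  that respects composition and adjoints, so the operator norm on \<open>M\<close> is the norm of
  the ambient operator space. The identity of \<open>M\<close> becomes the orthogonal projection onto \<open>M\<close>.\<close>

definition ops :: "'h::complex_hilbert set \<Rightarrow> ('h \<Rightarrow>\<^sub>L 'h) set"
  where "ops M = {A :: 'h \<Rightarrow>\<^sub>L 'h. (\<forall>c x. A (c *\<^sub>C x) = c *\<^sub>C A x) \<and> (\<forall>x. A x \<in> M) \<and>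
    (\<forall>x. (\<forall>y\<in>M. cinner x y = 0) \<longrightarrow> A x = 0)}"

definition op_one :: "'h::complex_hilbert set \<Rightarrow> 'h \<Rightarrow>\<^sub>L 'h"
  where "op_one M = (THE P. P \<in> ops M \<and> (\<forall>x\<in>M. P x = x))"

definition op_adjoint :: "('h::complex_hilbert \<Rightarrow>\<^sub>L 'h) \<Rightarrow> 'h \<Rightarrow>\<^sub>L 'h"
  where "op_adjoint A = (THE B :: 'h \<Rightarrow>\<^sub>L 'h. \<forall>x y. cinner (A x) y = cinner x (B y))"

definition is_op_inverse :: "'h::complex_hilbert set \<Rightarrow> ('h \<Rightarrow>\<^sub>L 'h) \<Rightarrow> ('h \<Rightarrow>\<^sub>L 'h) \<Rightarrow> bool"
  where "is_op_inverse M A B \<longleftrightarrow> B \<in> ops M \<and> A o\<^sub>L B = op_one M \<and> B o\<^sub>L A = op_one M"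

definition op_invertible :: "'h::complex_hilbert set \<Rightarrow> ('h \<Rightarrow>\<^sub>L 'h) \<Rightarrow> bool"
  where "op_invertible M A \<longleftrightarrow> A \<in> ops M \<and> (\<exists>B. is_op_inverse M A B)"

definition op_inverse :: "'h::complex_hilbert set \<Rightarrow> ('h \<Rightarrow>\<^sub>L 'h) \<Rightarrow> 'h \<Rightarrow>\<^sub>L 'h"
  where "op_inverse M A = (THE B. is_op_inverse M A B)"

definition contraction :: "'h::complex_hilbert set \<Rightarrow> ('h \<Rightarrow>\<^sub>L 'h) \<Rightarrow> bool"
  where "contraction M A \<longleftrightarrow> A \<in> ops M \<and> norm A \<le> 1"

definition positive_op :: "'h::complex_hilbert set \<Rightarrow> ('h \<Rightarrow>\<^sub>L 'h) \<Rightarrow> bool"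
  where "positive_op M A \<longleftrightarrow> A \<in> ops M \<and> (\<forall>x\<in>M. cinner (A x) x \<in> \<real> \<and> 0 \<le> Re (cinner (A x) x))"

definition isometric_op :: "'h::complex_hilbert set \<Rightarrow> ('h \<Rightarrow>\<^sub>L 'h) \<Rightarrow> bool"
  where "isometric_op M A \<longleftrightarrow> A \<in> ops M \<and> (\<forall>x\<in>M. norm (A x) = norm x)"


section \<open>Analytic functions on the polydisc\<close>

definition polydisc :: "(complex ^ 'd) set"
  where "polydisc = {z. \<forall>j. cmod (z $ j) < 1}"

definition torus :: "(complex ^ 'd) set"
  where "torus = {z. \<forall>j. cmod (z $ j) = 1}"

definition maxnorm :: "complex ^ 'd \<Rightarrow> real"
  where "maxnorm z = Max (range (\<lambda>j. cmod (z $ j)))"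

text \<open>Analyticity on an open set is complex Frechet differentiability in the norm of the target:
  the real derivative exists and is complex linear.\<close>

definition analytic_fun_on :: "(complex ^ 'd \<Rightarrow> 'v::complex_normed_vector) \<Rightarrow> (complex ^ 'd) set \<Rightarrow> bool"
  where "analytic_fun_on f U \<longleftrightarrow>
    (\<forall>z\<in>U. \<exists>D. (f has_derivative D) (at z) \<and> (\<forall>c h. D (c *s h) = c *\<^sub>C D h))"


section \<open>The Schur-Agler class\<close>

text \<open>The coefficients of the power series expansion on the polydisc; multi-indices are functions
  on the index type.\<close>

definition taylor_coeff :: "(complex ^ 'd \<Rightarrow> complex) \<Rightarrow> ('d \<Rightarrow> nat) \<Rightarrow> complex"
  where "taylor_coeff \<phi> = (THE a. \<forall>z\<in>polydisc.
    ((\<lambda>\<alpha>. a \<alpha> * (\<Prod>j\<in>UNIV. (z $ j) ^ \<alpha> j)) has_sum \<phi> z) UNIV)"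

text \<open>The monomial in the operators \<open>X j\<close> with exponents \<open>\<alpha> j\<close>, which is independent of the
  order of the factors when the \<open>X j\<close> commute (the only case in which it is used).\<close>

definition op_monomial ::
    "'h::complex_hilbert set \<Rightarrow> ('d::finite \<Rightarrow> 'h \<Rightarrow>\<^sub>L 'h) \<Rightarrow> ('d \<Rightarrow> nat) \<Rightarrow> 'h \<Rightarrow>\<^sub>L 'h"
  where "op_monomial M X \<alpha> =
    Finite_Set.fold (\<lambda>j A. ((\<lambda>B. X j o\<^sub>L B) ^^ \<alpha> j) A) (op_one M) UNIV"

text \<open>\<open>\<phi>(X)\<close> for a commuting tuple of strict contractions on \<open>M\<close>; the series
  converges absolutely in operator norm.\<close>

definition fun_calc ::
    "'h::complex_hilbert set \<Rightarrow> (complex ^ 'd \<Rightarrow> complex) \<Rightarrow> ('d \<Rightarrow> 'h \<Rightarrow>\<^sub>L 'h) \<Rightarrow> 'h \<Rightarrow>\<^sub>L 'h"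
  where "fun_calc M \<phi> X = (\<Sum>\<^sub>\<infinity>\<alpha>. taylor_coeff \<phi> \<alpha> *\<^sub>C op_monomial M X \<alpha>)"

text \<open>The type argument is the ambient space of the Hilbert spaces on which the tuples act. For
  \<^typ>\<open>ell2\<close> these are all separable Hilbert spaces, which yields the usual
  class: for \<open>x\<close> in an arbitrary Hilbert space the closed subspace generated by \<open>x\<close> under the tuple
  is separable and invariant, so the bound on separable spaces implies the bound on all.\<close>

definition schur_agler :: "'h::complex_hilbert itself \<Rightarrow> (complex ^ 'd \<Rightarrow> complex) set"
  where "schur_agler _ = {\<phi>. analytic_fun_on \<phi> polydisc \<and>
    (\<forall>(M :: 'h set) T. hilbert_subspace M \<longrightarrow> (\<forall>j. contraction M (T j)) \<longrightarrow>
      (\<forall>i j. T i o\<^sub>L T j = T j o\<^sub>L T i) \<longrightarrow>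
      (\<forall>r\<in>{0<..<1::real}. norm (fun_calc M \<phi> (\<lambda>j. r *\<^sub>R T j)) \<le> 1))}"


section \<open>Carapoints and nontangential limits\<close>

definition carapoint :: "complex ^ 'd \<Rightarrow> (complex ^ 'd \<Rightarrow> 'v::real_normed_vector) \<Rightarrow> bool"
  where "carapoint \<tau> f \<longleftrightarrow>
    Liminf (at \<tau> within polydisc) (\<lambda>z. ereal ((1 - norm (f z)) / (1 - maxnorm z))) < \<infinity>"

definition approaches_nt :: "(complex ^ 'd) set \<Rightarrow> complex ^ 'd \<Rightarrow> bool"
  where "approaches_nt S \<tau> \<longleftrightarrow> S \<subseteq> polydisc \<and> \<tau> \<in> closure S \<and>
    (\<exists>c>0. \<forall>z\<in>S. maxnorm (z - \<tau>) \<le> c * (1 - maxnorm z))"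

definition nt_lim :: "(complex ^ 'd \<Rightarrow> 'v::topological_space) \<Rightarrow> 'v \<Rightarrow> complex ^ 'd \<Rightarrow> bool"
  where "nt_lim f l \<tau> \<longleftrightarrow> (\<forall>S. approaches_nt S \<tau> \<longrightarrow> (f \<longlongrightarrow> l) (at \<tau> within S))"


section \<open>Generalized and desingularized models\<close>

definition generalized_model ::
    "(complex ^ 'd \<Rightarrow> complex) \<Rightarrow> 'h::complex_hilbert set \<Rightarrow> (complex ^ 'd \<Rightarrow> 'h) \<Rightarrow>
      (complex ^ 'd \<Rightarrow> 'h \<Rightarrow>\<^sub>L 'h) \<Rightarrow> bool"
  where "generalized_model \<phi> M u I \<longleftrightarrow>
    hilbert_subspace M \<and> separable_space (top_of_set M) \<and>
    (\<forall>z\<in>polydisc. u z \<in> M) \<and> analytic_fun_on u polydisc \<and>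
    (\<forall>z\<in>polydisc. I z \<in> ops M \<and> norm (I z) < 1) \<and> analytic_fun_on I polydisc \<and>
    (\<forall>z\<in>polydisc. \<forall>w\<in>polydisc.
      1 - cnj (\<phi> w) * \<phi> z = cinner ((op_one M - (op_adjoint (I w) o\<^sub>L I z)) (u z)) (u w))"

definition C_point :: "complex ^ 'd \<Rightarrow> 'h::complex_hilbert set \<Rightarrow> (complex ^ 'd \<Rightarrow> 'h) \<Rightarrow> bool"
  where "C_point \<tau> M u \<longleftrightarrow> (\<forall>S. approaches_nt S \<tau> \<longrightarrow>
    (\<exists>v. continuous_on (insert \<tau> S) v \<and> v \<tau> \<in> M \<and> (\<forall>z\<in>S. v z = u z)))"

definition torus_measure :: "(complex ^ 'd) measure"
  where "torus_measure =
    distr (restrict_space lborel (cbox 0 (\<chi> j. 2 * pi) :: (real ^ 'd) set)) borel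
      (\<lambda>\<theta>. \<chi> j. cis (\<theta> $ j))"

definition inner_fun :: "'h::complex_hilbert set \<Rightarrow> (complex ^ 'd \<Rightarrow> 'h \<Rightarrow>\<^sub>L 'h) \<Rightarrow> bool"
  where "inner_fun M I \<longleftrightarrow> (AE z in torus_measure. \<exists>A. isometric_op M A \<and>
    (\<forall>x\<in>M. ((\<lambda>r::real. I (r *\<^sub>R z) x) \<longlongrightarrow> A x) (at_left 1)))"

definition desingularized_model ::
    "(complex ^ 'd \<Rightarrow> complex) \<Rightarrow> complex ^ 'd \<Rightarrow> 'h::complex_hilbert set \<Rightarrow>
      (complex ^ 'd \<Rightarrow> 'h) \<Rightarrow> (complex ^ 'd \<Rightarrow> 'h \<Rightarrow>\<^sub>L 'h) \<Rightarrow> bool"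
  where "desingularized_model \<phi> \<tau> M u I \<longleftrightarrow>
    generalized_model \<phi> M u I \<and> C_point \<tau> M u \<and>
    carapoint \<tau> I \<and> nt_lim I (op_one M) \<tau> \<and> inner_fun M I"

definition op_combination :: "complex ^ 'd \<Rightarrow> ('d \<Rightarrow> 'h::complex_hilbert \<Rightarrow>\<^sub>L 'h) \<Rightarrow> 'h \<Rightarrow>\<^sub>L 'h"
  where "op_combination z Y = (\<Sum>j\<in>UNIV. (z $ j) *\<^sub>C Y j)"

text \<open>The value of an analytic extension of \<open>I\<close> at a boundary point is unique by continuity, so
  the relation below determines \<open>A\<close>.\<close>

definition extends_analytically_with_value ::
    "'h::complex_hilbert set \<Rightarrow> (complex ^ 'd \<Rightarrow> 'h \<Rightarrow>\<^sub>L 'h) \<Rightarrow> complex ^ 'd \<Rightarrow> ('h \<Rightarrow>\<^sub>L 'h) \<Rightarrow> bool"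
  where "extends_analytically_with_value M I p A \<longleftrightarrow>
    (\<exists>U F. open U \<and> p \<in> U \<and> analytic_fun_on F U \<and> (\<forall>z\<in>U. F z \<in> ops M) \<and>
      (\<forall>z\<in>U \<inter> polydisc. F z = I z) \<and> F p = A)"

end

theory Submission
  imports Defs "HOL-Complex_Analysis.Cauchy_Integral_Formula" "HOL-Library.Diagonal_Subsequence"
begin

text \<open>Approximating the kernel \<open>1 - \<phi>(z) cnj(\<phi>(w))\<close> on finitely many nodes by least squares, and
  evaluating \<open>\<phi>\<close> at commuting contractions that have the nodes as joint eigenvalues, yields an Agler
  decomposition on a countable dense set. The resulting lurking isometry extends to a contraction \<open>V\<close>
  on \<open>\<complex> e0 \<oplus> range Pall\<close>, where \<open>Pall\<close> is the sum of orthogonal projections \<open>P j\<close>, with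
  \<open>V (e0 + \<Delta>(z) u(z)) = \<phi>(z) e0 + u(z)\<close> for \<open>\<Delta>(z) = (\<Sum>j. z\<^sub>j P j)\<close>.

  Put \<open>T = Pall V \<Delta>(\<tau>)\<close>. Since \<open>\<tau>\<close> is a carapoint, \<open>u\<close> is bounded along some sequence tending to \<open>\<tau>\<close>,
  so that \<open>(1 - T) x = Pall V e0\<close> is solvable. Removing the singularity of \<open>u\<close> at \<open>\<tau>\<close> amounts to
  compressing to the orthogonal complement \<open>M\<close> of the kernel of \<open>1 - T\<close>: the \<open>Y j\<close> are the compressions
  of the \<open>P j\<close>, and the compression of \<open>u\<close> converges nontangentially, first weakly and then, by
  compactness of the directions of approach, in norm.\<close>

section \<open>Complex Hilbert spaces\<close>

text \<open>The form of \<open>I\<close> comes from the vectors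
  \<open>v z = u z - D z (u z)\<close>, where \<open>D\<close> is \<open>\<Delta>\<close> after
  rotating \<tau> to 1. Coordinatewise multiplication by \<open>zet z\<close> undoes
  \<open>1 - D z\<close>, so the compressed combination sends \<open>v z\<close> to
  \<open>um z\<close>, its inverse \<open>B\<close> sends \<open>um z\<close> back, and
  \<open>I = 1 - B\<close> maps \<open>um z\<close> to \<open>um z - v z\<close>. Fixed vectors of a
  contraction are fixed by its adjoint; hence \<open>v z\<close> is orthogonal to the kernel of
  \<open>1 - T\<close>, the components of \<open>u\<close> and \<open>D u\<close> in that kernel
  agree, and dropping them keeps the model identity. The identity 2 Re (1/(1-w)) - 1 =
  (1-|w|^2)/|1-w|^2 makes \<open>I\<close> strictly contractive inside and isometric on the torus.
  The obstacle at \<tau> is norm convergence, since boundedness gives only weak limits. It is met by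
  showing that the boundary value \<omega> of \<phi> along the carapoint sequence has modulus 1:
  comparing \<phi> with \<omega> gives 2 Re <um - x0, v> \<le> |v|^2, and coercivity of
  \<open>B\<close> turns the left side into control of |um - x0|^2.\<close>

lemma scaleC_one [simp]: "1 *\<^sub>C (x::'a::complex_normed_vector) = x"
  using scaleR_scaleC[of 1 x] by simp

lemma scaleC_zero_left [simp]: "0 *\<^sub>C (x::'a::complex_normed_vector) = 0"
  using scaleR_scaleC[of 0 x] by simp

lemma scaleC_zero_right [simp]: "c *\<^sub>C (0::'a::complex_normed_vector) = 0"
  by (metis norm_eq_zero norm_scaleC mult_zero_right)

lemma scaleC_minus_left: "(- c) *\<^sub>C (x::'a::complex_normed_vector) = - (c *\<^sub>C x)"
  using scaleC_add_left[of "-c" c x] by (simp add: eq_neg_iff_add_eq_0)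

lemma scaleC_minus_right: "c *\<^sub>C (- x::'a::complex_normed_vector) = - (c *\<^sub>C x)"
  using scaleC_add_right[of c "-x" x] by (simp add: eq_neg_iff_add_eq_0)

lemma scaleC_diff_right: "c *\<^sub>C (x - y::'a::complex_normed_vector) = c *\<^sub>C x - c *\<^sub>C y"
  using scaleC_add_right[of c x "-y"] by (simp add: scaleC_minus_right)

lemma scaleC_diff_left: "(b - c) *\<^sub>C (x::'a::complex_normed_vector) = b *\<^sub>C x - c *\<^sub>C x"
  using scaleC_add_left[of b "-c" x] by (simp add: scaleC_minus_left)

lemma scaleC_sum_right: "c *\<^sub>C (\<Sum>i\<in>A. f i :: 'a::complex_normed_vector) = (\<Sum>i\<in>A. c *\<^sub>C f i)"
  by (induction A rule: infinite_finite_induct) (auto simp: scaleC_add_right)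

lemma scaleC_scaleR_commute: "c *\<^sub>C (r *\<^sub>R (x::'a::complex_normed_vector)) = r *\<^sub>R (c *\<^sub>C x)"
  by (simp add: scaleR_scaleC scaleC_scaleC mult.commute)

lemma bounded_linear_scaleC_left: "bounded_linear (\<lambda>c. c *\<^sub>C (x::'a::complex_normed_vector))"
  by (rule bounded_linear_intro[where K="norm x"])
    (auto simp: scaleC_add_left scaleR_scaleC[of _ x] scaleR_scaleC[of _ "_ *\<^sub>C x"] scaleC_scaleC norm_scaleC scaleR_conv_of_real)

lemma cinner_add_right: "cinner x (y + z) = cinner x y + cinner x z"
  by (subst (1 2 3) cinner_commute) (simp add: cinner_add_left)

lemma cinner_scaleC_right: "cinner x (c *\<^sub>C y) = cnj c * cinner x y"
  by (subst (1 2) cinner_commute) (simp add: cinner_scaleC_left)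

lemma cinner_zero_left [simp]: "cinner 0 x = 0"
  using cinner_add_left[of 0 0 x] by simp

lemma cinner_zero_right [simp]: "cinner x 0 = 0"
  using cinner_add_right[of x 0 0] by simp

lemma cinner_minus_left: "cinner (- x) y = - cinner x y"
  using cinner_add_left[of "-x" x y] by (simp add: eq_neg_iff_add_eq_0)

lemma cinner_minus_right: "cinner x (- y) = - cinner x y"
  using cinner_add_right[of x "-y" y] by (simp add: eq_neg_iff_add_eq_0)

lemma cinner_diff_left: "cinner (x - y) z = cinner x z - cinner y z"
  using cinner_add_left[of x "-y" z] by (simp add: cinner_minus_left)

lemma cinner_diff_right: "cinner x (y - z) = cinner x y - cinner x z"
  using cinner_add_right[of x y "-z"] by (simp add: cinner_minus_right)

lemma cinner_sum_left: "cinner (\<Sum>i\<in>A. f i) y = (\<Sum>i\<in>A. cinner (f i) y)"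
  by (induction A rule: infinite_finite_induct) (auto simp: cinner_add_left)

lemma cinner_sum_right: "cinner y (\<Sum>i\<in>A. f i) = (\<Sum>i\<in>A. cinner y (f i))"
  by (induction A rule: infinite_finite_induct) (auto simp: cinner_add_right)

lemmas cinner_linear_simps = cinner_add_left cinner_add_right cinner_diff_left cinner_diff_right
  cinner_scaleC_left cinner_scaleC_right cinner_sum_left cinner_sum_right

lemma cinner_self: "cinner x x = of_real ((norm x)\<^sup>2)"
proof -
  have "Im (cinner x x) = 0"
    using cinner_commute[of x x] by (metis Reals_cnj_iff complex_is_Real_iff)
  then show ?thesis
    by (simp add: complex_eq_iff power2_norm_eq_inner inner_eq_Re_cinner)
qed

lemma Re_cinner_self: "Re (cinner x x) = (norm x)\<^sup>2"
  by (simp add: cinner_self)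

lemma cmod_cinner_le: "cmod (cinner x y) \<le> norm x * norm y"
proof (cases "cinner x y = 0")
  case False
  define c where "c = cnj (cinner x y) / cmod (cinner x y)"
  have "cinner x y * cnj (cinner x y) = complex_of_real (cmod (cinner x y)) * cmod (cinner x y)"
    by (metis complex_norm_square power2_eq_square of_real_mult)
  then have "complex_of_real (cmod (cinner x y)) = c * cinner x y"
    using False unfolding c_def by (simp add: divide_simps mult.commute)
  then have "cmod (cinner x y) = Re (cinner (c *\<^sub>C x) y)"
    by (metis Re_complex_of_real cinner_scaleC_left)
  also have "\<dots> \<le> norm (c *\<^sub>C x) * norm y"
    by (metis inner_eq_Re_cinner norm_cauchy_schwarz)
  also have "norm (c *\<^sub>C x) = norm x"
    using False by (simp add: norm_scaleC c_def norm_divide)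
  finally show ?thesis .
qed simp

lemma bounded_bilinear_cinner: "bounded_bilinear (cinner :: 'a::complex_hilbert \<Rightarrow> 'a \<Rightarrow> complex)"
proof
  show "\<exists>K. \<forall>a b. norm (cinner a (b::'a)) \<le> norm a * norm b * K"
    by (rule exI[of _ 1]) (simp add: cmod_cinner_le)
  show "cinner (r *\<^sub>R a) b = r *\<^sub>R cinner a b" "cinner a (r *\<^sub>R b) = r *\<^sub>R cinner a b" for r and a b :: 'a
    by (simp_all add: scaleR_scaleC[of r "_::'a"] cinner_linear_simps scaleR_conv_of_real)
qed (simp_all add: cinner_linear_simps)

lemmas tendsto_cinner [tendsto_intros] = bounded_bilinear.tendsto[OF bounded_bilinear_cinner]

lemma Re_cinner_commute: "Re (cinner x y) = Re (cinner y x)"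
  by (subst cinner_commute) simp

lemma norm_diff_sq_cinner: "(norm (x - y))\<^sup>2 = (norm x)\<^sup>2 - 2 * Re (cinner x y) + (norm y)\<^sup>2"
  using Re_cinner_commute[of x y]
  by (simp flip: Re_cinner_self add: cinner_linear_simps)

lemma norm_add_sq_cinner: "(norm (x + y))\<^sup>2 = (norm x)\<^sup>2 + 2 * Re (cinner x y) + (norm y)\<^sup>2"
  using Re_cinner_commute[of x y]
  by (simp flip: Re_cinner_self add: cinner_linear_simps)

lemma cinner_ext:
  assumes "\<And>y. Re (cinner x y) = Re (cinner x' y)"
  shows "x = x'"
proof -
  have "Re (cinner (x - x') (x - x')) = 0"
    using assms[of "x - x'"] by (simp add: cinner_diff_left)
  then show ?thesis by (simp add: cinner_self)
qed

lemma cinner_eqI_Re: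
  assumes "\<And>c. Re (cinner (c *\<^sub>C x) y) = Re (cinner (c *\<^sub>C x') y')"
  shows "cinner x y = cinner x' y'"
  using assms[of 1] assms[of \<i>] by (simp add: complex_eq_iff cinner_scaleC_left)

subsection \<open>Closest points\<close>

text \<open>The norms \<open>d n\<close> of the sets increase to a limit, and by the parallelogram law almost
  minimal elements form a Cauchy sequence.\<close>

lemma nested_closed_convex_nonempty:
  fixes C :: "nat \<Rightarrow> 'a::{real_inner,banach} set"
  assumes cl: "\<And>n. closed (C n)" and cv: "\<And>n. convex (C n)"
    and mono: "\<And>n. C (Suc n) \<subseteq> C n" and bd: "\<And>n. \<exists>y\<in>C n. norm y \<le> R"
  shows "\<exists>x. \<forall>n. x \<in> C n"
proof -
  define d where "d n = Inf (norm ` C n)" for n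
  have ne: "norm ` C n \<noteq> {}" for n using bd[of n] by auto
  have bb: "bdd_below (norm ` C n)" for n by (rule bdd_belowI[of _ 0]) auto
  have d_le: "d n \<le> norm y" if "y \<in> C n" for n y
    unfolding d_def using that bb by (auto intro: cInf_lower)
  have dR: "d n \<le> R" for n using bd[of n] d_le by (meson order_trans)
  have d0: "0 \<le> d n" for n unfolding d_def using ne by (intro cInf_greatest) auto
  have anti: "C m \<subseteq> C n" if "n \<le> m" for m n
    using lift_Suc_antimono_le[of C, OF mono that] .
  have dinc: "incseq d"
    unfolding incseq_def d_def using anti by (auto intro!: cInf_superset_mono bb simp: bd ne)
      (metis bd empty_iff)
  have "convergent d"
    using dinc dR d0 by (intro Bseq_mono_convergent) (auto intro!: BseqI'[of _ R] simp: incseq_def)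
  then obtain D where D: "d \<longlonglongrightarrow> D" by (auto simp: convergent_def)
  have dD: "d n \<le> D" for n using dinc D by (rule incseq_le)
  define eps where "eps n = inverse (real (Suc n))" for n
  have ep: "eps n > 0" for n by (simp add: eps_def)
  have elim: "eps \<longlonglongrightarrow> 0" unfolding eps_def by (rule LIMSEQ_inverse_real_of_nat)
  have "\<exists>y\<in>C n. norm y < d n + eps n" for n
  proof -
    have "Inf (norm ` C n) < d n + eps n" using ep[of n] by (simp add: d_def)
    then show ?thesis using cInf_lessD[OF ne] by blast
  qed
  then obtain y where y: "\<And>n. y n \<in> C n" "\<And>n. norm (y n) < d n + eps n" by metis
  \<comment> \<open>The midpoint of \<open>y n\<close> and \<open>y m\<close> lies in
    \<open>C n\<close>, so its norm is at least \<open>d n\<close>; the parallelogram law then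
    leaves this quantity as a bound for the squared distance.\<close>
  define g where "g n = 4 * (D + eps n)\<^sup>2 - 4 * (d n)\<^sup>2" for n
  have g0: "g \<longlonglongrightarrow> 0"
  proof -
    have "g \<longlonglongrightarrow> 4 * (D + 0)\<^sup>2 - 4 * D\<^sup>2"
      unfolding g_def by (intro tendsto_intros D elim)
    then show ?thesis by simp
  qed
  have key: "(norm (y n - y m))\<^sup>2 \<le> g n" if "n \<le> m" for n m
  proof -
    have ym: "y m \<in> C n" using anti[OF that] y by blast
    have "(1/2) *\<^sub>R y n + (1/2) *\<^sub>R y m \<in> C n"
      using convexD[OF cv y(1)[of n] ym, of "1/2" "1/2"] by simp
    then have "d n \<le> norm ((1/2) *\<^sub>R y n + (1/2) *\<^sub>R y m)" by (rule d_le)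
    also have "(1/2) *\<^sub>R y n + (1/2) *\<^sub>R y m = (1/2) *\<^sub>R (y n + y m)"
      by (simp add: scaleR_add_right)
    finally have "2 * d n \<le> norm (y n + y m)" by simp
    then have mid: "4 * (d n)\<^sup>2 \<le> (norm (y n + y m))\<^sup>2"
      using power_mono[of "2 * d n" "norm (y n + y m)" 2] d0[of n] by (simp add: power_mult_distrib)
    have e: "eps m \<le> eps n" using that by (simp add: eps_def)
    have "norm (y n) \<le> D + eps n" using y(2)[of n] dD[of n] by linarith
    then have a: "(norm (y n))\<^sup>2 \<le> (D + eps n)\<^sup>2" by (intro power_mono) auto
    have "norm (y m) \<le> D + eps n" using y(2)[of m] dD[of m] e by linarith
    then have b: "(norm (y m))\<^sup>2 \<le> (D + eps n)\<^sup>2" by (intro power_mono) auto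
    have "(norm (y n - y m))\<^sup>2 = 2 * (norm (y n))\<^sup>2 + 2 * (norm (y m))\<^sup>2 - (norm (y n + y m))\<^sup>2"
      unfolding power2_norm_eq_inner by (simp add: inner_simps algebra_simps inner_commute)
    then show ?thesis using mid a b unfolding g_def by linarith
  qed
  have "Cauchy y"
  proof (rule CauchyI')
    fix e :: real assume e: "e > 0"
    have "\<forall>\<^sub>F n in sequentially. g n < e\<^sup>2"
      using g0 e by (intro order_tendstoD) auto
    then obtain N where N: "\<And>n. n \<ge> N \<Longrightarrow> g n < e\<^sup>2"
      by (auto simp: eventually_sequentially)
    have "dist (y m) (y n) < e" if "m \<ge> N" "n > m" for m n
      unfolding dist_norm
    proof (rule power2_less_imp_less)
      show "(norm (y m - y n))\<^sup>2 < e\<^sup>2" using key[of m n] N[OF that(1)] that(2) by simp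
    qed (use e in simp)
    then show "\<exists>M. \<forall>m\<ge>M. \<forall>n>m. dist (y m) (y n) < e" by blast
  qed
  then obtain x where x: "y \<longlonglongrightarrow> x"
    using Cauchy_convergent convergent_def by blast
  have "x \<in> C n" for n
  proof (rule Lim_in_closed_set[OF cl _ _ x])
    show "\<forall>\<^sub>F m in sequentially. y m \<in> C n"
      using eventually_ge_at_top[of n] by eventually_elim (use anti y in blast)
  qed simp
  then show ?thesis by blast
qed

text \<open>The minimum is a common point of the nested sets obtained by cutting \<open>C\<close>
  with balls of radius \<open>d + 1/(n+1)\<close>, where \<open>d\<close> is the infimum of the
  norms on \<open>C\<close>.\<close>

lemma min_norm_exists:
  fixes C :: "'a::{real_inner,banach} set"
  assumes "closed C" "convex C" "C \<noteq> {}"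
  shows "\<exists>x\<in>C. \<forall>y\<in>C. norm x \<le> norm y"
proof -
  define d where "d = Inf (norm ` C)"
  have bb: "bdd_below (norm ` C)" by (rule bdd_belowI[of _ 0]) auto
  define K where "K n = C \<inter> cball 0 (d + inverse (real (Suc n)))" for n
  have "\<exists>x. \<forall>n. x \<in> K n"
  proof (rule nested_closed_convex_nonempty)
    show "closed (K n)" "convex (K n)" for n
      unfolding K_def using assms by (auto intro: closed_Int convex_Int)
    show "K (Suc n) \<subseteq> K n" for n
    proof -
      have "inverse (real (Suc (Suc n))) \<le> inverse (real (Suc n))"
        by (rule le_imp_inverse_le) auto
      then show ?thesis unfolding K_def by (intro Int_mono subset_cball) auto
    qed
    fix n
    have "Inf (norm ` C) < d + inverse (real (Suc n))" by (simp add: d_def)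
    then obtain y where y: "y \<in> C" "norm y < d + inverse (real (Suc n))"
      using cInf_lessD[of "norm ` C"] assms by blast
    have "inverse (real (Suc n)) \<le> 1" using le_imp_inverse_le[of 1 "real (Suc n)"] by simp
    then show "\<exists>y\<in>K n. norm y \<le> d + 1" using y by (intro bexI[of _ y]) (auto simp: K_def)
  qed
  then obtain x where x: "\<And>n. x \<in> K n" by blast
  have "norm x \<le> d"
  proof (rule LIMSEQ_le_const)
    show "(\<lambda>n. d + inverse (real (Suc n))) \<longlonglongrightarrow> d"
      using tendsto_add[OF tendsto_const LIMSEQ_inverse_real_of_nat] by simp
    show "\<exists>N. \<forall>n\<ge>N. norm x \<le> d + inverse (real (Suc n))"
      using x by (auto simp: K_def)
  qed
  moreover have "d \<le> norm y" if "y \<in> C" for y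
    unfolding d_def using that bb by (auto intro: cInf_lower)
  ultimately show ?thesis using x[of 0] by (intro bexI[of _ x]) (force simp: K_def)+
qed

lemma inner_eq_0_if_min_norm:
  fixes x k :: "'a::real_inner"
  assumes "\<And>t. norm x \<le> norm (x + t *\<^sub>R k)"
  shows "inner x k = 0"
proof (cases "k = 0")
  case False
  \<comment> \<open>The minimizer of \<open>(norm (x + t *\<^sub>R k))\<^sup>2\<close> as a
    quadratic function of \<open>t\<close>; there it lies below \<open>(norm x)\<^sup>2\<close> by
    \<open>(inner x k)\<^sup>2 / (norm k)\<^sup>2\<close>.\<close>
  define t where "t = - inner x k / (norm k)\<^sup>2"
  have k: "(norm k)\<^sup>2 > 0" using False by simp
  have "(norm x)\<^sup>2 \<le> (norm (x + t *\<^sub>R k))\<^sup>2" using assms by (intro power_mono) auto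
  also have "\<dots> = (norm x)\<^sup>2 + 2 * t * inner x k + t\<^sup>2 * (norm k)\<^sup>2"
    unfolding power2_norm_eq_inner by (simp add: inner_simps algebra_simps inner_commute power2_eq_square)
  also have "\<dots> = (norm x)\<^sup>2 - (inner x k)\<^sup>2 / (norm k)\<^sup>2"
    using k unfolding t_def by (simp add: field_simps power2_eq_square)
  finally have "(inner x k)\<^sup>2 / (norm k)\<^sup>2 \<le> 0" by simp
  then show ?thesis using k by (simp add: divide_le_0_iff)
qed simp

lemma closest_point_subspace_exists:
  fixes S :: "'a::{real_inner,banach} set"
  assumes "closed S" "subspace S"
  shows "\<exists>s\<in>S. \<forall>y\<in>S. inner (x - s) y = 0"
proof -
  \<comment> \<open>\<open>C\<close> is the translate \<open>x - S\<close>; its element of least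
    norm is the component of \<open>x\<close> orthogonal to \<open>S\<close>.\<close>
  define C where "C = (\<lambda>y. x - y) -` S"
  have "closed C" unfolding C_def by (intro closed_vimage assms continuous_intros)
  moreover have "convex C"
  proof (rule convexI)
    fix a b :: 'a and u v :: real
    assume ab: "a \<in> C" "b \<in> C" and uv: "0 \<le> u" "0 \<le> v" "u + v = 1"
    have "x - (u *\<^sub>R a + v *\<^sub>R b) = u *\<^sub>R (x - a) + v *\<^sub>R (x - b)"
      using scaleR_left.add[of u v x] uv(3) by (simp add: scaleR_diff_right)
    also have "\<dots> \<in> S" using ab assms(2) by (auto simp: C_def intro: subspace_add subspace_scale)
    finally show "u *\<^sub>R a + v *\<^sub>R b \<in> C" by (simp add: C_def)
  qed
  moreover have "x \<in> C" using assms(2) by (simp add: C_def subspace_0)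
  ultimately obtain c where c: "c \<in> C" "\<And>y. y \<in> C \<Longrightarrow> norm c \<le> norm y"
    using min_norm_exists[of C] by auto
  have "inner c y = 0" if "y \<in> S" for y
  proof (rule inner_eq_0_if_min_norm)
    fix t
    have "x - (c + t *\<^sub>R y) = (x - c) - t *\<^sub>R y" by simp
    also have "\<dots> \<in> S" using c(1) that assms(2) by (auto simp: C_def intro: subspace_diff subspace_scale)
    finally show "norm c \<le> norm (c + t *\<^sub>R y)" by (intro c(2)) (simp add: C_def)
  qed
  then show ?thesis using c(1) by (intro bexI[of _ "x - c"]) (auto simp: C_def)
qed

text \<open>The representing vector is the point \<open>c\<close> of least norm on the hyperplane
  \<open>f = 1\<close>, which is orthogonal to the kernel of \<open>f\<close>, divided by
  \<open>(norm c)\<^sup>2\<close>.\<close>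

lemma riesz_representation:
  fixes f :: "'a::{real_inner,banach} \<Rightarrow> real"
  assumes "bounded_linear f"
  shows "\<exists>y. \<forall>x. f x = inner x y"
proof (cases "\<forall>x. f x = 0")
  case True
  then show ?thesis by (intro exI[of _ 0]) auto
next
  case False
  interpret bounded_linear f by fact
  define C where "C = f -` {1}"
  have "closed C" unfolding C_def by (intro closed_vimage closed_singleton continuous_on_eq_continuous_within[THEN iffD2] ballI)
     (simp add: isCont linear_continuous_at bounded_linear_axioms)
  moreover have "convex C"
    by (rule convexI) (simp add: C_def add scaleR)
  moreover obtain a where "f a \<noteq> 0" using False by blast
  then have "(1 / f a) *\<^sub>R a \<in> C" by (simp add: C_def scaleR)
  ultimately obtain c where c: "c \<in> C" "\<And>y. y \<in> C \<Longrightarrow> norm c \<le> norm y"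
    using min_norm_exists[of C] by auto
  have fc: "f c = 1" using c(1) by (simp add: C_def)
  then have "c \<noteq> 0" using zero by auto
  have orth: "inner c k = 0" if "f k = 0" for k
    by (rule inner_eq_0_if_min_norm) (rule c(2), simp add: C_def add scaleR fc that)
  have "f x = inner x ((1 / (norm c)\<^sup>2) *\<^sub>R c)" for x
  proof -
    have "f (x - f x *\<^sub>R c) = 0" by (simp add: diff scaleR fc)
    then have "inner c (x - f x *\<^sub>R c) = 0" by (rule orth)
    then have "inner c x = f x * (norm c)\<^sup>2"
      by (simp add: inner_diff_right power2_norm_eq_inner)
    then show ?thesis using \<open>c \<noteq> 0\<close> by (simp add: inner_commute)
  qed
  then show ?thesis by blast
qed

subsection \<open>Operators on closed subspaces\<close>

lemma ops_UNIV_iff: "A \<in> ops UNIV \<longleftrightarrow> (\<forall>c x. A (c *\<^sub>C x) = c *\<^sub>C A x)"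
proof -
  have "x = 0" if "\<forall>y. cinner x y = 0" for x :: 'a
    using that[rule_format, of x] by (simp add: cinner_self)
  then have "A x = 0" if "\<forall>y. cinner x y = 0" for x
    using that by (metis blinfun.zero_right)
  then show ?thesis by (auto simp: ops_def)
qed

lemma ops_UNIV: "A \<in> ops M \<Longrightarrow> A \<in> ops UNIV"
  by (simp add: ops_UNIV_iff) (simp add: ops_def)

lemma ops_scaleC: "A \<in> ops M \<Longrightarrow> A (c *\<^sub>C x) = c *\<^sub>C A x"
  by (simp add: ops_def)

lemma hilbert_subspace_UNIV: "hilbert_subspace UNIV"
  by (simp add: hilbert_subspace_def)

lemma hilbert_subspaceD:
  assumes "hilbert_subspace M"
  shows "closed M" "subspace M" "x \<in> M \<Longrightarrow> c *\<^sub>C x \<in> M" "0 \<in> M"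
    "x \<in> M \<Longrightarrow> y \<in> M \<Longrightarrow> x + y \<in> M" "x \<in> M \<Longrightarrow> y \<in> M \<Longrightarrow> x - y \<in> M"
    "x \<in> M \<Longrightarrow> r *\<^sub>R x \<in> M"
  using assms by (auto simp: hilbert_subspace_def subspace_add subspace_diff subspace_0 subspace_scale)

lemma hilbert_subspace_sum:
  assumes "hilbert_subspace M" "\<And>i. i \<in> A \<Longrightarrow> f i \<in> M"
  shows "(\<Sum>i\<in>A. f i) \<in> M"
  using assms by (simp add: hilbert_subspace_def subspace_sum)

text \<open>A complex subspace contains \<open>\<i> *\<^sub>C y\<close> along with \<open>y\<close>,
  and the real inner product with that vector is the imaginary part of the complex one.\<close>

lemma inner_orth_imp_cinner_orth:
  assumes "hilbert_subspace M" "\<forall>y\<in>M. inner z y = 0" "y \<in> M"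
  shows "cinner z y = 0"
proof -
  have "inner z y = 0" "inner z (\<i> *\<^sub>C y) = 0"
    using assms by (auto intro: hilbert_subspaceD)
  then show ?thesis by (simp add: inner_eq_Re_cinner cinner_scaleC_right complex_eq_iff)
qed

lemma op_one_exists:
  fixes M :: "'h::complex_hilbert set"
  assumes M: "hilbert_subspace M"
  shows "\<exists>P. P \<in> ops M \<and> (\<forall>x\<in>M. blinfun_apply P x = x)"
proof -
  note MD = hilbert_subspaceD[OF M]
  have "\<forall>x. \<exists>s\<in>M. \<forall>y\<in>M. cinner (x - s) y = 0"
    using closest_point_subspace_exists[OF MD(1,2)] inner_orth_imp_cinner_orth[OF M] by meson
  then obtain p where p: "\<And>x. p x \<in> M" "\<And>x y. y \<in> M \<Longrightarrow> cinner (x - p x) y = 0"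
    by metis
  have uniq: "p x = s" if "s \<in> M" "\<And>y. y \<in> M \<Longrightarrow> cinner (x - s) y = 0" for x s
  proof -
    have "s - p x \<in> M" by (rule MD(6)[OF that(1) p(1)])
    then have "cinner (x - p x) (s - p x) = 0" "cinner (x - s) (s - p x) = 0"
      by (rule p(2), rule that(2))
    then have "cinner (x - p x) (s - p x) - cinner (x - s) (s - p x) = 0" by simp
    then have "cinner (s - p x) (s - p x) = 0" by (simp flip: cinner_diff_left)
    then show ?thesis by (simp add: cinner_self)
  qed
  have add: "p (x + y) = p x + p y" for x y
  proof (rule uniq)
    fix z assume "z \<in> M"
    then have "cinner (x - p x) z + cinner (y - p y) z = 0" by (simp add: p)
    then show "cinner (x + y - (p x + p y)) z = 0" by (simp add: cinner_linear_simps algebra_simps)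
  qed (simp add: MD p)
  have sc: "p (c *\<^sub>C x) = c *\<^sub>C p x" for c x
  proof (rule uniq)
    fix y assume "y \<in> M"
    then have "c * cinner (x - p x) y = 0" using p by simp
    then show "cinner (c *\<^sub>C x - c *\<^sub>C p x) y = 0"
      by (simp add: cinner_linear_simps algebra_simps)
  qed (simp add: MD p)
  have nle: "norm (p x) \<le> norm x" for x
  proof (rule power2_le_imp_le)
    have "cinner (x - p x) (p x) = 0" using p by auto
    then have "(norm x)\<^sup>2 = (norm (p x))\<^sup>2 + (norm (x - p x))\<^sup>2"
      using norm_add_sq_cinner[of "x - p x" "p x"] by simp
    then show "(norm (p x))\<^sup>2 \<le> (norm x)\<^sup>2" by simp
  qed simp
  have bl: "bounded_linear p"
    by (rule bounded_linear_intro[where K=1]) (auto simp: add sc scaleR_scaleC nle)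
  have "Blinfun p \<in> ops M"
    unfolding ops_def
  proof (safe; (simp add: bounded_linear_Blinfun_apply[OF bl])?)
    fix x assume "\<forall>y\<in>M. cinner x y = 0"
    then show "p x = 0" by (intro uniq) (auto simp: MD)
  qed (use p sc in auto)
  moreover have "Blinfun p x = x" if "x \<in> M" for x
    using uniq[of x x] that by (simp add: bounded_linear_Blinfun_apply[OF bl])
  ultimately show ?thesis by blast
qed

text \<open>The definite description is well defined because an element of \<open>ops M\<close>
  vanishes on the orthogonal complement of \<open>M\<close> and so is determined by its values on
  \<open>M\<close>.\<close>

lemma op_one:
  assumes M: "hilbert_subspace M"
  shows op_one_in_ops: "op_one M \<in> ops M"
    and op_one_id: "x \<in> M \<Longrightarrow> op_one M x = x"
    and op_one_in: "op_one M x \<in> M"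
    and op_one_orth: "y \<in> M \<Longrightarrow> cinner (x - op_one M x) y = 0"
proof -
  note MD = hilbert_subspaceD[OF M]
  have dec: "\<exists>s\<in>M. \<forall>y\<in>M. cinner (x - s) y = 0" for x
    using closest_point_subspace_exists[OF MD(1,2)] inner_orth_imp_cinner_orth[OF M] by meson
  have val: "blinfun_apply P x = s"
    if "P \<in> ops M" "\<forall>x\<in>M. blinfun_apply P x = x" "s \<in> M" "\<forall>y\<in>M. cinner (x - s) y = 0" for P x s
  proof -
    have "P (x - s) = 0" using that by (auto simp: ops_def)
    then show ?thesis using that by (simp add: blinfun.diff_right)
  qed
  have ex1: "\<exists>!P. P \<in> ops M \<and> (\<forall>x\<in>M. blinfun_apply P x = x)"
  proof (rule ex_ex1I[OF op_one_exists[OF M]])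
    fix P Q assume a: "P \<in> ops M \<and> (\<forall>x\<in>M. blinfun_apply P x = x)"
      "Q \<in> ops M \<and> (\<forall>x\<in>M. blinfun_apply Q x = x)"
    show "P = Q"
    proof (rule blinfun_eqI)
      fix x
      obtain s where s: "s \<in> M" "\<forall>y\<in>M. cinner (x - s) y = 0" using dec by blast
      show "P x = Q x" using val[of P s x] val[of Q s x] a s by simp
    qed
  qed
  have 1: "op_one M \<in> ops M \<and> (\<forall>x\<in>M. op_one M x = x)"
    unfolding op_one_def by (rule theI'[OF ex1])
  then show "op_one M \<in> ops M" "x \<in> M \<Longrightarrow> op_one M x = x" "op_one M x \<in> M"
    by (auto simp: ops_def)
  obtain s where s: "s \<in> M" "\<forall>y\<in>M. cinner (x - s) y = 0" using dec by blast
  have "op_one M x = s" using val[of "op_one M" s x] 1 s by blast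
  with s show "y \<in> M \<Longrightarrow> cinner (x - op_one M x) y = 0" by simp
qed

lemma op_one_cinner_right:
  assumes "hilbert_subspace M" "y \<in> M"
  shows "cinner (op_one M x) y = cinner x y"
  using op_one_orth[OF assms, of x] by (simp add: cinner_diff_left)

lemma norm_op_one_split:
  assumes M: "hilbert_subspace M"
  shows "(norm x)\<^sup>2 = (norm (op_one M x))\<^sup>2 + (norm (x - op_one M x))\<^sup>2"
  using norm_add_sq_cinner[of "x - op_one M x" "op_one M x"] op_one_orth[OF M op_one_in[OF M], of x]
  by simp

lemma norm_op_one_apply_le:
  assumes "hilbert_subspace M"
  shows "norm (op_one M x) \<le> norm x"
  by (rule power2_le_imp_le) (simp_all add: norm_op_one_split[OF assms, of x])

lemma norm_op_one_le: "hilbert_subspace M \<Longrightarrow> norm (op_one M) \<le> 1"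
  by (rule norm_blinfun_bound) (auto simp: norm_op_one_apply_le)

lemma norm_op_one:
  assumes M: "hilbert_subspace M" and "x \<in> M" "x \<noteq> 0"
  shows "norm (op_one M) = 1"
proof (rule antisym[OF norm_op_one_le[OF M]])
  have "norm x \<le> norm (op_one M) * norm x"
    using norm_blinfun[of "op_one M" x] by (simp add: op_one_id[OF M] assms)
  then show "1 \<le> norm (op_one M)" using assms(3) by simp
qed

lemma ops_op_one:
  assumes M: "hilbert_subspace M" and A: "A \<in> ops M"
  shows "A (op_one M x) = A x"
proof -
  have "A (x - op_one M x) = 0" using A op_one_orth[OF M] by (auto simp: ops_def)
  then show ?thesis by (simp add: blinfun.diff_right)
qed

lemma ops_in: "A \<in> ops M \<Longrightarrow> A x \<in> M"
  by (simp add: ops_def)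

lemma opsI_op_one:
  assumes M: "hilbert_subspace M" and "A \<in> ops UNIV" "\<And>x. A x \<in> M" "\<And>x. A (op_one M x) = A x"
  shows "A \<in> ops M"
proof -
  have "A x = 0" if "\<forall>y\<in>M. cinner x y = 0" for x
  proof -
    have "cinner (op_one M x) (op_one M x) = 0"
      using that op_one_cinner_right[OF M op_one_in[OF M]] op_one_in[OF M] by metis
    then have "op_one M x = 0" by (simp add: cinner_self)
    then show ?thesis using assms(4)[of x] by (simp add: blinfun.zero_right)
  qed
  then show ?thesis using assms by (auto simp: ops_def)
qed

lemma ops_eqI:
  assumes M: "hilbert_subspace M" and "A \<in> ops M" "B \<in> ops M"
    "\<And>x. x \<in> M \<Longrightarrow> blinfun_apply A x = blinfun_apply B x"
  shows "A = B"
  by (rule blinfun_eqI) (metis assms op_one_in[OF M] ops_op_one[OF M])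

lemma ops_add: "hilbert_subspace M \<Longrightarrow> A \<in> ops M \<Longrightarrow> B \<in> ops M \<Longrightarrow> A + B \<in> ops M"
  by (auto simp: ops_def blinfun.add_left scaleC_add_right intro: hilbert_subspaceD)

lemma ops_diff: "hilbert_subspace M \<Longrightarrow> A \<in> ops M \<Longrightarrow> B \<in> ops M \<Longrightarrow> A - B \<in> ops M"
  by (auto simp: ops_def blinfun.diff_left scaleC_diff_right intro: hilbert_subspaceD)

lemma ops_cscale: "hilbert_subspace M \<Longrightarrow> A \<in> ops M \<Longrightarrow> c *\<^sub>C A \<in> ops M"
  by (auto simp: ops_def scaleC_blinfun.rep_eq scaleC_scaleC mult.commute intro: hilbert_subspaceD)

lemma ops_zero: "hilbert_subspace M \<Longrightarrow> 0 \<in> ops M"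
  by (auto simp: ops_def intro: hilbert_subspaceD)

lemma ops_sum:
  assumes "hilbert_subspace M" "\<And>i. i \<in> A \<Longrightarrow> f i \<in> ops M"
  shows "(\<Sum>i\<in>A. f i) \<in> ops M"
  using assms(2)
  by (induction A rule: infinite_finite_induct) (auto intro: ops_add ops_zero assms(1))

lemma ops_compose: "A \<in> ops M \<Longrightarrow> B \<in> ops M \<Longrightarrow> A o\<^sub>L B \<in> ops M"
  by (auto simp: ops_def blinfun.zero_right)

lemma norm_ops_le:
  assumes M: "hilbert_subspace M" and A: "A \<in> ops M" and "0 \<le> b"
    and "\<And>x. x \<in> M \<Longrightarrow> norm (blinfun_apply A x) \<le> b * norm x"
  shows "norm A \<le> b"
proof (rule norm_blinfun_bound[OF \<open>0 \<le> b\<close>])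
  fix x
  have "norm (A x) = norm (A (op_one M x))" by (simp add: ops_op_one[OF M A])
  also have "\<dots> \<le> b * norm (op_one M x)" by (rule assms(4)[OF op_one_in[OF M]])
  also have "\<dots> \<le> b * norm x" using norm_op_one_apply_le[OF M] \<open>0 \<le> b\<close> by (intro mult_left_mono)
  finally show "norm (A x) \<le> b * norm x" .
qed

section \<open>Adjoints\<close>

lemma op_adjoint_exists:
  fixes A :: "'h::complex_hilbert \<Rightarrow>\<^sub>L 'h"
  assumes A: "A \<in> ops UNIV"
  shows "\<exists>B::'h \<Rightarrow>\<^sub>L 'h. \<forall>x y. cinner (A x) y = cinner x (B y)"
proof -
  \<comment> \<open>Riesz for the real inner product yields the real part of the adjoint identity;
    complex linearity of \<open>A\<close> then recovers all of it.\<close>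
  have "\<forall>y. \<exists>b. \<forall>x. inner (A x) y = inner x b"
    by (intro allI riesz_representation bounded_linear_compose[OF bounded_linear_inner_left]
        blinfun.bounded_linear_right)
  then obtain b where b: "\<And>x y. inner (A x) y = inner x (b y)" by metis
  have cb: "cinner (A x) y = cinner x (b y)" for x y
    by (rule cinner_eqI_Re) (metis A b inner_eq_Re_cinner ops_scaleC)
  have ext: "u = v" if "\<And>x. cinner x u = cinner x v" for u v :: 'h
    by (rule cinner_ext) (metis that Re_cinner_commute)
  have "bounded_linear b"
  proof (rule bounded_linear_intro[where K="norm A"])
    show "b (x + y) = b x + b y" for x y
      by (rule ext) (simp add: cinner_add_right flip: cb)
    show "b (r *\<^sub>R x) = r *\<^sub>R b x" for r x
      by (rule ext) (simp add: cinner_scaleC_right scaleR_scaleC flip: cb)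
    show "norm (b x) \<le> norm x * norm A" for x
    proof (cases "b x = 0")
      case False
      have "(norm (b x))\<^sup>2 = Re (cinner (A (b x)) x)" by (simp add: cb cinner_self)
      also have "\<dots> \<le> norm (A (b x)) * norm x"
        using cmod_cinner_le complex_Re_le_cmod order_trans by blast
      also have "\<dots> \<le> norm A * norm (b x) * norm x"
        by (intro mult_right_mono norm_blinfun) auto
      finally have "norm (b x) * norm (b x) \<le> norm (b x) * (norm x * norm A)"
        by (simp add: power2_eq_square algebra_simps)
      then show ?thesis using False by simp
    qed simp
  qed
  then show ?thesis using cb
    by (intro exI[of _ "Blinfun b"]) (simp add: bounded_linear_Blinfun_apply)
qed

lemma cinner_op_adjoint:
  fixes A :: "'h::complex_hilbert \<Rightarrow>\<^sub>L 'h"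
  assumes A: "A \<in> ops UNIV"
  shows "cinner x (op_adjoint A y) = cinner (A x) y"
proof -
  have "\<exists>!B::'h \<Rightarrow>\<^sub>L 'h. \<forall>x y. cinner (A x) y = cinner x (B y)"
  proof (rule ex_ex1I[OF op_adjoint_exists[OF A]])
    fix B C :: "'h \<Rightarrow>\<^sub>L 'h"
    assume B: "\<forall>x y. cinner (A x) y = cinner x (B y)" and C: "\<forall>x y. cinner (A x) y = cinner x (C y)"
    show "B = C"
    proof (rule blinfun_eqI, rule cinner_ext)
      fix i y
      have "cinner y (B i) = cinner y (C i)" by (simp flip: B[rule_format] C[rule_format])
      then show "Re (cinner (B i) y) = Re (cinner (C i) y)"
        by (simp add: Re_cinner_commute[of _ y])
    qed
  qed
  from theI'[OF this, rule_format, of x y] show ?thesis unfolding op_adjoint_def by (rule sym)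
qed

lemma cinner_op_adjoint_left:
  fixes A :: "'h::complex_hilbert \<Rightarrow>\<^sub>L 'h"
  assumes A: "A \<in> ops UNIV"
  shows "cinner (op_adjoint A y) x = cinner y (A x)"
  using cinner_op_adjoint[OF A, of x y] by (metis cinner_commute)

subsection \<open>Inverses of coercive operators\<close>

lemma is_op_inverse_unique:
  assumes M: "hilbert_subspace M" and "is_op_inverse M A B" "is_op_inverse M A C"
  shows "B = C"
proof (rule ops_eqI[OF M])
  show B: "B \<in> ops M" and C: "C \<in> ops M" using assms by (auto simp: is_op_inverse_def)
  fix x assume x: "x \<in> M"
  have "A o\<^sub>L C = op_one M" "B o\<^sub>L A = op_one M" using assms by (auto simp: is_op_inverse_def)
  then have "A (C x) = x" "B (A (C x)) = C x"
    using x ops_in[OF C] by (metis blinfun_apply_blinfun_compose op_one_id[OF M])+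
  then show "B x = C x" by simp
qed

lemma op_inverse_eq:
  assumes M: "hilbert_subspace M" and "is_op_inverse M A B"
  shows "op_inverse M A = B"
  unfolding op_inverse_def using assms is_op_inverse_unique[OF M] by blast

lemma coercive_bounded_below:
  assumes "\<rho> * (norm x)\<^sup>2 \<le> inner y x"
  shows "\<rho> * norm (x::'a::real_inner) \<le> norm y"
proof (cases "x = 0")
  case False
  have "\<rho> * norm x * norm x \<le> norm y * norm x"
    using assms norm_cauchy_schwarz[of y x] by (simp add: power2_eq_square mult.assoc)
  then show ?thesis using False by simp
qed simp

text \<open>Lax-Milgram by fixed points: for a suitable \<open>t\<close> the map
  \<open>x \<mapsto> x - t (A x - y)\<close> contracts \<open>M\<close>, and its fixed point solves
  \<open>A x = y\<close>. The inverse is extended by zero off \<open>M\<close> by projecting with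
  \<open>op_one M\<close> first.\<close>

lemma coercive_inverse:
  fixes M :: "'h::complex_hilbert set"
  assumes M: "hilbert_subspace M" and A: "A \<in> ops M" and \<rho>: "\<rho> > 0"
    and co: "\<And>x. x \<in> M \<Longrightarrow> \<rho> * (norm x)\<^sup>2 \<le> inner (blinfun_apply A x) x"
  shows "is_op_inverse M A (op_inverse M A)" and "norm (op_inverse M A x) \<le> norm x / \<rho>"
proof -
  note MD = hilbert_subspaceD[OF M]
  have bb: "\<rho> * norm x \<le> norm (A x)" if "x \<in> M" for x
    by (rule coercive_bounded_below) (rule co[OF that])
  define K where "K = norm A + \<rho>"
  have K: "K > 0" "norm A \<le> K" using \<rho> by (auto simp: K_def add_nonneg_pos)
  \<comment> \<open>This minimizes the bound \<open>1 - 2 t \<rho> + t^2 K^2\<close> for the squared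
    contraction factor, and the minimum is \<open>q^2\<close>. The summand \<open>\<rho>\<close> in
    \<open>K\<close> keeps \<open>K\<close> positive and at least \<open>\<rho>\<close>, so
    \<open>q\<close> is the root of a nonnegative number.\<close>
  define t where "t = \<rho> / K\<^sup>2"
  have t: "t > 0" using \<rho> K by (simp add: t_def)
  define q where "q = sqrt (1 - \<rho>\<^sup>2 / K\<^sup>2)"
  have rK: "\<rho>\<^sup>2 \<le> K\<^sup>2" using \<rho> by (intro power_mono) (auto simp: K_def)
  have q: "0 \<le> q" "q < 1" using \<rho> K rK by (auto simp: q_def)
  have contr: "norm (x - t *\<^sub>R A x) \<le> q * norm x" if "x \<in> M" for x
  proof (rule power2_le_imp_le)
    have "(norm (A x))\<^sup>2 \<le> (K * norm x)\<^sup>2"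
      by (intro power_mono order_trans[OF norm_blinfun] mult_right_mono K) auto
    then have 1: "t\<^sup>2 * (norm (A x))\<^sup>2 \<le> t\<^sup>2 * (K\<^sup>2 * (norm x)\<^sup>2)"
      by (intro mult_left_mono) (auto simp: power_mult_distrib)
    have 2: "2 * t * (\<rho> * (norm x)\<^sup>2) \<le> 2 * t * inner (A x) x"
      using co[OF that] t by (intro mult_left_mono) auto
    have "(norm (x - t *\<^sub>R A x))\<^sup>2 = (norm x)\<^sup>2 - 2 * t * inner (A x) x + t\<^sup>2 * (norm (A x))\<^sup>2"
      unfolding power2_norm_eq_inner by (simp add: inner_simps algebra_simps inner_commute power2_eq_square)
    also have "\<dots> \<le> (norm x)\<^sup>2 - 2 * t * (\<rho> * (norm x)\<^sup>2) + t\<^sup>2 * (K\<^sup>2 * (norm x)\<^sup>2)"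
      using 1 2 by linarith
    also have "\<dots> = (1 - \<rho>\<^sup>2 / K\<^sup>2) * (norm x)\<^sup>2"
      using K(1) by (simp add: t_def field_simps power2_eq_square)
    also have "\<dots> = (q * norm x)\<^sup>2" using rK K(1) by (simp add: q_def power_mult_distrib)
    finally show "(norm (x - t *\<^sub>R A x))\<^sup>2 \<le> (q * norm x)\<^sup>2" .
  qed (use q in simp)
  have "\<exists>x\<in>M. A x = y" if y: "y \<in> M" for y
  proof -
    define f where "f x = x - t *\<^sub>R (A x - y)" for x
    have "\<exists>!x\<in>M. f x = x"
    proof (rule Banach_fix)
      show "complete M" using MD(1) by (simp add: complete_eq_closed)
      show "M \<noteq> {}" using MD(4) by auto
      show "f ` M \<subseteq> M" using y A by (auto simp: f_def intro!: MD(5-7) ops_in)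
      show "dist (f x) (f z) \<le> q * dist x z" if "x \<in> M" "z \<in> M" for x z
        using contr[of "x - z"] MD(6)[OF that]
        by (simp add: f_def dist_norm algebra_simps blinfun.diff_right)
    qed (use q in auto)
    then obtain x where "x \<in> M" "f x = x" by blast
    then show ?thesis using t by (auto simp: f_def intro!: bexI[of _ x])
  qed
  then obtain g where g: "\<And>y. y \<in> M \<Longrightarrow> g y \<in> M" "\<And>y. y \<in> M \<Longrightarrow> A (g y) = y" by metis
  have inj: "x = x'" if "x \<in> M" "x' \<in> M" "A x = A x'" for x x'
  proof -
    have "\<rho> * norm (x - x') \<le> 0"
      using bb[OF MD(6)[OF that(1,2)]] that(3) by (simp add: blinfun.diff_right)
    then show ?thesis using \<rho> by (simp add: mult_le_0_iff)
  qed
  define b where "b y = g (op_one M y)" for y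
  have bM: "b y \<in> M" and Ab: "A (b y) = op_one M y" for y
    using g op_one_in[OF M] by (auto simp: b_def)
  have bn: "norm (b y) \<le> norm y / \<rho>" for y
    using bb[OF bM[of y]] norm_op_one_apply_le[OF M, of y] \<rho> by (simp add: Ab field_simps)
  have sc: "b (c *\<^sub>C x) = c *\<^sub>C b x" for c x
    by (rule inj) (simp_all add: bM MD Ab ops_scaleC[OF A] ops_scaleC[OF op_one_in_ops[OF M]])
  have bl: "bounded_linear b"
  proof (rule bounded_linear_intro[where K="1/\<rho>"])
    show "b (x + y) = b x + b y" for x y
      by (rule inj) (simp_all add: bM MD Ab blinfun.add_right)
  qed (use sc bn in \<open>auto simp: scaleR_scaleC\<close>)
  define B where "B = Blinfun b"
  have B: "B y = b y" for y by (simp add: B_def bounded_linear_Blinfun_apply[OF bl])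
  have idem: "op_one M (op_one M y) = op_one M y" for y by (simp add: op_one_id op_one_in M)
  have "B \<in> ops M"
    by (rule opsI_op_one[OF M]) (auto simp: ops_UNIV_iff B sc bM, simp add: b_def idem)
  moreover have "A o\<^sub>L B = op_one M" by (rule blinfun_eqI) (simp add: B Ab)
  moreover have "B o\<^sub>L A = op_one M"
  proof (rule ops_eqI[OF M ops_compose[OF calculation(1) A] op_one_in_ops[OF M]])
    fix x assume x: "x \<in> M"
    have "A (b (A x)) = A x" by (simp add: Ab op_one_id[OF M ops_in[OF A]])
    then have "b (A x) = x" by (rule inj[OF bM x])
    then show "(B o\<^sub>L A) x = op_one M x" by (simp add: B op_one_id[OF M x])
  qed
  ultimately have inv: "is_op_inverse M A B" by (simp add: is_op_inverse_def)
  then have "op_inverse M A = B" by (rule op_inverse_eq[OF M])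
  then show "is_op_inverse M A (op_inverse M A)" "norm (op_inverse M A x) \<le> norm x / \<rho>"
    using inv bn by (auto simp: B)
qed

lemma is_op_inverse_apply:
  assumes M: "hilbert_subspace M" and "is_op_inverse M A B" "x \<in> M"
  shows "A (B x) = x" "B (A x) = x" "B x \<in> M"
  using assms(2,3) unfolding is_op_inverse_def
  by (metis blinfun_apply_blinfun_compose op_one_id[OF M], metis blinfun_apply_blinfun_compose op_one_id[OF M],
      simp add: ops_in)

section \<open>Positive semidefinite kernels\<close>

text \<open>Only the real part of the quadratic form is required to be nonnegative, so Hermitian
  symmetry is a clause of its own.\<close>

definition psd :: "(nat \<Rightarrow> nat \<Rightarrow> complex) \<Rightarrow> bool"
  where "psd K \<longleftrightarrow> (\<forall>k l. K l k = cnj (K k l)) \<and>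
    (\<forall>n c. 0 \<le> Re (\<Sum>k<n. \<Sum>l<n. c k * cnj (c l) * K k l))"

lemma psd_commute: "psd K \<Longrightarrow> K l k = cnj (K k l)"
  unfolding psd_def by blast

lemma psd_Re_nonneg: "psd K \<Longrightarrow> 0 \<le> Re (\<Sum>k<n. \<Sum>l<n. c k * cnj (c l) * K k l)"
  unfolding psd_def by blast

lemma psd_zero: "psd (\<lambda>k l. 0)"
  by (simp add: psd_def)

lemma psd_rank_one: "psd (\<lambda>k l. f k * cnj (f l))"
proof -
  have "(\<Sum>k<n. \<Sum>l<n. c k * cnj (c l) * (f k * cnj (f l))) =
      (\<Sum>k<n. c k * f k) * cnj (\<Sum>k<n. c k * f k)" for n c
    unfolding cnj_sum sum_product by (simp add: mult_ac)
  then have "0 \<le> Re (\<Sum>k<n. \<Sum>l<n. c k * cnj (c l) * (f k * cnj (f l)))" for n c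
    by (simp only: complex_mult_cnj Re_complex_of_real) simp
  then show ?thesis unfolding psd_def by simp
qed

lemma psd_add:
  assumes "psd K" "psd L"
  shows "psd (\<lambda>k l. K k l + L k l)"
  unfolding psd_def
proof (intro conjI allI)
  show "K l k + L l k = cnj (K k l + L k l)" for k l
    using psd_commute[OF assms(1), of l k] psd_commute[OF assms(2), of l k] by simp
  show "0 \<le> Re (\<Sum>k<n. \<Sum>l<n. c k * cnj (c l) * (K k l + L k l))" for n c
    using psd_Re_nonneg[OF assms(1), of c n] psd_Re_nonneg[OF assms(2), of c n]
    by (simp add: distrib_left sum.distrib)
qed

lemma psd_scale:
  assumes "psd K" "0 \<le> r"
  shows "psd (\<lambda>k l. complex_of_real r * K k l)"
  unfolding psd_def
proof (intro conjI allI)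
  show "complex_of_real r * K l k = cnj (complex_of_real r * K k l)" for k l
    using psd_commute[OF assms(1), of l k] by simp
  fix n c
  have "(\<Sum>k<n. \<Sum>l<n. c k * cnj (c l) * (complex_of_real r * K k l)) =
    complex_of_real r * (\<Sum>k<n. \<Sum>l<n. c k * cnj (c l) * K k l)"
    by (simp add: sum_distrib_left mult_ac)
  then show "0 \<le> Re (\<Sum>k<n. \<Sum>l<n. c k * cnj (c l) * (complex_of_real r * K k l))"
    using psd_Re_nonneg[OF assms(1), of c n] assms(2) by simp
qed

lemma psd_limit:
  assumes "\<And>m. psd (K m)" and "\<And>k l. (\<lambda>m. K m k l) \<longlonglongrightarrow> L k l"
  shows "psd L"
  unfolding psd_def
proof (intro conjI allI)
  show "L l k = cnj (L k l)" for k l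
  proof (rule LIMSEQ_unique[OF assms(2)])
    have "(\<lambda>m. cnj (K m k l)) \<longlonglongrightarrow> cnj (L k l)" by (intro tendsto_intros assms)
    then show "(\<lambda>m. K m l k) \<longlonglongrightarrow> cnj (L k l)"
      using psd_commute[OF assms(1), where k=k and l=l] by simp
  qed
  fix n c
  show "0 \<le> Re (\<Sum>k<n. \<Sum>l<n. c k * cnj (c l) * L k l)"
  proof (rule LIMSEQ_le_const)
    show "(\<lambda>m. Re (\<Sum>k<n. \<Sum>l<n. c k * cnj (c l) * K m k l)) \<longlonglongrightarrow>
       Re (\<Sum>k<n. \<Sum>l<n. c k * cnj (c l) * L k l)"
      by (intro tendsto_intros assms)
  qed (use psd_Re_nonneg[OF assms(1)] in blast)
qed

section \<open>Schur complements, Cholesky factors and Gram vectors\<close>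

lemma quadratic_form_shift:
  fixes K :: "nat \<Rightarrow> nat \<Rightarrow> complex"
  assumes "p < n"
  shows "(\<Sum>k<n. \<Sum>l<n. (c(p := c p + t)) k * cnj ((c(p := c p + t)) l) * K k l) =
    (\<Sum>k<n. \<Sum>l<n. c k * cnj (c l) * K k l) + cnj t * (\<Sum>k<n. c k * K k p) +
    t * (\<Sum>l<n. cnj (c l) * K p l) + t * cnj t * K p p"
proof -
  define \<delta> where "\<delta> k = (if k = p then t else 0)" for k
  have c: "(c(p := c p + t)) k = c k + \<delta> k" for k by (simp add: \<delta>_def)
  have "(\<Sum>k<n. \<Sum>l<n. (c k + \<delta> k) * cnj (c l + \<delta> l) * K k l) =
    (\<Sum>k<n. \<Sum>l<n. c k * cnj (c l) * K k l) + (\<Sum>k<n. \<Sum>l<n. cnj (\<delta> l) * (c k * K k l)) +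
    (\<Sum>k<n. \<Sum>l<n. \<delta> k * (cnj (c l) * K k l)) + (\<Sum>k<n. \<Sum>l<n. \<delta> k * (cnj (\<delta> l) * K k l))"
    unfolding sum.distrib[symmetric] by (intro sum.cong refl) (simp add: algebra_simps)
  also have "(\<Sum>k<n. \<Sum>l<n. cnj (\<delta> l) * (c k * K k l)) = cnj t * (\<Sum>k<n. c k * K k p)"
    using assms by (simp add: \<delta>_def if_distrib[of cnj] if_distrib[of "\<lambda>x. x * _"] sum_distrib_left cong: if_cong)
  also have "(\<Sum>k<n. \<Sum>l<n. \<delta> k * (cnj (c l) * K k l)) = t * (\<Sum>l<n. cnj (c l) * K p l)"
    using assms by (subst sum.swap)
      (simp add: \<delta>_def if_distrib[of cnj] if_distrib[of "\<lambda>x. x * _"] sum_distrib_left cong: if_cong)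
  also have "(\<Sum>k<n. \<Sum>l<n. \<delta> k * (cnj (\<delta> l) * K k l)) = t * cnj t * K p p"
    using assms
    by (simp add: \<delta>_def if_distrib[of cnj] if_distrib[of "\<lambda>x. x * _"] cong: if_cong)
      (subst sum.swap, simp add: if_distrib[of "\<lambda>x. _ * x"] cong: if_cong)
  finally show ?thesis unfolding c .
qed

lemma psd_diag:
  assumes "psd K"
  shows "K p p = of_real (Re (K p p))" "0 \<le> Re (K p p)"
proof -
  show "K p p = of_real (Re (K p p))"
    using psd_commute[OF assms, of p p] by (metis Reals_cnj_iff of_real_Re)
  show "0 \<le> Re (K p p)"
    using psd_Re_nonneg[OF assms, of "(\<lambda>_. 0)(p := 0 + 1)" "Suc p"]
    unfolding quadratic_form_shift[OF lessI] by simp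
qed

lemma psd_shift_nonneg:
  fixes c :: "nat \<Rightarrow> complex"
  assumes "psd K" "p < n"
  defines "s \<equiv> \<Sum>k<n. c k * K k p"
  shows "0 \<le> Re (\<Sum>k<n. \<Sum>l<n. c k * cnj (c l) * K k l) + 2 * Re (cnj t * s) + (cmod t)\<^sup>2 * Re (K p p)"
proof -
  have "(\<Sum>l<n. cnj (c l) * K p l) = cnj s"
    unfolding s_def by (simp add: psd_commute[OF assms(1), of _ p])
  then have "0 \<le> Re ((\<Sum>k<n. \<Sum>l<n. c k * cnj (c l) * K k l) + cnj t * s + t * cnj s + t * cnj t * K p p)"
    using psd_Re_nonneg[OF assms(1), of "c(p := c p + t)" n]
    unfolding quadratic_form_shift[OF assms(2)] s_def by simp
  moreover have "Re (t * cnj s) = Re (cnj t * s)" by simp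
  moreover have "Re (t * cnj t * K p p) = (cmod t)\<^sup>2 * Re (K p p)"
    unfolding complex_norm_square[symmetric] by simp
  ultimately show ?thesis unfolding plus_complex.sel by linarith
qed

text \<open>With a zero pivot, shifting the coefficient at \<open>p\<close> changes the quadratic
  form only linearly, and a nonzero linear term would make it negative somewhere.\<close>

lemma psd_zero_pivot:
  assumes "psd K" "K p p = 0"
  shows "K k p = 0"
proof (rule ccontr)
  assume nz: "K k p \<noteq> 0"
  define n where "n = Suc (max k p)"
  define c where "c i = (if i = k then 1 else 0 :: complex)" for i
  have s: "(\<Sum>i<n. c i * K i p) = K k p"
    by (simp add: c_def n_def if_distrib[of "\<lambda>x. x * _"] cong: if_cong)
  define Q where "Q = Re (\<Sum>k<n. \<Sum>l<n. c k * cnj (c l) * K k l)"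
  have "0 \<le> Q + 2 * Re (cnj t * K k p)" for t
    using psd_shift_nonneg[OF assms(1), of p n c t] unfolding s Q_def
    by (simp add: n_def assms(2))
  \<comment> \<open>Scaled so that the linear term equals \<open>- 2 (|Q| + 1)\<close> and outweighs
    \<open>Q\<close>.\<close>
  moreover define r where "r = (\<bar>Q\<bar> + 1) / (cmod (K k p))\<^sup>2"
  ultimately have "0 \<le> Q + 2 * Re (cnj (- of_real r * K k p) * K k p)" by blast
  also have "cnj (- of_real r * K k p) * K k p = - of_real (r * (cmod (K k p))\<^sup>2)"
    unfolding of_real_mult complex_norm_square by simp
  also have "r * (cmod (K k p))\<^sup>2 = \<bar>Q\<bar> + 1" using nz by (simp add: r_def)
  finally show False by simp
qed

text \<open>Gaussian elimination of the index \<open>p\<close>. For a zero pivot the quotient is 0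
  by convention and nothing is subtracted, which is right for a positive kernel because its row and
  column \<open>p\<close> then vanish.\<close>

definition schur_complement :: "nat \<Rightarrow> (nat \<Rightarrow> nat \<Rightarrow> complex) \<Rightarrow> nat \<Rightarrow> nat \<Rightarrow> complex"
  where "schur_complement p K k l = K k l - K k p * K p l / K p p"

text \<open>The new quadratic form is the minimum of the old one over the coefficient at
  \<open>p\<close>; for a nonzero pivot the minimizing shift is \<open>- s / K p p\<close>.\<close>

lemma psd_schur_complement:
  assumes "psd K"
  shows "psd (schur_complement p K)"
  unfolding psd_def schur_complement_def
proof (intro conjI allI)
  show "K l k - K l p * K p k / K p p = cnj (K k l - K k p * K p l / K p p)" for k l
    using psd_commute[OF assms, of k l] psd_commute[OF assms, of k p] psd_commute[OF assms, of p l]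
      psd_commute[OF assms, of p p] by (simp add: mult.commute)
  fix n and c :: "nat \<Rightarrow> complex"
  have main: "0 \<le> Re (\<Sum>k<n. \<Sum>l<n. c k * cnj (c l) * (K k l - K k p * K p l / K p p))"
    if pn: "p < n" for n and c :: "nat \<Rightarrow> complex"
  proof -
    define s where "s = (\<Sum>k<n. c k * K k p)"
    have s': "(\<Sum>l<n. cnj (c l) * K p l) = cnj s"
      unfolding s_def by (simp add: psd_commute[OF assms(1), of _ p])
    have "(\<Sum>k<n. \<Sum>l<n. c k * cnj (c l) * (K k l - K k p * K p l / K p p)) =
      (\<Sum>k<n. \<Sum>l<n. c k * cnj (c l) * K k l) - s * cnj s / K p p"
      unfolding s'[symmetric] unfolding s_def sum_product sum_divide_distrib sum_subtractf[symmetric]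
      by (intro sum.cong refl) (simp add: algebra_simps)
    moreover have "0 \<le> Re (\<Sum>k<n. \<Sum>l<n. c k * cnj (c l) * K k l) - (cmod s)\<^sup>2 / Re (K p p)"
    proof (cases "K p p = 0")
      case True
      then show ?thesis using psd_Re_nonneg[OF assms] by simp
    next
      case False
      then have kp: "Re (K p p) > 0" using psd_diag[OF assms, of p]
        by (metis less_eq_real_def of_real_0)
      define r where "r = Re (K p p)"
      have "(cmod (- s / of_real r))\<^sup>2 * r = (cmod s)\<^sup>2 / r"
        using kp unfolding r_def[symmetric] by (simp add: norm_divide power_divide power2_eq_square)
      moreover have "cnj (- s / of_real r) * s = - (cnj s * s / of_real r)" by simp
      then have "cnj (- s / of_real r) * s = - of_real ((cmod s)\<^sup>2 / r)"
        by (metis (no_types, lifting) complex_norm_square mult.commute of_real_divide)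
      then have "2 * Re (cnj (- s / of_real r) * s) = - 2 * ((cmod s)\<^sup>2 / r)"
        by (simp only:) simp
      ultimately show ?thesis
        using psd_shift_nonneg[OF assms pn, of c "- s / of_real r", folded s_def]
        unfolding r_def[symmetric] by linarith
    qed
    moreover have "Re (s * cnj s / K p p) = (cmod s)\<^sup>2 / Re (K p p)"
      by (subst psd_diag(1)[OF assms]) (simp add: complex_mult_cnj cmod_power2 flip: of_real_divide of_real_add)
    ultimately show ?thesis by simp
  qed
  \<comment> \<open>Shifting at \<open>p\<close> needs \<open>p\<close> among the indices, so the
    range is enlarged to contain it and the coefficients are padded by zeros.\<close>
  define m where "m = max n (Suc p)"
  define d where "d k = (if k < n then c k else 0)" for k
  have "(\<Sum>k<n. \<Sum>l<n. c k * cnj (c l) * (K k l - K k p * K p l / K p p)) =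
    (\<Sum>k<m. \<Sum>l<m. d k * cnj (d l) * (K k l - K k p * K p l / K p p))"
  proof -
    have "(\<Sum>l<n. c k * cnj (c l) * (K k l - K k p * K p l / K p p)) =
      (\<Sum>l<m. d k * cnj (d l) * (K k l - K k p * K p l / K p p))" if "k < n" for k
      by (rule sum.mono_neutral_cong_left) (use that in \<open>auto simp: m_def d_def\<close>)
    then show ?thesis
      by (intro sum.mono_neutral_cong_left) (auto simp: m_def d_def)
  qed
  then show "0 \<le> Re (\<Sum>k<n. \<Sum>l<n. c k * cnj (c l) * (K k l - K k p * K p l / K p p))"
    using main[of m d] by (simp add: m_def)
qed

primrec schur_iter :: "(nat \<Rightarrow> nat \<Rightarrow> complex) \<Rightarrow> nat \<Rightarrow> nat \<Rightarrow> nat \<Rightarrow> complex" where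
  "schur_iter K 0 = K"
| "schur_iter K (Suc p) = schur_complement p (schur_iter K p)"

lemma psd_schur_iter: "psd K \<Longrightarrow> psd (schur_iter K m)"
  by (induction m) (simp_all add: psd_schur_complement)

text \<open>An eliminated index stays eliminated: later steps subtract products containing an entry
  of its zero row or column.\<close>

lemma schur_iter_eq_0:
  assumes "psd K"
  shows "k < m \<Longrightarrow> schur_iter K m k l = 0" "k < m \<Longrightarrow> schur_iter K m l k = 0"
proof -
  have "schur_iter K m k l = 0 \<and> schur_iter K m l k = 0" if "k < m" for k l
    using that
  proof (induction m arbitrary: l)
    case (Suc m)
    note P = psd_schur_iter[OF assms, of m]
    show ?case
    proof (cases "k = m")
      case [simp]: True
      show ?thesis
      proof (cases "schur_iter K m m m = 0")
        case True
        then show ?thesis using psd_zero_pivot[OF P True, of l] psd_commute[OF P, of l m]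
          by (simp add: schur_complement_def)
      qed (simp add: schur_complement_def)
    next
      case False
      then show ?thesis using Suc by (simp add: schur_complement_def)
    qed
  qed simp
  then show "k < m \<Longrightarrow> schur_iter K m k l = 0" "k < m \<Longrightarrow> schur_iter K m l k = 0" by auto
qed

text \<open>Each elimination step splits off a rank-one kernel, the pivot column divided by the root
  of the pivot; after \<open>n\<close> steps the remainder has zero rows at all indices below
  \<open>n\<close>.\<close>

lemma psd_cholesky:
  assumes "psd K"
  shows "\<exists>L. (\<forall>k i. k < i \<longrightarrow> L k i = 0) \<and> (\<forall>k l n. k < n \<longrightarrow> K k l = (\<Sum>i<n. L k i * cnj (L l i)))"
proof -
  define L where "L k i = schur_iter K i k i / of_real (sqrt (Re (schur_iter K i i i)))" for k i
  have "K k l = (\<Sum>i<n. L k i * cnj (L l i)) + schur_iter K n k l" for k l n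
  proof (induction n)
    case (Suc n)
    note P = psd_schur_iter[OF assms, of n]
    have "cnj (schur_iter K n l n) = schur_iter K n n l"
      using psd_commute[OF P] by metis
    then have "L k n * cnj (L l n) = schur_iter K n k n * schur_iter K n n l /
        of_real (sqrt (Re (schur_iter K n n n)) * sqrt (Re (schur_iter K n n n)))"
      by (simp add: L_def del: real_sqrt_mult_self)
    also have "sqrt (Re (schur_iter K n n n)) * sqrt (Re (schur_iter K n n n)) = Re (schur_iter K n n n)"
      using psd_diag(2)[OF P] by simp
    also have "of_real \<dots> = schur_iter K n n n" using psd_diag(1)[OF P] by simp
    finally show ?case using Suc by (simp add: schur_complement_def)
  qed simp
  then have "K k l = (\<Sum>i<n. L k i * cnj (L l i))" if "k < n" for k l n
    using schur_iter_eq_0(1)[OF assms that] by (metis add.right_neutral)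
  moreover have "L k i = 0" if "k < i" for k i
    using schur_iter_eq_0(1)[OF assms that] by (simp add: L_def)
  ultimately show ?thesis by blast
qed

text \<open>The rows of a Cholesky factor are finite, so each vector is a finite combination of the
  prescribed orthonormal sequence. This control of the span later keeps selected basis vectors
  orthogonal to all Gram vectors.\<close>

lemma psd_gram_vectors:
  fixes e :: "nat \<Rightarrow> 'h::complex_hilbert"
  assumes "psd K" and e: "\<And>i j. cinner (e i) (e j) = (if i = j then 1 else 0)"
  shows "\<exists>v. (\<forall>k. \<exists>n c. v k = (\<Sum>i<n. c i *\<^sub>C e i)) \<and> (\<forall>k l. cinner (v k) (v l) = K k l)"
proof -
  obtain L where L: "\<And>k i. k < i \<Longrightarrow> L k i = 0"
      "\<And>k l n. k < n \<Longrightarrow> K k l = (\<Sum>i<n. L k i * cnj (L l i))"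
    using psd_cholesky[OF assms(1)] by blast
  define v where "v k = (\<Sum>i<Suc k. L k i *\<^sub>C e i)" for k
  have v: "v k = (\<Sum>i<n. L k i *\<^sub>C e i)" if "k < n" for k n
    unfolding v_def by (rule sum.mono_neutral_left) (use that L(1) in auto)
  have "cinner (v k) (v l) = K k l" for k l
  proof -
    define n where "n = Suc (max k l)"
    have "cinner (v k) (v l) = cinner (\<Sum>i<n. L k i *\<^sub>C e i) (\<Sum>i<n. L l i *\<^sub>C e i)"
      by (subst (1 2) v[of _ n]) (auto simp: n_def)
    also have "\<dots> = (\<Sum>i<n. L k i * cnj (L l i))"
      by (simp add: cinner_linear_simps e if_distrib[of "\<lambda>x. _ * x"] mult.commute cong: if_cong)
    also have "\<dots> = K k l" by (rule L(2)[symmetric]) (simp add: n_def)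
    finally show ?thesis .
  qed
  then show ?thesis using v_def by blast
qed

text \<open>Cauchy-Schwarz for the rows of a Cholesky factor.\<close>

lemma psd_cmod_le:
  fixes K :: "nat \<Rightarrow> nat \<Rightarrow> complex"
  assumes "psd K"
  shows "(cmod (K k l))\<^sup>2 \<le> Re (K k k) * Re (K l l)"
proof -
  obtain L where L: "\<And>k l n. k < n \<Longrightarrow> K k l = (\<Sum>i<n. L k i * cnj (L l i))"
    using psd_cholesky[OF assms(1)] by blast
  define n where "n = Suc (max k l)"
  have kk: "Re (K j j) = (\<Sum>i<n. (cmod (L j i))\<^sup>2)" if "j < n" for j
    using L[OF that, of j] by (simp flip: complex_norm_square)
  have "cmod (K k l) \<le> (\<Sum>i<n. cmod (L k i) * cmod (L l i))"
    unfolding L[of k n l, unfolded n_def, simplified, folded n_def]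
    by (subst L[of k n]) (auto simp: n_def norm_mult simp del: sum.lessThan_Suc intro!: order_trans[OF norm_sum])
  then have "(cmod (K k l))\<^sup>2 \<le> (\<Sum>i<n. cmod (L k i) * cmod (L l i))\<^sup>2"
    by (intro power_mono) auto
  also have "\<dots> \<le> (\<Sum>i<n. (cmod (L k i))\<^sup>2) * (\<Sum>i<n. (cmod (L l i))\<^sup>2)"
    by (rule Cauchy_Schwarz_ineq_sum)
  also have "\<dots> = Re (K k k) * Re (K l l)" by (simp add: kk n_def)
  finally show ?thesis .
qed

section \<open>Extension of contractions\<close>

definition clspan :: "(nat \<Rightarrow> 'h::complex_hilbert) \<Rightarrow> 'h set"
  where "clspan a = closure {\<Sum>k<n. c k *\<^sub>C a k | n c. True}"

lemma lincomb_pad: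
  assumes "n \<le> (m::nat)"
  shows "(\<Sum>k<n. c k *\<^sub>C a k) = (\<Sum>k<m. (if k < n then c k else 0) *\<^sub>C (a k :: 'h::complex_hilbert))"
  by (rule sum.mono_neutral_cong_left) (use assms in auto)

text \<open>The new coefficients are chosen before the family \<open>a\<close>, so the same ones
  serve both components of a pair in the graph of an extension.\<close>

lemma lincomb_add: fixes n n' :: nat and c c' :: "nat \<Rightarrow> complex" shows
  "\<exists>m d. \<forall>a :: nat \<Rightarrow> 'h::complex_hilbert.
    (\<Sum>k<n. c k *\<^sub>C a k) + (\<Sum>k<n'. c' k *\<^sub>C a k) = (\<Sum>k<(m::nat). d k *\<^sub>C a k)"
proof -
  define m where "m = max n n'"
  have "(\<Sum>k<n. c k *\<^sub>C a k) + (\<Sum>k<n'. c' k *\<^sub>C a k) =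
    (\<Sum>k<m. ((if k < n then c k else 0) + (if k < n' then c' k else 0)) *\<^sub>C a k)"
    for a :: "nat \<Rightarrow> 'h"
    unfolding scaleC_add_left sum.distrib
    by (simp add: lincomb_pad[of n m c a] lincomb_pad[of n' m c' a] m_def)
  then show ?thesis by (intro exI allI)
qed

lemma closure_closed_under:
  assumes "x \<in> closure S" "\<And>x. x \<in> S \<Longrightarrow> f x \<in> S" "continuous_on UNIV f"
  shows "f x \<in> closure S"
proof -
  have "f ` closure S \<subseteq> closure S"
    by (rule image_closure_subset) (use assms closure_subset continuous_on_subset in blast)+
  then show ?thesis using assms by blast
qed

lemma closure_closed_under2:
  fixes x :: "'a::topological_space"
  assumes "x \<in> closure S" "y \<in> closure S" "\<And>x y. x \<in> S \<Longrightarrow> y \<in> S \<Longrightarrow> f (x, y) \<in> S"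
    "continuous_on UNIV f"
  shows "f (x, y) \<in> closure S"
proof -
  have "f ` closure (S \<times> S) \<subseteq> closure S"
    by (rule image_closure_subset) (use assms closure_subset continuous_on_subset in \<open>force+\<close>)
  then show ?thesis using assms by (auto simp: closure_Times)
qed

lemma continuous_on_scaleC: "continuous_on S (\<lambda>x. c *\<^sub>C (x::'a::complex_normed_vector))"
  by (rule linear_continuous_on) (rule bounded_linear_scaleC)

lemma hilbert_subspace_closure:
  fixes S :: "'h::complex_hilbert set"
  assumes "0 \<in> S" "\<And>x y. x \<in> S \<Longrightarrow> y \<in> S \<Longrightarrow> x + y \<in> S" "\<And>c x. x \<in> S \<Longrightarrow> c *\<^sub>C x \<in> S"
  shows "hilbert_subspace (closure S)"
proof -
  have sc: "c *\<^sub>C x \<in> closure S" if "x \<in> closure S" for c x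
    by (rule closure_closed_under[OF that]) (auto intro: assms continuous_on_scaleC)
  have ad: "x + y \<in> closure S" if "x \<in> closure S" "y \<in> closure S" for x y
    using closure_closed_under2[OF that, of "\<lambda>p. fst p + snd p"] assms(2)
    by (simp add: continuous_on_add continuous_on_fst continuous_on_snd)
  show ?thesis
    unfolding hilbert_subspace_def subspace_def
    using assms(1) closure_subset by (auto simp: sc ad scaleR_scaleC)
qed

lemma hilbert_subspace_clspan: "hilbert_subspace (clspan a)"
  unfolding clspan_def
proof (rule hilbert_subspace_closure, goal_cases)
  case 1
  show ?case by (auto intro!: exI[of _ 0])
next
  case (2 x y)
  then obtain n c n' c' where "x = (\<Sum>k<n. c k *\<^sub>C a k)" "y = (\<Sum>k<n'. c' k *\<^sub>C a k)" by auto
  then show ?case using lincomb_add[of c n c' n'] by fastforce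
next
  case (3 d x)
  then obtain n c where "x = (\<Sum>k<n. c k *\<^sub>C a k)" by auto
  then have "d *\<^sub>C x = (\<Sum>k<n. (d * c k) *\<^sub>C a k)" by (simp add: scaleC_sum_right scaleC_scaleC)
  then show ?case by (intro CollectI exI[of _ n] exI[of _ "\<lambda>k. d * c k"] conjI TrueI)
qed

lemma in_clspan: "a k \<in> clspan a"
proof -
  have "a k = (\<Sum>i<Suc k. (if i = k then 1 else 0) *\<^sub>C a i)"
    by (subst sum.mono_neutral_right[of _ "{k}"]) auto
  then have "\<exists>n c. a k = (\<Sum>i<n. c i *\<^sub>C a i) \<and> True" by (intro exI conjI TrueI)
  then have "a k \<in> {\<Sum>k<n. c k *\<^sub>C a k | n c. True}" by (intro CollectI)
  then show ?thesis unfolding clspan_def by (rule subsetD[OF closure_subset])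
qed

lemma clspan_minimal:
  assumes M: "hilbert_subspace M" and "\<And>k. a k \<in> M"
  shows "clspan a \<subseteq> M"
  unfolding clspan_def
proof (rule closure_minimal)
  show "{\<Sum>k<n. c k *\<^sub>C a k | n c. True} \<subseteq> M"
    using assms by (auto intro!: hilbert_subspace_sum hilbert_subspaceD(3))
qed (rule hilbert_subspaceD[OF M])

text \<open>The graph of the extension is the closure of the linear span of the pairs \<open>(a k, b k)\<close>.\<close>

lemma contraction_extension:
  fixes a b :: "nat \<Rightarrow> 'h::complex_hilbert"
  assumes K: "psd (\<lambda>k l. cinner (a k) (a l) - cinner (b k) (b l))"
  shows "\<exists>V. V \<in> ops UNIV \<and> norm V \<le> 1 \<and> (\<forall>k. blinfun_apply V (a k) = b k) \<and>
    (\<forall>x. V (op_one (clspan a) x) = V x) \<and> (\<forall>x. V x \<in> clspan b)"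
proof -
  define R where "R = {(\<Sum>k<n. c k *\<^sub>C a k, \<Sum>k<n. c k *\<^sub>C b k) | n c. True}"
  define G where "G = closure R"
  \<comment> \<open>Positivity of the difference of the Gram kernels, tested on the coefficients
    \<open>c\<close>, says that the second component is no longer than the first.\<close>
  have ineq: "norm (snd p) \<le> norm (fst p)" if "p \<in> R" for p
  proof -
    have "\<exists>n c. p = (\<Sum>k<n. c k *\<^sub>C a k, \<Sum>k<n. c k *\<^sub>C b k)"
      using that unfolding R_def mem_Collect_eq by simp
    then obtain n c where p: "p = (\<Sum>k<n. c k *\<^sub>C a k, \<Sum>k<n. c k *\<^sub>C b k)"
      by (elim exE)
    have *: "complex_of_real ((norm (\<Sum>k<n. c k *\<^sub>C v k))\<^sup>2) =
        (\<Sum>k<n. \<Sum>l<n. c k * cnj (c l) * cinner (v k) (v l))" for v :: "nat \<Rightarrow> 'h"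
      unfolding cinner_self[symmetric]
      by (simp add: cinner_linear_simps sum_distrib_left mult_ac) (rule sum.swap)
    have "complex_of_real ((norm (fst p))\<^sup>2 - (norm (snd p))\<^sup>2) =
        (\<Sum>k<n. \<Sum>l<n. c k * cnj (c l) * (cinner (a k) (a l) - cinner (b k) (b l)))"
      unfolding of_real_diff p fst_conv snd_conv * by (simp add: right_diff_distrib sum_subtractf)
    from arg_cong[OF this, of Re] have "0 \<le> (norm (fst p))\<^sup>2 - (norm (snd p))\<^sup>2"
      using psd_Re_nonneg[OF K, of c n] by (simp only: Re_complex_of_real)
    then have "(norm (snd p))\<^sup>2 \<le> (norm (fst p))\<^sup>2" by linarith
    then show ?thesis by (rule power2_le_imp_le) simp
  qed
  have Gineq: "norm (snd p) \<le> norm (fst p)" if "p \<in> G" for p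
  proof -
    have "G \<subseteq> {p. norm (snd p) \<le> norm (fst p)}"
      unfolding G_def using ineq
      by (intro closure_minimal) (auto intro!: closed_Collect_le continuous_intros)
    then show ?thesis using that by blast
  qed
  have Gadd: "(x + x', y + y') \<in> G" if g: "(x, y) \<in> G" "(x', y') \<in> G" for x y x' y'
  proof -
    have "(\<lambda>q. fst q + snd q) ((x, y), (x', y')) \<in> closure R"
    proof (rule closure_closed_under2[where f="\<lambda>q. fst q + snd q"])
      fix p q assume "p \<in> R" "q \<in> R"
      then have "\<exists>n c. p = (\<Sum>k<n. c k *\<^sub>C a k, \<Sum>k<n. c k *\<^sub>C b k)"
        "\<exists>n c. q = (\<Sum>k<n. c k *\<^sub>C a k, \<Sum>k<n. c k *\<^sub>C b k)"
        unfolding R_def mem_Collect_eq by simp_all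
      then obtain n c n' c' where
        pq: "p = (\<Sum>k<n. c k *\<^sub>C a k, \<Sum>k<n. c k *\<^sub>C b k)"
        "q = (\<Sum>k<n'. c' k *\<^sub>C a k, \<Sum>k<n'. c' k *\<^sub>C b k)" by (elim exE)
      obtain m d where "\<And>a :: nat \<Rightarrow> 'h.
          (\<Sum>k<n. c k *\<^sub>C a k) + (\<Sum>k<n'. c' k *\<^sub>C a k) = (\<Sum>k<(m::nat). d k *\<^sub>C a k)"
        using lincomb_add[of c n c' n', where 'h='h] by metis
      then have "fst (p, q) + snd (p, q) = (\<Sum>k<m. d k *\<^sub>C a k, \<Sum>k<m. d k *\<^sub>C b k)"
        by (simp add: pq)
      then show "fst (p, q) + snd (p, q) \<in> R"
        unfolding R_def by (intro CollectI exI[of _ m] exI[of _ d] conjI TrueI)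
    qed (use g in \<open>auto simp: G_def intro!: continuous_intros\<close>)
    then show ?thesis by (simp add: G_def)
  qed
  have Gsc: "(d *\<^sub>C x, d *\<^sub>C y) \<in> G" if "(x, y) \<in> G" for d x y
  proof -
    have "(\<lambda>p. (d *\<^sub>C fst p, d *\<^sub>C snd p)) (x, y) \<in> closure R"
    proof (rule closure_closed_under[where f="\<lambda>p. (d *\<^sub>C fst p, d *\<^sub>C snd p)"])
      fix p assume "p \<in> R"
      then have "\<exists>n c. p = (\<Sum>k<n. c k *\<^sub>C a k, \<Sum>k<n. c k *\<^sub>C b k)"
        unfolding R_def mem_Collect_eq by simp
      then obtain n c where "p = (\<Sum>k<n. c k *\<^sub>C a k, \<Sum>k<n. c k *\<^sub>C b k)" by (elim exE)
      then have "(d *\<^sub>C fst p, d *\<^sub>C snd p) = (\<Sum>k<n. (d * c k) *\<^sub>C a k, \<Sum>k<n. (d * c k) *\<^sub>C b k)"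
        by (simp add: scaleC_sum_right scaleC_scaleC)
      then show "(d *\<^sub>C fst p, d *\<^sub>C snd p) \<in> R" 
        unfolding R_def by (intro CollectI exI[of _ n] exI[of _ "\<lambda>k. d * c k"] conjI TrueI)
    qed (use that in \<open>auto simp: G_def intro!: continuous_intros
           continuous_on_compose2[OF continuous_on_scaleC]\<close>)
    then show ?thesis by (simp add: G_def)
  qed
  have Guniq: "y = y'" if "(x, y) \<in> G" "(x, y') \<in> G" for x y y'
  proof -
    have "(x + (-1) *\<^sub>C x, y + (-1) *\<^sub>C y') \<in> G" using that by (intro Gadd Gsc)
    from Gineq[OF this] show ?thesis by (simp add: scaleC_minus_left)
  qed
  \<comment> \<open>Approximants of \<open>x\<close> in the linear span have partners in
    \<open>R\<close>, and these form a Cauchy sequence because differences of pairs in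
    \<open>G\<close> do not grow from the first to the second component.\<close>
  have Gex: "\<exists>y. (x, y) \<in> G" if x: "x \<in> clspan a" for x
  proof -
    define S where "S = {\<Sum>k<n. c k *\<^sub>C a k | n c. True}"
    obtain X where X: "\<And>n. X n \<in> S" "X \<longlonglongrightarrow> x"
      using x unfolding clspan_def S_def[symmetric] closure_sequential by blast
    have "\<exists>y. (s, y) \<in> R" if s: "s \<in> S" for s
    proof -
      obtain n c where "s = (\<Sum>k<n. c k *\<^sub>C a k)"
        using s unfolding S_def mem_Collect_eq by (elim exE conjE)
      then show ?thesis unfolding R_def by (intro exI CollectI conjI TrueI) simp
    qed
    then have "\<forall>n. \<exists>y. (X n, y) \<in> R" using X(1) by simp
    then obtain Y where Y: "\<And>n. (X n, Y n) \<in> R" by metis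
    have YG: "(X n, Y n) \<in> G" for n using Y closure_subset unfolding G_def by blast
    have d: "dist (Y m) (Y n) \<le> dist (X m) (X n)" for m n
      using Gineq[OF Gadd[OF YG[of m] Gsc[OF YG[of n], of "-1"]]]
      by (simp add: dist_norm scaleC_minus_left)
    have "Cauchy X" using X(2) by (rule LIMSEQ_imp_Cauchy)
    then have "Cauchy Y" unfolding Cauchy_def by (meson d le_less_trans)
    then obtain y where "Y \<longlonglongrightarrow> y" using Cauchy_convergent convergent_def by blast
    then have "(\<lambda>n. (X n, Y n)) \<longlonglongrightarrow> (x, y)" using X(2) by (rule tendsto_Pair[rotated])
    then have "(x, y) \<in> G"
      by (rule closed_sequentially[of G, rotated 2]) (simp_all add: YG G_def[symmetric], simp add: G_def)
    then show ?thesis by blast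
  qed
  have Gsnd: "y \<in> clspan b" if "(x, y) \<in> G" for x y
  proof -
    have "snd ` closure R \<subseteq> clspan b"
      unfolding clspan_def
    proof (rule image_closure_subset)
      show "snd ` R \<subseteq> closure {\<Sum>k<n. c k *\<^sub>C b k | n c. True}"
        by (rule order_trans[OF _ closure_subset]) (auto simp: R_def, rule exI, rule exI, rule refl)
    qed (auto intro: continuous_intros)
    then show ?thesis using that unfolding G_def by force
  qed
  note M = hilbert_subspace_clspan[of a]
  note op1 = op_one_in[OF M]
  \<comment> \<open>Projecting onto \<open>clspan a\<close> first extends the map by zero to the
    orthogonal complement.\<close>
  obtain f where f: "\<And>x. (op_one (clspan a) x, f x) \<in> G" using Gex[OF op1] by metis
  have fn: "norm (f x) \<le> norm x" for x
    using Gineq[OF f[of x]] norm_op_one_apply_le[OF M, of x] by simp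
  have fsc: "f (d *\<^sub>C x) = d *\<^sub>C f x" for d x
    using f[of "d *\<^sub>C x"] Gsc[OF f[of x], of d] ops_scaleC[OF op_one_in_ops[OF M]]
    by (intro Guniq) auto
  have fadd: "f (x + y) = f x + f y" for x y
    using f[of "x + y"] Gadd[OF f[of x] f[of y]]
    by (intro Guniq) (auto simp: blinfun.add_right)
  have bl: "bounded_linear f"
    by (rule bounded_linear_intro[where K=1]) (auto simp: fadd fsc scaleR_scaleC fn)
  define V where "V = Blinfun f"
  have V: "V x = f x" for x by (simp add: V_def bounded_linear_Blinfun_apply[OF bl])
  have "V \<in> ops UNIV" by (simp add: ops_UNIV_iff V fsc)
  moreover have "norm V \<le> 1" by (rule norm_blinfun_bound) (auto simp: V fn)
  moreover have "V (a k) = b k" for k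
  proof -
    have "(\<Sum>i<Suc k. (if i = k then 1 else 0) *\<^sub>C v i) = v k" for v :: "nat \<Rightarrow> 'h"
      by (subst sum.mono_neutral_right[of _ "{k}"]) auto
    then have "(a k, b k) = (\<Sum>i<Suc k. (if i = k then 1 else 0) *\<^sub>C a i,
        \<Sum>i<Suc k. (if i = k then 1 else 0) *\<^sub>C b i)" by simp
    then have "\<exists>n c. (a k, b k) = (\<Sum>i<n. c i *\<^sub>C a i, \<Sum>i<n. c i *\<^sub>C b i) \<and> True"
      by (intro exI conjI TrueI)
    then have "(a k, b k) \<in> R" unfolding R_def by (intro CollectI)
    then have "(a k, b k) \<in> G" unfolding G_def using closure_subset by blast
    then show ?thesis using f[of "a k"] op_one_id[OF M in_clspan] V Guniq by metis
  qed
  moreover have "V (op_one (clspan a) x) = V x" for x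
    using f[of "op_one (clspan a) x"] f[of x] op_one_id[OF M op1] V Guniq by metis
  moreover have "V x \<in> clspan b" for x using Gsnd[OF f] by (simp add: V)
  ultimately show ?thesis by blast
qed

section \<open>Power series on the polydisc\<close>

definition vupd :: "complex ^ 'd \<Rightarrow> 'd \<Rightarrow> complex \<Rightarrow> complex ^ 'd"
  where "vupd z j w = (\<chi> i. if i = j then w else z $ i)"

lemma vupd_nth [simp]: "vupd z j w $ i = (if i = j then w else z $ i)"
  by (simp add: vupd_def)

lemma vupd_vupd [simp]: "vupd (vupd z j v) j w = vupd z j w"
  by (simp add: vec_eq_iff)

lemma vupd_same [simp]: "vupd z j (z $ j) = z"
  by (simp add: vec_eq_iff)

lemma vupd_commute: "i \<noteq> j \<Longrightarrow> vupd (vupd z i v) j w = vupd (vupd z j w) i v"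
  by (simp add: vec_eq_iff)

definition disc_power :: "real \<Rightarrow> (complex ^ 'd) set"
  where "disc_power R = {z. \<forall>j. cmod (z $ j) < R}"

lemma polydisc_eq: "polydisc = disc_power 1"
  by (simp add: polydisc_def disc_power_def)

lemma vupd_disc_power: "z \<in> disc_power R \<Longrightarrow> cmod w < R \<Longrightarrow> vupd z j w \<in> disc_power R"
  by (simp add: disc_power_def)

definition vmonom :: "'d set \<Rightarrow> complex ^ 'd \<Rightarrow> ('d \<Rightarrow> nat) \<Rightarrow> complex"
  where "vmonom J z \<alpha> = (\<Prod>i\<in>J. (z $ i) ^ \<alpha> i)"

definition supported :: "'d set \<Rightarrow> ('d \<Rightarrow> nat) set"
  where "supported J = {\<alpha>. \<forall>i. i \<notin> J \<longrightarrow> \<alpha> i = 0}"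

lemma supported_empty: "supported {} = {\<lambda>_. 0}"
  by (auto simp: supported_def)

lemma supported_UNIV: "supported UNIV = UNIV"
  by (simp add: supported_def)

lemma bij_betw_supported_insert:
  assumes "j \<notin> J"
  shows "bij_betw (\<lambda>(n, \<beta>). \<beta>(j := n)) (UNIV \<times> supported J) (supported (insert j J))"
  by (rule bij_betw_byWitness[where f' = "\<lambda>\<alpha>. (\<alpha> j, \<alpha>(j := 0))"])
    (use assms in \<open>auto simp: supported_def fun_eq_iff\<close>)

text \<open>Fubini with one geometric series per variable, the variables being peeled off by
  induction.\<close>

lemma geometric_multi_summable:
  fixes \<rho> :: "'d \<Rightarrow> real"
  assumes "finite J" "\<And>i. 0 \<le> \<rho> i" "\<And>i. \<rho> i < 1"
  shows "(\<lambda>\<alpha>. \<Prod>i\<in>J. \<rho> i ^ \<alpha> i) summable_on supported J"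
  using assms(1)
proof induction
  case empty
  then show ?case by (simp add: supported_empty)
next
  case (insert j J)
  have prod: "(\<Prod>i\<in>insert j J. \<rho> i ^ (\<beta>(j := n)) i) = \<rho> j ^ n * (\<Prod>i\<in>J. \<rho> i ^ \<beta> i)" for n \<beta>
  proof -
    have "(\<Prod>i\<in>J. \<rho> i ^ (\<beta>(j := n)) i) = (\<Prod>i\<in>J. \<rho> i ^ \<beta> i)"
      using insert.hyps(2) by (intro prod.cong) auto
    then show ?thesis using insert.hyps by simp
  qed
  obtain s where s: "((\<lambda>\<alpha>. \<Prod>i\<in>J. \<rho> i ^ \<alpha> i) has_sum s) (supported J)"
    using insert.IH by (auto simp: summable_on_def)
  have "summable (\<lambda>n. \<rho> j ^ n)" using assms by (intro summable_geometric) auto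
  then have geo: "(\<lambda>n. \<rho> j ^ n) summable_on UNIV"
    using assms by (subst summable_on_UNIV_nonneg_real_iff) auto
  have "(\<lambda>(n, \<beta>). \<rho> j ^ n * (\<Prod>i\<in>J. \<rho> i ^ \<beta> i)) summable_on (UNIV \<times> supported J)"
  proof (rule summable_on_SigmaI)
    show "((\<lambda>\<beta>. case (n, \<beta>) of (n, \<beta>) \<Rightarrow> \<rho> j ^ n * (\<Prod>i\<in>J. \<rho> i ^ \<beta> i)) has_sum \<rho> j ^ n * s) (supported J)" for n
      using s by (simp add: has_sum_cmult_right)
    show "(\<lambda>n. \<rho> j ^ n * s) summable_on UNIV" by (rule summable_on_cmult_left[OF geo])
  qed (use assms in \<open>auto intro!: mult_nonneg_nonneg prod_nonneg\<close>)
  then have "(\<lambda>x. \<Prod>i\<in>insert j J. \<rho> i ^ (case x of (n, \<beta>) \<Rightarrow> \<beta>(j := n)) i) summable_on (UNIV \<times> supported J)"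
    by (simp only: prod split_beta case_prod_beta')
  then show ?case
    using summable_on_reindex_bij_betw[OF bij_betw_supported_insert[OF insert.hyps(2)],
        of "\<lambda>\<alpha>. \<Prod>i\<in>insert j J. \<rho> i ^ \<alpha> i"] by simp
qed

text \<open>Separate holomorphy is the property that, together with a bound, passes to the
  coefficients in one variable and so allows the next variable to be expanded.\<close>

definition sep_holomorphic :: "real \<Rightarrow> (complex ^ 'd \<Rightarrow> complex) \<Rightarrow> bool"
  where "sep_holomorphic R f \<longleftrightarrow>
    (\<forall>z\<in>disc_power R. \<forall>j. (\<lambda>w. f (vupd z j w)) holomorphic_on ball 0 R)"

text \<open>Locally uniformly, the \<open>n\<close>-th coefficient in one variable is the limit as \<open>h \<rightarrow> 0\<close> of
  the remainder after the first \<open>n\<close> terms divided by \<open>h ^ n\<close>; this makes it holomorphic in the other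
  variables.\<close>

lemma coefficient_functions:
  fixes f :: "complex ^ 'd \<Rightarrow> complex" and j :: 'd
  assumes R: "R > 0" and hol: "sep_holomorphic R f" and bd: "\<And>z. z \<in> disc_power R \<Longrightarrow> cmod (f z) \<le> B"
  defines "c \<equiv> \<lambda>n z. (deriv ^^ n) (\<lambda>w. f (vupd z j w)) 0 / fact n"
  shows "\<And>n z. z \<in> disc_power R \<Longrightarrow> cmod (c n z) \<le> B / R ^ n"
    and "\<And>z. z \<in> disc_power R \<Longrightarrow> (\<lambda>n. c n z * (z $ j) ^ n) sums f z"
    and "\<And>n. sep_holomorphic R (c n)"
proof -
  have h1: "(\<lambda>w. f (vupd z j w)) holomorphic_on ball 0 R" if "z \<in> disc_power R" for z
    using hol that by (simp add: sep_holomorphic_def)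
  show cb: "cmod (c n z) \<le> B / R ^ n" if z: "z \<in> disc_power R" for n z
  proof -
    have *: "cmod (c n z) * r ^ n \<le> B" if r: "0 < r" "r < R" for r
    proof -
      have "cmod ((deriv ^^ n) (\<lambda>w. f (vupd z j w)) 0) \<le> fact n * B / r ^ n"
      proof (rule Cauchy_inequality)
        show "(\<lambda>w. f (vupd z j w)) holomorphic_on ball 0 r"
          by (rule holomorphic_on_subset[OF h1[OF z]]) (use r in auto)
        show "continuous_on (cball 0 r) (\<lambda>w. f (vupd z j w))"
          by (rule continuous_on_subset[OF holomorphic_on_imp_continuous_on[OF h1[OF z]]]) (use r in auto)
        show "cmod (f (vupd z j x)) \<le> B" if "cmod (0 - x) = r" for x
          by (rule bd) (use that r z in \<open>simp add: vupd_disc_power\<close>)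
      qed (use r in auto)
      then have "cmod (c n z) \<le> fact n * B / r ^ n / fact n"
        unfolding c_def norm_divide norm_fact by (intro divide_right_mono) auto
      also have "\<dots> = B / r ^ n" by simp
      finally have "cmod (c n z) \<le> B / r ^ n" .
      then show ?thesis using r by (simp add: field_simps)
    qed
    \<comment> \<open>Cauchy's inequality applies to circles of radius \<open>r < R\<close>; letting
      \<open>r\<close> tend to \<open>R\<close> gives the full power of \<open>R\<close>.\<close>
    have "cmod (c n z) * R ^ n \<le> B"
    proof (rule tendsto_upperbound)
      show "((\<lambda>r. cmod (c n z) * r ^ n) \<longlongrightarrow> cmod (c n z) * R ^ n) (at_left R)"
        by (intro tendsto_intros)
      show "\<forall>\<^sub>F r in at_left R. cmod (c n z) * r ^ n \<le> B"
        using eventually_at_left_field[of _ R] R * by (metis (mono_tags, lifting) gt_ex less_trans)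
    qed simp
    then show ?thesis using R by (simp add: field_simps)
  qed
  have ser: "(\<lambda>n. c n z * w ^ n) sums f (vupd z j w)" if "z \<in> disc_power R" "cmod w < R" for z w
    using holomorphic_power_series[OF h1[OF that(1)], of w] that(2) by (simp add: c_def)
  show "(\<lambda>n. c n z * (z $ j) ^ n) sums f z" if "z \<in> disc_power R" for z
    using ser[OF that, of "z $ j"] that by (simp add: disc_power_def)
  show "sep_holomorphic R (c n)" for n
  proof (induction n rule: less_induct)
    case (less n)
    show ?case
      unfolding sep_holomorphic_def
    proof (intro ballI allI)
      fix z :: "complex ^ 'd" and i assume z: "z \<in> disc_power R"
      show "(\<lambda>w. c n (vupd z i w)) holomorphic_on ball 0 R"
      proof (cases "i = j")
        case True
        then show ?thesis by (simp add: c_def)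
      next
        case False
        \<comment> \<open>The sample points tend to 0 and stay below \<open>R / 2\<close>, so that
          the sum of the geometric tail in \<open>err\<close> is at most twice its first
          term.\<close>
        define h where "h k = R / (2 * real (Suc k))" for k
        have h: "0 < h k" "h k \<le> R / 2" for k
          using R by (auto simp: h_def divide_simps)
        have hR: "h k < R" for k using h(2)[of k] R by linarith
        define g where "g k w = (f (vupd (vupd z i w) j (of_real (h k))) -
            (\<Sum>m<n. c m (vupd z i w) * of_real (h k) ^ m)) / of_real (h k) ^ n" for k w
        show ?thesis
        proof (rule holomorphic_uniform_sequence)
          show "g k holomorphic_on ball 0 R" for k
            unfolding g_def
          proof (intro holomorphic_intros)
            show "(\<lambda>w. f (vupd (vupd z i w) j (of_real (h k)))) holomorphic_on ball 0 R"
              unfolding vupd_commute[OF False]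
              using hol vupd_disc_power[OF z, of "of_real (h k)" j] hR[of k] h(1)[of k]
              by (simp add: sep_holomorphic_def)
            show "(\<lambda>w. c m (vupd z i w)) holomorphic_on ball 0 R" if "m \<in> {..<n}" for m
              using less[of m] that z by (simp add: sep_holomorphic_def)
          qed (use h(1)[of k] in simp)
          have err: "cmod (g k w - c n (vupd z i w)) \<le> 2 * B / R ^ n * (h k / R)" if w: "cmod w < R" for k w
          proof -
            let ?z = "vupd z i w" and ?h = "complex_of_real (h k)"
            have zz: "?z \<in> disc_power R" using z w by (rule vupd_disc_power)
            have "(\<lambda>m. c m ?z * ?h ^ m) sums f (vupd ?z j ?h)"
              using ser[OF zz, of ?h] hR[of k] h(1)[of k] by simp
            then have "(\<lambda>m. c (m + n) ?z * ?h ^ (m + n)) sums (f (vupd ?z j ?h) - (\<Sum>m<n. c m ?z * ?h ^ m))"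
              by (rule sums_split_initial_segment)
            then have "(\<lambda>m. c (m + n) ?z * ?h ^ (m + n) / ?h ^ n) sums g k w"
              unfolding g_def by (rule sums_divide)
            then have "(\<lambda>m. c (m + n) ?z * ?h ^ m) sums g k w"
              using h(1)[of k] by (simp add: power_add)
            from sums_split_initial_segment[OF this, of 1]
            have s1: "(\<lambda>m. c (Suc m + n) ?z * ?h ^ Suc m) sums (g k w - c n ?z)" by simp
            have q: "0 \<le> h k / R" "h k / R \<le> 1/2" "h k / R < 1" using h[of k] hR[of k] R by (auto simp: field_simps)
            have "(\<lambda>m. B / R ^ n * (h k / R) * (h k / R) ^ m) sums (B / R ^ n * (h k / R) * (1 / (1 - h k / R)))"
              by (intro sums_mult geometric_sums) (use q(1,3) in \<open>simp only: real_norm_def abs_of_nonneg\<close>)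
            from norm_sums_le[OF s1 this]
            have "cmod (g k w - c n ?z) \<le> B / R ^ n * (h k / R) * (1 / (1 - h k / R))"
            proof -
              have "cmod (c (Suc m + n) ?z * ?h ^ Suc m) \<le> B / R ^ n * (h k / R) * (h k / R) ^ m" for m
              proof -
                have "cmod (c (Suc m + n) ?z * ?h ^ Suc m) \<le> B / R ^ (Suc m + n) * h k ^ Suc m"
                  unfolding norm_mult norm_power using cb[OF zz, of "Suc m + n"] h(1)[of k]
                      order_trans[OF norm_ge_zero cb[OF zz, of "Suc m + n"]]
                  by (intro mult_mono) auto
                also have "\<dots> = B / R ^ n * (h k / R) * (h k / R) ^ m"
                  using R by (simp add: power_add power_divide mult_ac)
                finally show ?thesis .
              qed
              then show ?thesis using norm_sums_le[OF s1 \<open>(\<lambda>m. B / R ^ n * (h k / R) * (h k / R) ^ m) sums _\<close>] by blast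
            qed
            also have "\<dots> \<le> B / R ^ n * (h k / R) * 2"
            proof (rule mult_left_mono)
              have "1 / (1 - x) \<le> 2" if "x \<le> 1/2" for x :: real
                using that by (simp add: divide_simps)
              then show "1 / (1 - h k / R) \<le> 2" using q(2) .
              have "0 \<le> B / R ^ n" using cb[OF zz, of n] norm_ge_zero order_trans by blast
              then show "0 \<le> B / R ^ n * (h k / R)" using q(1) by (rule mult_nonneg_nonneg)
            qed
            finally show ?thesis by (simp add: mult_ac)
          qed
          have lim: "(\<lambda>k. 2 * B / R ^ n * (h k / R)) \<longlonglongrightarrow> 0"
          proof -
            have "(\<lambda>k. 2 * B / R ^ n * (1 / 2 * inverse (real (Suc k)))) \<longlonglongrightarrow> 2 * B / R ^ n * (1 / 2 * 0)"
              by (intro tendsto_intros LIMSEQ_inverse_real_of_nat)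
            moreover have "h k / R = 1 / 2 * inverse (real (Suc k))" for k
              using R by (simp add: h_def inverse_eq_divide)
            ultimately show ?thesis by (simp only: mult_zero_right)
          qed
          fix x :: complex assume "x \<in> ball 0 R"
          then obtain d where d: "0 < d" "cball x d \<subseteq> ball 0 R"
            using open_contains_cball[of "ball 0 R"] open_ball by blast
          have "uniform_limit (cball x d) g (\<lambda>w. c n (vupd z i w)) sequentially"
          proof (rule uniform_limitI)
            fix e :: real assume "e > 0"
            have "\<forall>\<^sub>F k in sequentially. 2 * B / R ^ n * (h k / R) < e"
              using lim \<open>e > 0\<close> by (rule order_tendstoD)
            then show "\<forall>\<^sub>F k in sequentially. \<forall>w\<in>cball x d. dist (g k w) (c n (vupd z i w)) < e"
            proof eventually_elim
              case (elim k)
              show ?case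
              proof
                fix w assume "w \<in> cball x d"
                then have "cmod w < R" using d(2) by auto
                from err[OF this, of k] elim show "dist (g k w) (c n (vupd z i w)) < e"
                  by (simp add: dist_norm)
              qed
            qed
          qed
          with d show "\<exists>d>0. cball x d \<subseteq> ball 0 R \<and>
              uniform_limit (cball x d) g (\<lambda>w. c n (vupd z i w)) sequentially" by blast
        qed simp
      qed
    qed
  qed
qed

text \<open>Induction on the set of variables: expand in \<open>z $ j\<close>, apply the induction
  hypothesis to each coefficient with the constant \<open>B / R ^ n\<close>, and merge the iterated
  sums. The Cauchy bounds make the double family absolutely summable. The last hypothesis confines
  \<open>f\<close> to the variables in \<open>J\<close>, so in the empty case \<open>f\<close> is
  constant.\<close>

lemma sep_holomorphic_expansion:
  fixes f :: "complex ^ 'd \<Rightarrow> complex"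
  assumes "finite J" "R > 0" "sep_holomorphic R f" "\<And>z. z \<in> disc_power R \<Longrightarrow> cmod (f z) \<le> B"
    and "\<And>z z'. (\<And>i. i \<in> J \<Longrightarrow> z $ i = z' $ i) \<Longrightarrow> f z = f z'"
  shows "\<exists>a. (\<forall>\<alpha>\<in>supported J. cmod (a \<alpha>) \<le> B / R ^ (\<Sum>i\<in>J. \<alpha> i)) \<and>
    (\<forall>z\<in>disc_power R. ((\<lambda>\<alpha>. a \<alpha> * vmonom J z \<alpha>) has_sum f z) (supported J))"
  using assms
proof (induction J arbitrary: f B rule: finite_induct)
  case empty
  have f0: "f z = f 0" for z using empty.prems(4) by auto
  have "cmod (f 0) \<le> B" using empty.prems(3)[of 0] \<open>R > 0\<close> by (simp add: disc_power_def)
  moreover have "((\<lambda>\<alpha>. f 0 * vmonom {} z \<alpha>) has_sum f z) (supported {})" for z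
    using has_sum_finite[of "supported {}" "\<lambda>\<alpha>. f 0 * vmonom {} z \<alpha>"] f0[of z]
    by (simp add: supported_empty vmonom_def)
  ultimately show ?case by (intro exI[of _ "\<lambda>_. f 0"]) (auto simp: supported_empty)
next
  case (insert j J)
  define c where "c = (\<lambda>n z. (deriv ^^ n) (\<lambda>w. f (vupd z j w)) 0 / fact n)"
  have cf: "\<And>n z. z \<in> disc_power R \<Longrightarrow> cmod (c n z) \<le> B / R ^ n"
    "\<And>z. z \<in> disc_power R \<Longrightarrow> (\<lambda>n. c n z * (z $ j) ^ n) sums f z"
    "\<And>n. sep_holomorphic R (c n)"
    unfolding c_def using coefficient_functions[OF insert.prems(1,2,3), where j=j] by blast+
  have dep: "c n z = c n z'" if "\<And>i. i \<in> J \<Longrightarrow> z $ i = z' $ i" for n z z'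
  proof -
    have "f (vupd z j w) = f (vupd z' j w)" for w
      by (rule insert.prems(4)) (use that in auto)
    then show ?thesis by (simp add: c_def)
  qed
  have "\<forall>n. \<exists>a. (\<forall>\<alpha>\<in>supported J. cmod (a \<alpha>) \<le> B / R ^ n / R ^ (\<Sum>i\<in>J. \<alpha> i)) \<and>
    (\<forall>z\<in>disc_power R. ((\<lambda>\<alpha>. a \<alpha> * vmonom J z \<alpha>) has_sum c n z) (supported J))"
  proof
    fix n
    show "\<exists>a. (\<forall>\<alpha>\<in>supported J. cmod (a \<alpha>) \<le> B / R ^ n / R ^ (\<Sum>i\<in>J. \<alpha> i)) \<and>
      (\<forall>z\<in>disc_power R. ((\<lambda>\<alpha>. a \<alpha> * vmonom J z \<alpha>) has_sum c n z) (supported J))"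
    proof (rule insert.IH)
      show "c n z = c n z'" if "\<And>i. i \<in> J \<Longrightarrow> z $ i = z' $ i" for z z'
        using that by (rule dep)
    qed (rule insert.prems(1) cf(3) | erule cf(1))+
  qed
  then obtain a where a: "\<And>n \<alpha>. \<alpha> \<in> supported J \<Longrightarrow> cmod (a n \<alpha>) \<le> B / R ^ n / R ^ (\<Sum>i\<in>J. \<alpha> i)"
    "\<And>n z. z \<in> disc_power R \<Longrightarrow> ((\<lambda>\<alpha>. a n \<alpha> * vmonom J z \<alpha>) has_sum c n z) (supported J)"
    by metis
  define A where "A \<alpha> = a (\<alpha> j) (\<alpha>(j := 0))" for \<alpha>
  have J0: "\<beta>(j := 0) = \<beta>" if "\<beta> \<in> supported J" for \<beta>
    using that insert.hyps(2) by (auto simp: supported_def)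
  have "cmod (A \<alpha>) \<le> B / R ^ (\<Sum>i\<in>insert j J. \<alpha> i)" if "\<alpha> \<in> supported (insert j J)" for \<alpha>
  proof -
    have "\<alpha>(j := 0) \<in> supported J" using that by (auto simp: supported_def)
    from a(1)[OF this, of "\<alpha> j"]
    have "cmod (A \<alpha>) \<le> B / R ^ \<alpha> j / R ^ (\<Sum>i\<in>J. (\<alpha>(j := 0)) i)" by (simp add: A_def)
    also have "(\<Sum>i\<in>J. (\<alpha>(j := 0)) i) = (\<Sum>i\<in>J. \<alpha> i)"
      using insert.hyps(2) by (intro sum.cong) auto
    finally show ?thesis using insert.hyps by (simp add: power_add divide_divide_eq_left)
  qed
  moreover have "((\<lambda>\<alpha>. A \<alpha> * vmonom (insert j J) z \<alpha>) has_sum f z) (supported (insert j J))"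
    if z: "z \<in> disc_power R" for z
  proof -
    define t where "t = (\<lambda>(n, \<beta>). a n \<beta> * vmonom J z \<beta> * (z $ j) ^ n)"
    have zR: "cmod (z $ i) < R" for i using z by (simp add: disc_power_def)
    have "t summable_on (UNIV \<times> supported J)"
    proof (rule abs_summable_summable, rule Infinite_Sum.abs_summable_on_comparison_test)
      define g where "g = (\<lambda>\<alpha>. B * (\<Prod>i\<in>insert j J. (cmod (z $ i) / R) ^ \<alpha> i))"
      have "(\<lambda>\<alpha>. \<Prod>i\<in>insert j J. (cmod (z $ i) / R) ^ \<alpha> i) summable_on supported (insert j J)"
        by (rule geometric_multi_summable) (use insert.hyps(1) insert.prems(1) zR in simp_all)
      then have "g summable_on supported (insert j J)"
        unfolding g_def by (rule summable_on_cmult_right)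
      then have "(\<lambda>x. g ((\<lambda>(n, \<beta>). \<beta>(j := n)) x)) summable_on (UNIV \<times> supported J)"
        using summable_on_reindex_bij_betw[OF bij_betw_supported_insert[OF insert.hyps(2)], of g] by blast
      then show "(\<lambda>x. norm (g ((\<lambda>(n, \<beta>). \<beta>(j := n)) x))) summable_on (UNIV \<times> supported J)"
        by (rule summable_on_iff_abs_summable_on_real[THEN iffD1])
      fix x :: "nat \<times> ('d \<Rightarrow> nat)" assume "x \<in> UNIV \<times> supported J"
      then obtain n \<beta> where x: "x = (n, \<beta>)" "\<beta> \<in> supported J" by auto
      have pc: "(\<Prod>i\<in>J. (cmod (z $ i) / R) ^ (\<beta>(j := n)) i) = (\<Prod>i\<in>J. (cmod (z $ i) / R) ^ \<beta> i)"
        using insert.hyps(2) by (intro prod.cong) auto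
      have "cmod (t x) = cmod (a n \<beta>) * ((\<Prod>i\<in>J. cmod (z $ i) ^ \<beta> i) * cmod (z $ j) ^ n)"
        by (simp add: t_def x vmonom_def norm_mult norm_power flip: prod_norm)
      also have "\<dots> \<le> B / R ^ n / R ^ (\<Sum>i\<in>J. \<beta> i) * ((\<Prod>i\<in>J. cmod (z $ i) ^ \<beta> i) * cmod (z $ j) ^ n)"
        by (intro mult_right_mono a(1) x mult_nonneg_nonneg prod_nonneg) auto
      also have "\<dots> = g (\<beta>(j := n))"
      proof -
        have "(\<Prod>i\<in>insert j J. (cmod (z $ i) / R) ^ (\<beta>(j := n)) i) =
            (cmod (z $ j) / R) ^ n * (\<Prod>i\<in>J. (cmod (z $ i) / R) ^ \<beta> i)"
          using insert.hyps pc by simp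
        also have "(\<Prod>i\<in>J. (cmod (z $ i) / R) ^ \<beta> i) =
            (\<Prod>i\<in>J. cmod (z $ i) ^ \<beta> i) / R ^ (\<Sum>i\<in>J. \<beta> i)"
          by (simp only: power_divide prod_dividef power_sum)
        finally show ?thesis unfolding g_def by (simp add: power_divide)
      qed
      also have "\<dots> \<le> norm (g (\<beta>(j := n)))" by simp
      finally show "norm (t x) \<le> norm (g ((\<lambda>(n, \<beta>). \<beta>(j := n)) x))" by (simp add: x)
    qed
    then obtain S where S: "(t has_sum S) (UNIV \<times> supported J)" by (auto simp: summable_on_def)
    have "((\<lambda>n. c n z * (z $ j) ^ n) has_sum S) UNIV"
      by (rule has_sum_SigmaD[OF S]) (simp add: t_def has_sum_cmult_left a(2)[OF z])
    then have "(\<lambda>n. c n z * (z $ j) ^ n) sums S" by (rule has_sum_imp_sums)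
    then have "S = f z" using cf(2)[OF z] sums_unique2 by blast
    moreover have "t x = (\<lambda>\<alpha>. A \<alpha> * vmonom (insert j J) z \<alpha>) ((\<lambda>(n, \<beta>). \<beta>(j := n)) x)"
      if xin: "x \<in> UNIV \<times> supported J" for x
    proof -
      obtain n \<beta> where x: "x = (n, \<beta>)" "\<beta> \<in> supported J" using xin by auto
      have "(\<Prod>i\<in>J. (z $ i) ^ (\<beta>(j := n)) i) = (\<Prod>i\<in>J. (z $ i) ^ \<beta> i)"
        using insert.hyps(2) by (intro prod.cong) auto
      then show ?thesis using insert.hyps by (simp add: t_def x A_def J0 vmonom_def)
    qed
    ultimately have "((\<lambda>x. (\<lambda>\<alpha>. A \<alpha> * vmonom (insert j J) z \<alpha>) ((\<lambda>(n, \<beta>). \<beta>(j := n)) x)) has_sum f z) (UNIV \<times> supported J)"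
      using S by (subst has_sum_cong[symmetric]) simp_all
    then show ?thesis
      using has_sum_reindex_bij_betw[OF bij_betw_supported_insert[OF insert.hyps(2)],
          of "\<lambda>\<alpha>. A \<alpha> * vmonom (insert j J) z \<alpha>"] by blast
  qed
  ultimately show ?case by blast
qed

section \<open>Uniqueness of power series coefficients\<close>

lemma power_series_eq_0:
  fixes s :: "nat \<Rightarrow> complex"
  assumes "R > 0" "\<And>w. cmod w < R \<Longrightarrow> (\<lambda>n. s n * w ^ n) sums 0"
  shows "s n = 0"
proof (rule ccontr)
  assume nz: "s n \<noteq> 0"
  have "s 0 = 0" using assms(2)[of 0] assms(1) by simp
  with nz have "n > 0" by (cases n) auto
  show False
  proof (rule powser_0_nonzero[of R 0 s "\<lambda>_. 0" n])
    fix e :: real assume e: "0 < e" "\<And>z::complex. z \<in> cball 0 e - {0} \<Longrightarrow> (0::complex) \<noteq> 0"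
    have "complex_of_real e \<in> cball 0 e - {0}" using \<open>0 < e\<close> by simp
    then show False using e(2)[of "complex_of_real e"] by blast
  qed (use assms nz \<open>n > 0\<close> in auto)
qed

text \<open>Exponents are fixed one variable at a time: grouping the terms by the exponent of
  \<open>z $ j\<close> gives a power series in one variable that vanishes identically. When all
  exponents are fixed, a single coefficient is left.\<close>

lemma multi_power_series_eq_0:
  fixes a :: "('d::finite \<Rightarrow> nat) \<Rightarrow> complex"
  assumes R: "R > 0" and sum0: "\<And>z. z \<in> disc_power R \<Longrightarrow> ((\<lambda>\<alpha>. a \<alpha> * vmonom UNIV z \<alpha>) has_sum 0) UNIV"
  shows "a \<beta> = 0"
proof -
  have "\<forall>\<beta>. \<forall>z\<in>disc_power R. ((\<lambda>\<alpha>. a \<alpha> * vmonom (- J) z \<alpha>) has_sum 0) {\<alpha>. \<forall>i\<in>J. \<alpha> i = \<beta> i}"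
    if "finite J" for J :: "'d set"
    using that
  proof induction
    case empty
    then show ?case using sum0 by (simp add: Compl_eq_Diff_UNIV)
  next
    case (insert j J)
    show ?case
    proof (intro allI ballI)
      fix \<beta> :: "'d \<Rightarrow> nat" and z :: "complex ^ 'd" assume z: "z \<in> disc_power R"
      define X where "X = {\<alpha>. \<forall>i\<in>J. \<alpha> i = \<beta> i}"
      define Y where "Y n = {\<alpha> \<in> X. \<alpha> j = n}" for n
      define b where "b \<alpha> = a \<alpha> * vmonom (- insert j J) z \<alpha>" for \<alpha>
      have eq: "a \<alpha> * vmonom (- J) (vupd z j w) \<alpha> = b \<alpha> * w ^ \<alpha> j" for w \<alpha>
      proof -
        have J: "- J = insert j (- insert j J)" using insert.hyps(2) by auto
        have "vmonom (- J) (vupd z j w) \<alpha> = w ^ \<alpha> j * (\<Prod>i\<in>- insert j J. (vupd z j w $ i) ^ \<alpha> i)"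
          unfolding vmonom_def by (subst J, subst prod.insert) auto
        also have "(\<Prod>i\<in>- insert j J. (vupd z j w $ i) ^ \<alpha> i) = vmonom (- insert j J) z \<alpha>"
          unfolding vmonom_def by (intro prod.cong) auto
        finally show ?thesis by (simp add: b_def)
      qed
      have hs: "((\<lambda>\<alpha>. b \<alpha> * w ^ \<alpha> j) has_sum 0) X" if "cmod w < R" for w
        using insert.IH vupd_disc_power[OF z that, of j] unfolding X_def eq[symmetric] by blast
      \<comment> \<open>Evaluating at a nonzero \<open>w\<close> of modulus \<open>R / 2\<close> and
        dividing by \<open>w ^ n\<close> gives summability of each group by itself.\<close>
      have sY: "b summable_on Y n" for n
      proof -
        define w where "w = complex_of_real (R / 2)"
        have w: "cmod w < R" "w \<noteq> 0" using R by (auto simp: w_def)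
        have "(\<lambda>\<alpha>. b \<alpha> * w ^ \<alpha> j) summable_on Y n"
          using hs[OF w(1)] by (intro summable_on_subset_banach[of _ X "Y n"]) (auto simp: summable_on_def Y_def)
        then have "(\<lambda>\<alpha>. b \<alpha> * w ^ n) summable_on Y n"
          by (rule summable_on_cong[THEN iffD1, rotated]) (auto simp: Y_def)
        then have "(\<lambda>\<alpha>. b \<alpha> * w ^ n * inverse (w ^ n)) summable_on Y n" by (rule summable_on_cmult_left)
        moreover have "(\<lambda>\<alpha>. b \<alpha> * w ^ n * inverse (w ^ n)) = b"
          using w by (simp add: fun_eq_iff mult.assoc)
        ultimately show ?thesis by simp
      qed
      define s where "s n = infsum b (Y n)" for n
      have bs: "(b has_sum s n) (Y n)" for n using sY by (simp add: s_def)
      have "(\<lambda>n. s n * w ^ n) sums 0" if w: "cmod w < R" for w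
      proof -
        have bij: "bij_betw snd (Sigma UNIV Y) X"
          by (rule bij_betw_byWitness[where f' = "\<lambda>\<alpha>. (\<alpha> j, \<alpha>)"]) (auto simp: Y_def)
        have "((\<lambda>p. b (snd p) * w ^ (snd p) j) has_sum 0) (Sigma UNIV Y)"
          using has_sum_reindex_bij_betw[OF bij, of "\<lambda>\<alpha>. b \<alpha> * w ^ \<alpha> j"] hs[OF w] by blast
        then have "((\<lambda>n. s n * w ^ n) has_sum 0) UNIV"
        proof (rule has_sum_SigmaD)
          fix n
          have "((\<lambda>\<alpha>. b \<alpha> * w ^ n) has_sum s n * w ^ n) (Y n)" by (intro has_sum_cmult_left bs)
          then show "((\<lambda>\<alpha>. b (snd (n, \<alpha>)) * w ^ (snd (n, \<alpha>)) j) has_sum s n * w ^ n) (Y n)"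
            by (rule has_sum_cong[THEN iffD1, rotated]) (auto simp: Y_def)
        qed
        then show ?thesis by (rule has_sum_imp_sums)
      qed
      then have "s (\<beta> j) = 0" by (rule power_series_eq_0[OF R])
      moreover have "Y (\<beta> j) = {\<alpha>. \<forall>i\<in>insert j J. \<alpha> i = \<beta> i}" by (auto simp: Y_def X_def)
      ultimately show "((\<lambda>\<alpha>. a \<alpha> * vmonom (- insert j J) z \<alpha>) has_sum 0) {\<alpha>. \<forall>i\<in>insert j J. \<alpha> i = \<beta> i}"
        using bs[of "\<beta> j"] by (simp add: b_def[abs_def])
    qed
  qed
  from this[of UNIV] have "((\<lambda>\<alpha>. a \<alpha> * vmonom {} 0 \<alpha>) has_sum 0) {\<alpha>. \<forall>i. \<alpha> i = \<beta> i}"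
    using R by (simp add: disc_power_def)
  moreover have "{\<alpha>. \<forall>i. \<alpha> i = \<beta> i} = {\<beta>}" by auto
  ultimately show ?thesis
    using has_sum_finite[of "{\<beta>}" a] has_sum_unique by (fastforce simp: vmonom_def)
qed

section \<open>Analytic functions on the polydisc and their Taylor coefficients\<close>

lemma closed_disc_power_compact: "compact {z :: complex ^ 'd. \<forall>j. cmod (z $ j) \<le> R}"
proof -
  have "{z :: complex ^ 'd. \<forall>j. cmod (z $ j) \<le> R} = (\<Inter>j. {z. cmod (z $ j) \<le> R})" by auto
  moreover have "closed {z :: complex ^ 'd. cmod (z $ j) \<le> R}" for j
    by (intro closed_Collect_le continuous_intros)
  ultimately have "closed {z :: complex ^ 'd. \<forall>j. cmod (z $ j) \<le> R}" by auto
  moreover have "bounded {z :: complex ^ 'd. \<forall>j. cmod (z $ j) \<le> R}"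
  proof (rule boundedI)
    fix z :: "complex ^ 'd" assume "z \<in> {z. \<forall>j. cmod (z $ j) \<le> R}"
    then have "(\<Sum>j\<in>UNIV. cmod (z $ j)) \<le> (\<Sum>j\<in>(UNIV::'d set). R)" by (intro sum_mono) auto
    moreover have "norm z \<le> (\<Sum>j\<in>UNIV. cmod (z $ j))"
      unfolding norm_vec_def by (rule L2_set_le_sum) simp
    ultimately show "norm z \<le> (\<Sum>j\<in>(UNIV::'d set). R)" by linarith
  qed
  ultimately show ?thesis by (simp add: compact_eq_bounded_closed)
qed

lemma analytic_fun_on_subset: "analytic_fun_on f U \<Longrightarrow> V \<subseteq> U \<Longrightarrow> analytic_fun_on f V"
  unfolding analytic_fun_on_def by blast

lemma analytic_fun_on_continuous: "analytic_fun_on f U \<Longrightarrow> continuous_on U f"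
  unfolding analytic_fun_on_def
  by (meson continuous_at_imp_continuous_on has_derivative_continuous)

lemma vupd_has_derivative: "((\<lambda>w. vupd (z :: complex ^ 'd) j w) has_derivative (\<lambda>h. h *s axis j 1)) (at w)"
proof -
  define v where "v = vupd z j 0"
  have eq: "(\<lambda>w. vupd z j w) = (\<lambda>w. v + w *s axis j 1)"
    by (auto simp: vec_eq_iff axis_def fun_eq_iff v_def)
  have "norm (h *s x) = norm h * norm x" for h and x :: "complex ^ 'd"
    by (simp add: norm_vec_def L2_set_def norm_mult power_mult_distrib real_sqrt_mult
        flip: sum_distrib_left)
  then have bl: "bounded_linear (\<lambda>h::complex. h *s (axis j 1 :: complex ^ 'd))"
    by (intro bounded_linear_intro[where K="norm (axis j 1 :: complex ^ 'd)"])
      (auto simp: vec_eq_iff algebra_simps)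
  show ?thesis
    unfolding eq using has_derivative_add[OF has_derivative_const bounded_linear.has_derivative[OF bl has_derivative_ident]]
    by simp
qed

lemma analytic_imp_sep_holomorphic:
  fixes f :: "complex ^ 'd \<Rightarrow> complex"
  assumes "analytic_fun_on f (disc_power R)"
  shows "sep_holomorphic R f"
  unfolding sep_holomorphic_def
proof (intro ballI allI)
  fix z :: "complex ^ 'd" and j assume z: "z \<in> disc_power R"
  show "(\<lambda>w. f (vupd z j w)) holomorphic_on ball 0 R"
  proof (rule holomorphic_onI)
    fix w :: complex assume "w \<in> ball 0 R"
    then have "vupd z j w \<in> disc_power R" using z by (simp add: vupd_disc_power)
    then obtain D where D: "(f has_derivative D) (at (vupd z j w))" "\<And>c h. D (c *s h) = c *\<^sub>C D h"
      using assms unfolding analytic_fun_on_def by blast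
    have "((f \<circ> vupd z j) has_derivative (D \<circ> (\<lambda>h. h *s axis j 1))) (at w)"
      by (rule diff_chain_at[OF vupd_has_derivative D(1)])
    moreover have "D \<circ> (\<lambda>h. h *s axis j 1) = (*) (D (axis j 1))"
      by (rule ext) (simp add: D(2) scaleC_complex_def mult.commute)
    ultimately have "((\<lambda>w. f (vupd z j w)) has_field_derivative D (axis j 1)) (at w)"
      by (simp add: has_field_derivative_def o_def)
    then show "(\<lambda>w. f (vupd z j w)) field_differentiable at w within ball 0 R"
      using field_differentiable_at_within field_differentiable_def by blast
  qed
qed

text \<open>An analytic function may be unbounded on the open polydisc, so it is expanded on
  polydiscs of radius \<open>R < 1\<close>, where compactness supplies a bound. By uniqueness all
  these expansions share their coefficients, and \<open>taylor_coeff\<close> is well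
  defined.\<close>

lemma taylor_coeff_has_sum:
  fixes \<phi> :: "complex ^ 'd \<Rightarrow> complex"
  assumes "analytic_fun_on \<phi> polydisc" and "z \<in> polydisc"
  shows "((\<lambda>\<alpha>. taylor_coeff \<phi> \<alpha> * vmonom UNIV z \<alpha>) has_sum \<phi> z) UNIV"
proof -
  have "\<exists>a. \<forall>z\<in>disc_power R. ((\<lambda>\<alpha>. a \<alpha> * vmonom UNIV z \<alpha>) has_sum \<phi> z) UNIV"
    if R: "0 < R" "R < 1" for R
  proof -
    have sub: "{z :: complex ^ 'd. \<forall>j. cmod (z $ j) \<le> R} \<subseteq> polydisc"
      using R by (auto simp: polydisc_def intro: le_less_trans)
    then have "compact (\<phi> ` {z. \<forall>j. cmod (z $ j) \<le> R})"
      by (intro compact_continuous_image closed_disc_power_compact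
          continuous_on_subset[OF analytic_fun_on_continuous[OF assms(1)]])
    then have "bounded (\<phi> ` {z. \<forall>j. cmod (z $ j) \<le> R})" by (rule compact_imp_bounded)
    then obtain B where B: "\<And>z. \<forall>j. cmod (z $ j) \<le> R \<Longrightarrow> cmod (\<phi> z) \<le> B"
      unfolding bounded_iff by auto
    have "analytic_fun_on \<phi> (disc_power R)"
    proof (rule analytic_fun_on_subset[OF assms(1)])
      show "disc_power R \<subseteq> (polydisc :: (complex ^ 'd) set)"
        using sub by (rule order_trans[rotated]) (auto simp: disc_power_def less_imp_le)
    qed
    then have "sep_holomorphic R \<phi>" by (rule analytic_imp_sep_holomorphic)
    then have "\<exists>a. (\<forall>\<alpha>\<in>supported UNIV. cmod (a \<alpha>) \<le> B / R ^ (\<Sum>i\<in>UNIV. \<alpha> i)) \<and>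
      (\<forall>z\<in>disc_power R. ((\<lambda>\<alpha>. a \<alpha> * vmonom UNIV z \<alpha>) has_sum \<phi> z) (supported UNIV))"
      using B by (intro sep_holomorphic_expansion)
        (auto simp: R disc_power_def less_imp_le vec_eq_iff intro: arg_cong[of _ _ \<phi>])
    then show ?thesis by (auto simp: supported_UNIV)
  qed
  then obtain a where a: "\<And>R z. 0 < R \<Longrightarrow> R < 1 \<Longrightarrow> z \<in> disc_power R \<Longrightarrow>
      ((\<lambda>\<alpha>. a R \<alpha> * vmonom UNIV z \<alpha>) has_sum \<phi> z) UNIV"
    by metis
  have uniq: "b = b'" if R: "R > 0" and
    b: "\<And>z. z \<in> disc_power R \<Longrightarrow> ((\<lambda>\<alpha>. b \<alpha> * vmonom UNIV z \<alpha>) has_sum \<phi> z) UNIV" and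
    b': "\<And>z. z \<in> disc_power R \<Longrightarrow> ((\<lambda>\<alpha>. b' \<alpha> * vmonom UNIV z \<alpha>) has_sum \<phi> z) UNIV" for b b' R
  proof
    fix \<alpha>
    have "b \<alpha> - b' \<alpha> = 0"
    proof (rule multi_power_series_eq_0[OF R])
      fix z :: "complex ^ 'd" assume z: "z \<in> disc_power R"
      show "((\<lambda>\<alpha>. (b \<alpha> - b' \<alpha>) * vmonom UNIV z \<alpha>) has_sum 0) UNIV"
        using has_sum_add[OF b[OF z] has_sum_cmult_right[OF b'[OF z], of "-1"]]
        by (simp add: left_diff_distrib)
    qed
    then show "b \<alpha> = b' \<alpha>" by simp
  qed
  define A where "A = a (1/2)"
  have A: "((\<lambda>\<alpha>. A \<alpha> * vmonom UNIV z \<alpha>) has_sum \<phi> z) UNIV" if z: "z \<in> polydisc" for z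
  proof -
    \<comment> \<open>Including \<open>1/2\<close> in the maximum makes \<open>R\<close> at least
      \<open>1/2\<close>, so the two expansions can be compared on the polydisc of radius
      \<open>1/2\<close>.\<close>
    define m where "m = Max (insert (1/2) (range (\<lambda>j. cmod (z $ j))))"
    have m: "1/2 \<le> m" "cmod (z $ j) \<le> m" for j
      unfolding m_def by (rule Max_ge; simp)+
    have m1: "m < 1" using z unfolding m_def by (auto simp: polydisc_def)
    define R where "R = (m + 1) / 2"
    have R: "1/2 \<le> R" "R < 1" "0 < R" and zR: "z \<in> disc_power R"
      using m(1) m1 le_less_trans[OF m(2), of R] by (auto simp: R_def disc_power_def)
    have "a R = A"
    proof (rule uniq[of "1/2"])
      fix z :: "complex ^ 'd" assume z: "z \<in> disc_power (1/2)"
      then have "z \<in> disc_power R"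
        using less_le_trans[OF _ R(1)] unfolding disc_power_def by blast
      then show "((\<lambda>\<alpha>. a R \<alpha> * vmonom UNIV z \<alpha>) has_sum \<phi> z) UNIV"
        "((\<lambda>\<alpha>. A \<alpha> * vmonom UNIV z \<alpha>) has_sum \<phi> z) UNIV"
        using a R z unfolding A_def by auto
    qed simp
    then show ?thesis using a[OF R(3,2) zR] by simp
  qed
  have "\<exists>!a. \<forall>z\<in>polydisc. ((\<lambda>\<alpha>. a \<alpha> * (\<Prod>j\<in>UNIV. (z $ j) ^ \<alpha> j)) has_sum \<phi> z) UNIV"
  proof (rule ex1I[of _ A])
    show "\<forall>z\<in>polydisc. ((\<lambda>\<alpha>. A \<alpha> * (\<Prod>j\<in>UNIV. (z $ j) ^ \<alpha> j)) has_sum \<phi> z) UNIV"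
      using A unfolding vmonom_def by blast
    fix b assume "\<forall>z\<in>polydisc. ((\<lambda>\<alpha>. b \<alpha> * (\<Prod>j\<in>UNIV. (z $ j) ^ \<alpha> j)) has_sum \<phi> z) UNIV"
    then show "b = A" using A unfolding vmonom_def polydisc_eq by (intro uniq[of 1]) (auto simp: vmonom_def)
  qed
  from theI'[OF this] show ?thesis
    using assms(2) unfolding taylor_coeff_def vmonom_def by blast
qed

section \<open>The functional calculus on joint eigenvectors\<close>

lemma funpow_comp_commute:
  assumes "\<And>x. f (g x) = g (f x)"
  shows "(f ^^ m) ((g ^^ n) x) = (g ^^ n) ((f ^^ m) x)"
proof -
  have 1: "f ((g ^^ n) x) = (g ^^ n) (f x)" for x
    by (induction n arbitrary: x) (simp_all add: assms)
  show ?thesis by (induction m arbitrary: x) (simp_all add: 1)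
qed

text \<open>Commutativity makes the fold well defined; on a joint eigenvector each factor acts as
  its eigenvalue. The norm bound serves to dominate the operator series of the functional
  calculus.\<close>

lemma op_monomial_eigenvector:
  fixes X :: "'d::finite \<Rightarrow> 'h::complex_hilbert \<Rightarrow>\<^sub>L 'h"
  assumes M: "hilbert_subspace M" and X: "\<And>j. X j \<in> ops UNIV" and comm: "\<And>i j. X i o\<^sub>L X j = X j o\<^sub>L X i"
    and nX: "\<And>j. norm (X j) \<le> r" and v: "v \<in> M" "\<And>j. X j v = \<mu> $ j *\<^sub>C v"
  shows "op_monomial M X \<alpha> v = vmonom UNIV \<mu> \<alpha> *\<^sub>C v" and "norm (op_monomial M X \<alpha>) \<le> (\<Prod>j\<in>UNIV. r ^ \<alpha> j)"
proof -
  define F :: "'d \<Rightarrow> ('h \<Rightarrow>\<^sub>L 'h) \<Rightarrow> 'h \<Rightarrow>\<^sub>L 'h" where "F j = (\<lambda>B. X j o\<^sub>L B) ^^ \<alpha> j" for j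
  have cc: "X i o\<^sub>L (X j o\<^sub>L B) = X j o\<^sub>L (X i o\<^sub>L B)" for i j B
    using arg_cong[OF comm[of i j], of "\<lambda>A. blinfun_apply (A o\<^sub>L B)"]
    by (intro blinfun_eqI) (simp add: fun_eq_iff)
  interpret comp_fun_commute F
    by standard (auto simp: F_def fun_eq_iff intro!: funpow_comp_commute cc)
  have r0: "0 \<le> r" using nX norm_ge_zero order_trans by blast
  have Fe: "blinfun_apply (((\<lambda>B. X j o\<^sub>L B) ^^ n) A) v = ((\<mu> $ j) ^ n * c) *\<^sub>C v"
    if "A v = c *\<^sub>C v" for n j c and A :: "'h \<Rightarrow>\<^sub>L 'h"
    by (induction n) (simp_all add: that ops_scaleC[OF X] v scaleC_scaleC mult_ac)
  have Fn: "norm (((\<lambda>B. X j o\<^sub>L B) ^^ n) A) \<le> r ^ n * b" if "norm A \<le> b" for n j b and A :: "'h \<Rightarrow>\<^sub>L 'h"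
  proof (induction n)
    case (Suc n)
    have "norm (X j o\<^sub>L ((\<lambda>B. X j o\<^sub>L B) ^^ n) A) \<le> norm (X j) * norm (((\<lambda>B. X j o\<^sub>L B) ^^ n) A)"
      by (rule norm_blinfun_compose)
    also have "\<dots> \<le> r * (r ^ n * b)" by (intro mult_mono nX Suc r0) simp
    finally show ?case by (simp add: mult.assoc)
  qed (simp add: that)
  have "blinfun_apply (Finite_Set.fold F (op_one M) J) v = vmonom J \<mu> \<alpha> *\<^sub>C v \<and>
      norm (Finite_Set.fold F (op_one M) J) \<le> (\<Prod>j\<in>J. r ^ \<alpha> j)" if "finite J" for J
    using that
  proof induction
    case empty
    then show ?case by (simp add: vmonom_def op_one_id[OF M v(1)] norm_op_one_le[OF M])
  next
    case (insert j J)
    show ?case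
    proof -
      let ?Z = "Finite_Set.fold F (op_one M) J"
      have "blinfun_apply (F j ?Z) v = ((\<mu> $ j) ^ \<alpha> j * vmonom J \<mu> \<alpha>) *\<^sub>C v"
        unfolding F_def[of j] by (rule Fe) (use insert.IH in blast)
      moreover have "norm (F j ?Z) \<le> r ^ \<alpha> j * (\<Prod>j\<in>J. r ^ \<alpha> j)"
        unfolding F_def[of j] by (rule Fn) (use insert.IH in blast)
      ultimately show ?thesis using insert.hyps by (simp add: vmonom_def)
    qed
  qed
  from this[of UNIV] show "op_monomial M X \<alpha> v = vmonom UNIV \<mu> \<alpha> *\<^sub>C v"
    "norm (op_monomial M X \<alpha>) \<le> (\<Prod>j\<in>UNIV. r ^ \<alpha> j)"
    by (simp_all add: op_monomial_def F_def[abs_def])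
qed

text \<open>The bridge from operators to values of \<phi>: on a joint eigenvector the operator
  series becomes the Taylor series at the tuple of eigenvalues. Its convergence in operator norm
  follows by comparison with the Taylor series at the point \<open>(r, ..., r)\<close>.\<close>

lemma fun_calc_eigenvector:
  fixes X :: "'d::finite \<Rightarrow> 'h::complex_hilbert \<Rightarrow>\<^sub>L 'h"
  assumes M: "hilbert_subspace M" and X: "\<And>j. X j \<in> ops UNIV" and comm: "\<And>i j. X i o\<^sub>L X j = X j o\<^sub>L X i"
    and nX: "\<And>j. norm (X j) \<le> r" and r: "r < 1" and v: "v \<in> M" "\<And>j. X j v = \<mu> $ j *\<^sub>C v"
    and \<phi>: "analytic_fun_on \<phi> polydisc" and \<mu>: "\<mu> \<in> polydisc"
  shows "fun_calc M \<phi> X v = \<phi> \<mu> *\<^sub>C v"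
proof -
  note E = op_monomial_eigenvector[OF M X comm nX]
  have r0: "0 \<le> r" using nX norm_ge_zero order_trans by blast
  define t where "t \<alpha> = taylor_coeff \<phi> \<alpha> *\<^sub>C op_monomial M X \<alpha>" for \<alpha>
  define z :: "complex ^ 'd" where "z = (\<chi> j. of_real r)"
  have "z \<in> polydisc" using r r0 by (simp add: polydisc_def z_def)
  from taylor_coeff_has_sum[OF \<phi> this]
  have "(\<lambda>\<alpha>. norm (taylor_coeff \<phi> \<alpha> * vmonom UNIV z \<alpha>)) summable_on UNIV"
    by (intro summable_on_iff_abs_summable_on_complex[THEN iffD1] has_sum_imp_summable)
  then have "(\<lambda>\<alpha>. norm (t \<alpha>)) summable_on UNIV"
  proof (rule Infinite_Sum.abs_summable_on_comparison_test)
    fix \<alpha> :: "'d \<Rightarrow> nat"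
    have "norm (t \<alpha>) \<le> cmod (taylor_coeff \<phi> \<alpha>) * (\<Prod>j\<in>UNIV. r ^ \<alpha> j)"
      unfolding t_def norm_scaleC by (intro mult_left_mono E(2)[OF v]) auto
    also have "(\<Prod>j\<in>UNIV. r ^ \<alpha> j) = cmod (vmonom UNIV z \<alpha>)"
      using r0 by (simp add: vmonom_def z_def norm_power flip: prod_norm)
    finally show "norm (t \<alpha>) \<le> norm (taylor_coeff \<phi> \<alpha> * vmonom UNIV z \<alpha>)" by (simp add: norm_mult)
  qed
  then have "t summable_on UNIV" by (rule abs_summable_summable)
  then have "(t has_sum fun_calc M \<phi> X) UNIV" by (simp add: fun_calc_def t_def[abs_def])
  then have "((\<lambda>\<alpha>. t \<alpha> v) has_sum fun_calc M \<phi> X v) UNIV"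
    by (rule has_sum_bounded_linear[OF blinfun.bounded_linear_left])
  moreover have "t \<alpha> v = (taylor_coeff \<phi> \<alpha> * vmonom UNIV \<mu> \<alpha>) *\<^sub>C v" for \<alpha>
    by (simp add: t_def scaleC_blinfun.rep_eq E(1)[OF v] scaleC_scaleC)
  moreover have "((\<lambda>\<alpha>. (taylor_coeff \<phi> \<alpha> * vmonom UNIV \<mu> \<alpha>) *\<^sub>C v) has_sum \<phi> \<mu> *\<^sub>C v) UNIV"
    by (rule has_sum_bounded_linear[OF bounded_linear_scaleC_left taylor_coeff_has_sum[OF \<phi> \<mu>]])
  ultimately show ?thesis using has_sum_unique by fastforce
qed

section \<open>Kernel manipulations\<close>

lemma psdI:
  assumes "\<And>k l. K l k = cnj (K k l)" "\<And>n c. 0 \<le> Re (\<Sum>k<n. \<Sum>l<n. c k * cnj (c l) * K k l)"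
  shows "psd K"
  unfolding psd_def using assms by blast

lemma psd_congruence:
  assumes "psd K"
  shows "psd (\<lambda>k l. f k * cnj (f l) * K k l)"
proof (rule psdI)
  show "f l * cnj (f k) * K l k = cnj (f k * cnj (f l) * K k l)" for k l
    using psd_commute[OF assms, of l k] by simp
  show "0 \<le> Re (\<Sum>k<n. \<Sum>l<n. c k * cnj (c l) * (f k * cnj (f l) * K k l))" for n c
    using psd_Re_nonneg[OF assms, of "\<lambda>k. c k * f k" n] by (simp add: mult_ac)
qed

lemma psd_truncate:
  assumes "psd K"
  shows "psd (\<lambda>k l. if k < n \<and> l < n then K k l else 0)"
proof -
  have "(\<lambda>k l. if k < n \<and> l < n then K k l else 0) =
      (\<lambda>k l. (if k < n then 1 else 0) * cnj (if l < n then 1 else 0) * K k l)"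
    by (auto simp: fun_eq_iff)
  then show ?thesis using psd_congruence[OF assms, of "\<lambda>k. if k < n then 1 else 0"] by simp
qed

lemma psd_finiteI:
  assumes herm: "\<And>k l. K l k = cnj (K k l)" and out: "\<And>k l. \<not> (k < n \<and> l < n) \<Longrightarrow> K k l = 0"
    and nonneg: "\<And>c. 0 \<le> Re (\<Sum>k<n. \<Sum>l<n. c k * cnj (c l) * K k l)"
  shows "psd K"
proof (rule psdI[OF herm])
  fix N and c :: "nat \<Rightarrow> complex"
  define d where "d k = (if k < N then c k else 0)" for k
  have "(\<Sum>k<N. \<Sum>l<N. c k * cnj (c l) * K k l) = (\<Sum>k<N. \<Sum>l<n. d k * cnj (d l) * K k l)"
  proof (rule sum.cong[OF refl])
    fix k assume "k \<in> {..<N}"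
    then show "(\<Sum>l<N. c k * cnj (c l) * K k l) = (\<Sum>l<n. d k * cnj (d l) * K k l)"
      by (intro sum.mono_neutral_cong) (auto simp: d_def out)
  qed
  also have "\<dots> = (\<Sum>k<n. \<Sum>l<n. d k * cnj (d l) * K k l)"
    by (intro sum.mono_neutral_cong) (auto simp: d_def out)
  finally show "0 \<le> Re (\<Sum>k<N. \<Sum>l<N. c k * cnj (c l) * K k l)" using nonneg[of d] by simp
qed

text \<open>The quadratic form of \<open>G\<close> does not increase under \<open>c k \<mapsto> c k * s k\<close>, and iterating
  this map sends \<open>c\<close> to \<open>0\<close>.\<close>

lemma psd_of_defect:
  fixes s :: "nat \<Rightarrow> complex"
  assumes s: "\<And>k. cmod (s k) < 1" and herm: "\<And>k l. G l k = cnj (G k l)"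
    and E: "psd (\<lambda>k l. (1 - s k * cnj (s l)) * G k l)"
  shows "psd G"
proof (rule psdI[OF herm])
  fix n and c :: "nat \<Rightarrow> complex"
  define Q where "Q c = Re (\<Sum>k<n. \<Sum>l<n. c k * cnj (c l) * G k l)" for c
  have step: "Q (\<lambda>k. c k * s k) \<le> Q c" for c
  proof -
    have "Q c - Q (\<lambda>k. c k * s k) = Re (\<Sum>k<n. \<Sum>l<n. c k * cnj (c l) * ((1 - s k * cnj (s l)) * G k l))"
      unfolding Q_def minus_complex.sel(1)[symmetric] sum_subtractf[symmetric]
      by (intro arg_cong[of _ _ Re] sum.cong refl) (simp add: algebra_simps)
    also have "\<dots> \<ge> 0" by (rule psd_Re_nonneg[OF E])
    finally show ?thesis by simp
  qed
  have iter: "Q (\<lambda>k. c k * s k ^ m) \<le> Q c" for m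
  proof (induction m)
    case (Suc m)
    have "Q (\<lambda>k. c k * s k ^ Suc m) = Q (\<lambda>k. (c k * s k ^ m) * s k)" by (simp add: mult_ac)
    also have "\<dots> \<le> Q (\<lambda>k. c k * s k ^ m)" by (rule step)
    finally show ?case using Suc by simp
  qed simp
  have lim: "(\<lambda>m. c k * s k ^ m) \<longlonglongrightarrow> c k * 0" for k
    by (intro tendsto_intros LIMSEQ_power_zero s)
  have "(\<lambda>m. Q (\<lambda>k. c k * s k ^ m)) \<longlonglongrightarrow> Re (\<Sum>k<n. \<Sum>l<n. (c k * 0) * cnj (c l * 0) * G k l)"
    unfolding Q_def by (intro tendsto_intros lim)
  then have "(\<lambda>m. Q (\<lambda>k. c k * s k ^ m)) \<longlonglongrightarrow> 0" by simp
  then have "0 \<le> Q c" by (rule LIMSEQ_le_const2) (use iter in blast)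
  then show "0 \<le> Re (\<Sum>k<n. \<Sum>l<n. c k * cnj (c l) * G k l)" by (simp add: Q_def)
qed

text \<open>Sequential compactness of a countable product of closed discs, by the diagonal
  argument.\<close>

lemma bounded_family_subsequence:
  fixes X :: "nat \<Rightarrow> 'i \<Rightarrow> complex"
  assumes count: "countable (UNIV :: 'i set)" and bd: "\<And>m i. cmod (X m i) \<le> b i"
  shows "\<exists>r L. strict_mono r \<and> (\<forall>i. (\<lambda>m. X (r m) i) \<longlonglongrightarrow> L i)"
proof -
  define x where "x m n = X m (from_nat_into UNIV n)" for m n
  interpret subseqs "\<lambda>n s. convergent (\<lambda>m. x (s m) n)"
  proof
    fix n and s :: "nat \<Rightarrow> nat"
    have "bounded (range (\<lambda>m. x (s m) n))"
      by (rule boundedI[of _ "b (from_nat_into UNIV n)"]) (auto simp: x_def bd)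
    then obtain l r where "strict_mono r" "((\<lambda>m. x (s m) n) \<circ> r) \<longlonglongrightarrow> l"
      using bounded_imp_convergent_subsequence by blast
    then show "\<exists>r'. strict_mono r' \<and> convergent (\<lambda>m. x ((s \<circ> r') m) n)"
      by (auto simp: o_def convergent_def)
  qed
  have "convergent (\<lambda>m. x ((diagseq \<circ> (+) (Suc n)) m) n)" for n
  proof (rule diagseq_holds)
    fix r s :: "nat \<Rightarrow> nat" and n
    assume "strict_mono r" "convergent (\<lambda>m. x (s m) n)"
    then show "convergent (\<lambda>m. x ((s \<circ> r) m) n)"
      using convergent_subseq_convergent[of "\<lambda>m. x (s m) n" r] by (simp add: o_def)
  qed
  then have "convergent (\<lambda>m. x (diagseq (m + Suc n)) n)" for n
    by (simp add: o_def add.commute[of _ n])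
  then have cv: "convergent (\<lambda>m. x (diagseq m) n)" for n
    using convergent_ignore_initial_segment[of "\<lambda>m. x (diagseq m) n"] by blast
  have "convergent (\<lambda>m. X (diagseq m) i)" for i
  proof -
    obtain n where "from_nat_into UNIV n = i"
      using from_nat_into_surj[OF count, of i] by auto
    then show ?thesis using cv[of n] by (simp add: x_def)
  qed
  then have "\<forall>i. \<exists>l. (\<lambda>m. X (diagseq m) i) \<longlonglongrightarrow> l" by (simp add: convergent_def)
  then obtain L where "\<forall>i. (\<lambda>m. X (diagseq m) i) \<longlonglongrightarrow> L i" by metis
  then show ?thesis using subseq_diagseq by blast
qed

section \<open>The Agler decomposition\<close>

text \<open>The right side of the Agler decomposition, 1 - \<phi>(z) cnj(\<phi>(w)) as the sum over
  j of (1 - z_j cnj(w_j)) K_j(z, w), restricted to nodes; \<open>s j k\<close> is coordinate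
  \<open>j\<close> of node \<open>k\<close>.\<close>

definition agler_sum :: "('d::finite \<Rightarrow> nat \<Rightarrow> complex) \<Rightarrow> ('d \<Rightarrow> nat \<Rightarrow> nat \<Rightarrow> complex) \<Rightarrow> nat \<Rightarrow> nat \<Rightarrow> complex"
  where "agler_sum s K k l = (\<Sum>j\<in>UNIV. (1 - s j k * cnj (s j l)) * K j k l)"

lemma agler_sum_commute:
  assumes "\<And>j. psd (K j)"
  shows "agler_sum s K l k = cnj (agler_sum s K k l)"
proof -
  have "K j l k = cnj (K j k l)" for j using psd_commute[OF assms] by blast
  then show ?thesis by (simp add: agler_sum_def mult.commute)
qed

lemma agler_sum_diag:
  assumes s: "\<And>j k. cmod (s j k) < 1" and K: "\<And>j. psd (K j)"
  shows "(1 - (cmod (s j k))\<^sup>2) * Re (K j k k) \<le> Re (agler_sum s K k k)"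
proof -
  have pos: "0 < 1 - (cmod (s j k))\<^sup>2" for j
    using s[of j k] power_less_one_iff[of "cmod (s j k)" 2] by simp
  have "Re (agler_sum s K k k) = (\<Sum>j\<in>UNIV. (1 - (cmod (s j k))\<^sup>2) * Re (K j k k))"
    unfolding agler_sum_def Re_sum
  proof (rule sum.cong[OF refl])
    fix j
    have "1 - s j k * cnj (s j k) = of_real (1 - (cmod (s j k))\<^sup>2)"
      by (simp add: complex_norm_square[symmetric])
    then show "Re ((1 - s j k * cnj (s j k)) * K j k k) = (1 - (cmod (s j k))\<^sup>2) * Re (K j k k)"
      by (metis Re_complex_of_real Im_complex_of_real mult_zero_left diff_zero times_complex.sel(1))
  qed
  moreover have "(1 - (cmod (s j k))\<^sup>2) * Re (K j k k) \<le> (\<Sum>j\<in>UNIV. (1 - (cmod (s j k))\<^sup>2) * Re (K j k k))"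
  proof (rule member_le_sum)
    show "0 \<le> (1 - (cmod (s i k))\<^sup>2) * Re (K i k k)" for i
      by (intro mult_nonneg_nonneg less_imp_le[OF pos] psd_diag(2)[OF K])
  qed auto
  ultimately show ?thesis by simp
qed

text \<open>On the diagonal all terms of an Agler sum are nonnegative, so a bound for the sum bounds
  each kernel there and, by Cauchy-Schwarz, everywhere. This is the compactness behind both the
  minimizing sequence and the passage to infinitely many nodes.\<close>

lemma agler_sum_entry_bound:
  assumes s: "\<And>j k. cmod (s j k) < 1" and K: "\<And>j. psd (K j)"
    and C: "\<And>k. Re (agler_sum s K k k) \<le> C k"
  shows "cmod (K j k l) \<le> C k / (1 - (cmod (s j k))\<^sup>2) + C l / (1 - (cmod (s j l))\<^sup>2)"
proof -
  have b: "Re (K j k k) \<le> C k / (1 - (cmod (s j k))\<^sup>2)" for k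
  proof -
    have pos: "0 < 1 - (cmod (s j k))\<^sup>2"
      using s[of j k] power_less_one_iff[of "cmod (s j k)" 2] by simp
    have "(1 - (cmod (s j k))\<^sup>2) * Re (K j k k) \<le> C k"
      using agler_sum_diag[of s K j k, OF s K] C[of k] by linarith
    then show ?thesis using pos by (simp add: pos_le_divide_eq mult.commute)
  qed
  define x y where "x = Re (K j k k)" and "y = Re (K j l l)"
  have xy: "0 \<le> x" "0 \<le> y" unfolding x_def y_def using psd_diag(2)[OF K] by auto
  have "(cmod (K j k l))\<^sup>2 \<le> x * y" unfolding x_def y_def by (rule psd_cmod_le[OF K])
  also have "\<dots> \<le> (x + y)\<^sup>2" using xy by (simp add: power2_sum)
  finally have "cmod (K j k l) \<le> x + y" by (rule power2_le_imp_le) (use xy in simp)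
  then show ?thesis using b[of k] b[of l] unfolding x_def y_def by linarith
qed

text \<open>First-order optimality: \<open>- 2 * a\<close> is the one-sided derivative at 0 of an
  expression that vanishes there.\<close>

lemma quadratic_nonneg_imp:
  fixes a b :: real
  assumes "\<And>t. 0 < t \<Longrightarrow> t \<le> 1 \<Longrightarrow> 0 \<le> t\<^sup>2 * b - 2 * t * a"
  shows "a \<le> 0"
proof (rule ccontr)
  assume "\<not> a \<le> 0"
  then have a: "a > 0" by simp
  \<comment> \<open>For this \<open>t\<close> the product \<open>t * b\<close> is at most
    \<open>a\<close>, whereas the hypothesis demands at least \<open>2 * a\<close>.\<close>
  define t where "t = min 1 (a / (\<bar>b\<bar> + 1))"
  have t: "0 < t" "t \<le> 1" using a by (auto simp: t_def)
  have "t * b \<le> t * \<bar>b\<bar>" using t by (intro mult_left_mono) auto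
  also have "\<dots> \<le> a / (\<bar>b\<bar> + 1) * \<bar>b\<bar>"
    by (rule mult_right_mono) (simp_all add: t_def)
  also have "\<dots> \<le> a" using a by (simp add: divide_simps)
  finally have "t * b \<le> a" .
  moreover have "0 \<le> t * (t * b - 2 * a)"
    using assms[OF t] by (simp add: power2_eq_square algebra_simps)
  then have "2 * a \<le> t * b" using t(1) by (simp add: zero_le_mult_iff)
  ultimately show False using a by linarith
qed

text \<open>Least squares: the residual \<open>R\<close> of a best approximation of \<open>\<Phi>\<close> by Agler sums is, up to sign
  and transposition, an admissible test kernel, and testing \<open>\<Phi>\<close> against it forces \<open>R = 0\<close>.\<close>

lemma agler_decomposition_finite:
  fixes s :: "'d::finite \<Rightarrow> nat \<Rightarrow> complex"
  assumes s: "\<And>j k. cmod (s j k) < 1" and herm: "\<And>k l. \<Phi> l k = cnj (\<Phi> k l)"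
    and test: "\<And>G. psd G \<Longrightarrow> (\<And>j. psd (\<lambda>k l. (1 - s j k * cnj (s j l)) * G k l)) \<Longrightarrow> psd (\<lambda>k l. \<Phi> k l * G k l)"
  shows "\<exists>K. (\<forall>j. psd (K j)) \<and> (\<forall>j k l. \<not> (k < n \<and> l < n) \<longrightarrow> K j k l = 0) \<and>
    (\<forall>k<n. \<forall>l<n. agler_sum s K k l = \<Phi> k l)"
proof -
  define adm where "adm K \<longleftrightarrow> (\<forall>j. psd (K j)) \<and> (\<forall>j k l. \<not> (k < n \<and> l < n) \<longrightarrow> K j k l = 0)"
    for K :: "'d \<Rightarrow> nat \<Rightarrow> nat \<Rightarrow> complex"
  define B where "B X Y = (\<Sum>k<n. \<Sum>l<n. Re (X k l * cnj (Y k l)))" for X Y :: "nat \<Rightarrow> nat \<Rightarrow> complex"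
  define res where "res K k l = \<Phi> k l - agler_sum s K k l" for K k l
  define cost where "cost K = B (res K) (res K)" for K
  have Bself: "B X X = (\<Sum>k<n. \<Sum>l<n. (cmod (X k l))\<^sup>2)" for X
    by (simp add: B_def complex_norm_square[symmetric])
  have cost0: "0 \<le> cost K" for K by (simp add: cost_def Bself sum_nonneg)
  define m where "m = Inf (cost ` Collect adm)"
  have adm0: "adm (\<lambda>_ _ _. 0)" by (simp add: adm_def psd_zero)
  have bb: "bdd_below (cost ` Collect adm)" by (rule bdd_belowI[of _ 0]) (auto simp: cost0)
  have m_le: "m \<le> cost K" if "adm K" for K
    unfolding m_def using that bb by (auto intro: cInf_lower)
  have "\<exists>K. adm K \<and> cost K < m + inverse (real (Suc i))" for i
  proof -
    have "Inf (cost ` Collect adm) < m + inverse (real (Suc i))" by (simp add: m_def)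
    then show ?thesis using cInf_lessD[of "cost ` Collect adm"] adm0 by blast
  qed
  then obtain KK where KK: "\<And>i. adm (KK i)" "\<And>i. cost (KK i) < m + inverse (real (Suc i))" by metis
  \<comment> \<open>The cost of every \<open>KK i\<close> is at most \<open>m + 1\<close>, so by
    \<open>x \<le> x^2 + 1\<close> the residual at \<open>(k, k)\<close> has modulus at most
    \<open>(m + 1) + 1\<close>.\<close>
  define C where "C k = cmod (\<Phi> k k) + (m + 1) + 1" for k
  have Cb: "Re (agler_sum s (KK i) k k) \<le> C k" for i k
  proof (cases "k < n")
    case True
    have "(cmod (res (KK i) k k))\<^sup>2 \<le> (\<Sum>l<n. (cmod (res (KK i) k l))\<^sup>2)"
      by (rule member_le_sum) (use True in auto)
    also have "\<dots> \<le> cost (KK i)" unfolding cost_def Bself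
      by (rule member_le_sum[where f="\<lambda>k. \<Sum>l<n. (cmod (res (KK i) k l))\<^sup>2"]) (use True in \<open>auto intro: sum_nonneg\<close>)
    also have "\<dots> \<le> m + 1" using KK(2)[of i] le_imp_inverse_le[of 1 "real (Suc i)"] by simp
    finally have le: "(cmod (res (KK i) k k))\<^sup>2 \<le> m + 1" .
    have "cmod (res (KK i) k k) \<le> (cmod (res (KK i) k k))\<^sup>2 + 1"
      using zero_le_power2[of "cmod (res (KK i) k k) - 1/2"] by (simp add: power2_eq_square algebra_simps)
    then have "cmod (\<Phi> k k - agler_sum s (KK i) k k) \<le> m + 1 + 1" using le by (simp add: res_def)
    then have "cmod (agler_sum s (KK i) k k) \<le> C k"
      using norm_triangle_ineq3[of "\<Phi> k k" "agler_sum s (KK i) k k"] unfolding C_def by linarith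
    then show ?thesis using complex_Re_le_cmod order_trans by blast
  next
    case False
    then have "agler_sum s (KK i) k k = 0" using KK(1)[of i] by (simp add: adm_def agler_sum_def)
    moreover have "0 \<le> m" unfolding m_def using adm0 cost0 by (intro cInf_greatest) auto
    ultimately show ?thesis by (simp add: C_def)
  qed
  have bound: "cmod (KK i j k l) \<le> C k / (1 - (cmod (s j k))\<^sup>2) + C l / (1 - (cmod (s j l))\<^sup>2)" for i j k l
    by (rule agler_sum_entry_bound[OF s _ Cb]) (use KK(1) in \<open>auto simp: adm_def\<close>)
  obtain r L where r: "strict_mono r" and
    L: "\<And>p. (\<lambda>i. (\<lambda>(j, k, l). KK (r i) j k l) p) \<longlonglongrightarrow> L p"
  proof -
    have "countable (UNIV :: ('d \<times> nat \<times> nat) set)"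
      by (simp flip: UNIV_Times_UNIV)
    from bounded_family_subsequence[OF this, of "\<lambda>i (j, k, l). KK i j k l"
        "\<lambda>(j, k, l). C k / (1 - (cmod (s j k))\<^sup>2) + C l / (1 - (cmod (s j l))\<^sup>2)"]
    show ?thesis using that bound by fastforce
  qed
  define K where "K j k l = L (j, k, l)" for j k l
  have lim: "(\<lambda>i. KK (r i) j k l) \<longlonglongrightarrow> K j k l" for j k l using L[of "(j, k, l)"] by (simp add: K_def)
  have Kpsd: "psd (K j)" for j
    by (rule psd_limit[where K="\<lambda>i. KK (r i) j"]) (use KK(1) lim in \<open>auto simp: adm_def\<close>)
  have admK: "adm K"
    unfolding adm_def
  proof (intro conjI allI impI)
    fix j k l assume "\<not> (k < n \<and> l < n)"
    then have "KK (r i) j k l = 0" for i using KK(1)[of "r i"] unfolding adm_def by blast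
    then show "K j k l = 0" using lim[of j k l] by (simp add: LIMSEQ_const_iff)
  qed (rule Kpsd)
  have "cost K \<le> m"
  proof (rule LIMSEQ_le)
    show "(\<lambda>i. cost (KK (r i))) \<longlonglongrightarrow> cost K"
      unfolding cost_def B_def res_def agler_sum_def by (intro tendsto_intros lim)
    have "(\<lambda>i. m + inverse (real (Suc (r i)))) \<longlonglongrightarrow> m + 0"
      using LIMSEQ_subseq_LIMSEQ[OF LIMSEQ_inverse_real_of_nat r] by (intro tendsto_intros) (simp add: o_def)
    then show "(\<lambda>i. m + inverse (real (Suc (r i)))) \<longlonglongrightarrow> m" by simp
    show "\<exists>N. \<forall>i\<ge>N. cost (KK (r i)) \<le> m + inverse (real (Suc (r i)))" using KK(2) less_imp_le by blast
  qed
  then have opt: "cost K \<le> cost K'" if "adm K'" for K' using m_le[OF that] by simp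
  define R where "R = res K"
  have Rherm: "R l k = cnj (R k l)" for k l
    by (simp add: R_def res_def herm[of l k] agler_sum_commute[of K s l k, OF Kpsd])
  have expand: "B (\<lambda>k l. X k l - of_real t * Y k l) (\<lambda>k l. X k l - of_real t * Y k l) =
      B X X + (t\<^sup>2 * B Y Y - 2 * t * B X Y)" for X Y t
    unfolding B_def sum_distrib_left sum.distrib[symmetric] sum_subtractf[symmetric]
    by (intro sum.cong refl) (simp add: algebra_simps power2_eq_square)
  \<comment> \<open>Admissible families form a convex cone, so \<open>K + t K'\<close> competes with
    \<open>K\<close>, and the first-order condition at \<open>t = 0\<close> fixes the sign.\<close>
  have le0: "B R (agler_sum s K') \<le> 0" if K': "adm K'" for K'
  proof (rule quadratic_nonneg_imp)
    fix t :: real assume t: "0 < t" "t \<le> 1"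
    define K2 where "K2 j k l = K j k l + of_real t * K' j k l" for j k l
    have "adm K2" using admK K' t unfolding adm_def K2_def by (auto intro!: psd_add psd_scale)
    then have "cost K \<le> cost K2" by (rule opt)
    moreover have "res K2 = (\<lambda>k l. R k l - of_real t * agler_sum s K' k l)"
      by (simp add: fun_eq_iff res_def R_def K2_def agler_sum_def algebra_simps sum.distrib sum_distrib_left sum_subtractf)
    ultimately show "0 \<le> t\<^sup>2 * B (agler_sum s K') (agler_sum s K') - 2 * t * B R (agler_sum s K')"
      using expand[of R t "agler_sum s K'"] by (simp add: cost_def R_def)
  qed
  \<comment> \<open>The competitor \<open>(1 - t) K\<close>, moving toward the apex of the cone,
    gives the opposite sign for \<open>K\<close> itself; thus \<open>B R \<Phi>\<close> is at least
    \<open>B R R\<close>.\<close>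
  have "- B R (agler_sum s K) \<le> 0"
  proof (rule quadratic_nonneg_imp)
    fix t :: real assume t: "0 < t" "t \<le> 1"
    define K2 where "K2 j k l = of_real (1 - t) * K j k l" for j k l
    have "adm K2" using admK t unfolding adm_def K2_def by (auto intro!: psd_scale simp del: of_real_diff)
    then have "cost K \<le> cost K2" by (rule opt)
    moreover have "agler_sum s K2 k l = of_real (1 - t) * agler_sum s K k l" for k l
      unfolding K2_def agler_sum_def sum_distrib_left by (intro sum.cong refl) (simp only: mult_ac)
    then have "res K2 = (\<lambda>k l. R k l - of_real (- t) * agler_sum s K k l)"
      by (simp add: fun_eq_iff res_def R_def algebra_simps)
    ultimately show "0 \<le> t\<^sup>2 * B (agler_sum s K) (agler_sum s K) - 2 * t * (- B R (agler_sum s K))"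
      using expand[of R "-t" "agler_sum s K"] by (simp add: cost_def R_def)
  qed
  moreover have "B R \<Phi> = B R R + B R (agler_sum s K)"
    unfolding B_def sum.distrib[symmetric]
    by (intro sum.cong refl) (simp add: R_def res_def algebra_simps)
  ultimately have BR: "B R R \<le> B R \<Phi>" by simp
  \<comment> \<open>\<open>B\<close> conjugates its second argument; since \<open>R\<close> is
    Hermitian, transposing it turns this pairing into the plain entrywise sums tested by
    \<open>psd\<close>.\<close>
  define G where "G k l = (if k < n \<and> l < n then - R l k else 0)" for k l
  have Gherm: "G l k = cnj (G k l)" for k l using Rherm[of k l] by (simp add: G_def)
  have E: "psd (\<lambda>k l. (1 - s j k * cnj (s j l)) * G k l)" for j
  proof (rule psd_finiteI)
    show "(1 - s j l * cnj (s j k)) * G l k = cnj ((1 - s j k * cnj (s j l)) * G k l)" for k l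
      by (simp add: Gherm[of l k] mult.commute)
    show "(1 - s j k * cnj (s j l)) * G k l = 0" if "\<not> (k < n \<and> l < n)" for k l
      using that by (auto simp: G_def)
    fix c :: "nat \<Rightarrow> complex"
    \<comment> \<open>Optimality against the rank-one kernel of \<open>c\<close> in the single slot
      \<open>j\<close> is positivity, on the coefficients \<open>c\<close>, of the
      \<open>j\<close>-th defect kernel of \<open>G\<close>.\<close>
    define K' where "K' i k l = (if i = j then (if k < n \<and> l < n then c k * cnj (c l) else 0) else 0)" for i k l
    have "adm K'"
      unfolding adm_def
    proof (intro conjI allI)
      show "psd (K' i)" for i
        using psd_truncate[OF psd_rank_one[of c], of n] psd_zero
        by (cases "i = j") (simp_all add: K'_def[abs_def])
    qed (auto simp: K'_def)
    then have "B R (agler_sum s K') \<le> 0" by (rule le0)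
    moreover have "agler_sum s K' k l = (1 - s j k * cnj (s j l)) * (c k * cnj (c l))" if "k < n" "l < n" for k l
    proof -
      have "agler_sum s K' k l = (\<Sum>i\<in>{j}. (1 - s i k * cnj (s i l)) * K' i k l)"
        unfolding agler_sum_def by (rule sum.mono_neutral_right) (auto simp: K'_def)
      then show ?thesis using that by (simp add: K'_def)
    qed
    ultimately have "(\<Sum>k<n. \<Sum>l<n. Re (R k l * cnj ((1 - s j k * cnj (s j l)) * (c k * cnj (c l))))) \<le> 0"
      unfolding B_def by simp
    moreover have "(\<Sum>k<n. \<Sum>l<n. Re (R k l * cnj ((1 - s j k * cnj (s j l)) * (c k * cnj (c l))))) =
        - Re (\<Sum>k<n. \<Sum>l<n. c k * cnj (c l) * ((1 - s j k * cnj (s j l)) * G k l))"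
      unfolding Re_sum sum_negf[symmetric]
      by (subst sum.swap, intro sum.cong refl) (simp add: G_def algebra_simps)
    ultimately show "0 \<le> Re (\<Sum>k<n. \<Sum>l<n. c k * cnj (c l) * ((1 - s j k * cnj (s j l)) * G k l))" by simp
  qed
  \<comment> \<open>Positivity of one defect kernel suffices; \<open>undefined\<close> stands for an
    arbitrary coordinate.\<close>
  have "psd G" by (rule psd_of_defect[OF s Gherm E[of undefined]])
  \<comment> \<open>With all coefficients equal to 1 the quadratic form of the entrywise product is
    the sum of its entries, which is the pairing of \<open>R\<close> with \<open>\<Phi>\<close> up
    to sign.\<close>
  from test[OF this E] have "0 \<le> Re (\<Sum>k<n. \<Sum>l<n. 1 * cnj 1 * (\<Phi> k l * G k l))"
    by (rule psd_Re_nonneg[where c="\<lambda>_. 1"])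
  also have "\<dots> = - B R \<Phi>"
    unfolding B_def Re_sum sum_negf[symmetric]
  proof (intro sum.cong refl)
    fix k l assume "k \<in> {..<n}" "l \<in> {..<n}"
    then have "1 * cnj 1 * (\<Phi> k l * G k l) = - cnj (R k l * cnj (\<Phi> k l))"
      using Rherm[of k l] by (simp add: G_def mult.commute)
    then show "Re (1 * cnj 1 * (\<Phi> k l * G k l)) = - Re (R k l * cnj (\<Phi> k l))"
      by (metis complex_cnj(1) complex.sel(1) uminus_complex.sel(1) cnj.sel(1))
  qed
  finally have "B R R \<le> 0" using BR by simp
  then have z: "(\<Sum>k<n. \<Sum>l<n. (cmod (R k l))\<^sup>2) = 0"
    unfolding Bself by (rule antisym) (intro sum_nonneg zero_le_power2)
  have "agler_sum s K k l = \<Phi> k l" if "k < n" "l < n" for k l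
  proof -
    have "(\<Sum>l<n. (cmod (R k l))\<^sup>2) = 0"
      using z that by (subst (asm) sum_nonneg_eq_0_iff) (auto intro: sum_nonneg)
    then have "(cmod (R k l))\<^sup>2 = 0"
      using that by (subst (asm) sum_nonneg_eq_0_iff) auto
    then show ?thesis by (simp add: R_def res_def)
  qed
  then show ?thesis using admK unfolding adm_def by blast
qed

text \<open>The decompositions on the first \<open>n\<close> nodes have diagonals bounded by those
  of \<open>\<Phi>\<close>, uniformly in \<open>n\<close>, so a subsequence converges
  entrywise.\<close>

lemma agler_decomposition:
  fixes s :: "'d::finite \<Rightarrow> nat \<Rightarrow> complex"
  assumes s: "\<And>j k. cmod (s j k) < 1" and herm: "\<And>k l. \<Phi> l k = cnj (\<Phi> k l)"
    and test: "\<And>G. psd G \<Longrightarrow> (\<And>j. psd (\<lambda>k l. (1 - s j k * cnj (s j l)) * G k l)) \<Longrightarrow> psd (\<lambda>k l. \<Phi> k l * G k l)"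
  shows "\<exists>K. (\<forall>j. psd (K j)) \<and> (\<forall>k l. agler_sum s K k l = \<Phi> k l)"
proof -
  have "\<forall>n. \<exists>K. (\<forall>j. psd (K j)) \<and> (\<forall>j k l. \<not> (k < n \<and> l < n) \<longrightarrow> K j k l = 0) \<and>
    (\<forall>k<n. \<forall>l<n. agler_sum s K k l = \<Phi> k l)"
    by (rule allI, rule agler_decomposition_finite) (rule s, rule herm, rule test, assumption, blast)
  then obtain KK where KK: "\<And>n j. psd (KK n j)"
    "\<And>n j k l. \<not> (k < n \<and> l < n) \<Longrightarrow> KK n j k l = 0"
    "\<And>n k l. k < n \<Longrightarrow> l < n \<Longrightarrow> agler_sum s (KK n) k l = \<Phi> k l" by metis
  define C where "C k = \<bar>Re (\<Phi> k k)\<bar>" for k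
  have Cb: "Re (agler_sum s (KK n) k k) \<le> C k" for n k
    using KK(2)[of k n k] KK(3)[of k n k] by (cases "k < n") (auto simp: C_def agler_sum_def)
  have bound: "cmod (KK i j k l) \<le> C k / (1 - (cmod (s j k))\<^sup>2) + C l / (1 - (cmod (s j l))\<^sup>2)" for i j k l
    by (rule agler_sum_entry_bound[OF s KK(1) Cb])
  obtain r L where r: "strict_mono r" and
    L: "\<And>p. (\<lambda>i. (\<lambda>(j, k, l). KK (r i) j k l) p) \<longlonglongrightarrow> L p"
  proof -
    have "countable (UNIV :: ('d \<times> nat \<times> nat) set)"
      by (simp flip: UNIV_Times_UNIV)
    from bounded_family_subsequence[OF this, of "\<lambda>i (j, k, l). KK i j k l"
        "\<lambda>(j, k, l). C k / (1 - (cmod (s j k))\<^sup>2) + C l / (1 - (cmod (s j l))\<^sup>2)"]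
    show ?thesis using that bound by fastforce
  qed
  define K where "K j k l = L (j, k, l)" for j k l
  have lim: "(\<lambda>i. KK (r i) j k l) \<longlonglongrightarrow> K j k l" for j k l using L[of "(j, k, l)"] by (simp add: K_def)
  have "psd (K j)" for j
    by (rule psd_limit[where K="\<lambda>i. KK (r i) j"]) (use KK(1) lim in auto)
  moreover have "agler_sum s K k l = \<Phi> k l" for k l
  proof (rule LIMSEQ_unique)
    show "(\<lambda>i. agler_sum s (KK (r i)) k l) \<longlonglongrightarrow> agler_sum s K k l"
      unfolding agler_sum_def by (intro tendsto_intros lim)
    have "\<forall>\<^sub>F i in sequentially. agler_sum s (KK (r i)) k l = \<Phi> k l"
      using eventually_gt_at_top[of "max k l"]
    proof eventually_elim
      case (elim i)
      then show ?case using seq_suble[OF r, of i] by (intro KK(3)) auto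
    qed
    then show "(\<lambda>i. agler_sum s (KK (r i)) k l) \<longlonglongrightarrow> \<Phi> k l" by (rule tendsto_eventually)
  qed
  ultimately show ?thesis by blast
qed

section \<open>Test kernels and the Schur-Agler condition\<close>

lemma ops_clspan_eqI:
  assumes A: "A \<in> ops (clspan a)" and B: "B \<in> ops (clspan a)"
    and eq: "\<And>k. blinfun_apply A (a k) = blinfun_apply B (a k)"
  shows "A = B"
proof (rule ops_eqI[OF hilbert_subspace_clspan A B])
  define S where "S = {x. blinfun_apply A x = blinfun_apply B x}"
  have "closed S" unfolding S_def by (intro closed_Collect_eq continuous_intros)
  then have "hilbert_subspace S"
    unfolding hilbert_subspace_def subspace_def
    by (auto simp: S_def blinfun.add_right blinfun.scaleR_right ops_scaleC[OF A] ops_scaleC[OF B])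
  then have "clspan a \<subseteq> S" by (rule clspan_minimal) (simp add: S_def eq)
  then show "A x = B x" if "x \<in> clspan a" for x using that by (auto simp: S_def)
qed

definition ell2_basis :: "nat \<Rightarrow> ell2"
  where "ell2_basis n = Abs_ell2 (\<lambda>m. if m = n then 1 else 0)"

lemma ell2_nth_basis: "ell2_nth (ell2_basis n) m = (if m = n then 1 else 0)"
proof -
  have "(\<lambda>m. (cmod (if m = n then 1 else 0))\<^sup>2) sums (cmod 1)\<^sup>2"
  proof -
    have "(cmod (if m = n then 1 else 0))\<^sup>2 = (if m = n then 1 else 0)" for m by simp
    then show ?thesis using sums_single[of n "\<lambda>_. 1::real"] by simp
  qed
  then show ?thesis by (simp add: ell2_basis_def Abs_ell2_inverse sums_iff)
qed

lemma cinner_ell2_basis: "cinner (ell2_basis i) (ell2_basis j) = (if i = j then 1 else 0)"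
proof -
  have "(\<lambda>n. ell2_nth (ell2_basis i) n * cnj (ell2_nth (ell2_basis j) n)) =
      (\<lambda>n. if n = i then if i = j then 1 else 0 else 0)"
    by (auto simp: ell2_nth_basis)
  then show ?thesis
    unfolding cinner_ell2_def using sums_single[of i "\<lambda>_. if i = j then 1 else 0::complex"]
    by (simp add: sums_iff)
qed

text \<open>Realize \<open>G\<close> as the Gram kernel of vectors \<open>v k\<close>. Positivity of
  the \<open>j\<close>-th defect kernel says that \<open>v k \<mapsto> q k $ j *\<^sub>C v k\<close>
  extends to a contraction. These contractions commute, and after scaling by \<open>r\<close> the
  functional calculus multiplies \<open>v k\<close> by \<open>\<phi> (r *\<^sub>R q k)\<close>; the
  Schur-Agler bound gives positivity at the nodes \<open>r *\<^sub>R q k\<close>, and then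
  \<open>r\<close> tends to 1.\<close>

lemma schur_agler_test:
  fixes \<phi> :: "complex ^ 'd \<Rightarrow> complex" and q :: "nat \<Rightarrow> complex ^ 'd"
  assumes \<phi>: "\<phi> \<in> schur_agler TYPE(ell2)" and q: "\<And>k. q k \<in> polydisc"
    and G: "psd G" and E: "\<And>j. psd (\<lambda>k l. (1 - q k $ j * cnj (q l $ j)) * G k l)"
  shows "psd (\<lambda>k l. (1 - \<phi> (q k) * cnj (\<phi> (q l))) * G k l)"
proof (rule psdI)
  show "(1 - \<phi> (q l) * cnj (\<phi> (q k))) * G l k = cnj ((1 - \<phi> (q k) * cnj (\<phi> (q l))) * G k l)" for k l
    using psd_commute[OF G, of l k] by (simp add: mult.commute)
  fix n and c :: "nat \<Rightarrow> complex"
  have an: "analytic_fun_on \<phi> polydisc" using \<phi> by (simp add: schur_agler_def)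
  obtain v :: "nat \<Rightarrow> ell2" where v: "\<And>k l. cinner (v k) (v l) = G k l"
    using psd_gram_vectors[OF G cinner_ell2_basis] by blast
  define M where "M = clspan v"
  have M: "hilbert_subspace M" by (simp add: M_def hilbert_subspace_clspan)
  have vM: "v k \<in> M" for k by (simp add: M_def in_clspan)
  have "\<exists>T. T \<in> ops M \<and> norm T \<le> 1 \<and> (\<forall>k. blinfun_apply T (v k) = q k $ j *\<^sub>C v k)" for j
  proof -
    have "psd (\<lambda>k l. cinner (v k) (v l) - cinner (q k $ j *\<^sub>C v k) (q l $ j *\<^sub>C v l))"
      using E[of j] by (simp add: cinner_linear_simps v algebra_simps)
    from contraction_extension[OF this] obtain T where T: "T \<in> ops UNIV" "norm T \<le> 1"
      "\<And>k. blinfun_apply T (v k) = q k $ j *\<^sub>C v k" "\<And>x. T (op_one M x) = T x"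
      "\<And>x. T x \<in> clspan (\<lambda>k. q k $ j *\<^sub>C v k)" unfolding M_def by blast
    have "clspan (\<lambda>k. q k $ j *\<^sub>C v k) \<subseteq> M"
      by (rule clspan_minimal[OF M]) (rule hilbert_subspaceD(3)[OF M vM])
    then have "T \<in> ops M" using T by (intro opsI_op_one[OF M]) auto
    then show ?thesis using T by blast
  qed
  then obtain T where T: "\<And>j. T j \<in> ops M" "\<And>j. norm (T j) \<le> 1"
    "\<And>j k. blinfun_apply (T j) (v k) = q k $ j *\<^sub>C v k" by metis
  have comm: "T i o\<^sub>L T j = T j o\<^sub>L T i" for i j
    unfolding M_def
    by (rule ops_clspan_eqI[of _ v]) (use T in \<open>auto intro!: ops_compose
        simp: M_def[symmetric] ops_scaleC[OF T(1)] scaleC_scaleC mult.commute\<close>)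
  have ineq: "0 \<le> Re (\<Sum>k<n. \<Sum>l<n. c k * cnj (c l) * ((1 - \<phi> (r *\<^sub>R q k) * cnj (\<phi> (r *\<^sub>R q l))) * G k l))"
    if r: "0 < r" "r < 1" for r
  proof -
    define W where "W = fun_calc M \<phi> (\<lambda>j. r *\<^sub>R T j)"
    have "norm W \<le> 1"
      using \<phi> M T comm r unfolding schur_agler_def W_def contraction_def by auto
    have Wv: "W (c k *\<^sub>C v k) = \<phi> (r *\<^sub>R q k) *\<^sub>C (c k *\<^sub>C v k)" for k
      unfolding W_def
    proof (rule fun_calc_eigenvector[OF M])
      show "r *\<^sub>R T j \<in> ops UNIV" for j
        by (simp add: ops_UNIV_iff ops_scaleC[OF T(1)] scaleC_scaleR_commute blinfun.scaleR_left)
      show "(r *\<^sub>R T i) o\<^sub>L (r *\<^sub>R T j) = (r *\<^sub>R T j) o\<^sub>L (r *\<^sub>R T i)" for i j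
      proof (rule blinfun_eqI)
        fix x
        have "T i (T j x) = T j (T i x)" using comm[of i j] by (metis blinfun_apply_blinfun_compose)
        then show "((r *\<^sub>R T i) o\<^sub>L (r *\<^sub>R T j)) x = ((r *\<^sub>R T j) o\<^sub>L (r *\<^sub>R T i)) x"
          by (simp add: blinfun.scaleR_left blinfun.scaleR_right)
      qed
      show "norm (r *\<^sub>R T j) \<le> r" for j using T(2)[of j] r by simp
      show "c k *\<^sub>C v k \<in> M" by (rule hilbert_subspaceD(3)[OF M vM])
      show "(r *\<^sub>R T j) (c k *\<^sub>C v k) = (r *\<^sub>R q k) $ j *\<^sub>C c k *\<^sub>C v k" for j
        by (simp add: blinfun.scaleR_left ops_scaleC[OF T(1)] T(3) scaleC_scaleC
            scaleR_scaleC[of _ "_ :: ell2"] scaleR_conv_of_real[of _ "_ :: complex"] mult_ac)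
      have "r * cmod (q k $ j) < 1" for j
        using mult_strict_mono'[of r 1 "cmod (q k $ j)" 1] q[of k] r by (simp add: polydisc_def)
      then show "r *\<^sub>R q k \<in> polydisc" using r by (simp add: polydisc_def)
    qed (use r an in auto)
    define x where "x = (\<Sum>k<n. c k *\<^sub>C v k)"
    have Wx: "W x = (\<Sum>k<n. (\<phi> (r *\<^sub>R q k) * c k) *\<^sub>C v k)"
      unfolding x_def blinfun.sum_right by (simp add: Wv scaleC_scaleC)
    have "norm (W x) \<le> 1 * norm x"
      by (rule order_trans[OF norm_blinfun]) (intro mult_right_mono \<open>norm W \<le> 1\<close> norm_ge_zero)
    then have "(norm (W x))\<^sup>2 \<le> (norm x)\<^sup>2" by (intro power_mono) auto
    then have "0 \<le> Re (cinner x x - cinner (W x) (W x))" by (simp add: cinner_self)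
    also have "cinner x x - cinner (W x) (W x) =
        (\<Sum>l<n. \<Sum>k<n. c k * cnj (c l) * ((1 - \<phi> (r *\<^sub>R q k) * cnj (\<phi> (r *\<^sub>R q l))) * G k l))"
      unfolding Wx unfolding x_def cinner_linear_simps v sum_distrib_left sum_subtractf[symmetric]
      by (intro sum.cong refl) (simp add: algebra_simps)
    also have "\<dots> = (\<Sum>k<n. \<Sum>l<n. c k * cnj (c l) * ((1 - \<phi> (r *\<^sub>R q k) * cnj (\<phi> (r *\<^sub>R q l))) * G k l))"
      by (rule sum.swap)
    finally show ?thesis .
  qed
  have lim: "((\<lambda>r. \<phi> (r *\<^sub>R q k)) \<longlongrightarrow> \<phi> (q k)) (at_left 1)" for k
  proof -
    have "isCont \<phi> (q k)"
      using an q[of k] unfolding analytic_fun_on_def by (meson has_derivative_continuous)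
    moreover have "((\<lambda>r. r *\<^sub>R q k) \<longlongrightarrow> 1 *\<^sub>R q k) (at_left 1)" by (intro tendsto_intros)
    ultimately show ?thesis using isCont_tendsto_compose by fastforce
  qed
  show "0 \<le> Re (\<Sum>k<n. \<Sum>l<n. c k * cnj (c l) * ((1 - \<phi> (q k) * cnj (\<phi> (q l))) * G k l))"
  proof (rule tendsto_lowerbound)
    show "((\<lambda>r. Re (\<Sum>k<n. \<Sum>l<n. c k * cnj (c l) * ((1 - \<phi> (r *\<^sub>R q k) * cnj (\<phi> (r *\<^sub>R q l))) * G k l))) \<longlongrightarrow>
        Re (\<Sum>k<n. \<Sum>l<n. c k * cnj (c l) * ((1 - \<phi> (q k) * cnj (\<phi> (q l))) * G k l))) (at_left 1)"
      by (intro tendsto_intros lim)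
    show "\<forall>\<^sub>F r in at_left 1. 0 \<le> Re (\<Sum>k<n. \<Sum>l<n. c k * cnj (c l) *
        ((1 - \<phi> (r *\<^sub>R q k) * cnj (\<phi> (r *\<^sub>R q l))) * G k l))"
      using eventually_at_left_real[of 0 "1::real"] ineq by (auto elim!: eventually_mono)
  qed simp
qed

section \<open>Analytic functions\<close>

lemma analytic_fun_onI:
  assumes "\<And>z. z \<in> U \<Longrightarrow> \<exists>D. (f has_derivative D) (at z) \<and> (\<forall>c h. D (c *s h) = c *\<^sub>C D h)"
  shows "analytic_fun_on f U"
  using assms unfolding analytic_fun_on_def by blast

lemma analytic_fun_on_linear:
  assumes "analytic_fun_on f U" "bounded_linear L" "\<And>c x. L (c *\<^sub>C x) = c *\<^sub>C L x"
  shows "analytic_fun_on (\<lambda>z. L (f z)) U"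
proof (rule analytic_fun_onI)
  fix z assume "z \<in> U"
  then obtain D where D: "(f has_derivative D) (at z)" "\<And>c h. D (c *s h) = c *\<^sub>C D h"
    using assms(1) unfolding analytic_fun_on_def by blast
  show "\<exists>D. ((\<lambda>z. L (f z)) has_derivative D) (at z) \<and> (\<forall>c h. D (c *s h) = c *\<^sub>C D h)"
    using bounded_linear.has_derivative[OF assms(2) D(1)] by (intro exI[of _ "\<lambda>h. L (D h)"]) (simp add: D(2) assms(3))
qed

lemma analytic_fun_on_const: "analytic_fun_on (\<lambda>z. c) U"
  by (rule analytic_fun_onI) (auto intro!: exI[of _ "\<lambda>_. 0"])

lemma analytic_fun_on_add:
  assumes "analytic_fun_on f U" "analytic_fun_on g U"
  shows "analytic_fun_on (\<lambda>z. f z + g z) U"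
proof (rule analytic_fun_onI)
  fix z assume "z \<in> U"
  then obtain D E where D: "(f has_derivative D) (at z)" "\<And>c h. D (c *s h) = c *\<^sub>C D h"
    and E: "(g has_derivative E) (at z)" "\<And>c h. E (c *s h) = c *\<^sub>C E h"
    using assms unfolding analytic_fun_on_def by meson
  show "\<exists>D. ((\<lambda>z. f z + g z) has_derivative D) (at z) \<and> (\<forall>c h. D (c *s h) = c *\<^sub>C D h)"
    using has_derivative_add[OF D(1) E(1)] by (intro exI[of _ "\<lambda>h. D h + E h"]) (simp add: D(2) E(2) scaleC_add_right)
qed

lemma analytic_fun_on_minus: "analytic_fun_on f U \<Longrightarrow> analytic_fun_on (\<lambda>z. - f z) U"
  by (rule analytic_fun_on_linear[where L=uminus]) (auto simp: scaleC_minus_right bounded_linear_minus bounded_linear_ident)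

lemma analytic_fun_on_diff:
  "analytic_fun_on f U \<Longrightarrow> analytic_fun_on g U \<Longrightarrow> analytic_fun_on (\<lambda>z. f z - g z) U"
  using analytic_fun_on_add[OF _ analytic_fun_on_minus, of f U g] by simp

lemma analytic_fun_on_sum:
  "(\<And>i. i \<in> A \<Longrightarrow> analytic_fun_on (f i) U) \<Longrightarrow> analytic_fun_on (\<lambda>z. \<Sum>i\<in>A. f i z) U"
  by (induction A rule: infinite_finite_induct)
    (auto intro: analytic_fun_on_const analytic_fun_on_add)

lemma analytic_fun_on_nth: "analytic_fun_on (\<lambda>z. z $ j) U"
  by (rule analytic_fun_onI)
    (auto intro!: exI[of _ "\<lambda>h. h $ j"] bounded_linear_imp_has_derivative bounded_linear_vec_nth
      simp: scaleC_complex_def)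

lemma analytic_fun_on_scaleC:
  "analytic_fun_on f U \<Longrightarrow> analytic_fun_on (\<lambda>z. f z *\<^sub>C (x :: 'v::complex_normed_vector)) U"
  by (rule analytic_fun_on_linear[OF _ bounded_linear_scaleC_left])
    (auto simp: scaleC_complex_def scaleC_scaleC)

lemma analytic_fun_on_cmult:
  fixes f :: "complex ^ 'd \<Rightarrow> complex"
  shows "analytic_fun_on f U \<Longrightarrow> analytic_fun_on (\<lambda>z. c * f z) U"
  by (rule analytic_fun_on_linear[where L="\<lambda>x. c * x"])
    (auto simp: scaleC_complex_def bounded_linear_mult_right)

lemma analytic_fun_on_inverse:
  fixes f :: "complex ^ 'd \<Rightarrow> complex"
  assumes "analytic_fun_on f U" "\<And>z. z \<in> U \<Longrightarrow> f z \<noteq> 0"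
  shows "analytic_fun_on (\<lambda>z. 1 / f z) U"
proof (rule analytic_fun_onI)
  fix z assume z: "z \<in> U"
  then obtain D where D: "(f has_derivative D) (at z)" "\<And>c h. D (c *s h) = c *\<^sub>C D h"
    using assms(1) unfolding analytic_fun_on_def by blast
  show "\<exists>D. ((\<lambda>z. 1 / f z) has_derivative D) (at z) \<and> (\<forall>c h. D (c *s h) = c *\<^sub>C D h)"
    using Deriv.has_derivative_inverse[OF assms(2)[OF z] D(1)]
    by (intro exI[of _ "\<lambda>h. - (inverse (f z) * D h * inverse (f z))"])
      (simp add: D(2) scaleC_complex_def inverse_eq_divide)
qed

lemma quadratic_bound_has_derivative_0:
  fixes r :: "'a::real_normed_vector \<Rightarrow> 'b::real_normed_vector"
  assumes "d > 0" "0 \<le> C" and bd: "\<And>w. norm (w - z) < d \<Longrightarrow> norm (r w) \<le> C * (norm (w - z))\<^sup>2"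
  shows "(r has_derivative (\<lambda>_. 0)) (at z)"
  unfolding has_derivative_at_alt
proof (intro conjI allI impI)
  have r0: "r z = 0" using bd[of z] assms(1) by simp
  fix e :: real assume e: "e > 0"
  define d' where "d' = min d (e / (C + 1))"
  have "d' > 0" using assms e by (simp add: d'_def)
  moreover have "norm (r w - r z - 0) \<le> e * norm (w - z)" if w: "norm (w - z) < d'" for w
  proof -
    have "C * norm (w - z) \<le> C * (e / (C + 1))" using w assms by (intro mult_left_mono) (auto simp: d'_def)
    also have "\<dots> \<le> e" using assms e by (simp add: divide_simps)
    finally have "C * norm (w - z) * norm (w - z) \<le> e * norm (w - z)" by (rule mult_right_mono) simp
    moreover have "norm (r w) \<le> C * (norm (w - z))\<^sup>2" by (rule bd) (use w in \<open>simp add: d'_def\<close>)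
    ultimately show ?thesis by (simp add: r0 power2_eq_square mult.assoc)
  qed
  ultimately show "\<exists>d>0. \<forall>y. norm (y - z) < d \<longrightarrow> norm (r y - r z - 0) \<le> e * norm (y - z)" by blast
qed simp

text \<open>Using the resolvent identity twice gives \<open>G w = G z - G z (F w - F z) G z\<close>
  plus a remainder quadratic in \<open>F w - F z\<close>; the derivative is therefore
  \<open>- G z (D h) G z\<close>.\<close>

lemma analytic_fun_on_op_inverse:
  fixes F G :: "complex ^ 'd \<Rightarrow> 'h::complex_hilbert \<Rightarrow>\<^sub>L 'h"
  assumes M: "hilbert_subspace M" and U: "open U" and F: "analytic_fun_on F U" and FM: "\<And>z. z \<in> U \<Longrightarrow> F z \<in> ops M"
    and G: "\<And>z. z \<in> U \<Longrightarrow> is_op_inverse M (F z) (G z)"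
  shows "analytic_fun_on G U"
proof (rule analytic_fun_onI)
  fix z assume z: "z \<in> U"
  then obtain D where D: "(F has_derivative D) (at z)" "\<And>c h. D (c *s h) = c *\<^sub>C D h"
    using F unfolding analytic_fun_on_def by blast
  define L where "L A = G z o\<^sub>L (A o\<^sub>L G z)" for A
  define R where "R w = G w o\<^sub>L ((F w - F z) o\<^sub>L L (F w - F z))" for w
  define N where "N = norm (G z)"
  have GM: "G w \<in> ops M" if "w \<in> U" for w using G[OF that] by (simp add: is_op_inverse_def)
  have one: "B o\<^sub>L op_one M = B" "op_one M o\<^sub>L B = B" if "B \<in> ops M" for B
    by (rule blinfun_eqI, simp add: ops_op_one[OF M that])
      (rule blinfun_eqI, simp add: op_one_id[OF M ops_in[OF that]])
  have step: "G w = G z - (G w o\<^sub>L ((F w - F z) o\<^sub>L G z))" if w: "w \<in> U" for w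
  proof (rule blinfun_eqI)
    fix x
    have 1: "G w (F w y) = y" if "y \<in> M" for y
      using is_op_inverse_apply(2)[OF M G[OF w] that] .
    have "F z (G z x) = op_one M x"
      using G[OF z] unfolding is_op_inverse_def by (metis blinfun_apply_blinfun_compose)
    then show "G w x = (G z - (G w o\<^sub>L ((F w - F z) o\<^sub>L G z))) x"
      by (simp add: blinfun.diff_left blinfun.diff_right 1[OF ops_in[OF GM[OF z]]] ops_op_one[OF M GM[OF w]])
  qed
  have blL: "bounded_linear L"
    unfolding L_def
    by (intro bounded_linear_compose[OF bounded_bilinear.bounded_linear_right[OF bounded_bilinear_blinfun_compose]
        bounded_bilinear.bounded_linear_left[OF bounded_bilinear_blinfun_compose], unfolded o_def])
  have eq: "G w = (G z - L (F w - F z)) + R w" if w: "w \<in> U" for w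
  proof (rule blinfun_eqI)
    fix x
    define y where "y = (F w - F z) (G z x)"
    have "G w x = G z x - G w y"
      using arg_cong[OF step[OF w], of "\<lambda>A. blinfun_apply A x"] by (simp add: blinfun.diff_left y_def)
    moreover have "G w y = G z y - G w ((F w - F z) (G z y))"
      using arg_cong[OF step[OF w], of "\<lambda>A. blinfun_apply A y"] by (simp add: blinfun.diff_left)
    ultimately show "G w x = ((G z - L (F w - F z)) + R w) x"
      by (simp add: blinfun.diff_left blinfun.add_left L_def R_def y_def)
  qed
  obtain K where K: "K > 0" "\<And>h. norm (D h) \<le> norm h * K"
    using bounded_linear.pos_bounded[OF has_derivative_bounded_linear[OF D(1)]] by blast
  obtain d1 where d1: "d1 > 0" "\<And>w. norm (w - z) < d1 \<Longrightarrow> norm (F w - F z - D (w - z)) \<le> 1 * norm (w - z)"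
    using D(1) unfolding has_derivative_at_alt by (meson zero_less_one)
  have lip: "norm (F w - F z) \<le> (1 + K) * norm (w - z)" if "norm (w - z) < d1" for w
    using d1(2)[OF that] K(2)[of "w - z"] norm_triangle_ineq[of "F w - F z - D (w - z)" "D (w - z)"]
    by (simp add: algebra_simps)
  obtain d2 where d2: "d2 > 0" "ball z d2 \<subseteq> U" using U z open_contains_ball by blast
  \<comment> \<open>The last entry forces \<open>norm (F w - F z) * N \<le> 1/2\<close>, hence
    \<open>norm (G w) \<le> 2 * N\<close> by absorption, which bounds the remainder;
    \<open>N + 1\<close> keeps the quotient finite if \<open>N = 0\<close>.\<close>
  define d where "d = min (min d1 d2) (1 / (2 * (N + 1) * (1 + K)))"
  have N0: "0 \<le> N" by (simp add: N_def)
  have d: "d > 0" using d1 d2 N0 K by (simp add: d_def)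
  have Rb: "norm (R w) \<le> 2 * N ^ 3 * (1 + K)\<^sup>2 * (norm (w - z))\<^sup>2" if w: "norm (w - z) < d" for w
  proof -
    have wU: "w \<in> U" using w d2 by (auto simp: d_def dist_norm norm_minus_commute)
    define E where "E = norm (F w - F z)"
    have E0: "0 \<le> E" by (simp add: E_def)
    have E: "E \<le> (1 + K) * norm (w - z)" using w by (simp add: E_def lip d_def)
    have "(1 + K) * norm (w - z) \<le> (1 + K) * (1 / (2 * (N + 1) * (1 + K)))"
      using w K by (intro mult_left_mono) (auto simp: d_def)
    also have "\<dots> = 1 / (2 * (N + 1))" using K N0 by simp
    finally have "E * (N + 1) \<le> 1 / (2 * (N + 1)) * (N + 1)" using E N0 by (intro mult_right_mono) auto
    also have "\<dots> = 1 / 2" using N0 by simp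
    finally have "E * (N + 1) \<le> 1 / 2" .
    then have EN: "E * N \<le> 1 / 2" using E0 by (simp add: algebra_simps)
    have "norm (G w) \<le> norm (G z) + norm (G w o\<^sub>L ((F w - F z) o\<^sub>L G z))"
      by (subst step[OF wU]) (rule norm_triangle_ineq4)
    also have "norm (G w o\<^sub>L ((F w - F z) o\<^sub>L G z)) \<le> norm (G w) * (E * N)"
      unfolding E_def N_def
      by (intro order_trans[OF norm_blinfun_compose] mult_left_mono norm_blinfun_compose) simp
    also have "\<dots> \<le> norm (G w) * (1 / 2)" by (intro mult_left_mono EN) simp
    finally have Gw: "norm (G w) \<le> 2 * N" by (simp add: N_def)
    have "norm (R w) \<le> norm (G w) * (E * (N * (E * N)))"
      unfolding R_def L_def E_def N_def
      by (intro order_trans[OF norm_blinfun_compose] mult_left_mono norm_blinfun_compose norm_ge_zero)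
    also have "\<dots> \<le> (2 * N) * (E * (N * (E * N)))"
      using Gw E0 N0 by (intro mult_right_mono) auto
    also have "\<dots> = 2 * N ^ 3 * E\<^sup>2" by (simp add: power2_eq_square power3_eq_cube)
    also have "\<dots> \<le> 2 * N ^ 3 * ((1 + K) * norm (w - z))\<^sup>2"
      using E E0 N0 by (intro mult_left_mono power_mono) auto
    finally show ?thesis by (simp add: power_mult_distrib mult.assoc)
  qed
  have R': "(R has_derivative (\<lambda>_. 0)) (at z)"
    by (rule quadratic_bound_has_derivative_0[OF d _ Rb]) (use N0 in simp_all)
  have "((\<lambda>w. G z - L (F w - F z)) has_derivative (\<lambda>h. 0 - L (D h - 0))) (at z)"
    by (intro has_derivative_diff has_derivative_const bounded_linear.has_derivative[OF blL] D(1))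
  from has_derivative_add[OF this R']
  have "((\<lambda>w. (G z - L (F w - F z)) + R w) has_derivative (\<lambda>h. - L (D h))) (at z)" by simp
  then have "(G has_derivative (\<lambda>h. - L (D h))) (at z)"
    by (rule has_derivative_transform_within_open[OF _ U z]) (simp flip: eq)
  moreover have "- L (D (c *s h)) = c *\<^sub>C (- L (D h))" for c h
    by (rule blinfun_eqI)
      (simp add: D(2) L_def scaleC_blinfun.rep_eq ops_scaleC[OF GM[OF z]] blinfun.minus_left scaleC_minus_right)
  ultimately show "\<exists>D. (G has_derivative D) (at z) \<and> (\<forall>c h. D (c *s h) = c *\<^sub>C D h)" by blast
qed

section \<open>Contractions\<close>

text \<open>If a contraction preserves the norm of \<open>y\<close>, its adjoint sends
  \<open>T y\<close> back to \<open>y\<close>, by the equality case of Cauchy-Schwarz.\<close>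

lemma contraction_isometric_vector:
  fixes T :: "'h::complex_hilbert \<Rightarrow>\<^sub>L 'h"
  assumes T: "T \<in> ops UNIV" "norm T \<le> 1" and y: "norm (T y) = norm y"
  shows "cinner (T x) (T y) = cinner x y"
proof -
  have Tn: "norm (T w) \<le> norm w" for w
    using norm_blinfun[of T w] mult_right_mono[OF T(2) norm_ge_zero[of w]] by simp
  define a where "a = op_adjoint T (T y)"
  have adj: "cinner w a = cinner (T w) (T y)" for w
    unfolding a_def by (rule cinner_op_adjoint[OF T(1)])
  have "(norm a)\<^sup>2 = Re (cinner (T a) (T y))" by (simp add: cinner_self flip: adj)
  also have "\<dots> \<le> norm (T a) * norm (T y)" using cmod_cinner_le complex_Re_le_cmod order_trans by blast
  also have "\<dots> \<le> norm a * norm y" unfolding y by (intro mult_right_mono Tn) simp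
  finally have "norm a * norm a \<le> norm a * norm y" by (simp add: power2_eq_square)
  then have na: "norm a \<le> norm y" by (cases "a = 0") auto
  have "Re (cinner y a) = (norm y)\<^sup>2" by (simp add: adj cinner_self y)
  then have "(norm (y - a))\<^sup>2 = (norm a)\<^sup>2 - (norm y)\<^sup>2" by (simp add: norm_diff_sq_cinner)
  also have "\<dots> \<le> 0" using na by (simp add: power_mono)
  finally have "y = a" by simp
  then show ?thesis using adj[of x] by simp
qed

lemma hilbert_subspace_fixed_points:
  fixes T :: "'h::complex_hilbert \<Rightarrow>\<^sub>L 'h"
  assumes "T \<in> ops UNIV"
  shows "hilbert_subspace {x. T x = x}"
proof -
  have "closed {x. T x = x}" by (intro closed_Collect_eq continuous_intros)
  then show ?thesis
    unfolding hilbert_subspace_def subspace_def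
    by (auto simp: blinfun.add_right blinfun.scaleR_right ops_scaleC[OF assms])
qed

text \<open>A vector orthogonal to the kernel of \<open>A\<close> lies in the closure of the range
  of the adjoint \<open>W\<close>. Against \<open>W w\<close> the inner product is
  \<open>cinner (A (y i)) w\<close>, which tends to 0, and boundedness of the \<open>y i\<close>
  carries this over to the closure.\<close>

lemma weak_convergence_orth_kernel:
  fixes A :: "'h::complex_hilbert \<Rightarrow>\<^sub>L 'h"
  assumes A: "A \<in> ops UNIV" and \<beta>: "\<And>n. A n = 0 \<Longrightarrow> cinner \<beta> n = 0"
    and bd: "\<And>i. norm (y i) \<le> R" and lim: "(\<lambda>i. A (y i)) \<longlonglongrightarrow> 0"
  shows "(\<lambda>i. cinner (y i) \<beta>) \<longlonglongrightarrow> 0"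
proof -
  define W where "W = op_adjoint A"
  have adj: "cinner x (W w) = cinner (A x) w" for x w unfolding W_def by (rule cinner_op_adjoint[OF A])
  have Wsc: "W (c *\<^sub>C x) = c *\<^sub>C W x" for c x
  proof (rule cinner_ext)
    fix w
    have "cinner w (W (c *\<^sub>C x)) = cinner w (c *\<^sub>C W x)"
      by (simp add: adj cinner_scaleC_right)
    then show "Re (cinner (W (c *\<^sub>C x)) w) = Re (cinner (c *\<^sub>C W x) w)"
      by (subst (1 2) Re_cinner_commute) simp
  qed
  define S where "S = closure (range W)"
  have S: "hilbert_subspace S"
    unfolding S_def
  proof (rule hilbert_subspace_closure)
    show "0 \<in> range W" by (rule image_eqI[of _ _ 0]) (simp_all add: blinfun.zero_right)
    show "x + w \<in> range W" if "x \<in> range W" "w \<in> range W" for x w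
      using that by (auto simp flip: blinfun.add_right)
    show "c *\<^sub>C x \<in> range W" if "x \<in> range W" for c x
      using that by (auto simp flip: Wsc)
  qed
  have rS: "W w \<in> S" for w unfolding S_def by (rule subsetD[OF closure_subset rangeI])
  define \<delta> where "\<delta> = \<beta> - op_one S \<beta>"
  have "cinner \<delta> (W w) = 0" for w unfolding \<delta>_def by (rule op_one_orth[OF S rS])
  then have "cinner (A \<delta>) (A \<delta>) = 0" by (simp add: adj)
  then have "A \<delta> = 0" by (simp add: cinner_self)
  then have 1: "cinner \<beta> \<delta> = 0" by (rule \<beta>)
  have "cinner \<delta> (op_one S \<beta>) = 0" unfolding \<delta>_def by (rule op_one_orth[OF S op_one_in[OF S]])
  then have "cinner \<delta> \<beta> - cinner \<delta> (op_one S \<beta>) = 0" using 1 cinner_commute[of \<delta> \<beta>] by simp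
  then have "cinner \<delta> \<delta> = 0" by (simp add: \<delta>_def cinner_diff_right)
  then have "\<delta> = 0" by (simp add: cinner_self)
  then have \<beta>S: "\<beta> \<in> closure (range W)" using op_one_in[OF S, of \<beta>] by (simp add: \<delta>_def S_def)
  have R0: "0 \<le> R" using bd[of 0] norm_ge_zero order_trans by blast
  show ?thesis
  proof (rule LIMSEQ_I)
    fix e :: real assume e: "e > 0"
    have "e / (2 * (R + 1)) > 0" using e R0 by simp
    then obtain w where w: "norm (W w - \<beta>) < e / (2 * (R + 1))"
      using \<beta>S unfolding closure_approachable dist_norm by blast
    have "(\<lambda>i. cinner (A (y i)) w) \<longlonglongrightarrow> cinner 0 w" by (intro tendsto_intros lim)
    then have "\<forall>\<^sub>F i in sequentially. cmod (cinner (A (y i)) w) < e / 2"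
      using tendstoD[of _ _ _ "e / 2"] e by fastforce
    then obtain N where N: "\<And>i. i \<ge> N \<Longrightarrow> cmod (cinner (A (y i)) w) < e / 2"
      unfolding eventually_sequentially by blast
    have "norm (cinner (y i) \<beta> - 0) < e" if "i \<ge> N" for i
    proof -
      have "cinner (y i) \<beta> = cinner (A (y i)) w - cinner (y i) (W w - \<beta>)"
        by (simp add: cinner_diff_right adj)
      then have "cmod (cinner (y i) \<beta>) \<le> cmod (cinner (A (y i)) w) + cmod (cinner (y i) (W w - \<beta>))"
        by (simp add: norm_triangle_ineq4)
      also have "cmod (cinner (y i) (W w - \<beta>)) \<le> R * (e / (2 * (R + 1)))"
        using w by (intro order_trans[OF cmod_cinner_le] mult_mono bd R0) auto
      also have "\<dots> \<le> e / 2" using e R0 by (simp add: divide_simps)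
      finally show ?thesis using N[OF that] by simp
    qed
    then show "\<exists>N. \<forall>i\<ge>N. norm (cinner (y i) \<beta> - 0) < e" by blast
  qed
qed

text \<open>Weak compactness in elementary form: the sets where \<open>A x\<close> is within
  \<open>1/(m+1)\<close> of \<open>g\<close> are nested, closed and convex, and each contains some
  \<open>y i\<close>, hence meets the ball of radius \<open>R\<close>.\<close>

lemma approximate_solution_imp_solution:
  fixes A :: "'h::complex_hilbert \<Rightarrow>\<^sub>L 'h"
  assumes bd: "\<And>i. norm (y i) \<le> R" and lim: "(\<lambda>i. A (y i)) \<longlonglongrightarrow> g"
  shows "\<exists>x. A x = g"
proof -
  define C where "C m = {x. norm (A x - g) \<le> inverse (real (Suc m))}" for m
  have "\<exists>x. \<forall>m. x \<in> C m"
  proof (rule nested_closed_convex_nonempty)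
    show "closed (C m)" for m
      unfolding C_def by (intro closed_Collect_le continuous_intros)
    show "convex (C m)" for m
    proof (rule convexI)
      fix a b :: 'h and u v :: real
      assume ab: "a \<in> C m" "b \<in> C m" and uv: "0 \<le> u" "0 \<le> v" "u + v = 1"
      have "g = u *\<^sub>R g + v *\<^sub>R g" using scaleR_left.add[of u v g] uv(3) by simp
      then have "A (u *\<^sub>R a + v *\<^sub>R b) - g = A (u *\<^sub>R a + v *\<^sub>R b) - (u *\<^sub>R g + v *\<^sub>R g)"
        by (rule arg_cong)
      also have "\<dots> = u *\<^sub>R (A a - g) + v *\<^sub>R (A b - g)"
        by (simp add: blinfun.add_right blinfun.scaleR_right scaleR_diff_right)
      also have "norm \<dots> \<le> u * norm (A a - g) + v * norm (A b - g)"
        using uv by (intro order_trans[OF norm_triangle_ineq]) simp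
      also have "\<dots> \<le> u * inverse (real (Suc m)) + v * inverse (real (Suc m))"
        using ab uv unfolding C_def by (intro add_mono mult_left_mono) auto
      also have "\<dots> = inverse (real (Suc m))" using uv(3) by (simp flip: distrib_right)
      finally show "u *\<^sub>R a + v *\<^sub>R b \<in> C m" by (simp add: C_def)
    qed
    show "C (Suc m) \<subseteq> C m" for m
    proof -
      have "inverse (real (Suc (Suc m))) \<le> inverse (real (Suc m))" by (rule le_imp_inverse_le) auto
      then show ?thesis unfolding C_def using order_trans by blast
    qed
    show "\<exists>x\<in>C m. norm x \<le> R" for m
    proof -
      have "\<forall>\<^sub>F i in sequentially. dist (A (y i)) g < inverse (real (Suc m))"
        by (rule tendstoD[OF lim]) simp
      then obtain i where "dist (A (y i)) g < inverse (real (Suc m))"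
        using eventually_happens'[OF sequentially_bot] by blast
      then show ?thesis using bd by (intro bexI[of _ "y i"]) (auto simp: C_def dist_norm)
    qed
  qed
  then obtain x where x: "\<And>m. x \<in> C m" by blast
  have "norm (A x - g) \<le> 0"
    by (rule LIMSEQ_le_const[OF LIMSEQ_inverse_real_of_nat]) (use x in \<open>auto simp: C_def\<close>)
  then show ?thesis by auto
qed

section \<open>Combinations of orthogonal projections\<close>

text \<open>Mutually orthogonal projections whose sum \<open>Pall\<close> may be smaller than the
  identity, which leaves room for the vector \<open>e0\<close> of a colligation.\<close>

locale projections =
  fixes P :: "'d::finite \<Rightarrow> 'h::complex_hilbert \<Rightarrow>\<^sub>L 'h"
  assumes P_ops: "P j \<in> ops UNIV"
    and P_P: "P j (P k x) = (if j = k then P j x else 0)"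
    and P_sym: "cinner (P j x) y = cinner x (P j y)"
begin

definition Pall :: "'h \<Rightarrow>\<^sub>L 'h" where "Pall = (\<Sum>j\<in>UNIV. P j)"

abbreviation \<Delta> :: "complex ^ 'd \<Rightarrow> 'h \<Rightarrow>\<^sub>L 'h" where "\<Delta> z \<equiv> op_combination z P"

lemma Pall_apply: "Pall x = (\<Sum>j\<in>UNIV. P j x)"
  by (simp add: Pall_def blinfun.sum_left)

lemma \<Delta>_apply: "\<Delta> z x = (\<Sum>j\<in>UNIV. z $ j *\<^sub>C P j x)"
  by (simp add: op_combination_def blinfun.sum_left scaleC_blinfun.rep_eq)

lemma P_scaleC: "P j (c *\<^sub>C x) = c *\<^sub>C P j x"
  by (rule ops_scaleC[OF P_ops])

lemma Pall_ops: "Pall \<in> ops UNIV"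
  unfolding Pall_def by (rule ops_sum[OF hilbert_subspace_UNIV P_ops])

lemma \<Delta>_ops: "\<Delta> z \<in> ops UNIV"
  unfolding op_combination_def
  by (intro ops_sum[OF hilbert_subspace_UNIV] ops_cscale[OF hilbert_subspace_UNIV] P_ops)

lemma P_\<Delta>: "P j (\<Delta> z x) = z $ j *\<^sub>C P j x"
  by (simp add: \<Delta>_apply blinfun.sum_right P_scaleC P_P if_distrib[of "\<lambda>x. _ *\<^sub>C x"] cong: if_cong)

lemma P_Pall: "P j (Pall x) = P j x"
  by (simp add: Pall_apply blinfun.sum_right P_P)

lemma Pall_\<Delta>: "Pall (\<Delta> z x) = \<Delta> z x"
  by (simp add: Pall_apply P_\<Delta>) (simp add: \<Delta>_apply)

lemma Pall_Pall: "Pall (Pall x) = Pall x"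
  by (simp add: Pall_apply[of "Pall x"] P_Pall) (simp add: Pall_apply)

lemma \<Delta>_\<Delta>: "\<Delta> z (\<Delta> w x) = \<Delta> (z * w) x"
  by (simp add: \<Delta>_apply[of z] \<Delta>_apply[of "z * w"] P_\<Delta> scaleC_scaleC)

lemma Pall_sym: "cinner (Pall x) y = cinner x (Pall y)"
  by (simp add: Pall_apply cinner_linear_simps P_sym)

lemma cinner_P_P: "cinner (P j x) (P k y) = (if j = k then cinner (P j x) y else 0)"
proof -
  have "cinner (P j x) (P k y) = cinner (P k (P j x)) y" by (simp add: P_sym[of k])
  then show ?thesis by (simp add: P_P)
qed

lemma cinner_\<Delta>: "cinner (\<Delta> z x) (\<Delta> w y) = (\<Sum>j\<in>UNIV. z $ j * cnj (w $ j) * cinner (P j x) (P j y))"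
  by (simp add: \<Delta>_apply cinner_linear_simps cinner_P_P if_distrib[of "\<lambda>x. _ * x"] mult_ac cong: if_cong)

lemma cinner_P_self: "cinner (P j x) x = of_real ((norm (P j x))\<^sup>2)"
  using cinner_P_P[of j x j x] cinner_self[of "P j x"] by simp

lemma cinner_\<Delta>_self: "cinner (\<Delta> z x) x = (\<Sum>j\<in>UNIV. z $ j * of_real ((norm (P j x))\<^sup>2))"
  by (simp add: \<Delta>_apply cinner_linear_simps cinner_P_self)

lemma norm_\<Delta>_sq: "(norm (\<Delta> z x))\<^sup>2 = (\<Sum>j\<in>UNIV. (cmod (z $ j))\<^sup>2 * (norm (P j x))\<^sup>2)"
proof -
  have "complex_of_real ((norm (\<Delta> z x))\<^sup>2) = of_real (\<Sum>j\<in>UNIV. (cmod (z $ j))\<^sup>2 * (norm (P j x))\<^sup>2)"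
    unfolding cinner_self[symmetric] cinner_\<Delta> of_real_sum of_real_mult
    by (simp only: complex_norm_square cinner_self)
  then show ?thesis by (simp only: of_real_eq_iff)
qed

lemma norm_Pall_sq: "(norm (Pall x))\<^sup>2 = (\<Sum>j\<in>UNIV. (norm (P j x))\<^sup>2)"
proof -
  have "Pall x = \<Delta> (\<chi> j. 1) x" by (simp add: Pall_apply \<Delta>_apply)
  then show ?thesis by (simp add: norm_\<Delta>_sq)
qed

lemma norm_Pall_le: "norm (Pall x) \<le> norm x"
proof (cases "Pall x = 0")
  case False
  have "(norm (Pall x))\<^sup>2 = Re (cinner (Pall x) x)"
    using Pall_sym[of "Pall x" x] unfolding Re_cinner_self[symmetric] Pall_Pall by simp
  also have "\<dots> \<le> norm (Pall x) * norm x" using cmod_cinner_le complex_Re_le_cmod order_trans by blast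
  finally show ?thesis using False by (simp add: power2_eq_square)
qed simp

lemma norm_\<Delta>_le:
  assumes "\<And>j. cmod (z $ j) \<le> b" "0 \<le> b"
  shows "norm (\<Delta> z x) \<le> b * norm x"
proof (rule power2_le_imp_le)
  have "(norm (\<Delta> z x))\<^sup>2 \<le> (\<Sum>j\<in>UNIV. b\<^sup>2 * (norm (P j x))\<^sup>2)"
    unfolding norm_\<Delta>_sq using assms by (intro sum_mono mult_right_mono power_mono) auto
  also have "\<dots> = b\<^sup>2 * (norm (Pall x))\<^sup>2" by (simp add: norm_Pall_sq sum_distrib_left)
  also have "\<dots> \<le> b\<^sup>2 * (norm x)\<^sup>2" by (intro mult_left_mono power_mono norm_Pall_le) auto
  finally show "(norm (\<Delta> z x))\<^sup>2 \<le> (b * norm x)\<^sup>2" by (simp add: power_mult_distrib)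
qed (use assms in simp)

lemma \<Delta>_diff: "\<Delta> (z - w) x = \<Delta> z x - \<Delta> w x"
  by (simp add: \<Delta>_apply scaleC_diff_left sum_subtractf)

end

section \<open>The maximum norm and carapoints\<close>

lemma cmod_le_maxnorm: "cmod (z $ j) \<le> maxnorm z"
  unfolding maxnorm_def by (rule Max_ge) auto

lemma maxnorm_le: "(\<And>j. cmod (z $ j) \<le> b) \<Longrightarrow> maxnorm z \<le> b"
  unfolding maxnorm_def by (subst Max_le_iff) auto

lemma maxnorm_nonneg: "0 \<le> maxnorm z"
  using cmod_le_maxnorm[of z undefined] norm_ge_zero order_trans by blast

lemma maxnorm_le_norm: "maxnorm z \<le> norm z"
  by (rule maxnorm_le) (rule Finite_Cartesian_Product.norm_nth_le)

lemma maxnorm_less_1: "z \<in> polydisc \<Longrightarrow> maxnorm z < 1"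
  unfolding maxnorm_def polydisc_def by (subst Max_less_iff) auto

lemma one_minus_maxnorm_le:
  assumes "\<tau> \<in> torus"
  shows "1 - maxnorm z \<le> norm (z - \<tau>)"
proof -
  have "1 - cmod (z $ undefined) \<le> cmod ((z - \<tau>) $ undefined)"
    using assms norm_triangle_ineq3[of "z $ undefined" "\<tau> $ undefined"] by (simp add: torus_def)
  then show ?thesis
    using cmod_le_maxnorm[of z undefined] Finite_Cartesian_Product.norm_nth_le[of "z - \<tau>" undefined] by linarith
qed

lemma open_polydisc: "open (polydisc :: (complex ^ 'd) set)"
proof -
  have "(polydisc :: (complex ^ 'd) set) = (\<Inter>j. {z. cmod (z $ j) < 1})" by (auto simp: polydisc_def)
  moreover have "open {z :: complex ^ 'd. cmod (z $ j) < 1}" for j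
    by (intro open_Collect_less continuous_intros)
  then have "open (\<Inter>j. {z :: complex ^ 'd. cmod (z $ j) < 1})" by (intro open_INT) auto
  ultimately show ?thesis by (simp only:)
qed

text \<open>A finite lower limit keeps the quotient below some \<open>C\<close> at points
  arbitrarily close to \<tau>. Nothing is known about the direction in which these points
  approach.\<close>

lemma carapoint_sequence:
  fixes \<phi> :: "complex ^ 'd \<Rightarrow> complex"
  assumes "carapoint \<tau> \<phi>"
  shows "\<exists>zs C. (\<forall>n. zs n \<in> polydisc) \<and> zs \<longlonglongrightarrow> \<tau> \<and>
    (\<forall>n::nat. 1 - cmod (\<phi> (zs n)) \<le> C * (1 - maxnorm (zs n)))"
proof -
  let ?F = "at \<tau> within polydisc" and ?q = "\<lambda>z. (1 - cmod (\<phi> z)) / (1 - maxnorm z)"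
  have less: "Liminf ?F (\<lambda>z. ereal (?q z)) < \<infinity>" using assms by (simp add: carapoint_def)
  then obtain C where C: "Liminf ?F (\<lambda>z. ereal (?q z)) < ereal C"
    using ereal_dense2[OF less] by blast
  have "\<exists>\<^sub>F z in ?F. ?q z < C"
    unfolding frequently_def
  proof
    assume "\<forall>\<^sub>F z in ?F. \<not> ?q z < C"
    then have "\<forall>\<^sub>F z in ?F. ereal C \<le> ereal (?q z)" by (rule eventually_mono) simp
    then have "ereal C \<le> Liminf ?F (\<lambda>z. ereal (?q z))" by (rule Liminf_bounded)
    with C show False by simp
  qed
  then have "\<exists>z\<in>polydisc. dist z \<tau> < d \<and> ?q z < C" if "d > 0" for d
    using that unfolding frequently_def eventually_at by blast
  then have "\<forall>n. \<exists>z. z \<in> polydisc \<and> dist z \<tau> < inverse (real (Suc n)) \<and> ?q z < C"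
    using positive_imp_inverse_positive of_nat_0_less_iff by (metis zero_less_Suc)
  then obtain zs where zs: "\<And>n. zs n \<in> polydisc" "\<And>n. dist (zs n) \<tau> < inverse (real (Suc n))" "\<And>n. ?q (zs n) < C"
    by metis
  have "zs \<longlonglongrightarrow> \<tau>"
  proof (rule metric_LIMSEQ_I)
    fix e :: real assume "e > 0"
    have "\<forall>\<^sub>F n in sequentially. inverse (real (Suc n)) < e"
      using order_tendstoD(2)[OF LIMSEQ_inverse_real_of_nat \<open>e > 0\<close>] .
    then show "\<exists>N. \<forall>n\<ge>N. dist (zs n) \<tau> < e"
      unfolding eventually_sequentially using zs(2) less_trans by blast
  qed
  moreover have "1 - cmod (\<phi> (zs n)) \<le> C * (1 - maxnorm (zs n))" for n
    using zs(3)[of n] maxnorm_less_1[OF zs(1)[of n]] by (simp add: divide_simps split: if_splits)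
  ultimately show ?thesis using zs(1) by blast
qed

lemma Re_one_div:
  assumes "w \<noteq> 1"
  shows "Re (1 / (1 - w)) = Re (1 - w) / (cmod (1 - w))\<^sup>2"
  by (simp add: Re_divide cmod_power2)

text \<open>The map \<open>w \<mapsto> 1 / (1 - w)\<close> carries the disc to the half-plane
  \<open>Re > 1/2\<close> and the circle without 1 to its boundary line. Contractivity of
  \<open>I\<close> inside and isometry on the torus both rest on this identity.\<close>

lemma two_Re_one_div:
  assumes "w \<noteq> 1"
  shows "2 * Re (1 / (1 - w)) - 1 = (1 - (cmod w)\<^sup>2) / (cmod (1 - w))\<^sup>2"
proof -
  have n: "(cmod (1 - w))\<^sup>2 \<noteq> 0" using assms by simp
  have "(cmod (1 - w))\<^sup>2 = 1 - 2 * Re w + (cmod w)\<^sup>2"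
    unfolding cmod_power2 by (simp add: power2_eq_square algebra_simps)
  then have "2 * Re (1 - w) - (cmod (1 - w))\<^sup>2 = 1 - (cmod w)\<^sup>2" by simp
  then show ?thesis unfolding Re_one_div[OF assms] using n by (simp add: divide_simps)
qed

lemma not_LIMSEQ_0_subsequence:
  fixes a :: "nat \<Rightarrow> 'a::real_normed_vector"
  assumes "\<not> a \<longlonglongrightarrow> 0"
  shows "\<exists>e>0. \<exists>r. strict_mono r \<and> (\<forall>n::nat. e \<le> norm (a (r n)))"
proof -
  obtain e where e: "e > 0" "\<And>N. \<exists>n\<ge>N. e \<le> norm (a n)"
    using assms unfolding LIMSEQ_iff by (force simp: not_less)
  then have "infinite {n. e \<le> norm (a n)}" unfolding infinite_nat_iff_unbounded_le by blast
  from infinite_enumerate[OF this] show ?thesis using e(1) by blast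
qed

section \<open>Desingularization of a colligation\<close>

text \<open>The assumption \<open>nontrivial\<close> excludes \<open>M = {0}\<close>, for which the extension of \<open>I\<close> to the torus
  would have norm \<open>0\<close> instead of \<open>1\<close>.\<close>

locale colligation = projections P
  for P :: "'d::finite \<Rightarrow> 'h::complex_hilbert \<Rightarrow>\<^sub>L 'h" +
  fixes e0 :: 'h and V :: "'h \<Rightarrow>\<^sub>L 'h" and u :: "complex ^ 'd \<Rightarrow> 'h"
    and \<phi> :: "complex ^ 'd \<Rightarrow> complex" and \<tau> :: "complex ^ 'd"
  assumes e0: "norm e0 = 1" and P_e0: "P j e0 = 0"
    and V_ops: "V \<in> ops UNIV" and V_norm: "norm V \<le> 1"
    and V_range: "V x = cinner (V x) e0 *\<^sub>C e0 + Pall (V x)"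
    and Pall_u: "z \<in> polydisc \<Longrightarrow> Pall (u z) = u z"
    and V_u: "z \<in> polydisc \<Longrightarrow> V (e0 + \<Delta> z (u z)) = \<phi> z *\<^sub>C e0 + u z"
    and V_iso: "z \<in> polydisc \<Longrightarrow> w \<in> polydisc \<Longrightarrow>
      1 + cinner (\<Delta> z (u z)) (\<Delta> w (u w)) = \<phi> z * cnj (\<phi> w) + cinner (u z) (u w)"
    and u_analytic: "analytic_fun_on u polydisc"
    and \<tau>: "\<tau> \<in> torus" and cara: "carapoint \<tau> \<phi>"
    and nontrivial: "\<exists>x. Pall x = x \<and> x \<noteq> 0 \<and> V (\<Delta> \<tau> x) = 0"
begin

definition T :: "'h \<Rightarrow>\<^sub>L 'h" where "T = Pall o\<^sub>L (V o\<^sub>L \<Delta> \<tau>)"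
text \<open>Rotation of the coordinates that moves \<tau> to 1: on the range of \<open>Pall\<close>,
  \<open>D z\<close> tends to the identity as \<open>z\<close> tends to \<tau>, while
  \<open>T\<close> absorbs the factor \<open>\<Delta> \<tau>\<close>.\<close>

definition tw :: "complex ^ 'd \<Rightarrow> complex ^ 'd" where "tw z = (\<chi> j. cnj (\<tau> $ j) * z $ j)"
abbreviation D :: "complex ^ 'd \<Rightarrow> 'h \<Rightarrow>\<^sub>L 'h" where "D z \<equiv> \<Delta> (tw z)"
definition \<gamma> :: 'h where "\<gamma> = Pall (V e0)"
definition N :: "'h set" where "N = {x. T x = x}"
definition M :: "'h set" where "M = {x. Pall x = x \<and> (\<forall>n\<in>N. cinner x n = 0)}"
definition Y :: "'d \<Rightarrow> 'h \<Rightarrow>\<^sub>L 'h" where "Y j = op_one M o\<^sub>L (P j o\<^sub>L op_one M)"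
definition zet :: "complex ^ 'd \<Rightarrow> complex ^ 'd" where "zet z = (\<chi> j. 1 / (1 - cnj (\<tau> $ j) * z $ j))"
text \<open>Meaningful when all coordinates of \<zeta> have positive real part, since the
  combination is then coercive on \<open>M\<close>.\<close>

definition B :: "complex ^ 'd \<Rightarrow> 'h \<Rightarrow>\<^sub>L 'h" where "B \<zeta> = op_inverse M (op_combination \<zeta> Y)"
definition I :: "complex ^ 'd \<Rightarrow> 'h \<Rightarrow>\<^sub>L 'h" where "I z = op_one M - B (zet z)"
definition um :: "complex ^ 'd \<Rightarrow> 'h" where "um z = op_one M (u z)"
text \<open>Unlike \<open>u z\<close>, this vector lies in \<open>M\<close>, so the compressed
  combination can be evaluated on it exactly.\<close>

definition v :: "complex ^ 'd \<Rightarrow> 'h" where "v z = u z - D z (u z)"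

section \<open>The contraction \<open>T\<close> and the bound for \<open>u\<close>\<close>

lemma \<tau>_cmod: "cmod (\<tau> $ j) = 1"
  using \<tau> by (simp add: torus_def)

lemma \<tau>_cnj: "\<tau> $ j * cnj (\<tau> $ j) = 1"
  unfolding complex_norm_square[symmetric] \<tau>_cmod by simp

lemma Pall_e0: "Pall e0 = 0"
  by (simp add: Pall_apply P_e0)

lemma cinner_Pall_e0: "cinner (Pall x) e0 = 0"
  by (simp add: Pall_sym Pall_e0)

lemma T_apply: "T x = Pall (V (\<Delta> \<tau> x))"
  by (simp add: T_def)

lemma T_ops: "T \<in> ops UNIV"
  unfolding T_def by (intro ops_compose Pall_ops V_ops \<Delta>_ops)

lemma norm_V_le: "norm (V x) \<le> norm x"
  using norm_blinfun[of V x] mult_right_mono[OF V_norm norm_ge_zero[of x]] by simp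

lemma norm_\<Delta>_\<tau>_le: "norm (\<Delta> \<tau> x) \<le> norm x"
  using norm_\<Delta>_le[of \<tau> 1 x] \<tau>_cmod by simp

lemma norm_T_apply_le: "norm (T x) \<le> norm x"
  unfolding T_apply by (rule order_trans[OF norm_Pall_le order_trans[OF norm_V_le norm_\<Delta>_\<tau>_le]])

lemma norm_T_le: "norm T \<le> 1"
  by (rule norm_blinfun_bound) (simp_all add: norm_T_apply_le)

lemma \<tau>_tw: "\<tau> * tw z = z"
  by (simp add: vec_eq_iff tw_def \<tau>_cnj mult.assoc[symmetric])

lemma T_D: "T (D z x) = Pall (V (\<Delta> z x))"
  by (simp add: T_apply \<Delta>_\<Delta> \<tau>_tw)

lemma Pall_T: "Pall (T x) = T x"
  by (simp add: T_apply Pall_Pall)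

lemma u_eq:
  assumes "z \<in> polydisc"
  shows "u z = \<gamma> + T (D z (u z))"
proof -
  have "Pall (V (e0 + \<Delta> z (u z))) = u z"
    unfolding V_u[OF assms]
    by (simp add: blinfun.add_right ops_scaleC[OF Pall_ops] Pall_e0 Pall_u[OF assms])
  then show ?thesis by (simp add: T_D \<gamma>_def blinfun.add_right)
qed

lemma \<phi>_eq:
  assumes "z \<in> polydisc"
  shows "\<phi> z = cinner (V (e0 + \<Delta> z (u z))) e0"
  unfolding V_u[OF assms] using cinner_Pall_e0[of "u z"]
  by (simp add: cinner_linear_simps Pall_u[OF assms] cinner_self e0)

lemma Pall_\<Delta>_1: "Pall x = x \<Longrightarrow> \<Delta> 1 x = x"
  by (simp add: \<Delta>_apply flip: Pall_apply)

lemma norm_D_diff: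
  assumes "Pall x = x"
  shows "norm (D z x - x) \<le> maxnorm (z - \<tau>) * norm x"
proof -
  have "D z x - x = \<Delta> (tw z - 1) x" by (simp add: \<Delta>_diff Pall_\<Delta>_1[OF assms])
  moreover have "cmod ((tw z - 1) $ j) \<le> maxnorm (z - \<tau>)" for j
  proof -
    have "(tw z - 1) $ j = cnj (\<tau> $ j) * (z - \<tau>) $ j"
      using \<tau>_cnj[of j] by (simp add: tw_def algebra_simps)
    then have "cmod ((tw z - 1) $ j) = cmod ((z - \<tau>) $ j)" by (simp add: norm_mult \<tau>_cmod)
    then show ?thesis using cmod_le_maxnorm[of "z - \<tau>" j] by simp
  qed
  ultimately show ?thesis using norm_\<Delta>_le[OF _ maxnorm_nonneg, of "tw z - 1" "z - \<tau>" x] by simp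
qed

lemma defect_\<phi>:
  assumes z: "z \<in> polydisc"
  shows "1 - (cmod (\<phi> z))\<^sup>2 = (norm (u z))\<^sup>2 - (norm (\<Delta> z (u z)))\<^sup>2"
proof -
  have "Re (1 + cinner (\<Delta> z (u z)) (\<Delta> z (u z))) = Re (\<phi> z * cnj (\<phi> z) + cinner (u z) (u z))"
    unfolding V_iso[OF z z] ..
  then show ?thesis by (simp add: Re_cinner_self flip: complex_norm_square)
qed

text \<open>Solved for \<open>norm (u z)\<close>, this turns the carapoint quotient of \<phi> into a
  bound for \<open>u\<close>.\<close>

lemma defect_ge:
  assumes z: "z \<in> polydisc"
  shows "(1 - maxnorm z) * (norm (u z))\<^sup>2 \<le> 1 - (cmod (\<phi> z))\<^sup>2"
proof -
  have m: "0 \<le> maxnorm z" "maxnorm z \<le> 1" using maxnorm_nonneg maxnorm_less_1[OF z] by auto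
  have "(norm (\<Delta> z (u z)))\<^sup>2 \<le> (maxnorm z * norm (u z))\<^sup>2"
    by (intro power_mono norm_\<Delta>_le cmod_le_maxnorm m) simp
  also have "\<dots> = (maxnorm z)\<^sup>2 * (norm (u z))\<^sup>2" by (simp add: power_mult_distrib)
  also have "\<dots> \<le> maxnorm z * (norm (u z))\<^sup>2"
    using m by (intro mult_right_mono) (auto simp: power2_eq_square mult_left_le)
  finally show ?thesis unfolding defect_\<phi>[OF z] by (simp add: algebra_simps)
qed

lemma cmod_\<phi>_le:
  assumes z: "z \<in> polydisc"
  shows "cmod (\<phi> z) \<le> 1"
proof -
  have "0 \<le> (1 - maxnorm z) * (norm (u z))\<^sup>2" using maxnorm_less_1[OF z] by simp
  then have "(cmod (\<phi> z))\<^sup>2 \<le> 1\<^sup>2" using defect_ge[OF z] by simp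
  then show ?thesis by (rule power2_le_imp_le) simp
qed

section \<open>The fixed space of \<open>T\<close> and its complement\<close>

lemma N_subspace: "hilbert_subspace N"
  unfolding N_def by (rule hilbert_subspace_fixed_points[OF T_ops])

lemma M_subspace: "hilbert_subspace M"
proof -
  have "closed {x. Pall x = x}" by (intro closed_Collect_eq continuous_intros)
  moreover have "closed (\<Inter>n\<in>N. {x. cinner x n = 0})"
    by (intro closed_INT ballI closed_Collect_eq continuous_intros
        bounded_bilinear.continuous_on[OF bounded_bilinear_cinner])
  moreover have "M = {x. Pall x = x} \<inter> (\<Inter>n\<in>N. {x. cinner x n = 0})" by (auto simp: M_def)
  ultimately have "closed M" by (simp add: closed_Int)
  then show ?thesis
    unfolding hilbert_subspace_def subspace_def
    by (auto simp: M_def blinfun.add_right blinfun.scaleR_right ops_scaleC[OF Pall_ops]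
        cinner_linear_simps scaleR_scaleC[of _ "_ :: 'h"])
qed

lemmas M_closed_under = hilbert_subspaceD(3-7)[OF M_subspace]

lemma M_Pall: "x \<in> M \<Longrightarrow> Pall x = x" and M_N: "x \<in> M \<Longrightarrow> n \<in> N \<Longrightarrow> cinner x n = 0"
  by (auto simp: M_def)

lemma N_Pall: "n \<in> N \<Longrightarrow> Pall n = n"
  using Pall_T[of n] by (simp add: N_def)

text \<open>Fixed vectors of a contraction are fixed by its adjoint, so \<open>N\<close> reduces
  \<open>T\<close>.\<close>

lemma cinner_T_N:
  assumes "n \<in> N"
  shows "cinner (T x) n = cinner x n"
proof -
  have n: "T n = n" using assms by (simp add: N_def)
  then have "cinner (T x) (T n) = cinner x n"
    by (intro contraction_isometric_vector[OF T_ops norm_T_le]) simp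
  then show ?thesis by (simp add: n)
qed

lemma op_one_M_eq:
  assumes "Pall x = x"
  shows "op_one M x = x - op_one N x"
proof -
  have nN: "op_one N x \<in> N" by (rule op_one_in[OF N_subspace])
  have "x - op_one N x \<in> M"
    using op_one_orth[OF N_subspace, of _ x] by (simp add: M_def blinfun.diff_right assms N_Pall[OF nN])
  then have "op_one M (x - op_one N x) = x - op_one N x" by (rule op_one_id[OF M_subspace])
  moreover have "op_one M (op_one N x) = 0"
  proof -
    have "cinner (op_one N x) y = 0" if "y \<in> M" for y
      using M_N[OF that nN] by (metis cinner_commute complex_cnj_zero)
    then show ?thesis using op_one_in_ops[OF M_subspace] by (auto simp: ops_def)
  qed
  ultimately show ?thesis by (simp add: blinfun.diff_right)
qed

text \<open>On the carapoint sequence \<open>defect_ge\<close> gives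
  \<open>norm (u z) \<le> sqrt (2 * \<bar>C\<bar>)\<close>, because 1 - x^2 is at most 2 (1 - x) for
  x in [0, 1]. As \<open>D z\<close> tends to the identity, bounded \<open>u\<close> makes
  \<open>D u - u\<close> tend to 0.\<close>

lemma approach_sequence:
  "\<exists>zs R. (\<forall>n::nat. zs n \<in> polydisc \<and> norm (u (zs n)) \<le> R) \<and>
    (\<lambda>n. D (zs n) (u (zs n)) - u (zs n)) \<longlonglongrightarrow> 0 \<and> (\<lambda>n. cmod (\<phi> (zs n))) \<longlonglongrightarrow> 1"
proof -
  obtain zs C where zs: "\<And>n::nat. zs n \<in> polydisc" "zs \<longlonglongrightarrow> \<tau>"
    "\<And>n. 1 - cmod (\<phi> (zs n)) \<le> C * (1 - maxnorm (zs n))"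
    using carapoint_sequence[OF cara] by blast
  have ub: "norm (u (zs n)) \<le> sqrt (2 * \<bar>C\<bar>)" for n
  proof -
    define s where "s = 1 - maxnorm (zs n)"
    have s: "s > 0" using maxnorm_less_1[OF zs(1)] by (simp add: s_def)
    have c1: "cmod (\<phi> (zs n)) \<le> 1" by (rule cmod_\<phi>_le[OF zs(1)])
    have "s * (norm (u (zs n)))\<^sup>2 \<le> 1 - (cmod (\<phi> (zs n)))\<^sup>2"
      using defect_ge[OF zs(1)] by (simp add: s_def)
    also have "\<dots> = (1 + cmod (\<phi> (zs n))) * (1 - cmod (\<phi> (zs n)))"
      by (simp add: power2_eq_square algebra_simps)
    also have "\<dots> \<le> 2 * (1 - cmod (\<phi> (zs n)))" using c1 by (intro mult_right_mono) auto
    also have "\<dots> \<le> 2 * (C * s)" using zs(3)[of n] by (simp add: s_def)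
    also have "\<dots> \<le> 2 * (\<bar>C\<bar> * s)" using s by (intro mult_left_mono mult_right_mono) auto
    finally have "s * (norm (u (zs n)))\<^sup>2 \<le> s * (2 * \<bar>C\<bar>)" by (simp add: mult_ac)
    then have "(norm (u (zs n)))\<^sup>2 \<le> 2 * \<bar>C\<bar>" using s by simp
    then show ?thesis by (rule real_le_rsqrt)
  qed
  have lim: "(\<lambda>n. norm (zs n - \<tau>) * c) \<longlonglongrightarrow> 0" for c
  proof -
    have "(\<lambda>n. norm (zs n - \<tau>) * c) \<longlonglongrightarrow> norm (\<tau> - \<tau>) * c" by (intro tendsto_intros zs)
    then show ?thesis by simp
  qed
  have "(\<lambda>n. D (zs n) (u (zs n)) - u (zs n)) \<longlonglongrightarrow> 0"
  proof (rule Lim_null_comparison[OF _ lim], rule always_eventually, rule allI)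
    fix n
    have "norm (D (zs n) (u (zs n)) - u (zs n)) \<le> maxnorm (zs n - \<tau>) * norm (u (zs n))"
      by (rule norm_D_diff[OF Pall_u[OF zs(1)]])
    also have "\<dots> \<le> norm (zs n - \<tau>) * sqrt (2 * \<bar>C\<bar>)" by (intro mult_mono maxnorm_le_norm ub) auto
    finally show "norm (D (zs n) (u (zs n)) - u (zs n)) \<le> norm (zs n - \<tau>) * sqrt (2 * \<bar>C\<bar>)" .
  qed
  moreover have "(\<lambda>n. cmod (\<phi> (zs n)) - 1) \<longlonglongrightarrow> 0"
  proof (rule Lim_null_comparison[OF _ lim], rule always_eventually, rule allI)
    fix n
    have "norm (cmod (\<phi> (zs n)) - 1) \<le> C * (1 - maxnorm (zs n))"
      using zs(3)[of n] cmod_\<phi>_le[OF zs(1)[of n]] by simp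
    also have "\<dots> \<le> \<bar>C\<bar> * (1 - maxnorm (zs n))"
      using maxnorm_less_1[OF zs(1)[of n]] by (intro mult_right_mono) auto
    also have "\<dots> \<le> \<bar>C\<bar> * norm (zs n - \<tau>)" by (intro mult_left_mono one_minus_maxnorm_le \<tau>) simp
    finally show "norm (cmod (\<phi> (zs n)) - 1) \<le> norm (zs n - \<tau>) * \<bar>C\<bar>" by (simp add: mult.commute)
  qed
  then have "(\<lambda>n. cmod (\<phi> (zs n))) \<longlonglongrightarrow> 1" by (simp add: LIM_zero_iff)
  ultimately show ?thesis using zs(1) ub by blast
qed

text \<open>The bounded vectors \<open>u (zs n)\<close> solve \<open>(1 - T) x = \<gamma>\<close> up
  to the error \<open>T (D u - u)\<close>, which tends to 0. Removing the component in
  \<open>N\<close> from a solution does not change \<open>(1 - T) x\<close>.\<close>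

lemma solution_exists: "\<exists>x\<in>M. x - T x = \<gamma>"
proof -
  obtain zs R where zs: "\<And>n::nat. zs n \<in> polydisc" and ub: "\<And>n. norm (u (zs n)) \<le> R"
    and lim: "(\<lambda>n. D (zs n) (u (zs n)) - u (zs n)) \<longlonglongrightarrow> 0"
    using approach_sequence by blast
  have "(\<lambda>n. \<gamma> + T (D (zs n) (u (zs n)) - u (zs n))) \<longlonglongrightarrow> \<gamma> + T 0"
    by (intro tendsto_intros lim)
  moreover have "\<gamma> + T (D (zs n) (u (zs n)) - u (zs n)) = (id_blinfun - T) (u (zs n))" for n
    using u_eq[OF zs[of n]] by (simp add: blinfun.diff_left blinfun.diff_right algebra_simps)
  ultimately have "(\<lambda>n. (id_blinfun - T) (u (zs n))) \<longlonglongrightarrow> \<gamma>" by simp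
  from approximate_solution_imp_solution[OF ub this] obtain x where x: "x - T x = \<gamma>"
    by (auto simp: blinfun.diff_left)
  have "x = \<gamma> + T x" using x by (metis diff_add_cancel)
  then have Px: "Pall x = x" by (metis Pall_Pall Pall_T \<gamma>_def blinfun.add_right)
  have "T (op_one N x) = op_one N x" using op_one_in[OF N_subspace, of x] by (simp add: N_def)
  then have "op_one M x - T (op_one M x) = \<gamma>"
    unfolding op_one_M_eq[OF Px] using x by (simp add: blinfun.diff_right)
  then show ?thesis using op_one_in[OF M_subspace] by blast
qed

definition x0 :: 'h where "x0 = (SOME x. x \<in> M \<and> x - T x = \<gamma>)"

lemma x0: "x0 \<in> M" "x0 - T x0 = \<gamma>"
  using someI_ex[of "\<lambda>x. x \<in> M \<and> x - T x = \<gamma>"] solution_exists unfolding x0_def by blast+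

lemma \<gamma>_orth:
  assumes "n \<in> N"
  shows "cinner \<gamma> n = 0"
  by (simp add: x0(2)[symmetric] cinner_diff_left cinner_T_N[OF assms])

text \<open>Since the adjoint of \<open>T\<close> fixes \<open>n\<close>, the inner product of
  \<open>v z\<close> with \<open>n\<close> is that of \<open>u z - T (D z (u z))\<close>, which is
  \<gamma>; and \<gamma>, being in the range of \<open>1 - T\<close>, is orthogonal to
  \<open>N\<close>.\<close>

lemma v_in_M:
  assumes z: "z \<in> polydisc"
  shows "v z \<in> M"
proof -
  have "Pall (v z) = v z" by (simp add: v_def blinfun.diff_right Pall_u[OF z] Pall_\<Delta>)
  moreover have "cinner (v z) n = 0" if n: "n \<in> N" for n
  proof -
    have "cinner (v z) n = cinner (u z) n - cinner (T (D z (u z))) n"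
      by (simp add: v_def cinner_diff_left cinner_T_N[OF n])
    also have "\<dots> = cinner \<gamma> n" using u_eq[OF z] by (metis add_diff_cancel_right' cinner_diff_left)
    finally show ?thesis by (simp add: \<gamma>_orth[OF n])
  qed
  ultimately show ?thesis by (simp add: M_def)
qed

lemma um_in_M: "um z \<in> M"
  by (simp add: um_def op_one_in[OF M_subspace])

lemma u_split:
  assumes z: "z \<in> polydisc"
  shows "u z = um z + op_one N (u z)"
  using op_one_M_eq[OF Pall_u[OF z]] by (simp add: um_def)

section \<open>Compressed combinations and their inverses\<close>

lemma Y_ops: "Y j \<in> ops M"
proof (rule opsI_op_one[OF M_subspace])
  show "Y j \<in> ops UNIV"
    unfolding Y_def by (intro ops_compose P_ops ops_UNIV[OF op_one_in_ops[OF M_subspace]])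
qed (simp_all add: Y_def op_one_in[OF M_subspace] op_one_id[OF M_subspace])

lemma comb_Y_ops: "op_combination \<zeta> Y \<in> ops M"
  unfolding op_combination_def by (intro ops_sum[OF M_subspace] ops_cscale[OF M_subspace] Y_ops)

lemma comb_Y_apply:
  assumes "x \<in> M"
  shows "op_combination \<zeta> Y x = op_one M (\<Delta> \<zeta> x)"
  by (simp add: op_combination_def[of \<zeta> Y] blinfun.sum_left scaleC_blinfun.rep_eq Y_def
      op_one_id[OF M_subspace assms] \<Delta>_apply blinfun.sum_right ops_scaleC[OF op_one_in_ops[OF M_subspace]])

lemma norm_sq_M:
  assumes "x \<in> M"
  shows "(norm x)\<^sup>2 = (\<Sum>j\<in>UNIV. (norm (P j x))\<^sup>2)"
  using norm_Pall_sq[of x] by (simp add: M_Pall[OF assms])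

lemma Re_cinner_comb:
  assumes "x \<in> M"
  shows "Re (cinner (op_combination \<zeta> Y x) x) = (\<Sum>j\<in>UNIV. Re (\<zeta> $ j) * (norm (P j x))\<^sup>2)"
  by (simp add: comb_Y_apply[OF assms] op_one_cinner_right[OF M_subspace assms] cinner_\<Delta>_self
      flip: of_real_power)

lemma comb_coercive:
  assumes x: "x \<in> M" and \<rho>: "\<And>j. \<rho> \<le> Re (\<zeta> $ j)"
  shows "\<rho> * (norm x)\<^sup>2 \<le> Re (cinner (op_combination \<zeta> Y x) x)"
  unfolding norm_sq_M[OF x] Re_cinner_comb[OF x] sum_distrib_left
  by (intro sum_mono mult_right_mono \<rho>) simp

lemma norm_comb_le:
  assumes "x \<in> M" "\<And>j. cmod (\<zeta> $ j) \<le> b" "0 \<le> b"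
  shows "norm (op_combination \<zeta> Y x) \<le> b * norm x"
  unfolding comb_Y_apply[OF assms(1)]
  using norm_op_one_apply_le[OF M_subspace] norm_\<Delta>_le[OF assms(2,3)] order_trans by blast

lemma B_inverse:
  assumes "\<rho> > 0" "\<And>j. \<rho> \<le> Re (\<zeta> $ j)"
  shows "is_op_inverse M (op_combination \<zeta> Y) (B \<zeta>)" and "norm (B \<zeta> x) \<le> norm x / \<rho>"
  unfolding B_def
  using coercive_inverse[OF M_subspace comb_Y_ops assms(1), of \<zeta>] comb_coercive[OF _ assms(2)]
  by (auto simp: inner_eq_Re_cinner)

lemma B_ops: "\<rho> > 0 \<Longrightarrow> (\<And>j. \<rho> \<le> Re (\<zeta> $ j)) \<Longrightarrow> B \<zeta> \<in> ops M"
  using B_inverse(1) by (simp add: is_op_inverse_def)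

lemma B_apply:
  assumes "\<rho> > 0" "\<And>j. \<rho> \<le> Re (\<zeta> $ j)" "x \<in> M"
  shows "op_combination \<zeta> Y (B \<zeta> x) = x" "B \<zeta> (op_combination \<zeta> Y x) = x" "B \<zeta> x \<in> M"
  using is_op_inverse_apply[OF M_subspace B_inverse(1)[OF assms(1,2)] assms(3)] .

lemma B_bounded_below:
  assumes \<rho>: "\<rho> > 0" "\<And>j. \<rho> \<le> Re (\<zeta> $ j)" and Z: "\<And>j. cmod (\<zeta> $ j) \<le> Z" "Z > 0" and x: "x \<in> M"
  shows "norm x \<le> Z * norm (B \<zeta> x)"
  using norm_comb_le[OF B_apply(3)[OF \<rho> x] Z(1)] Z(2) B_apply(1)[OF \<rho> x] by simp

text \<open>With \<open>b = B \<zeta> x\<close>, the form of \<open>B\<close> at \<open>x\<close> is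
  the form of the combination at \<open>b\<close>, hence at least
  \<open>\<rho> * (norm b)\<^sup>2\<close>, and \<open>norm b\<close> is at least
  \<open>norm x / Z\<close>.\<close>

lemma B_coercive:
  assumes \<rho>: "\<rho> > 0" "\<And>j. \<rho> \<le> Re (\<zeta> $ j)" and Z: "\<And>j. cmod (\<zeta> $ j) \<le> Z" "Z > 0" and x: "x \<in> M"
  shows "\<rho> / Z\<^sup>2 * (norm x)\<^sup>2 \<le> Re (cinner (B \<zeta> x) x)"
proof -
  define b where "b = B \<zeta> x"
  have b: "b \<in> M" "op_combination \<zeta> Y b = x" using B_apply[OF \<rho> x] by (auto simp: b_def)
  have "(norm x)\<^sup>2 \<le> (Z * norm b)\<^sup>2"
    unfolding b_def by (intro power_mono B_bounded_below[OF \<rho> Z x]) simp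
  then have "\<rho> / Z\<^sup>2 * (norm x)\<^sup>2 \<le> \<rho> / Z\<^sup>2 * (Z\<^sup>2 * (norm b)\<^sup>2)"
    using \<rho>(1) by (intro mult_left_mono) (auto simp: power_mult_distrib)
  also have "\<dots> = \<rho> * (norm b)\<^sup>2" using Z(2) by simp
  also have "\<dots> \<le> Re (cinner x b)" using comb_coercive[OF b(1) \<rho>(2)] b(2) by simp
  also have "\<dots> = Re (cinner (B \<zeta> x) x)" by (simp add: b_def Re_cinner_commute)
  finally show ?thesis .
qed

text \<open>In terms of \<open>b = B \<zeta> x\<close> the defect of \<open>1 - B \<zeta>\<close> is
  diagonal in the projections \<open>P j\<close>. The signs of
  \<open>2 * Re (\<zeta> $ j) - 1\<close> thus decide between contraction and isometry.\<close>

lemma norm_defect_B: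
  assumes \<rho>: "\<rho> > 0" "\<And>j. \<rho> \<le> Re (\<zeta> $ j)" and x: "x \<in> M"
  shows "(norm x)\<^sup>2 - (norm (x - B \<zeta> x))\<^sup>2 = (\<Sum>j\<in>UNIV. (2 * Re (\<zeta> $ j) - 1) * (norm (P j (B \<zeta> x)))\<^sup>2)"
proof -
  define b where "b = B \<zeta> x"
  have b: "b \<in> M" "op_combination \<zeta> Y b = x" using B_apply[OF \<rho> x] by (auto simp: b_def)
  have "(norm x)\<^sup>2 - (norm (x - b))\<^sup>2 = 2 * Re (cinner x b) - (norm b)\<^sup>2" by (simp add: norm_diff_sq_cinner)
  also have "Re (cinner x b) = (\<Sum>j\<in>UNIV. Re (\<zeta> $ j) * (norm (P j b))\<^sup>2)"
    using Re_cinner_comb[OF b(1), of \<zeta>] b(2) by simp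
  also have "(norm b)\<^sup>2 = (\<Sum>j\<in>UNIV. (norm (P j b))\<^sup>2)" by (rule norm_sq_M[OF b(1)])
  also have "2 * (\<Sum>j\<in>UNIV. Re (\<zeta> $ j) * (norm (P j b))\<^sup>2) - (\<Sum>j\<in>UNIV. (norm (P j b))\<^sup>2) =
      (\<Sum>j\<in>UNIV. (2 * Re (\<zeta> $ j) - 1) * (norm (P j b))\<^sup>2)"
    unfolding sum_distrib_left sum_subtractf[symmetric] by (intro sum.cong refl) (simp add: algebra_simps)
  finally show ?thesis by (simp add: b_def)
qed

lemma cnj_\<tau>_mult: "cmod (cnj (\<tau> $ j) * z) = cmod z" "cmod (1 - cnj (\<tau> $ j) * z) = cmod (z - \<tau> $ j)"
proof -
  show "cmod (cnj (\<tau> $ j) * z) = cmod z" for z by (simp add: norm_mult \<tau>_cmod)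
  have "1 - cnj (\<tau> $ j) * z = - (cnj (\<tau> $ j) * (z - \<tau> $ j))"
    using \<tau>_cnj[of j] by (simp add: algebra_simps)
  then have "cmod (1 - cnj (\<tau> $ j) * z) = cmod (cnj (\<tau> $ j) * (z - \<tau> $ j))" by simp
  then show "cmod (1 - cnj (\<tau> $ j) * z) = cmod (z - \<tau> $ j)" by (simp add: norm_mult \<tau>_cmod)
qed

lemma zet_polydisc:
  assumes z: "z \<in> polydisc"
  shows "1 / 2 \<le> Re (zet z $ j)" and "0 < 2 * Re (zet z $ j) - 1"
    and "cmod (zet z $ j) \<le> 1 / (1 - maxnorm z)" and "cnj (\<tau> $ j) * z $ j \<noteq> 1"
proof -
  define w where "w = cnj (\<tau> $ j) * z $ j"
  have w: "cmod w < 1" "cmod w \<le> maxnorm z"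
    using z cmod_le_maxnorm[of z j] by (auto simp: w_def cnj_\<tau>_mult polydisc_def)
  then show w1: "cnj (\<tau> $ j) * z $ j \<noteq> 1" by (auto simp: w_def)
  then have w1': "w \<noteq> 1" by (simp add: w_def)
  have "0 < (1 - (cmod w)\<^sup>2) / (cmod (1 - w))\<^sup>2"
    using w(1) w1' power_less_one_iff[of "cmod w" 2] by (intro divide_pos_pos) auto
  then show p: "0 < 2 * Re (zet z $ j) - 1"
    using two_Re_one_div[OF w1'] by (simp add: zet_def w_def)
  then show "1 / 2 \<le> Re (zet z $ j)" by simp
  have "1 - maxnorm z \<le> cmod (1 - w)" using w(2) norm_triangle_ineq2[of 1 w] by simp
  then have "1 / cmod (1 - w) \<le> 1 / (1 - maxnorm z)"
    using maxnorm_less_1[OF z] w1' by (intro divide_left_mono mult_pos_pos) simp_all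
  then show "cmod (zet z $ j) \<le> 1 / (1 - maxnorm z)" by (simp add: zet_def w_def norm_divide)
qed

text \<open>\<open>v z\<close> is \<open>\<Delta> (1 - tw z) (u z)\<close>, and \<open>zet z\<close>
  is the coordinatewise reciprocal of \<open>1 - tw z\<close>; because \<open>v z\<close> lies in
  \<open>M\<close>, projecting the input changes nothing and the output is the projection of
  \<open>u z\<close>.\<close>

lemma comb_v:
  assumes z: "z \<in> polydisc"
  shows "op_combination (zet z) Y (v z) = um z"
proof -
  have "\<Delta> (zet z) (v z) = \<Delta> (zet z) (\<Delta> (1 - tw z) (u z))"
    by (simp add: v_def \<Delta>_diff Pall_\<Delta>_1[OF Pall_u[OF z]])
  also have "\<dots> = \<Delta> 1 (u z)"
  proof -
    have "zet z * (1 - tw z) = 1"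
      using zet_polydisc(4)[OF z] by (simp add: vec_eq_iff zet_def tw_def)
    then show ?thesis by (simp add: \<Delta>_\<Delta>)
  qed
  finally show ?thesis by (simp add: comb_Y_apply[OF v_in_M[OF z]] Pall_\<Delta>_1[OF Pall_u[OF z]] um_def)
qed

lemma half: "(0::real) < 1/2" by simp

lemma B_um:
  assumes z: "z \<in> polydisc"
  shows "B (zet z) (um z) = v z"
  using B_apply(2)[OF half zet_polydisc(1)[OF z] v_in_M[OF z]] by (simp add: comb_v[OF z])

lemma I_um:
  assumes z: "z \<in> polydisc"
  shows "I z (um z) = um z - v z"
  by (simp add: I_def blinfun.diff_left op_one_id[OF M_subspace um_in_M] B_um[OF z])

text \<open>\<open>u z\<close> and \<open>D z (u z)\<close> differ by \<open>v z\<close>, which lies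
  in \<open>M\<close>; their components in \<open>N\<close> therefore coincide and cancel from the
  difference of the two Gram kernels in \<open>V_iso\<close>.\<close>

lemma model_identity:
  assumes z: "z \<in> polydisc" and w: "w \<in> polydisc"
  shows "cinner (um z) (um w) - cinner (um z - v z) (um w - v w) = 1 - cnj (\<phi> w) * \<phi> z"
proof -
  define n where "n z = op_one N (u z)" for z
  have nN: "n z \<in> N" for z by (simp add: n_def op_one_in[OF N_subspace])
  have orth: "cinner x (n z) = 0" "cinner (n z) x = 0" if "x \<in> M" for x z
    using M_N[OF that nN[of z]] by (auto, metis cinner_commute complex_cnj_zero)
  have u: "u z = um z + n z" if "z \<in> polydisc" for z using u_split[OF that] by (simp add: n_def)
  have Du: "D z (u z) = (um z - v z) + n z" if "z \<in> polydisc" for z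
    using u[OF that] by (simp add: v_def algebra_simps)
  have M: "um z - v z \<in> M" if "z \<in> polydisc" for z
    by (intro M_closed_under um_in_M v_in_M that)
  have 1: "cinner (u z) (u w) = cinner (um z) (um w) + cinner (n z) (n w)"
    unfolding u[OF z] u[OF w] by (simp add: cinner_add_left cinner_add_right orth[OF um_in_M])
  have 2: "cinner (D z (u z)) (D w (u w)) = cinner (um z - v z) (um w - v w) + cinner (n z) (n w)"
    unfolding Du[OF z] Du[OF w] cinner_add_left cinner_add_right orth[OF M[OF z]] orth[OF M[OF w]] by simp
  have "tw z $ j * cnj (tw w $ j) = z $ j * cnj (w $ j)" for j
    using \<tau>_cnj[of j] by (simp add: tw_def mult_ac)
  then have 3: "cinner (D z (u z)) (D w (u w)) = cinner (\<Delta> z (u z)) (\<Delta> w (u w))"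
    by (simp add: cinner_\<Delta>)
  show ?thesis using V_iso[OF z w] 1 2 3 by (simp add: algebra_simps)
qed

end

context colligation
begin

section \<open>The boundary value of \<phi>\<close>

lemma id_minus_T_ops: "id_blinfun - T \<in> ops UNIV"
  by (simp add: ops_UNIV_iff blinfun.diff_left ops_scaleC[OF T_ops] scaleC_diff_right)

lemma weak_convergence_fixed_points:
  assumes "\<And>n. n \<in> N \<Longrightarrow> cinner \<beta> n = 0" "\<And>i. norm (y i) \<le> R" "(\<lambda>i. y i - T (y i)) \<longlonglongrightarrow> 0"
  shows "(\<lambda>i. cinner (y i) \<beta>) \<longlonglongrightarrow> 0"
proof (rule weak_convergence_orth_kernel[OF id_minus_T_ops _ assms(2)])
  show "cinner \<beta> n = 0" if "(id_blinfun - T) n = 0" for n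
    using that assms(1)[of n] by (simp add: N_def blinfun.diff_left)
  show "(\<lambda>i. (id_blinfun - T) (y i)) \<longlonglongrightarrow> 0" using assms(3) by (simp add: blinfun.diff_left)
qed

text \<open>Candidate boundary value: the formula \<open>\<phi>_eq\<close> for \<phi> with
  \<open>z\<close> and \<open>u z\<close> replaced by \<tau> and the solution
  \<open>x0\<close>.\<close>

definition \<omega> :: complex where "\<omega> = cinner (V (e0 + \<Delta> \<tau> x0)) e0"

lemma V_x0: "V (e0 + \<Delta> \<tau> x0) = \<omega> *\<^sub>C e0 + x0"
proof -
  have "Pall (V (e0 + \<Delta> \<tau> x0)) = \<gamma> + T x0" by (simp add: blinfun.add_right \<gamma>_def T_apply)
  also have "\<dots> = x0" using x0(2) by (metis diff_add_cancel)
  finally show ?thesis using V_range[of "e0 + \<Delta> \<tau> x0"] by (simp add: \<omega>_def)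
qed

lemma norm_e0_add_sq:
  assumes "Pall x = x"
  shows "(norm (c *\<^sub>C e0 + x))\<^sup>2 = (cmod c)\<^sup>2 + (norm x)\<^sup>2"
proof -
  have "cinner (c *\<^sub>C e0) x = 0"
    using cinner_Pall_e0[of x] assms by (simp add: cinner_scaleC_left) (metis cinner_commute complex_cnj_zero)
  then show ?thesis by (simp add: norm_add_sq_cinner norm_scaleC e0)
qed

text \<open>Weak convergence of \<open>u (zs n) - x0\<close> against the single vector \<beta>
  identifies \<omega> as the limit of \<open>\<phi> (zs n)\<close>, and along this sequence the
  moduli of \<phi> tend to 1.\<close>

lemma cmod_\<omega>: "cmod \<omega> = 1"
proof -
  obtain zs R where zs: "\<And>n::nat. zs n \<in> polydisc" and ub: "\<And>n. norm (u (zs n)) \<le> R"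
    and lim: "(\<lambda>n. D (zs n) (u (zs n)) - u (zs n)) \<longlonglongrightarrow> 0" and lim1: "(\<lambda>n. cmod (\<phi> (zs n))) \<longlonglongrightarrow> 1"
    using approach_sequence by blast
  define W where "W = V o\<^sub>L \<Delta> \<tau>"
  have W: "W \<in> ops UNIV" unfolding W_def by (intro ops_compose V_ops \<Delta>_ops)
  define \<beta> where "\<beta> = op_adjoint W e0"
  have \<beta>: "cinner x \<beta> = cinner (W x) e0" for x unfolding \<beta>_def by (rule cinner_op_adjoint[OF W])
  \<comment> \<open>For \<open>n\<close> in \<open>N\<close> the component of \<open>W n\<close>
    orthogonal to \<open>e0\<close> is \<open>n\<close> itself, already of full norm, so
    contractivity leaves nothing along \<open>e0\<close>.\<close>
  have \<beta>N: "cinner \<beta> n = 0" if n: "n \<in> N" for n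
  proof -
    have "W n = cinner (W n) e0 *\<^sub>C e0 + n"
      using V_range[of "\<Delta> \<tau> n"] n T_apply[of n] by (simp add: W_def N_def)
    then have "(norm (W n))\<^sup>2 = (cmod (cinner (W n) e0))\<^sup>2 + (norm n)\<^sup>2"
      using norm_e0_add_sq[OF N_Pall[OF n]] by metis
    moreover have "norm (W n) \<le> norm n"
      unfolding W_def blinfun_apply_blinfun_compose by (rule order_trans[OF norm_V_le norm_\<Delta>_\<tau>_le])
    then have "(norm (W n))\<^sup>2 \<le> (norm n)\<^sup>2" by (intro power_mono) auto
    ultimately have "cinner (W n) e0 = 0" by simp
    then show ?thesis using \<beta>[of n] by (metis cinner_commute complex_cnj_zero)
  qed
  have "(\<lambda>n. cinner (u (zs n) - x0) \<beta>) \<longlonglongrightarrow> 0"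
  proof (rule weak_convergence_fixed_points[OF \<beta>N])
    show "norm (u (zs n) - x0) \<le> R + norm x0" for n
      using norm_triangle_ineq4[of "u (zs n)" x0] ub[of n] by linarith
    have "(\<lambda>n. T (D (zs n) (u (zs n)) - u (zs n))) \<longlonglongrightarrow> T 0" by (intro tendsto_intros lim)
    moreover have "T (D (zs n) (u (zs n)) - u (zs n)) = (u (zs n) - x0) - T (u (zs n) - x0)" for n
    proof -
      have "T (D (zs n) (u (zs n))) = u (zs n) - \<gamma>" using u_eq[OF zs[of n]] by (metis add_diff_cancel_left')
      moreover have "T x0 = x0 - \<gamma>" by (simp flip: x0(2))
      ultimately show ?thesis by (simp add: blinfun.diff_right)
    qed
    ultimately show "(\<lambda>n. (u (zs n) - x0) - T (u (zs n) - x0)) \<longlonglongrightarrow> 0" by simp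
  qed
  then have "(\<lambda>n. cinner (D (zs n) (u (zs n)) - u (zs n)) \<beta> + cinner (u (zs n) - x0) \<beta>) \<longlonglongrightarrow> cinner 0 \<beta> + 0"
    by (intro tendsto_intros lim)
  moreover have "cinner (D (zs n) (u (zs n)) - u (zs n)) \<beta> + cinner (u (zs n) - x0) \<beta> = \<phi> (zs n) - \<omega>" for n
  proof -
    have "\<phi> (zs n) - \<omega> = cinner (V (e0 + \<Delta> (zs n) (u (zs n))) - V (e0 + \<Delta> \<tau> x0)) e0"
      by (simp add: \<phi>_eq[OF zs] \<omega>_def cinner_diff_left)
    also have "V (e0 + \<Delta> (zs n) (u (zs n))) - V (e0 + \<Delta> \<tau> x0) = W (D (zs n) (u (zs n)) - x0)"
      by (simp add: W_def blinfun.add_right blinfun.diff_right \<Delta>_\<Delta> \<tau>_tw)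
    finally show ?thesis by (simp add: \<beta>[symmetric] cinner_diff_left)
  qed
  ultimately have "(\<lambda>n. \<phi> (zs n)) \<longlonglongrightarrow> \<omega>" by (simp add: LIM_zero_iff)
  then have "(\<lambda>n. cmod (\<phi> (zs n))) \<longlonglongrightarrow> cmod \<omega>" by (rule tendsto_norm)
  then show ?thesis using lim1 LIMSEQ_unique by blast
qed

text \<open>Because \<omega> is unimodular, \<open>V\<close> preserves the norm of
  \<open>e0 + \<Delta> \<tau> x0\<close> and hence all inner products with it; the formula is this
  invariance for the vector \<open>e0 + \<Delta> z (u z)\<close>.\<close>

lemma one_minus_\<phi>:
  assumes z: "z \<in> polydisc"
  shows "1 - \<phi> z * cnj \<omega> = cinner (v z) x0"
proof -
  have x0P: "Pall x0 = x0" by (rule M_Pall[OF x0(1)])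
  have e0P: "cinner e0 x = 0" if "Pall x = x" for x
    using cinner_Pall_e0[of x] that by (metis cinner_commute complex_cnj_zero)
  have Pe0: "cinner x e0 = 0" if "Pall x = x" for x
    using cinner_Pall_e0[of x] that by simp
  have \<Delta>x0: "norm (\<Delta> \<tau> x0) = norm x0"
    using norm_\<Delta>_sq[of \<tau> x0] norm_sq_M[OF x0(1)]
    by (intro power2_eq_imp_eq[OF _ norm_ge_zero norm_ge_zero]) (simp add: \<tau>_cmod)
  have "(norm (V (e0 + \<Delta> \<tau> x0)))\<^sup>2 = (norm (e0 + \<Delta> \<tau> x0))\<^sup>2"
    unfolding V_x0 norm_e0_add_sq[OF x0P]
    using norm_e0_add_sq[of "\<Delta> \<tau> x0" 1] by (simp add: Pall_\<Delta> \<Delta>x0 cmod_\<omega>)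
  then have "norm (V (e0 + \<Delta> \<tau> x0)) = norm (e0 + \<Delta> \<tau> x0)"
    by (rule power2_eq_imp_eq) simp_all
  from contraction_isometric_vector[OF V_ops V_norm this, of "e0 + \<Delta> z (u z)"]
  have "cinner (\<phi> z *\<^sub>C e0 + u z) (\<omega> *\<^sub>C e0 + x0) = cinner (e0 + \<Delta> z (u z)) (e0 + \<Delta> \<tau> x0)"
    unfolding V_u[OF z] V_x0 .
  then have "\<phi> z * cnj \<omega> + cinner (u z) x0 = 1 + cinner (\<Delta> z (u z)) (\<Delta> \<tau> x0)"
    by (simp add: cinner_linear_simps cinner_self e0 e0P Pe0 x0P Pall_u[OF z] Pall_\<Delta> mult.commute)
  moreover have "cinner (\<Delta> z (u z)) (\<Delta> \<tau> x0) = cinner (D z (u z)) x0"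
  proof -
    have "cinner (D z (u z)) (\<Delta> 1 x0) = cinner (\<Delta> z (u z)) (\<Delta> \<tau> x0)"
      unfolding cinner_\<Delta> by (intro sum.cong refl) (simp add: tw_def mult_ac)
    then show ?thesis by (simp add: Pall_\<Delta>_1[OF x0P])
  qed
  ultimately show ?thesis by (simp add: v_def cinner_diff_left algebra_simps)
qed

text \<open>For \<open>a = \<phi> z * cnj \<omega>\<close>, nonnegativity of
  \<open>(cmod (1 - a))\<^sup>2\<close> gives
  \<open>1 - (cmod (\<phi> z))\<^sup>2 \<le> 2 * Re (1 - a)\<close>. The left side is known from the
  model identity, the right side from \<open>one_minus_\<phi>\<close>.\<close>

lemma v_inequality:
  assumes z: "z \<in> polydisc"
  shows "2 * Re (cinner (um z - x0) (v z)) \<le> (norm (v z))\<^sup>2"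
proof -
  have "Re (cinner (um z) (um z) - cinner (um z - v z) (um z - v z)) = Re (1 - cnj (\<phi> z) * \<phi> z)"
    unfolding model_identity[OF z z] ..
  then have 1: "(norm (um z))\<^sup>2 - (norm (um z - v z))\<^sup>2 = 1 - (cmod (\<phi> z))\<^sup>2"
    by (simp add: Re_cinner_self mult.commute[of "cnj _"] flip: complex_norm_square)
  define a where "a = \<phi> z * cnj \<omega>"
  have "cmod a = cmod (\<phi> z)" by (simp add: a_def norm_mult cmod_\<omega>)
  moreover have "(cmod (1 - a))\<^sup>2 = 1 - 2 * Re a + (cmod a)\<^sup>2"
    unfolding cmod_power2 by (simp add: power2_eq_square algebra_simps)
  moreover have "0 \<le> (cmod (1 - a))\<^sup>2" by simp
  ultimately have "1 - (cmod (\<phi> z))\<^sup>2 \<le> 2 * Re (1 - a)" by simp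
  also have "Re (1 - a) = Re (cinner x0 (v z))"
    using one_minus_\<phi>[OF z] by (simp add: a_def Re_cinner_commute[of x0])
  finally show ?thesis using 1 by (simp add: norm_diff_sq_cinner cinner_diff_left)
qed

section \<open>Nontangential convergence of \<open>um\<close>\<close>

lemma nt_bounds:
  assumes z: "z \<in> polydisc" and c: "c > 0" "maxnorm (z - \<tau>) \<le> c * (1 - maxnorm z)"
  shows "1 / (c\<^sup>2 * (1 - maxnorm z)) \<le> Re (zet z $ j)"
proof -
  define s where "s = 1 - maxnorm z"
  have s: "s > 0" using maxnorm_less_1[OF z] by (simp add: s_def)
  define w where "w = cnj (\<tau> $ j) * z $ j"
  have w1: "w \<noteq> 1" using zet_polydisc(4)[OF z] by (simp add: w_def)
  \<comment> \<open>Nontangential approach enters here: it keeps \<open>1 - w\<close> of order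
    \<open>s\<close>, which makes \<open>Re (zet z $ j)\<close> comparable with the bound
    \<open>1 / s\<close> for the modulus.\<close>
  have "cmod (1 - w) \<le> c * s"
    using c(2) cmod_le_maxnorm[of "z - \<tau>" j] by (simp add: w_def cnj_\<tau>_mult s_def)
  then have "(cmod (1 - w))\<^sup>2 \<le> (c * s)\<^sup>2" by (intro power_mono) auto
  moreover have "s \<le> Re (1 - w)"
    using complex_Re_le_cmod[of w] cmod_le_maxnorm[of z j] by (simp add: w_def cnj_\<tau>_mult s_def)
  ultimately have "s / (c * s)\<^sup>2 \<le> Re (1 - w) / (cmod (1 - w))\<^sup>2"
    using s w1 by (intro frac_le) auto
  also have "\<dots> = Re (zet z $ j)" using Re_one_div[OF w1] by (simp add: zet_def w_def)
  also have "s / (c * s)\<^sup>2 = 1 / (c\<^sup>2 * s)" using s by (simp add: power2_eq_square)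
  finally show ?thesis by (simp add: s_def)
qed

text \<open>The combination with coefficients \<open>\<eta> n\<close> maps the difference of the two
  solutions to minus the combination with coefficients \<open>\<eta> n - \<eta>'\<close> at
  \<open>b\<close>; uniform coercivity then bounds that difference by a multiple of
  \<open>norm (\<eta> n - \<eta>')\<close>.\<close>

lemma scaled_resolvent_limit:
  fixes \<eta> :: "nat \<Rightarrow> complex ^ 'd"
  assumes \<rho>: "\<rho> > 0" "\<And>n j. \<rho> \<le> Re (\<eta> n $ j)" "\<And>j. \<rho> \<le> Re (\<eta>' $ j)" and lim: "\<eta> \<longlonglongrightarrow> \<eta>'" and x: "x \<in> M"
  shows "(\<lambda>n. B (\<eta> n) x) \<longlonglongrightarrow> B \<eta>' x"
proof (rule Lim_transform2[OF tendsto_const])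
  define b where "b = B \<eta>' x"
  have b: "b \<in> M" "op_combination \<eta>' Y b = x" using B_apply[OF \<rho>(1,3) x] by (auto simp: b_def)
  have "norm (b - B (\<eta> n) x) \<le> norm (\<eta> n - \<eta>') * (norm b / \<rho>)" for n
  proof -
    define d where "d = B (\<eta> n) x - b"
    have d: "d \<in> M" unfolding d_def by (intro M_closed_under B_apply(3)[OF \<rho>(1,2) x] b)
    have "op_combination (\<eta> n) Y d = op_combination \<eta>' Y b - op_combination (\<eta> n) Y b"
      by (simp add: d_def blinfun.diff_right B_apply(1)[OF \<rho>(1,2) x] b)
    also have "\<dots> = - op_combination (\<eta> n - \<eta>') Y b"
      by (simp add: comb_Y_apply[OF b(1)] \<Delta>_diff blinfun.diff_right)
    finally have "norm (op_combination (\<eta> n) Y d) = norm (op_combination (\<eta> n - \<eta>') Y b)" by simp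
    also have "\<dots> \<le> norm (\<eta> n - \<eta>') * norm b"
      by (intro norm_comb_le[OF b(1)] Finite_Cartesian_Product.norm_nth_le norm_ge_zero)
    finally have "norm (op_combination (\<eta> n) Y d) \<le> norm (\<eta> n - \<eta>') * norm b" .
    moreover have "\<rho> * norm d \<le> norm (op_combination (\<eta> n) Y d)"
      using comb_coercive[OF d \<rho>(2)] by (intro coercive_bounded_below) (simp add: inner_eq_Re_cinner)
    ultimately have "\<rho> * norm d \<le> norm (\<eta> n - \<eta>') * norm b" by simp
    then show ?thesis using \<rho>(1) by (simp add: d_def norm_minus_commute field_simps)
  qed
  then have ev: "\<forall>\<^sub>F n in sequentially. norm (b - B (\<eta> n) x) \<le> norm (\<eta> n - \<eta>') * (norm b / \<rho>)"
    by (intro always_eventually allI)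
  have "(\<lambda>n. norm (\<eta> n - \<eta>') * (norm b / \<rho>)) \<longlonglongrightarrow> norm (\<eta>' - \<eta>') * (norm b / \<rho>)"
    by (intro tendsto_intros lim)
  then have "(\<lambda>n. norm (\<eta> n - \<eta>') * (norm b / \<rho>)) \<longlonglongrightarrow> 0" by simp
  with ev have "(\<lambda>n. b - B (\<eta> n) x) \<longlonglongrightarrow> 0" by (rule Lim_null_comparison)
  then show "(\<lambda>n. B \<eta>' x - B (\<eta> n) x) \<longlonglongrightarrow> 0" by (simp add: b_def)
qed

text \<open>The \<open>\<eta> n\<close> stay in a compact set on which \<open>\<eta> \<mapsto> B \<eta> x\<close> is continuous, so along a
  subsequence the second argument of the inner product converges in norm.\<close>

lemma weak_limit_against_compact:
  fixes \<eta> :: "nat \<Rightarrow> complex ^ 'd"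
  assumes \<rho>: "\<rho> > 0" "\<And>n j. \<rho> \<le> Re (\<eta> n $ j)" and bd: "\<And>n j. cmod (\<eta> n $ j) \<le> 1" and x: "x \<in> M"
    and eb: "\<And>n. norm (e n) \<le> R" and weak: "\<And>\<beta>. \<beta> \<in> M \<Longrightarrow> (\<lambda>n. cinner (e n) \<beta>) \<longlonglongrightarrow> 0"
  shows "(\<lambda>n. cinner (e n) (B (\<eta> n) x)) \<longlonglongrightarrow> 0"
proof (rule ccontr)
  assume "\<not> ?thesis"
  then obtain \<epsilon> r where \<epsilon>: "\<epsilon> > 0" and r: "strict_mono r"
    and ge: "\<And>n::nat. \<epsilon> \<le> norm (cinner (e (r n)) (B (\<eta> (r n)) x))"
    using not_LIMSEQ_0_subsequence by meson
  have "bounded (range (\<eta> \<circ> r))"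
  proof (rule boundedI)
    fix z assume "z \<in> range (\<eta> \<circ> r)"
    then have "(\<Sum>j\<in>UNIV. cmod (z $ j)) \<le> (\<Sum>j\<in>(UNIV::'d set). 1)" using bd by (intro sum_mono) auto
    moreover have "norm z \<le> (\<Sum>j\<in>UNIV. cmod (z $ j))"
      unfolding norm_vec_def by (rule L2_set_le_sum) simp
    ultimately show "norm z \<le> (\<Sum>j\<in>(UNIV::'d set). 1)" by linarith
  qed
  then obtain \<eta>' r' where r': "strict_mono r'" and lim: "((\<eta> \<circ> r) \<circ> r') \<longlonglongrightarrow> \<eta>'"
    using bounded_imp_convergent_subsequence by blast
  define q where "q = r \<circ> r'"
  have lim: "(\<lambda>n. \<eta> (q n)) \<longlonglongrightarrow> \<eta>'" using lim by (simp add: q_def o_def)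
  have q: "strict_mono q" unfolding q_def using r r' by (rule strict_mono_o)
  have \<rho>': "\<rho> \<le> Re (\<eta>' $ j)" for j
  proof (rule LIMSEQ_le_const)
    show "(\<lambda>n. Re (\<eta> (q n) $ j)) \<longlonglongrightarrow> Re (\<eta>' $ j)" by (intro tendsto_intros lim)
  qed (use \<rho>(2) in blast)
  define b where "b = B \<eta>' x"
  have bM: "b \<in> M" unfolding b_def by (rule B_apply(3)[OF \<rho>(1) \<rho>' x])
  have lim2: "(\<lambda>n. B (\<eta> (q n)) x) \<longlonglongrightarrow> b"
    unfolding b_def by (rule scaled_resolvent_limit[OF \<rho>(1,2) \<rho>' lim x])
  have "(\<lambda>n. cinner (e (q n)) (B (\<eta> (q n)) x - b)) \<longlonglongrightarrow> 0"
  proof (rule Lim_null_comparison)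
    show "\<forall>\<^sub>F n in sequentially. norm (cinner (e (q n)) (B (\<eta> (q n)) x - b)) \<le> R * norm (B (\<eta> (q n)) x - b)"
      by (intro always_eventually allI order_trans[OF cmod_cinner_le] mult_right_mono eb norm_ge_zero)
    have "(\<lambda>n. R * norm (B (\<eta> (q n)) x - b)) \<longlonglongrightarrow> R * norm (b - b)" by (intro tendsto_intros lim2)
    then show "(\<lambda>n. R * norm (B (\<eta> (q n)) x - b)) \<longlonglongrightarrow> 0" by simp
  qed
  moreover have "(\<lambda>n. cinner (e (q n)) b) \<longlonglongrightarrow> 0"
    using LIMSEQ_subseq_LIMSEQ[OF weak[OF bM] q] by (simp add: o_def)
  ultimately have "(\<lambda>n. cinner (e (q n)) (B (\<eta> (q n)) x - b) + cinner (e (q n)) b) \<longlonglongrightarrow> 0 + 0"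
    by (rule tendsto_add)
  then have "(\<lambda>n. cinner (e (q n)) (B (\<eta> (q n)) x)) \<longlonglongrightarrow> 0" by (simp flip: cinner_add_right)
  then have "(\<lambda>n. norm (cinner (e (q n)) (B (\<eta> (q n)) x))) \<longlonglongrightarrow> 0" by (rule tendsto_norm_zero)
  then have "\<epsilon> \<le> 0" by (rule LIMSEQ_le_const) (use ge in \<open>auto simp: q_def\<close>)
  then show False using \<epsilon> by simp
qed

text \<open>Let \<open>e = um - x0\<close>. Since \<open>v = B e + s b\<close>,
  \<open>v_inequality\<close> and coercivity of \<open>B\<close> give, after division by a multiple
  of \<open>s\<close>, a bound for \<open>(norm e)\<^sup>2\<close> by a term with a factor
  \<open>s\<close> plus a multiple of \<open>cmod (cinner e b)\<close>. This yields first
  boundedness of \<open>e\<close>, then weak convergence to 0 because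
  \<open>e - T e = - T v\<close>, and finally norm convergence because the vectors \<open>b\<close>
  stay in a compact set.\<close>

lemma um_limit:
  fixes zs :: "nat \<Rightarrow> complex ^ 'd"
  assumes zs: "\<And>n. zs n \<in> polydisc" and c: "c > 0" "\<And>n. maxnorm (zs n - \<tau>) \<le> c * (1 - maxnorm (zs n))"
    and lim: "zs \<longlonglongrightarrow> \<tau>"
  shows "(\<lambda>n. um (zs n)) \<longlonglongrightarrow> x0"
proof -
  define \<kappa> where "\<kappa> = c\<^sup>2"
  have \<kappa>: "\<kappa> > 0" using c(1) by (simp add: \<kappa>_def)
  define s where "s n = 1 - maxnorm (zs n)" for n
  have s: "s n > 0" for n using maxnorm_less_1[OF zs] by (simp add: s_def)
  have s_lim: "s \<longlonglongrightarrow> 0"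
  proof (rule Lim_null_comparison)
    show "\<forall>\<^sub>F n in sequentially. norm (s n) \<le> norm (zs n - \<tau>)"
      using one_minus_maxnorm_le[OF \<tau>] s by (intro always_eventually) (auto simp: s_def abs_of_pos)
    have "(\<lambda>n. norm (zs n - \<tau>)) \<longlonglongrightarrow> norm (\<tau> - \<tau>)" by (intro tendsto_intros lim)
    then show "(\<lambda>n. norm (zs n - \<tau>)) \<longlonglongrightarrow> 0" by simp
  qed
  define e where "e n = um (zs n) - x0" for n
  have eM: "e n \<in> M" for n unfolding e_def by (intro M_closed_under um_in_M x0)
  define X where "X = norm x0"
  have X0: "0 \<le> X" by (simp add: X_def)
  have \<rho>: "1 / (\<kappa> * s n) > 0" "1 / (\<kappa> * s n) \<le> Re (zet (zs n) $ j)" for n j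
    using nt_bounds[OF zs c(1) c(2)] \<kappa> s[of n] by (auto simp: \<kappa>_def s_def)
  have Z: "cmod (zet (zs n) $ j) \<le> 1 / s n" "1 / s n > 0" for n j
    using zet_polydisc(3)[OF zs] s[of n] by (auto simp: s_def)
  \<comment> \<open>Scaling by \<open>s n\<close> puts the coefficients into the compact set given
    by \<open>1 / \<kappa> \<le> Re\<close> and modulus at most 1, and makes the small factor
    explicit in \<open>Bb\<close>.\<close>
  define \<eta> where "\<eta> n = (\<chi> j. of_real (s n) * zet (zs n) $ j)" for n
  have \<eta>1: "1 / \<kappa> > 0" "1 / \<kappa> \<le> Re (\<eta> n $ j)" "cmod (\<eta> n $ j) \<le> 1" for n j
    using \<rho>(2)[of n j] Z(1)[of n j] s[of n] \<kappa> by (auto simp: \<eta>_def norm_mult field_simps)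
  define b where "b n = B (\<eta> n) x0" for n
  have Bb: "B (zet (zs n)) x0 = of_real (s n) *\<^sub>C b n" for n
  proof -
    have b: "b n \<in> M" "op_combination (\<eta> n) Y (b n) = x0"
      unfolding b_def by (intro B_apply[OF \<eta>1(1,2) x0(1)])+
    have "op_combination (zet (zs n)) Y (of_real (s n) *\<^sub>C b n) = op_combination (\<eta> n) Y (b n)"
      by (simp add: op_combination_def \<eta>_def blinfun.sum_left scaleC_blinfun.rep_eq ops_scaleC[OF Y_ops]
          scaleC_scaleC mult.commute)
    then have "op_combination (zet (zs n)) Y (of_real (s n) *\<^sub>C b n) = x0" using b by simp
    then show ?thesis using B_apply(2)[OF \<rho> M_closed_under(1)[OF b(1)]] by metis
  qed
  have main: "(norm (e n))\<^sup>2 \<le> \<kappa> ^ 3 * s n * ((norm (e n))\<^sup>2 + X\<^sup>2) + \<kappa> * cmod (cinner (e n) (b n))"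
    and bn: "norm (b n) \<le> \<kappa> * X" and vn: "norm (v (zs n)) \<le> \<kappa> * s n * (norm (e n) + X)" for n
  proof -
    have v: "v (zs n) = B (zet (zs n)) (e n) + of_real (s n) *\<^sub>C b n"
      using B_um[OF zs[of n]] by (simp add: e_def blinfun.diff_right Bb)
    have "norm (v (zs n)) \<le> norm (um (zs n)) / (1 / (\<kappa> * s n))"
      using B_inverse(2)[OF \<rho>] B_um[OF zs[of n]] by metis
    also have "\<dots> = \<kappa> * s n * norm (um (zs n))" by simp
    also have "\<dots> \<le> \<kappa> * s n * (norm (e n) + X)"
      using norm_triangle_ineq[of "e n" x0] \<kappa> s[of n] by (intro mult_left_mono) (auto simp: e_def X_def)
    finally show vn: "norm (v (zs n)) \<le> \<kappa> * s n * (norm (e n) + X)" .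
    show "norm (b n) \<le> \<kappa> * X"
      using B_inverse(2)[OF \<eta>1(1,2), of n x0] by (simp add: b_def X_def mult.commute)
    \<comment> \<open>The lower bound \<open>1 / (\<kappa> * s n)\<close> and the modulus bound
      \<open>1 / s n\<close> combine to the coercivity constant \<open>s n / \<kappa>\<close>, of
      the same order in \<open>s n\<close> as the term containing \<open>b n\<close>.\<close>
    have "1 / (\<kappa> * s n) / (1 / s n)\<^sup>2 * (norm (e n))\<^sup>2 \<le> Re (cinner (B (zet (zs n)) (e n)) (e n))"
      by (rule B_coercive[OF \<rho> Z eM])
    also have "1 / (\<kappa> * s n) / (1 / s n)\<^sup>2 = s n / \<kappa>"
      using s[of n] by (simp add: power2_eq_square)
    finally have 1: "s n / \<kappa> * (norm (e n))\<^sup>2 \<le> Re (cinner (B (zet (zs n)) (e n)) (e n))" .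
    have "2 * Re (cinner (e n) (v (zs n))) \<le> (norm (v (zs n)))\<^sup>2"
      using v_inequality[OF zs[of n]] by (simp add: e_def)
    also have "\<dots> \<le> (\<kappa> * s n * (norm (e n) + X))\<^sup>2" by (intro power_mono vn) simp
    also have "\<dots> = (\<kappa> * s n)\<^sup>2 * (norm (e n) + X)\<^sup>2" by (simp add: power_mult_distrib)
    also have "\<dots> \<le> (\<kappa> * s n)\<^sup>2 * (2 * ((norm (e n))\<^sup>2 + X\<^sup>2))"
      using sum_squares_bound[of "norm (e n)" X] by (intro mult_left_mono) (auto simp: power2_sum)
    also have "\<dots> = 2 * ((\<kappa> * s n)\<^sup>2 * ((norm (e n))\<^sup>2 + X\<^sup>2))" by simp
    finally have 2: "Re (cinner (e n) (v (zs n))) \<le> (\<kappa> * s n)\<^sup>2 * ((norm (e n))\<^sup>2 + X\<^sup>2)" by simp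
    have "Re (cinner (e n) (v (zs n))) =
        Re (cinner (B (zet (zs n)) (e n)) (e n)) + s n * Re (cinner (e n) (b n))"
      using Re_cinner_commute[of "e n" "B (zet (zs n)) (e n)"]
      by (simp add: v cinner_add_right cinner_scaleC_right)
    then have "s n / \<kappa> * (norm (e n))\<^sup>2 \<le> (\<kappa> * s n)\<^sup>2 * ((norm (e n))\<^sup>2 + X\<^sup>2) - s n * Re (cinner (e n) (b n))"
      using 1 2 by linarith
    also have "\<dots> \<le> (\<kappa> * s n)\<^sup>2 * ((norm (e n))\<^sup>2 + X\<^sup>2) + s n * cmod (cinner (e n) (b n))"
    proof -
      have "- Re (cinner (e n) (b n)) \<le> cmod (cinner (e n) (b n))"
        using abs_Re_le_cmod[of "cinner (e n) (b n)"] by linarith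
      from mult_left_mono[OF this less_imp_le[OF s[of n]]] show ?thesis by simp
    qed
    also have "\<dots> = s n / \<kappa> * (\<kappa> ^ 3 * s n * ((norm (e n))\<^sup>2 + X\<^sup>2) + \<kappa> * cmod (cinner (e n) (b n)))"
      using \<kappa> by (simp add: power2_eq_square power3_eq_cube distrib_left)
    finally show "(norm (e n))\<^sup>2 \<le> \<kappa> ^ 3 * s n * ((norm (e n))\<^sup>2 + X\<^sup>2) + \<kappa> * cmod (cinner (e n) (b n))"
      using s[of n] \<kappa> by (simp only: mult_le_cancel_left_pos[OF divide_pos_pos])
  qed
  \<comment> \<open>If \<open>norm (e n)\<close> exceeds \<open>X\<close> and
    \<open>\<kappa> ^ 3 * s n < 1 / 2\<close>, then \<open>main\<close> bounds it by exactly this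
    number.\<close>
  define R where "R = X + 2 * \<kappa>\<^sup>2 * X"
  have "(\<lambda>n. \<kappa> ^ 3 * s n) \<longlonglongrightarrow> \<kappa> ^ 3 * 0" by (intro tendsto_intros s_lim)
  then have "\<forall>\<^sub>F n in sequentially. \<kappa> ^ 3 * s n < 1 / 2" by (intro order_tendstoD(2)[of _ 0]) auto
  then obtain n0 where n0: "\<And>n. n \<ge> n0 \<Longrightarrow> \<kappa> ^ 3 * s n < 1 / 2" unfolding eventually_sequentially by blast
  have eR: "norm (e n) \<le> R" if "n \<ge> n0" for n
  proof (rule ccontr)
    assume "\<not> norm (e n) \<le> R"
    then have gt: "R < norm (e n)" by simp
    have "cmod (cinner (e n) (b n)) \<le> norm (e n) * (\<kappa> * X)"
      by (rule order_trans[OF cmod_cinner_le]) (intro mult_left_mono bn norm_ge_zero)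
    then have "\<kappa> * cmod (cinner (e n) (b n)) \<le> \<kappa> * (norm (e n) * (\<kappa> * X))"
      using \<kappa> by (intro mult_left_mono) auto
    moreover have "\<kappa> ^ 3 * s n * ((norm (e n))\<^sup>2 + X\<^sup>2) \<le> 1 / 2 * ((norm (e n))\<^sup>2 + X\<^sup>2)"
      using n0[OF that] by (intro mult_right_mono) auto
    ultimately have "(norm (e n))\<^sup>2 \<le> 1 / 2 * ((norm (e n))\<^sup>2 + X\<^sup>2) + \<kappa> * (norm (e n) * (\<kappa> * X))"
      using main[of n] by linarith
    then have "norm (e n) * norm (e n) \<le> X * X + 2 * \<kappa>\<^sup>2 * X * norm (e n)"
      by (simp add: power2_eq_square algebra_simps)
    also have "\<dots> \<le> X * norm (e n) + 2 * \<kappa>\<^sup>2 * X * norm (e n)"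
    proof -
      have "X \<le> R" using X0 by (simp add: R_def)
      then have "X \<le> norm (e n)" using gt by simp
      then show ?thesis using X0 by (intro add_right_mono mult_left_mono)
    qed
    also have "\<dots> = R * norm (e n)" by (simp add: R_def algebra_simps)
    finally have "norm (e n) \<le> R"
      using gt X0 by (cases "norm (e n) = 0") (auto simp: R_def)
    with gt show False by simp
  qed
  \<comment> \<open>Dropping the first \<open>n0\<close> terms makes the bound \<open>R\<close>
    valid for the whole sequence.\<close>
  define e' where "e' n = e (n + n0)" for n
  have e'R: "norm (e' n) \<le> R" for n using eR by (simp add: e'_def)
  have weak: "(\<lambda>n. cinner (e' n) \<beta>) \<longlonglongrightarrow> 0" if \<beta>: "\<beta> \<in> M" for \<beta>
  proof (rule weak_convergence_fixed_points[OF M_N[OF \<beta>] e'R])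
    have id: "e n - T (e n) = - T (v (zs n))" for n
    proof -
      have "T (op_one N (u (zs n))) = op_one N (u (zs n))"
        using op_one_in[OF N_subspace, of "u (zs n)"] by (simp add: N_def)
      then have "um (zs n) - T (um (zs n)) = u (zs n) - T (u (zs n))"
        using u_split[OF zs[of n]] by (metis (no_types, lifting) add_diff_cancel_right blinfun.add_right)
      note 1 = this
      have 2: "u (zs n) - T (D (zs n) (u (zs n))) = x0 - T x0"
        using u_eq[OF zs[of n]] x0(2) by (metis add_diff_cancel_right')
      have "e n - T (e n) = (um (zs n) - T (um (zs n))) - (x0 - T x0)"
        by (simp add: e_def blinfun.diff_right)
      also have "\<dots> = (u (zs n) - T (u (zs n))) - (u (zs n) - T (D (zs n) (u (zs n))))"
        by (simp only: 1 2)
      also have "\<dots> = - T (v (zs n))" by (simp add: v_def blinfun.diff_right)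
      finally show ?thesis .
    qed
    show "(\<lambda>n. e' n - T (e' n)) \<longlonglongrightarrow> 0"
    proof (rule Lim_null_comparison)
      show "\<forall>\<^sub>F n in sequentially. norm (e' n - T (e' n)) \<le> \<kappa> * s (n + n0) * (R + X)"
      proof (rule always_eventually, rule allI)
        fix n
        have "norm (e' n - T (e' n)) \<le> norm (v (zs (n + n0)))"
          unfolding e'_def id by (simp add: norm_T_apply_le)
        also have "\<dots> \<le> \<kappa> * s (n + n0) * (norm (e (n + n0)) + X)" by (rule vn)
        also have "\<dots> \<le> \<kappa> * s (n + n0) * (R + X)"
          using \<kappa> s[of "n + n0"] eR[of "n + n0"] by (intro mult_left_mono) auto
        finally show "norm (e' n - T (e' n)) \<le> \<kappa> * s (n + n0) * (R + X)" .
      qed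
      have "(\<lambda>n. \<kappa> * s (n + n0) * (R + X)) \<longlonglongrightarrow> \<kappa> * 0 * (R + X)"
        by (intro tendsto_intros LIMSEQ_ignore_initial_segment s_lim)
      then show "(\<lambda>n. \<kappa> * s (n + n0) * (R + X)) \<longlonglongrightarrow> 0" by simp
    qed
  qed
  have wl: "(\<lambda>n. cinner (e' n) (b (n + n0))) \<longlonglongrightarrow> 0"
    unfolding b_def
    by (rule weak_limit_against_compact[OF \<eta>1(1) _ _ x0(1) e'R weak]) (use \<eta>1 in auto)
  have "(\<lambda>n. \<kappa> ^ 3 * s (n + n0) * (R\<^sup>2 + X\<^sup>2) + \<kappa> * cmod (cinner (e' n) (b (n + n0)))) \<longlonglongrightarrow>
      \<kappa> ^ 3 * 0 * (R\<^sup>2 + X\<^sup>2) + \<kappa> * 0"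
    by (intro tendsto_intros LIMSEQ_ignore_initial_segment s_lim tendsto_norm_zero wl)
  then have up: "(\<lambda>n. \<kappa> ^ 3 * s (n + n0) * (R\<^sup>2 + X\<^sup>2) + \<kappa> * cmod (cinner (e' n) (b (n + n0)))) \<longlonglongrightarrow> 0" by simp
  have "(\<lambda>n. (norm (e' n))\<^sup>2) \<longlonglongrightarrow> 0"
  proof (rule Lim_null_comparison[OF _ up], rule always_eventually, rule allI)
    fix n
    have "(norm (e' n))\<^sup>2 \<le> R\<^sup>2" by (intro power_mono e'R) simp
    then have "\<kappa> ^ 3 * s (n + n0) * ((norm (e' n))\<^sup>2 + X\<^sup>2) \<le> \<kappa> ^ 3 * s (n + n0) * (R\<^sup>2 + X\<^sup>2)"
      using \<kappa> s[of "n + n0"] by (intro mult_left_mono) auto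
    then show "norm ((norm (e' n))\<^sup>2) \<le> \<kappa> ^ 3 * s (n + n0) * (R\<^sup>2 + X\<^sup>2) + \<kappa> * cmod (cinner (e' n) (b (n + n0)))"
      using main[of "n + n0"] by (simp add: e'_def)
  qed
  then have "(\<lambda>n. sqrt ((norm (e' n))\<^sup>2)) \<longlonglongrightarrow> sqrt 0" by (rule tendsto_real_sqrt)
  then have "e' \<longlonglongrightarrow> 0" by (simp add: tendsto_norm_zero_iff)
  then have "e \<longlonglongrightarrow> 0" unfolding e'_def by (rule LIMSEQ_offset)
  then show ?thesis by (simp add: e_def[abs_def] LIM_zero_iff)
qed

end

section \<open>The torus\<close>

text \<open>Either no angle solves the equation, or the solutions lie in the countably many
  hyperplanes where \<open>\<theta> $ j\<close> differs from one solution by a multiple of 2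
  pi.\<close>

lemma cis_eq_null: "{\<theta> :: real ^ 'd. cis (\<theta> $ j) = c} \<in> null_sets lborel"
proof (cases "\<exists>t. cis t = c")
  case True
  then obtain t where t: "cis t = c" by blast
  have "{\<theta> :: real ^ 'd. cis (\<theta> $ j) = c} \<subseteq> (\<Union>n::int. {\<theta>. \<theta> $ j = t + 2 * pi * of_int n})"
  proof
    fix \<theta> :: "real ^ 'd" assume "\<theta> \<in> {\<theta>. cis (\<theta> $ j) = c}"
    then have "sin (\<theta> $ j) = sin t \<and> cos (\<theta> $ j) = cos t" using t by (auto simp: complex_eq_iff)
    then show "\<theta> \<in> (\<Union>n::int. {\<theta>. \<theta> $ j = t + 2 * pi * of_int n})"
      unfolding sin_cos_eq_iff by auto
  qed
  moreover have "{\<theta> :: real ^ 'd. \<theta> $ j = a} \<in> null_sets lborel" for a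
  proof -
    have "closed {\<theta> :: real ^ 'd. \<theta> $ j = a}" by (intro closed_Collect_eq continuous_intros)
    moreover have "{\<theta> :: real ^ 'd. \<theta> $ j = a} \<in> null_sets lebesgue"
      using negligible_standard_hyperplane[of "axis j (1::real) :: real ^ 'd" a]
      by (simp add: negligible_iff_null_sets axis_in_Basis_iff inner_axis)
    ultimately show ?thesis by (simp add: null_sets_completion_iff borel_closed)
  qed
  then have "(\<Union>n::int. {\<theta> :: real ^ 'd. \<theta> $ j = t + 2 * pi * of_int n}) \<in> null_sets lborel"
    by (intro null_sets_UN) auto
  moreover have "closed {\<theta> :: real ^ 'd. cis (\<theta> $ j) = c}"
    by (intro closed_Collect_eq continuous_intros continuous_on_cis)
  then have "{\<theta> :: real ^ 'd. cis (\<theta> $ j) = c} \<in> sets lborel" by (simp add: borel_closed)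
  ultimately show ?thesis using null_sets_subset by blast
next
  case False
  then have "{\<theta> :: real ^ 'd. cis (\<theta> $ j) = c} = {}" by auto
  then show ?thesis by simp
qed

lemma AE_torus_measure:
  fixes \<tau> :: "complex ^ 'd"
  shows "AE z in torus_measure. z \<in> torus \<and> (\<forall>j. z $ j \<noteq> \<tau> $ j)"
proof -
  let ?N = "restrict_space lborel (cbox 0 (\<chi> j. 2 * pi)) :: (real ^ 'd) measure"
  let ?f = "\<lambda>\<theta> :: real ^ 'd. (\<chi> j. cis (\<theta> $ j)) :: complex ^ 'd"
  have "continuous_on UNIV ?f"
    by (intro continuous_on_vec_lambda continuous_on_cis continuous_intros)
  then have f: "?f \<in> measurable ?N borel"
    by (intro measurable_restrict_space1) (simp add: borel_measurable_continuous_onI)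
  have "open (\<Inter>j. {z :: complex ^ 'd. z $ j \<noteq> \<tau> $ j})"
    by (intro open_INT ballI open_Collect_neq continuous_intros) simp
  moreover have "closed (\<Inter>j. {z :: complex ^ 'd. cmod (z $ j) = 1})"
    by (intro closed_INT ballI closed_Collect_eq continuous_intros)
  moreover have "{z :: complex ^ 'd. z \<in> torus \<and> (\<forall>j. z $ j \<noteq> \<tau> $ j)} =
      (\<Inter>j. {z. cmod (z $ j) = 1}) \<inter> (\<Inter>j. {z. z $ j \<noteq> \<tau> $ j})" by (auto simp: torus_def)
  ultimately have S: "{z \<in> space borel. z \<in> torus \<and> (\<forall>j. z $ j \<noteq> \<tau> $ j)} \<in> sets borel"
    by (simp add: borel_open borel_closed sets.Int)
  have "AE \<theta> in lborel. cis (\<theta> $ j) \<noteq> \<tau> $ j" for j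
    by (rule AE_I'[OF cis_eq_null[of j "\<tau> $ j"]]) auto
  then have "AE \<theta> in lborel. \<forall>j\<in>UNIV. cis (\<theta> $ j) \<noteq> \<tau> $ j"
    by (intro AE_finite_allI) auto
  then have "AE \<theta> in ?N. ?f \<theta> \<in> torus \<and> (\<forall>j. ?f \<theta> $ j \<noteq> \<tau> $ j)"
    by (subst AE_restrict_space_iff) (auto simp: torus_def elim: eventually_mono)
  then show ?thesis unfolding torus_measure_def by (subst AE_distr_iff[OF f S])
qed

context colligation
begin

text \<open>If \<open>M\<close> were zero, the vector supplied by \<open>nontrivial\<close> would
  lie in \<open>N\<close>; but \<open>T\<close> annihilates it.\<close>

lemma M_nontrivial: "\<exists>x\<in>M. x \<noteq> 0"
proof (rule ccontr)
  assume triv: "\<not> ?thesis"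
  obtain x where x: "Pall x = x" "x \<noteq> 0" "V (\<Delta> \<tau> x) = 0" using nontrivial by blast
  have "op_one M x = 0" using triv op_one_in[OF M_subspace] by blast
  then have "x \<in> N" using op_one_M_eq[OF x(1)] op_one_in[OF N_subspace, of x] by simp
  moreover have "T x = 0" by (simp add: T_apply x(3) blinfun.zero_right)
  ultimately show False using x(2) by (simp add: N_def)
qed

lemma norm_op_one_M: "norm (op_one M) = 1"
  using M_nontrivial norm_op_one[OF M_subspace] by blast

text \<open>A product of half-planes that contains the polydisc and all torus points with every
  coordinate different from that of \<tau>. There \<open>Re (zet z $ j)\<close> is still positive,
  so the formula for \<open>I\<close> is its own analytic extension.\<close>

definition Dom :: "(complex ^ 'd) set" where "Dom = {z. \<forall>j. Re (cnj (\<tau> $ j) * z $ j) < 1}"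

lemma open_Dom: "open Dom"
proof -
  have "Dom = (\<Inter>j. {z. Re (cnj (\<tau> $ j) * z $ j) < 1})" by (auto simp: Dom_def)
  moreover have "open (\<Inter>j. {z :: complex ^ 'd. Re (cnj (\<tau> $ j) * z $ j) < 1})"
    by (intro open_INT ballI open_Collect_less continuous_intros) simp
  ultimately show ?thesis by (simp only:)
qed

lemma polydisc_Dom: "polydisc \<subseteq> Dom"
proof
  fix z :: "complex ^ 'd" assume "z \<in> polydisc"
  then show "z \<in> Dom"
    using complex_Re_le_cmod[of "cnj (\<tau> $ _) * z $ _"] unfolding Dom_def polydisc_def cnj_\<tau>_mult
    by (auto intro: le_less_trans)
qed

lemma zet_Dom:
  assumes z: "z \<in> Dom"
  shows "cnj (\<tau> $ j) * z $ j \<noteq> 1" and "\<exists>\<rho>>0. \<forall>j. \<rho> \<le> Re (zet z $ j)"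
proof -
  have less: "Re (cnj (\<tau> $ j) * z $ j) < 1" for j using z unfolding Dom_def by blast
  then show ne: "cnj (\<tau> $ j) * z $ j \<noteq> 1" for j by (metis less_irrefl one_complex.sel(1))
  have "0 < Re (zet z $ j)" for j
  proof -
    have "0 < Re (1 - cnj (\<tau> $ j) * z $ j) / (cmod (1 - cnj (\<tau> $ j) * z $ j))\<^sup>2"
      using less[of j] ne[of j] by (intro divide_pos_pos) (simp_all only: minus_complex.sel one_complex.sel, auto)
    then show ?thesis using Re_one_div[OF ne[of j]] by (simp add: zet_def)
  qed
  then have "0 < Min (range (\<lambda>j. Re (zet z $ j)))" by (subst Min_gr_iff) auto
  moreover have "Min (range (\<lambda>j. Re (zet z $ j))) \<le> Re (zet z $ j)" for j by (rule Min_le) auto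
  ultimately show "\<exists>\<rho>>0. \<forall>j. \<rho> \<le> Re (zet z $ j)" by blast
qed

section \<open>Analyticity and contractivity of \<open>I\<close>\<close>

lemma I_ops:
  assumes "z \<in> Dom"
  shows "I z \<in> ops M"
  using zet_Dom(2)[OF assms] B_ops unfolding I_def by (auto intro!: ops_diff[OF M_subspace] op_one_in_ops[OF M_subspace])

lemma I_analytic: "analytic_fun_on I Dom"
proof -
  have F: "analytic_fun_on (\<lambda>z. op_combination (zet z) Y) Dom"
    unfolding op_combination_def
  proof (intro analytic_fun_on_sum analytic_fun_on_scaleC)
    fix j
    show "analytic_fun_on (\<lambda>z. zet z $ j) Dom"
      unfolding zet_def vec_lambda_beta
    proof (rule analytic_fun_on_inverse)
      show "1 - cnj (\<tau> $ j) * z $ j \<noteq> 0" if "z \<in> Dom" for z using zet_Dom(1)[OF that] by simp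
    qed (intro analytic_fun_on_diff analytic_fun_on_const analytic_fun_on_cmult analytic_fun_on_nth)
  qed
  have "analytic_fun_on (\<lambda>z. B (zet z)) Dom"
  proof (rule analytic_fun_on_op_inverse[OF M_subspace open_Dom F comb_Y_ops])
    fix z assume "z \<in> Dom"
    then show "is_op_inverse M (op_combination (zet z) Y) (B (zet z))"
      using zet_Dom(2)[of z] B_inverse(1) by blast
  qed
  then show ?thesis unfolding I_def[abs_def] by (intro analytic_fun_on_diff analytic_fun_on_const)
qed

lemma I_apply: "x \<in> M \<Longrightarrow> I z x = x - B (zet z) x"
  by (simp add: I_def blinfun.diff_left op_one_id[OF M_subspace])

text \<open>Having finitely many coordinates gives a uniform \<open>\<epsilon>\<close> below all
  \<open>2 * Re (zet z $ j) - 1\<close>, and \<open>B\<close> is bounded below, so the defect of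
  \<open>I z\<close> is at least a fixed fraction of \<open>(norm x)\<^sup>2\<close>.\<close>

lemma norm_I_less_1:
  assumes z: "z \<in> polydisc"
  shows "norm (I z) < 1"
proof -
  define \<epsilon> where "\<epsilon> = Min (range (\<lambda>j. 2 * Re (zet z $ j) - 1))"
  have \<epsilon>: "0 < \<epsilon>" unfolding \<epsilon>_def using zet_polydisc(2)[OF z] by (subst Min_gr_iff) auto
  have \<epsilon>le: "\<epsilon> \<le> 2 * Re (zet z $ j) - 1" for j unfolding \<epsilon>_def by (rule Min_le) auto
  define Z where "Z = 1 / (1 - maxnorm z)"
  have Z: "Z > 0" "\<And>j. cmod (zet z $ j) \<le> Z"
    using zet_polydisc(3)[OF z] maxnorm_less_1[OF z] by (auto simp: Z_def)
  \<comment> \<open>The maximum protects the square root; \<open>q < 1\<close> because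
    \<open>\<epsilon> / Z\<^sup>2\<close> is positive.\<close>
  define q where "q = sqrt (max 0 (1 - \<epsilon> / Z\<^sup>2))"
  have q: "0 \<le> q" "q < 1" using \<epsilon> Z(1) by (auto simp: q_def)
  have "norm (I z) \<le> q"
  proof (rule norm_ops_le[OF M_subspace I_ops q(1)])
    show "z \<in> Dom" using z polydisc_Dom by blast
    fix x assume x: "x \<in> M"
    have bM: "B (zet z) x \<in> M" by (rule B_apply(3)[OF half zet_polydisc(1)[OF z] x])
    have "norm x \<le> Z * norm (B (zet z) x)"
      by (rule B_bounded_below[OF half zet_polydisc(1)[OF z] Z(2,1) x])
    then have "(norm x)\<^sup>2 \<le> (Z * norm (B (zet z) x))\<^sup>2" by (intro power_mono) auto
    then have "\<epsilon> / Z\<^sup>2 * (norm x)\<^sup>2 \<le> \<epsilon> / Z\<^sup>2 * (Z\<^sup>2 * (norm (B (zet z) x))\<^sup>2)"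
      using \<epsilon> by (intro mult_left_mono) (auto simp: power_mult_distrib)
    also have "\<dots> = (\<Sum>j\<in>UNIV. \<epsilon> * (norm (P j (B (zet z) x)))\<^sup>2)"
      using Z(1) norm_sq_M[OF bM] by (simp add: sum_distrib_left)
    also have "\<dots> \<le> (\<Sum>j\<in>UNIV. (2 * Re (zet z $ j) - 1) * (norm (P j (B (zet z) x)))\<^sup>2)"
      by (intro sum_mono mult_right_mono \<epsilon>le) simp
    also have "\<dots> = (norm x)\<^sup>2 - (norm (I z x))\<^sup>2"
      using norm_defect_B[OF half zet_polydisc(1)[OF z] x] by (simp add: I_apply[OF x])
    finally have "(norm (I z x))\<^sup>2 \<le> (1 - \<epsilon> / Z\<^sup>2) * (norm x)\<^sup>2" by (simp add: algebra_simps)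
    also have "\<dots> \<le> max 0 (1 - \<epsilon> / Z\<^sup>2) * (norm x)\<^sup>2" by (intro mult_right_mono) auto
    also have "\<dots> = (q * norm x)\<^sup>2" by (simp add: q_def power_mult_distrib)
    finally show "norm (I z x) \<le> q * norm x" by (rule power2_le_imp_le) (use q in simp)
  qed
  then show ?thesis using q by simp
qed

lemma um_analytic: "analytic_fun_on um polydisc"
  unfolding um_def[abs_def]
  by (rule analytic_fun_on_linear[OF u_analytic blinfun.bounded_linear_right])
    (rule ops_scaleC[OF op_one_in_ops[OF M_subspace]])

lemma generalized_model:
  assumes "separable_space (top_of_set M)"
  shows "generalized_model \<phi> M um I"
  unfolding generalized_model_def
proof (intro conjI ballI M_subspace assms um_in_M um_analytic)
  show "I z \<in> ops M" "norm (I z) < 1" if "z \<in> polydisc" for z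
    using that polydisc_Dom I_ops norm_I_less_1 by auto
  show "analytic_fun_on I polydisc" by (rule analytic_fun_on_subset[OF I_analytic polydisc_Dom])
  fix z w :: "complex ^ 'd" assume z: "z \<in> polydisc" and w: "w \<in> polydisc"
  have Iw: "I w \<in> ops UNIV" using w polydisc_Dom I_ops ops_UNIV by blast
  have "cinner ((op_one M - (op_adjoint (I w) o\<^sub>L I z)) (um z)) (um w) =
      cinner (um z) (um w) - cinner (I z (um z)) (I w (um w))"
    by (simp add: blinfun.diff_left cinner_diff_left op_one_id[OF M_subspace um_in_M] cinner_op_adjoint_left[OF Iw])
  then show "1 - cnj (\<phi> w) * \<phi> z = cinner ((op_one M - (op_adjoint (I w) o\<^sub>L I z)) (um z)) (um w)"
    by (simp add: I_um[OF z] I_um[OF w] model_identity[OF z w])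
qed

section \<open>Behaviour at \<tau>\<close>

lemma \<tau>_not_polydisc: "\<tau> \<notin> polydisc"
  by (simp add: polydisc_def \<tau>_cmod)

lemma um_tendsto:
  assumes "approaches_nt S \<tau>"
  shows "(um \<longlongrightarrow> x0) (at \<tau> within S)"
proof -
  obtain c where c: "c > 0" "\<And>z. z \<in> S \<Longrightarrow> maxnorm (z - \<tau>) \<le> c * (1 - maxnorm z)" and S: "S \<subseteq> polydisc"
    using assms unfolding approaches_nt_def by blast
  show ?thesis
    unfolding tendsto_at_iff_sequentially
  proof (intro allI impI)
    fix X assume X: "\<forall>i. X i \<in> S - {\<tau>}" "X \<longlonglongrightarrow> \<tau>"
    show "(um \<circ> X) \<longlonglongrightarrow> x0"
      unfolding o_def by (rule um_limit[of _ c]) (use X S c in auto)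
  qed
qed

lemma C_point: "C_point \<tau> M um"
  unfolding C_point_def
proof (intro allI impI)
  fix S assume nt: "approaches_nt S \<tau>"
  then have S: "S \<subseteq> polydisc" by (simp add: approaches_nt_def)
  \<comment> \<open>Since \<tau> is outside the polydisc, prescribing the value \<open>x0\<close>
    there does not disturb \<open>um\<close> on \<open>S\<close>.\<close>
  define f where "f z = (if z = \<tau> then x0 else um z)" for z
  have "continuous_on (insert \<tau> S) f"
    unfolding continuous_on_def
  proof
    fix a assume a: "a \<in> insert \<tau> S"
    show "(f \<longlongrightarrow> f a) (at a within insert \<tau> S)"
    proof (cases "a = \<tau>")
      case True
      have "(f \<longlongrightarrow> x0) (at \<tau> within S)"
        by (rule Lim_transform_within[OF um_tendsto[OF nt], of 1]) (auto simp: f_def)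
      then show ?thesis
        unfolding True by (simp add: f_def tendsto_at_iff_sequentially[of _ _ \<tau> "insert \<tau> S"] tendsto_at_iff_sequentially[of _ _ \<tau> S])
    next
      case False
      then have "a \<in> polydisc" using a S by blast
      then have "isCont um a"
        using continuous_on_interior analytic_fun_on_continuous[OF um_analytic] interior_open[OF open_polydisc] by blast
      then have "(um \<longlongrightarrow> um a) (at a within insert \<tau> S)"
        using isCont_def tendsto_within_subset by blast
      then have "(f \<longlongrightarrow> um a) (at a within insert \<tau> S)"
        by (rule Lim_transform_within_open[of _ _ _ _ "- {\<tau>}"]) (use False in \<open>auto simp: f_def\<close>)
      then show ?thesis using False by (simp add: f_def)
    qed
  qed
  moreover have "f z = um z" if "z \<in> S" for z using that S \<tau>_not_polydisc by (auto simp: f_def)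
  ultimately show "\<exists>v. continuous_on (insert \<tau> S) v \<and> v \<tau> \<in> M \<and> (\<forall>z\<in>S. v z = um z)"
    using x0(1) by (intro exI[of _ f]) (auto simp: f_def)
qed

lemma norm_op_one_diff_I:
  assumes "\<rho> > 0" "\<And>j. \<rho> \<le> Re (zet z $ j)"
  shows "norm (op_one M - I z) \<le> 1 / \<rho>"
proof -
  have "norm (B (zet z)) \<le> 1 / \<rho>"
    using B_inverse(2)[OF assms] assms(1) by (intro norm_blinfun_bound) auto
  then show ?thesis by (simp add: I_def)
qed

text \<open>In a nontangential region the real parts of \<open>zet z\<close> are at least
  \<open>1 / (c\<^sup>2 * (1 - maxnorm z))\<close>, so their inverse combination
  \<open>1 - I z\<close> is of order \<open>1 - maxnorm z\<close>.\<close>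

lemma I_nt_lim: "nt_lim I (op_one M) \<tau>"
  unfolding nt_lim_def
proof (intro allI impI)
  fix S assume "approaches_nt S \<tau>"
  then obtain c where c: "c > 0" "\<And>z. z \<in> S \<Longrightarrow> maxnorm (z - \<tau>) \<le> c * (1 - maxnorm z)" and S: "S \<subseteq> polydisc"
    unfolding approaches_nt_def by blast
  have "((\<lambda>z. I z - op_one M) \<longlongrightarrow> 0) (at \<tau> within S)"
  proof (rule Lim_null_comparison)
    have "norm (I z - op_one M) \<le> c\<^sup>2 * norm (z - \<tau>)" if z: "z \<in> S" for z
    proof -
      have zp: "z \<in> polydisc" using z S by blast
      have s: "0 < 1 - maxnorm z" using maxnorm_less_1[OF zp] by simp
      have "norm (op_one M - I z) \<le> 1 / (1 / (c\<^sup>2 * (1 - maxnorm z)))"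
        by (rule norm_op_one_diff_I[OF _ nt_bounds[OF zp c(1) c(2)[OF z]]]) (use c(1) s in simp)
      also have "\<dots> = c\<^sup>2 * (1 - maxnorm z)" by simp
      also have "\<dots> \<le> c\<^sup>2 * norm (z - \<tau>)" by (intro mult_left_mono one_minus_maxnorm_le \<tau>) simp
      finally show ?thesis by (simp add: norm_minus_commute)
    qed
    then show "\<forall>\<^sub>F z in at \<tau> within S. norm (I z - op_one M) \<le> c\<^sup>2 * norm (z - \<tau>)"
      by (auto simp: eventually_at_filter)
    have "((\<lambda>z. c\<^sup>2 * norm (z - \<tau>)) \<longlongrightarrow> c\<^sup>2 * norm (\<tau> - \<tau>)) (at \<tau> within S)" by (intro tendsto_intros)
    then show "((\<lambda>z. c\<^sup>2 * norm (z - \<tau>)) \<longlongrightarrow> 0) (at \<tau> within S)" by simp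
  qed
  then show "(I \<longlongrightarrow> op_one M) (at \<tau> within S)" by (simp add: LIM_zero_iff)
qed

text \<open>At \<open>r *\<^sub>R \<tau>\<close> all coordinates of \<open>zet\<close> equal
  \<open>1 / (1 - r)\<close>; hence \<open>norm (op_one M - I z) \<le> 1 - r\<close>, and the
  quotient is at most 1 because \<open>op_one M\<close> has norm 1.\<close>

lemma I_carapoint: "carapoint \<tau> I"
proof -
  let ?F = "at \<tau> within polydisc" and ?q = "\<lambda>z. (1 - norm (I z)) / (1 - maxnorm z)"
  have "Liminf ?F (\<lambda>z. ereal (?q z)) \<le> 1"
  proof (rule ccontr)
    assume "\<not> ?thesis"
    then have "1 < Liminf ?F (\<lambda>z. ereal (?q z))" by simp
    then have "\<forall>\<^sub>F z in ?F. 1 < ereal (?q z)" by (rule less_LiminfD)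
    then obtain d where d: "d > 0" "\<And>z. z \<in> polydisc \<Longrightarrow> z \<noteq> \<tau> \<Longrightarrow> dist z \<tau> < d \<Longrightarrow> 1 < ereal (?q z)"
      unfolding eventually_at by blast
    \<comment> \<open>Positive, and so close to 1 that \<open>r *\<^sub>R \<tau>\<close> is within
      \<open>d\<close> of \<tau>.\<close>
    define r where "r = max (1/2) (1 - d / (2 * (norm \<tau> + 1)))"
    have r: "0 < r" "r < 1" using d(1) by (auto simp: r_def add_nonneg_pos)
    define z where "z = r *\<^sub>R \<tau>"
    have zc: "cmod (z $ j) = r" for j using r by (simp add: z_def \<tau>_cmod)
    then have zp: "z \<in> polydisc" using r by (simp add: polydisc_def)
    have mz: "maxnorm z = r"
    proof (rule antisym)
      show "maxnorm z \<le> r" by (rule maxnorm_le) (simp add: zc)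
      show "r \<le> maxnorm z" using cmod_le_maxnorm[of z undefined] by (simp add: zc)
    qed
    have "dist z \<tau> = (1 - r) * norm \<tau>"
    proof -
      have "z - \<tau> = (r - 1) *\<^sub>R \<tau>" by (simp add: z_def algebra_simps)
      then show ?thesis using r by (simp add: dist_norm)
    qed
    also have "\<dots> \<le> d / (2 * (norm \<tau> + 1)) * norm \<tau>" by (intro mult_right_mono) (auto simp: r_def)
    also have "\<dots> < d" using d(1) by (simp add: divide_simps add_nonneg_pos)
    finally have "1 < ereal (?q z)" using \<tau>_not_polydisc zp by (intro d(2)) auto
    moreover have "1 - norm (I z) \<le> 1 - r"
    proof -
      have "cnj (\<tau> $ j) * z $ j = of_real r * (\<tau> $ j * cnj (\<tau> $ j))" for j
        by (simp add: z_def scaleR_conv_of_real[of _ "_ :: complex"])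
      then have "zet z $ j = of_real (1 / (1 - r))" for j by (simp add: zet_def \<tau>_cnj)
      then have "norm (op_one M - I z) \<le> 1 / (1 / (1 - r))"
        using r by (intro norm_op_one_diff_I) auto
      then show ?thesis using norm_triangle_ineq2[of "op_one M" "I z"] by (simp add: norm_op_one_M)
    qed
    then have "?q z \<le> 1" using r by (simp add: mz divide_simps)
    ultimately show False by simp
  qed
  then show ?thesis unfolding carapoint_def using le_less_trans by fastforce
qed

section \<open>Behaviour on the torus\<close>

lemma torus_Dom:
  assumes p: "p \<in> torus" "\<And>j. p $ j \<noteq> \<tau> $ j"
  shows "p \<in> Dom" and "2 * Re (zet p $ j) = 1"
proof -
  define w where "w j = cnj (\<tau> $ j) * p $ j" for j
  have cw: "cmod (w j) = 1" for j using p(1) by (simp add: w_def cnj_\<tau>_mult torus_def)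
  have w1: "w j \<noteq> 1" for j
    using p(2)[of j] cnj_\<tau>_mult(2)[of j "p $ j"] by (auto simp: w_def)
  then show "2 * Re (zet p $ j) = 1"
    using two_Re_one_div[OF w1[of j]] cw[of j] by (simp add: zet_def w_def)
  have "Re (w j) < 1" for j
  proof (rule ccontr)
    assume "\<not> Re (w j) < 1"
    then have "Re (w j) = 1" using complex_Re_le_cmod[of "w j"] cw[of j] by simp
    moreover have "(Re (w j))\<^sup>2 + (Im (w j))\<^sup>2 = 1" using cw[of j] cmod_power2[of "w j"] by simp
    ultimately show False using w1[of j] by (simp add: complex_eq_iff)
  qed
  then show "p \<in> Dom" by (simp add: Dom_def w_def)
qed

text \<open>At these points all factors \<open>2 * Re (zet p $ j) - 1\<close> in the defect formula
  vanish.\<close>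

lemma I_isometric:
  assumes p: "p \<in> torus" "\<And>j. p $ j \<noteq> \<tau> $ j" and x: "x \<in> M"
  shows "norm (I p x) = norm x"
proof -
  obtain \<rho> where \<rho>: "\<rho> > 0" "\<And>j. \<rho> \<le> Re (zet p $ j)" using zet_Dom(2)[OF torus_Dom(1)[OF p]] by blast
  have "(norm (I p x))\<^sup>2 = (norm x)\<^sup>2"
    using norm_defect_B[OF \<rho> x] by (simp add: torus_Dom(2)[OF p] I_apply[OF x])
  then show ?thesis by (rule power2_eq_imp_eq) auto
qed

lemma I_inner: "inner_fun M I"
  unfolding inner_fun_def
proof (rule AE_mp[OF AE_torus_measure[of \<tau>]], rule AE_I2, rule impI)
  fix p :: "complex ^ 'd" assume "p \<in> torus \<and> (\<forall>j. p $ j \<noteq> \<tau> $ j)"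
  then have p: "p \<in> torus" "\<And>j. p $ j \<noteq> \<tau> $ j" by auto
  note pD = torus_Dom(1)[OF p]
  have "isCont I p"
    using continuous_on_interior[OF analytic_fun_on_continuous[OF I_analytic]] interior_open[OF open_Dom] pD by blast
  moreover have "((\<lambda>r. r *\<^sub>R p) \<longlongrightarrow> 1 *\<^sub>R p) (at_left 1)" by (intro tendsto_intros)
  ultimately have "((\<lambda>r. I (r *\<^sub>R p)) \<longlongrightarrow> I p) (at_left 1)"
    using isCont_tendsto_compose by fastforce
  then have "((\<lambda>r. I (r *\<^sub>R p) x) \<longlongrightarrow> I p x) (at_left 1)" for x by (intro tendsto_intros)
  moreover have "isometric_op M (I p)"
    unfolding isometric_op_def using I_ops[OF pD] I_isometric[OF p] by blast
  ultimately show "\<exists>A. isometric_op M A \<and> (\<forall>x\<in>M. ((\<lambda>r. I (r *\<^sub>R p) x) \<longlongrightarrow> A x) (at_left 1))" by blast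
qed

lemma I_extends:
  assumes p: "p \<in> torus" "\<And>j. p $ j \<noteq> \<tau> $ j"
  shows "extends_analytically_with_value M I p (I p)" and "norm (I p) = 1"
proof -
  show "extends_analytically_with_value M I p (I p)"
    unfolding extends_analytically_with_value_def
    using open_Dom torus_Dom(1)[OF p] I_analytic I_ops by (intro exI[of _ Dom] exI[of _ I]) auto
  obtain x where x: "x \<in> M" "x \<noteq> 0" using M_nontrivial by blast
  have "norm (I p) \<le> 1"
    by (rule norm_ops_le[OF M_subspace I_ops[OF torus_Dom(1)[OF p]]]) (simp_all add: I_isometric[OF p])
  moreover have "1 \<le> norm (I p)"
    using norm_blinfun[of "I p" x] x by (simp add: I_isometric[OF p x(1)])
  ultimately show "norm (I p) = 1" by simp
qed

section \<open>The tuple \<open>Y\<close> and the assembled model\<close>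

lemma Y_positive_contraction: "positive_op M (Y j)" "contraction M (Y j)"
proof -
  have c: "cinner (Y j x) x = of_real ((norm (P j x))\<^sup>2)" if x: "x \<in> M" for x
    by (simp add: Y_def op_one_id[OF M_subspace x] op_one_cinner_right[OF M_subspace x] cinner_P_self)
  show "positive_op M (Y j)"
    unfolding positive_op_def using Y_ops c by (auto simp del: of_real_power)
  have Pn: "norm (P j x) \<le> norm x" for x
  proof (rule power2_le_imp_le)
    have "(norm (P j x))\<^sup>2 \<le> (\<Sum>i\<in>UNIV. (norm (P i x))\<^sup>2)" by (rule member_le_sum) auto
    also have "\<dots> = (norm (Pall x))\<^sup>2" by (simp add: norm_Pall_sq)
    also have "\<dots> \<le> (norm x)\<^sup>2" by (intro power_mono norm_Pall_le) simp
    finally show "(norm (P j x))\<^sup>2 \<le> (norm x)\<^sup>2" .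
  qed simp
  have "norm (Y j) \<le> 1"
  proof (rule norm_blinfun_bound)
    fix x
    show "norm (Y j x) \<le> 1 * norm x"
      unfolding Y_def blinfun_apply_blinfun_compose
      using order_trans[OF norm_op_one_apply_le[OF M_subspace] order_trans[OF Pn norm_op_one_apply_le[OF M_subspace]]]
      by simp
  qed simp
  then show "contraction M (Y j)" by (simp add: contraction_def Y_ops)
qed

lemma sum_Y: "(\<Sum>j\<in>UNIV. Y j) = op_one M"
proof (rule ops_eqI[OF M_subspace ops_sum[OF M_subspace Y_ops] op_one_in_ops[OF M_subspace]])
  fix x assume x: "x \<in> M"
  have "(\<Sum>j\<in>UNIV. Y j) x = op_one M (Pall x)"
    by (simp add: blinfun.sum_left Y_def op_one_id[OF M_subspace x] Pall_apply blinfun.sum_right)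
  then show "(\<Sum>j\<in>UNIV. Y j) x = op_one M x" by (simp add: M_Pall[OF x])
qed

text \<open>\<open>op_inverse\<close> is a definite description; this existence statement is what
  gives content to the formula for \<open>I\<close>.\<close>

lemma invertible_comb:
  assumes "z \<in> polydisc"
  shows "op_invertible M (op_combination (zet z) Y)"
  unfolding op_invertible_def using comb_Y_ops B_inverse(1)[OF half zet_polydisc(1)[OF assms]] by blast

lemma desingularized_model:
  assumes "separable_space (top_of_set M)"
  shows "desingularized_model \<phi> \<tau> M um I"
  unfolding desingularized_model_def
  using generalized_model[OF assms] C_point I_carapoint I_nt_lim I_inner by blast

end

section \<open>Coordinate projections in the sequence space\<close>

lemma ell2_nth_add [simp]: "ell2_nth (x + y) n = ell2_nth x n + ell2_nth y n"
  by (simp add: plus_ell2.rep_eq)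

lemma ell2_nth_zero [simp]: "ell2_nth 0 n = 0"
  by (simp add: zero_ell2.rep_eq)

lemma ell2_nth_scaleC [simp]: "ell2_nth (c *\<^sub>C x) n = c * ell2_nth x n"
  by (simp add: scaleC_ell2.rep_eq)

lemma ell2_nth_sum: "ell2_nth (\<Sum>i\<in>A. f i) n = (\<Sum>i\<in>A. ell2_nth (f i) n)"
  by (induction A rule: infinite_finite_induct) auto

lemma cinner_basis_right: "cinner x (ell2_basis n) = ell2_nth x n"
proof -
  have "(\<lambda>m. ell2_nth x m * cnj (ell2_nth (ell2_basis n) m)) = (\<lambda>m. if m = n then ell2_nth x m else 0)"
    by (auto simp: ell2_nth_basis)
  then show ?thesis
    unfolding cinner_ell2_def using sums_single[of n "ell2_nth x"] by (simp add: sums_iff)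
qed

definition coord_proj :: "nat set \<Rightarrow> ell2 \<Rightarrow>\<^sub>L ell2"
  where "coord_proj A = Blinfun (\<lambda>x. Abs_ell2 (\<lambda>n. if n \<in> A then ell2_nth x n else 0))"

lemma coord_proj_nth: "ell2_nth (coord_proj A x) n = (if n \<in> A then ell2_nth x n else 0)"
proof -
  define f where "f x = Abs_ell2 (\<lambda>n. if n \<in> A then ell2_nth x n else 0)" for x
  have f: "ell2_nth (f x) n = (if n \<in> A then ell2_nth x n else 0)" for x n
  proof -
    have "summable (\<lambda>n. (cmod (if n \<in> A then ell2_nth x n else 0))\<^sup>2)"
      by (rule summable_comparison_test'[OF ell2_nth_summable[of x]]) auto
    then show ?thesis by (simp add: f_def Abs_ell2_inverse)
  qed
  have "norm (f x) \<le> norm x" for x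
  proof (rule power2_le_imp_le)
    show "(norm (f x))\<^sup>2 \<le> (norm x)\<^sup>2"
      unfolding norm_ell2_sq by (intro suminf_le ell2_nth_summable) (simp add: f)
  qed simp
  then have "bounded_linear f"
    by (intro bounded_linear_intro[where K=1])
      (auto intro!: ell2_eqI simp: f scaleR_scaleC[of _ "_ :: ell2"])
  then show ?thesis using f by (simp add: coord_proj_def f_def[abs_def] bounded_linear_Blinfun_apply)
qed

lemma cinner_coord_proj: "cinner (coord_proj A x) y = cinner x (coord_proj A y)"
  unfolding cinner_ell2_def coord_proj_nth
  by (intro arg_cong[of _ _ suminf] ext) simp

lemma coord_proj_basis: "coord_proj A (ell2_basis n) = (if n \<in> A then ell2_basis n else 0)"
  by (rule ell2_eqI) (auto simp: coord_proj_nth ell2_nth_basis)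

lemma clspan_basis: "clspan ell2_basis = UNIV"
proof -
  have "x \<in> clspan ell2_basis" for x
  proof -
    define y where "y = x - op_one (clspan ell2_basis) x"
    have "ell2_nth y n = 0" for n
    proof -
      have "cinner y (ell2_basis n) = 0"
        unfolding y_def by (rule op_one_orth[OF hilbert_subspace_clspan in_clspan])
      then show ?thesis by (simp add: cinner_basis_right)
    qed
    then have "y = 0" by (intro ell2_eqI) simp
    then show ?thesis
      using op_one_in[OF hilbert_subspace_clspan[of ell2_basis], of x] by (simp add: y_def)
  qed
  then show ?thesis by blast
qed

lemma ell2_countable_dense: "\<exists>C :: ell2 set. countable C \<and> closure C = UNIV"
proof -
  obtain D :: "complex set" where D: "countable D" "\<And>X. open X \<Longrightarrow> X \<noteq> {} \<Longrightarrow> \<exists>d\<in>D. d \<in> X"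
    using countable_dense_exists by blast
  define C where "C = (\<lambda>xs. \<Sum>k<length xs. (xs ! k) *\<^sub>C ell2_basis k) ` lists D"
  have "(\<Sum>k<n. c k *\<^sub>C ell2_basis k) \<in> closure C" for n and c :: "nat \<Rightarrow> complex"
    unfolding closure_approachable
  proof (intro allI impI)
    fix e :: real assume e: "e > 0"
    \<comment> \<open>A tolerance of which \<open>n\<close> copies add up to less than
      \<open>e\<close>, also for \<open>n = 0\<close>.\<close>
    have "0 < e / (real n + 1)" using e by (intro divide_pos_pos) auto
    then have "c k \<in> ball (c k) (e / (real n + 1))" for k by simp
    then have "\<exists>d\<in>D. d \<in> ball (c k) (e / (real n + 1))" for k
      using D(2)[OF open_ball] by blast
    then have "\<exists>d\<in>D. dist d (c k) < e / (real n + 1)" for k by (simp add: dist_commute)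
    then obtain d where d: "\<And>k. d k \<in> D" "\<And>k. dist (d k) (c k) < e / (real n + 1)" by metis
    define xs where "xs = map d [0..<n]"
    have "xs \<in> lists D" using d(1) by (auto simp: xs_def)
    then have "(\<Sum>k<length xs. (xs ! k) *\<^sub>C ell2_basis k) \<in> C" unfolding C_def by (rule imageI)
    moreover have "(\<Sum>k<length xs. (xs ! k) *\<^sub>C ell2_basis k) = (\<Sum>k<n. d k *\<^sub>C ell2_basis k)"
      by (intro sum.cong) (auto simp: xs_def)
    moreover have "dist (\<Sum>k<n. d k *\<^sub>C ell2_basis k) (\<Sum>k<n. c k *\<^sub>C ell2_basis k) < e"
    proof -
      have n1: "norm (ell2_basis k) = 1" for k
      proof -
        have "complex_of_real ((norm (ell2_basis k))\<^sup>2) = 1"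
          using cinner_self[of "ell2_basis k"] by (simp add: cinner_ell2_basis)
        then have "(norm (ell2_basis k))\<^sup>2 = 1" by (simp only: of_real_eq_1_iff)
        then show ?thesis using norm_ge_zero[of "ell2_basis k"] by (simp add: power2_eq_1_iff)
      qed
      have "norm ((\<Sum>k<n. d k *\<^sub>C ell2_basis k) - (\<Sum>k<n. c k *\<^sub>C ell2_basis k)) \<le> (\<Sum>k<n. e / (real n + 1))"
        unfolding sum_subtractf[symmetric] scaleC_diff_left[symmetric]
        by (rule sum_norm_le) (use d(2) in \<open>simp add: norm_scaleC n1 dist_norm less_imp_le\<close>)
      also have "\<dots> < e" using e by (simp add: divide_simps)
      finally show ?thesis by (simp add: dist_norm)
    qed
    ultimately show "\<exists>y\<in>C. dist y (\<Sum>k<n. c k *\<^sub>C ell2_basis k) < e" by auto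
  qed
  then have "clspan ell2_basis \<subseteq> closure C"
    unfolding clspan_def by (intro closure_minimal) auto
  then show ?thesis
    using countable_image[OF countable_lists[OF D(1)]] unfolding clspan_basis C_def by (metis UNIV_I subset_antisym subset_UNIV)
qed

text \<open>The projection onto \<open>M\<close> maps a countable dense subset of the whole space
  onto a countable dense subset of \<open>M\<close>.\<close>

lemma separable_hilbert_subspace:
  fixes M :: "ell2 set"
  assumes M: "hilbert_subspace M"
  shows "separable_space (top_of_set M)"
proof -
  obtain C :: "ell2 set" where C: "countable C" "closure C = UNIV" using ell2_countable_dense by blast
  define p where "p = blinfun_apply (op_one M)"
  have "M \<subseteq> closure (p ` C)"
  proof
    fix x assume "x \<in> M"
    have "p ` closure C \<subseteq> closure (p ` C)"
      unfolding p_def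
      by (rule image_closure_subset[OF _ closed_closure closure_subset]) (intro continuous_intros)
    then have "p x \<in> closure (p ` C)" using C(2) by blast
    then show "x \<in> closure (p ` C)" using op_one_id[OF M \<open>x \<in> M\<close>] by (simp add: p_def)
  qed
  moreover have "p ` C \<subseteq> M" using op_one_in[OF M] by (auto simp: p_def)
  ultimately have "top_of_set M closure_of (p ` C) = M"
    by (auto simp: closure_of_subtopology Int_absorb1)
  then show ?thesis
    unfolding separable_space_def using C(1) \<open>p ` C \<subseteq> M\<close> by (intro exI[of _ "p ` C"]) auto
qed

text \<open>Index 0 is reserved for \<open>e0\<close>; the positive indices are divided by residue
  into one infinite class per coordinate, which \<open>loc j\<close> enumerates.\<close>

lemma index_partition:
  "\<exists>(cls :: nat \<Rightarrow> 'd::finite option) (loc :: 'd \<Rightarrow> nat \<Rightarrow> nat). (\<forall>n. cls n = None \<longleftrightarrow> n = 0) \<and>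
    (\<forall>j k. cls (loc j k) = Some j) \<and> (\<forall>j. inj (loc j))"
proof -
  obtain f :: "'d \<Rightarrow> nat" where f: "bij_betw f UNIV {0..<CARD('d)}"
    using ex_bij_betw_finite_nat[of "UNIV :: 'd set"] by auto
  define cls where "cls n = (case n of 0 \<Rightarrow> None | Suc m \<Rightarrow> Some (inv_into UNIV f (m mod CARD('d))))" for n
  define loc where "loc j k = Suc (k * CARD('d) + f j)" for j k
  have "f j < CARD('d)" for j using bij_betwE[OF f] by auto
  then have "cls (loc j k) = Some j" for j k
    using bij_betw_imp_inj_on[OF f] by (simp add: cls_def loc_def)
  moreover have "cls n = None \<longleftrightarrow> n = 0" for n by (cases n) (simp_all add: cls_def)
  moreover have "inj (loc j)" for j by (rule injI) (simp add: loc_def)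
  ultimately show ?thesis by blast
qed

lemma polydisc_dense_sequence:
  "\<exists>q :: nat \<Rightarrow> complex ^ 'd. (\<forall>k. q k \<in> polydisc) \<and> polydisc \<subseteq> closure (range q)"
proof -
  obtain D :: "(complex ^ 'd) set" where D: "countable D" "\<And>X. open X \<Longrightarrow> X \<noteq> {} \<Longrightarrow> \<exists>d\<in>D. d \<in> X"
    using countable_dense_exists by blast
  have "(0 :: complex ^ 'd) \<in> polydisc" by (simp add: polydisc_def)
  then have ne: "D \<inter> polydisc \<noteq> {}" using D(2)[OF open_polydisc] by blast
  define q where "q = from_nat_into (D \<inter> polydisc)"
  have rq: "range q = D \<inter> polydisc"
    unfolding q_def by (rule range_from_nat_into[OF ne]) (simp add: D(1))
  have "z \<in> closure (range q)" if z: "z \<in> polydisc" for z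
    unfolding closure_approachable rq
  proof (intro allI impI)
    fix e :: real assume "e > 0"
    then have "z \<in> ball z e \<inter> polydisc" using z by simp
    then obtain d where "d \<in> D" "d \<in> ball z e \<inter> polydisc"
      using D(2)[of "ball z e \<inter> polydisc"] open_polydisc by blast
    then show "\<exists>y\<in>D \<inter> polydisc. dist y z < e" by (auto simp: dist_commute)
  qed
  then show ?thesis using rq by (intro exI[of _ q]) auto
qed

lemma continuous_eq_on_dense:
  fixes f g :: "'a::first_countable_topology \<Rightarrow> 'b::t2_space"
  assumes "continuous_on S f" "continuous_on S g" "range q \<subseteq> S" "S \<subseteq> closure (range q)"
    and "\<And>k. f (q k) = g (q k)" "z \<in> S"
  shows "f z = g z"
proof -
  obtain X where X: "\<And>n. X n \<in> range q" "X \<longlonglongrightarrow> z"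
    using subsetD[OF assms(4,6)] unfolding closure_sequential by blast
  have "(\<lambda>n. f (X n)) \<longlonglongrightarrow> f z" "(\<lambda>n. g (X n)) \<longlonglongrightarrow> g z"
    by (rule continuous_on_tendsto_compose[OF assms(1) X(2) assms(6)]
        continuous_on_tendsto_compose[OF assms(2) X(2) assms(6)];
        use X(1) assms(3) in \<open>auto intro!: always_eventually\<close>)+
  moreover have "f (X n) = g (X n)" for n using X(1)[of n] assms(5) by auto
  ultimately show ?thesis using LIMSEQ_unique by simp
qed

section \<open>The colligation of a Schur-Agler function\<close>

text \<open>The Agler kernels are realized by vectors \<open>w j k\<close> in the range of
  \<open>P j\<close>, and the decomposition says that \<open>a k \<mapsto> b k\<close> preserves
  inner products. Its contractive extension \<open>V\<close> defines \<open>u\<close> on the whole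
  polydisc through a resolvent that reproduces the Gram vectors at the nodes; the remaining
  identities spread from the nodes by density.\<close>

lemma schur_agler_colligation:
  fixes \<phi> :: "complex ^ 'd \<Rightarrow> complex" and \<tau> :: "complex ^ 'd"
  assumes \<tau>: "\<tau> \<in> torus" and \<phi>: "\<phi> \<in> schur_agler TYPE(ell2)" and cara: "carapoint \<tau> \<phi>"
  shows "\<exists>(P :: 'd \<Rightarrow> ell2 \<Rightarrow>\<^sub>L ell2) e0 V u. colligation P e0 V u \<phi> \<tau>"
proof -
  have an: "analytic_fun_on \<phi> polydisc" using \<phi> by (simp add: schur_agler_def)
  obtain cls :: "nat \<Rightarrow> 'd option" and loc :: "'d \<Rightarrow> nat \<Rightarrow> nat" where cls: "\<And>n. cls n = None \<longleftrightarrow> n = 0"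
    "\<And>j k. cls (loc j k) = Some j" and loc: "\<And>j. inj (loc j)"
    using index_partition by metis
  define P where "P j = coord_proj {n. cls n = Some j}" for j
  define e0 where "e0 = ell2_basis 0"
  interpret projections P
  proof
    show "P j \<in> ops UNIV" for j
      unfolding ops_UNIV_iff P_def by (auto intro!: ell2_eqI simp: coord_proj_nth)
    show "P j (P k x) = (if j = k then P j x else 0)" for j k x
      by (rule ell2_eqI) (auto simp: P_def coord_proj_nth)
    show "cinner (P j x) y = cinner x (P j y)" for j x y
      unfolding P_def by (rule cinner_coord_proj)
  qed
  have P_basis: "P j (ell2_basis n) = (if cls n = Some j then ell2_basis n else 0)" for j n
    by (simp add: P_def coord_proj_basis)
  have Pe0: "P j e0 = 0" for j using cls(1)[of 0] by (simp add: e0_def P_basis)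
  have e0n: "cinner e0 e0 = 1" by (simp add: e0_def cinner_ell2_basis)
  have Palle0: "Pall e0 = 0" by (simp add: Pall_apply Pe0)
  have e0P: "cinner e0 (Pall x) = 0" "cinner (Pall x) e0 = 0" for x
    using Pall_sym[of e0 x] Pall_sym[of x e0] by (simp_all add: Palle0)
  have decomp: "x = cinner x e0 *\<^sub>C e0 + Pall x" for x
  proof (rule ell2_eqI)
    fix n
    have "ell2_nth (Pall x) n = (\<Sum>j\<in>UNIV. if cls n = Some j then ell2_nth x n else 0)"
      by (simp add: Pall_apply ell2_nth_sum P_def coord_proj_nth)
    also have "\<dots> = (if n = 0 then 0 else ell2_nth x n)"
    proof (cases "cls n")
      case None
      then show ?thesis using cls(1)[of n] by simp
    next
      case (Some i)
      then show ?thesis using cls(1)[of n] by (simp add: eq_commute[of i])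
    qed
    finally show "ell2_nth x n = ell2_nth (cinner x e0 *\<^sub>C e0 + Pall x) n"
      by (simp add: e0_def cinner_basis_right ell2_nth_basis)
  qed
  obtain q :: "nat \<Rightarrow> complex ^ 'd" where q: "\<And>k. q k \<in> polydisc" and dense: "polydisc \<subseteq> closure (range q)"
    using polydisc_dense_sequence by blast
  have "\<exists>K. (\<forall>j. psd (K j)) \<and> (\<forall>k l. agler_sum (\<lambda>j k. q k $ j) K k l = 1 - \<phi> (q k) * cnj (\<phi> (q l)))"
  proof (rule agler_decomposition)
    show "cmod (q k $ j) < 1" for j k using q[of k] by (simp add: polydisc_def)
    show "1 - \<phi> (q l) * cnj (\<phi> (q k)) = cnj (1 - \<phi> (q k) * cnj (\<phi> (q l)))" for k l
      by (simp add: mult.commute)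
    show "psd (\<lambda>k l. (1 - \<phi> (q k) * cnj (\<phi> (q l))) * G k l)"
      if "psd G" "\<And>j. psd (\<lambda>k l. (1 - q k $ j * cnj (q l $ j)) * G k l)" for G
      by (rule schur_agler_test[OF \<phi> q that])
  qed
  then obtain K where K: "\<And>j. psd (K j)"
    and Ksum: "\<And>k l. agler_sum (\<lambda>j k. q k $ j) K k l = 1 - \<phi> (q k) * cnj (\<phi> (q l))" by blast
  \<comment> \<open>Starting at \<open>Suc i\<close> keeps the basis vector with index
    \<open>loc j 0\<close> orthogonal to all Gram vectors; such a vector later witnesses
    nontriviality.\<close>
  have "\<exists>w. (\<forall>k. \<exists>n c. w k = (\<Sum>i<n. c i *\<^sub>C ell2_basis (loc j (Suc i)))) \<and> (\<forall>k l. cinner (w k) (w l) = K j k l)" for j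
  proof (rule psd_gram_vectors[OF K])
    show "cinner (ell2_basis (loc j (Suc i))) (ell2_basis (loc j (Suc i'))) = (if i = i' then 1 else 0)" for i i'
      using inj_eq[OF loc[of j], of "Suc i" "Suc i'"] by (simp add: cinner_ell2_basis)
  qed
  then obtain w where w: "\<And>j k. \<exists>n c. w j k = (\<Sum>i<n. c i *\<^sub>C ell2_basis (loc j (Suc i)))"
    and wK: "\<And>j k l. cinner (w j k) (w j l) = K j k l" by metis
  have Pw: "P i (w j k) = (if i = j then w j k else 0)" for i j k
  proof -
    obtain n c where "w j k = (\<Sum>i<n. c i *\<^sub>C ell2_basis (loc j (Suc i)))" using w by blast
    then show ?thesis by (simp add: blinfun.sum_right P_scaleC P_basis cls(2))
  qed
  have w0: "cinner (ell2_basis (loc i 0)) (w j k) = 0" for i j k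
  proof -
    obtain n c where wj: "w j k = (\<Sum>i<n. c i *\<^sub>C ell2_basis (loc j (Suc i)))" using w by blast
    have "loc i 0 \<noteq> loc j (Suc m)" for m
    proof
      assume eq: "loc i 0 = loc j (Suc m)"
      then have "i = j" using cls(2)[of i 0] cls(2)[of j "Suc m"] by simp
      then show False using eq inj_eq[OF loc[of j], of 0 "Suc m"] by simp
    qed
    then show ?thesis by (simp add: wj cinner_linear_simps cinner_ell2_basis)
  qed
  define U where "U k = (\<Sum>j\<in>UNIV. w j k)" for k
  have PU: "P j (U k) = w j k" for j k by (simp add: U_def blinfun.sum_right Pw)
  have PallU: "Pall (U k) = U k" for k by (simp add: Pall_apply PU) (simp add: U_def)
  define a where "a k = e0 + \<Delta> (q k) (U k)" for k
  define b where "b k = \<phi> (q k) *\<^sub>C e0 + U k" for k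
  have e0\<Delta>: "cinner e0 (\<Delta> z x) = 0" "cinner (\<Delta> z x) e0 = 0" for z x
    using e0P[of "\<Delta> z x"] by (simp_all add: Pall_\<Delta>)
  have e0U: "cinner e0 (U k) = 0" "cinner (U k) e0 = 0" for k
    using e0P[of "U k"] by (simp_all add: PallU)
  have UU: "cinner (U k) (U l) = (\<Sum>j\<in>UNIV. K j k l)" for k l
  proof -
    have "cinner (\<Delta> 1 (U k)) (\<Delta> 1 (U l)) = (\<Sum>j\<in>UNIV. K j k l)" by (simp add: cinner_\<Delta> PU wK)
    moreover have "\<Delta> 1 (U k) = U k" for k using PallU[of k] by (simp add: \<Delta>_apply flip: Pall_apply)
    ultimately show ?thesis by simp
  qed
  have ab: "cinner (a k) (a l) = cinner (b k) (b l)" for k l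
  proof -
    have "cinner (a k) (a l) = 1 + (\<Sum>j\<in>UNIV. q k $ j * cnj (q l $ j) * K j k l)"
      by (simp add: a_def cinner_add_left cinner_add_right e0\<Delta> e0n cinner_\<Delta> PU wK)
    moreover have "cinner (b k) (b l) = \<phi> (q k) * cnj (\<phi> (q l)) + (\<Sum>j\<in>UNIV. K j k l)"
      by (simp add: b_def cinner_add_left cinner_add_right cinner_scaleC_left cinner_scaleC_right e0U e0n UU)
    moreover have "(\<Sum>j\<in>UNIV. K j k l) - (\<Sum>j\<in>UNIV. q k $ j * cnj (q l $ j) * K j k l) = 1 - \<phi> (q k) * cnj (\<phi> (q l))"
      using Ksum[of k l] by (simp add: agler_sum_def left_diff_distrib sum_subtractf)
    ultimately show ?thesis by (simp add: algebra_simps)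
  qed
  have "psd (\<lambda>k l. cinner (a k) (a l) - cinner (b k) (b l))" by (simp add: ab psd_zero)
  from contraction_extension[OF this] obtain V where V: "V \<in> ops UNIV" "norm V \<le> 1"
    "\<And>k. blinfun_apply V (a k) = b k" "\<And>x. V (op_one (clspan a) x) = V x" by blast
  have Vn: "norm (V x) \<le> norm x" for x
    using norm_blinfun[of V x] mult_right_mono[OF V(2) norm_ge_zero[of x]] by simp
  \<comment> \<open>\<open>u z\<close> has to solve \<open>x = Pall (V (e0 + \<Delta> z x))\<close>;
    \<open>F z\<close> is the operator of this linear equation, coercive with constant
    \<open>1 - maxnorm z\<close>.\<close>
  define F where "F z = id_blinfun - (Pall o\<^sub>L (V o\<^sub>L \<Delta> z))" for z
  have F_apply: "F z x = x - Pall (V (\<Delta> z x))" for z x by (simp add: F_def blinfun.diff_left)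
  have id_ops: "(id_blinfun :: ell2 \<Rightarrow>\<^sub>L ell2) \<in> ops UNIV" by (simp add: ops_UNIV_iff)
  have FM: "F z \<in> ops UNIV" for z
    unfolding F_def by (intro ops_diff[OF hilbert_subspace_UNIV] ops_compose id_ops Pall_ops V \<Delta>_ops)
  have inv: "is_op_inverse UNIV (F z) (op_inverse UNIV (F z))" if z: "z \<in> polydisc" for z
  proof (rule coercive_inverse[OF hilbert_subspace_UNIV FM])
    show "0 < 1 - maxnorm z" using maxnorm_less_1[OF z] by simp
    fix x
    have "norm (Pall (V (\<Delta> z x))) \<le> maxnorm z * norm x"
      using norm_\<Delta>_le[OF cmod_le_maxnorm maxnorm_nonneg, of z x] norm_Pall_le[of "V (\<Delta> z x)"] Vn[of "\<Delta> z x"]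
      by linarith
    then have "norm (Pall (V (\<Delta> z x))) * norm x \<le> maxnorm z * norm x * norm x"
      by (rule mult_right_mono) simp
    moreover have "inner (Pall (V (\<Delta> z x))) x \<le> norm (Pall (V (\<Delta> z x))) * norm x" by (rule norm_cauchy_schwarz)
    ultimately show "(1 - maxnorm z) * (norm x)\<^sup>2 \<le> inner (F z x) x"
      by (simp add: F_apply inner_diff_left power2_norm_eq_inner[symmetric] power2_eq_square algebra_simps)
  qed
  define g where "g = Pall (V e0)"
  define u where "u z = op_inverse UNIV (F z) g" for z
  have u_eq: "u z = Pall (V (e0 + \<Delta> z (u z)))" if z: "z \<in> polydisc" for z
  proof -
    have "F z (u z) = g"
      unfolding u_def by (rule is_op_inverse_apply(1)[OF hilbert_subspace_UNIV inv[OF z]]) simp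
    then have "u z = g + Pall (V (\<Delta> z (u z)))" by (simp add: F_apply algebra_simps)
    then show ?thesis by (simp add: g_def blinfun.add_right)
  qed
  have Pall_u: "Pall (u z) = u z" if "z \<in> polydisc" for z
    using u_eq[OF that] Pall_Pall by metis
  have uq: "u (q k) = U k" for k
  proof -
    have "Pall (V (a k)) = U k"
      by (simp add: V(3) b_def blinfun.add_right ops_scaleC[OF Pall_ops] Palle0 PallU)
    then have "F (q k) (U k) = g"
      by (simp add: F_apply g_def a_def blinfun.add_right) (metis add_diff_cancel_right')
    then show ?thesis
      unfolding u_def using is_op_inverse_apply(2)[OF hilbert_subspace_UNIV inv[OF q[of k]], of "U k"] by simp
  qed
  have \<Delta>_an: "analytic_fun_on \<Delta> polydisc"
    unfolding op_combination_def by (intro analytic_fun_on_sum analytic_fun_on_scaleC analytic_fun_on_nth)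
  have "analytic_fun_on F polydisc"
    unfolding F_def
  proof (intro analytic_fun_on_diff analytic_fun_on_const analytic_fun_on_linear[OF \<Delta>_an])
    show "bounded_linear (\<lambda>A. Pall o\<^sub>L (V o\<^sub>L A))"
      by (intro bounded_linear_compose[OF bounded_bilinear.bounded_linear_right[OF bounded_bilinear_blinfun_compose]
          bounded_bilinear.bounded_linear_right[OF bounded_bilinear_blinfun_compose], unfolded o_def])
    show "Pall o\<^sub>L (V o\<^sub>L (c *\<^sub>C A)) = c *\<^sub>C (Pall o\<^sub>L (V o\<^sub>L A))" for c A
      by (rule blinfun_eqI) (simp add: scaleC_blinfun.rep_eq ops_scaleC[OF V(1)] ops_scaleC[OF Pall_ops])
  qed
  then have "analytic_fun_on (\<lambda>z. op_inverse UNIV (F z)) polydisc"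
    by (intro analytic_fun_on_op_inverse[OF hilbert_subspace_UNIV open_polydisc _ FM inv])
  then have u_an: "analytic_fun_on u polydisc"
    unfolding u_def[abs_def]
    by (rule analytic_fun_on_linear[OF _ blinfun.bounded_linear_left]) (simp add: scaleC_blinfun.rep_eq)
  note cu = analytic_fun_on_continuous[OF u_an] and c\<phi> = analytic_fun_on_continuous[OF an]
  have c\<Delta>u: "continuous_on polydisc (\<lambda>z. \<Delta> z (u z))"
    by (intro bounded_bilinear.continuous_on[OF bounded_bilinear_blinfun_apply] cu analytic_fun_on_continuous[OF \<Delta>_an])
  note cc = bounded_bilinear.continuous_on[OF bounded_bilinear_cinner]
  have rq: "range q \<subseteq> polydisc" using q by auto
  have \<phi>_eq: "cinner (V (e0 + \<Delta> z (u z))) e0 = \<phi> z" if z: "z \<in> polydisc" for z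
  proof (rule continuous_eq_on_dense[OF _ c\<phi> rq dense _ z])
    show "continuous_on polydisc (\<lambda>z. cinner (V (e0 + \<Delta> z (u z))) e0)"
      by (intro cc continuous_intros c\<Delta>u)
    show "cinner (V (e0 + \<Delta> (q k) (u (q k)))) e0 = \<phi> (q k)" for k
      using V(3)[of k] by (simp add: uq a_def b_def cinner_add_left cinner_scaleC_left e0n e0U)
  qed
  \<comment> \<open>The isometry identity involves two points, so density is used twice, here with
    the second point still a node.\<close>
  have iso1: "1 + cinner (\<Delta> z (u z)) (\<Delta> (q l) (u (q l))) = \<phi> z * cnj (\<phi> (q l)) + cinner (u z) (u (q l))"
    if z: "z \<in> polydisc" for z l
  proof (rule continuous_eq_on_dense[where q = q and S = polydisc and z = z])
    show "range q \<subseteq> polydisc" "polydisc \<subseteq> closure (range q)" "z \<in> polydisc" by (fact rq dense z)+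
    show "1 + cinner (\<Delta> (q k) (u (q k))) (\<Delta> (q l) (u (q l))) = \<phi> (q k) * cnj (\<phi> (q l)) + cinner (u (q k)) (u (q l))" for k
      using ab[of k l]
      by (simp add: uq a_def b_def cinner_add_left cinner_add_right cinner_scaleC_left cinner_scaleC_right e0n e0U e0\<Delta>)
  qed (intro cc continuous_intros c\<Delta>u cu c\<phi>)+
  have iso: "1 + cinner (\<Delta> z (u z)) (\<Delta> w (u w)) = \<phi> z * cnj (\<phi> w) + cinner (u z) (u w)"
    if z: "z \<in> polydisc" and w: "w \<in> polydisc" for z w
  proof (rule continuous_eq_on_dense[where q = q and S = polydisc and z = w])
    show "range q \<subseteq> polydisc" "polydisc \<subseteq> closure (range q)" "w \<in> polydisc" by (fact rq dense w)+
    show "1 + cinner (\<Delta> z (u z)) (\<Delta> (q k) (u (q k))) = \<phi> z * cnj (\<phi> (q k)) + cinner (u z) (u (q k))" for k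
      by (rule iso1[OF z])
  qed (intro cc continuous_intros c\<Delta>u cu c\<phi>)+
  have "colligation P e0 V u \<phi> \<tau>"
  proof
    show "norm e0 = 1" using e0n cinner_self[of e0] norm_ge_zero[of e0]
      by (metis abs_norm_cancel abs_square_eq_1 of_real_eq_1_iff)
    show "V x = cinner (V x) e0 *\<^sub>C e0 + Pall (V x)" for x by (rule decomp)
    show "V (e0 + \<Delta> z (u z)) = \<phi> z *\<^sub>C e0 + u z" if z: "z \<in> polydisc" for z
      using decomp[of "V (e0 + \<Delta> z (u z))"] \<phi>_eq[OF z] u_eq[OF z] by metis
    \<comment> \<open>A spare basis vector of an arbitrary class. It is orthogonal to every
      \<open>a k\<close>, and \<open>V\<close> vanishes off \<open>clspan a\<close>, so
      \<open>V (\<Delta> \<tau> x)\<close>, a multiple of \<open>V x\<close>, is zero.\<close>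
    define x where "x = ell2_basis (loc undefined 0)"
    have Px: "P j x = (if j = undefined then x else 0)" for j by (auto simp: x_def P_basis cls(2))
    have "Pall x = x" by (simp add: Pall_apply Px)
    moreover have "x \<noteq> 0" using cinner_ell2_basis[of "loc undefined 0" "loc undefined 0"] by (auto simp: x_def)
    moreover have "V (\<Delta> \<tau> x) = 0"
    proof -
      have \<Delta>x: "\<Delta> \<tau> x = \<tau> $ undefined *\<^sub>C x"
        by (simp add: \<Delta>_apply Px if_distrib[of "\<lambda>x. _ *\<^sub>C x"] cong: if_cong)
      have "cinner (a k) x = 0" for k
      proof -
        have "cinner x (\<Delta> (q k) (U k)) = 0"
          by (simp add: \<Delta>_apply cinner_sum_right cinner_scaleC_right PU x_def w0)
        moreover have "cinner x e0 = 0" using e0P(2)[of x] \<open>Pall x = x\<close> by simp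
        ultimately have "cinner x (a k) = 0" by (simp add: a_def cinner_add_right)
        then show ?thesis by (metis cinner_commute complex_cnj_zero)
      qed
      moreover have "hilbert_subspace {y. cinner y x = 0}"
      proof -
        have "closed {y. cinner y x = 0}" by (intro closed_Collect_eq cc continuous_intros)
        then show ?thesis
          unfolding hilbert_subspace_def subspace_def
          by (auto simp: cinner_add_left cinner_scaleC_left scaleR_scaleC[of _ "_ :: ell2"])
      qed
      ultimately have sub: "clspan a \<subseteq> {y. cinner y x = 0}" by (intro clspan_minimal) auto
      have "cinner x y = 0" if "y \<in> clspan a" for y
        using sub that by (metis (mono_tags, lifting) cinner_commute complex_cnj_zero mem_Collect_eq subset_iff)
      then have "op_one (clspan a) x = 0"
        using op_one_in_ops[OF hilbert_subspace_clspan, of a] by (auto simp: ops_def)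
      then have "V x = 0" using V(4)[of x] by (simp add: blinfun.zero_right)
      then show ?thesis by (simp add: \<Delta>x ops_scaleC[OF V(1)])
    qed
    ultimately show "\<exists>x. Pall x = x \<and> x \<noteq> 0 \<and> V (\<Delta> \<tau> x) = 0" by blast
  qed (fact Pe0 V \<tau> cara u_an iso Pall_u)+
  then show ?thesis by blast
qed

theorem theorem1p12:
  fixes \<phi> :: "complex ^ 'd \<Rightarrow> complex" and \<tau> :: "complex ^ 'd"
  assumes "\<tau> \<in> torus"
    and "\<phi> \<in> schur_agler TYPE(ell2)"
    and "carapoint \<tau> \<phi>"
  shows "\<exists>(M :: ell2 set) u I.
    desingularized_model \<phi> \<tau> M u I \<and>
    (\<exists>Y :: 'd \<Rightarrow> ell2 \<Rightarrow>\<^sub>L ell2.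
      (\<forall>j. positive_op M (Y j) \<and> contraction M (Y j)) \<and>
      (\<Sum>j\<in>UNIV. Y j) = op_one M \<and>
      (\<forall>z\<in>polydisc.
        op_invertible M (op_combination (\<chi> j. 1 / (1 - cnj (\<tau> $ j) * z $ j)) Y) \<and>
        I z = op_one M - op_inverse M (op_combination (\<chi> j. 1 / (1 - cnj (\<tau> $ j) * z $ j)) Y))) \<and>
    (\<forall>p\<in>torus. (\<forall>j. p $ j \<noteq> \<tau> $ j) \<longrightarrow>
      (\<exists>A. extends_analytically_with_value M I p A \<and> norm A = 1))"
proof -
  obtain P :: "'d \<Rightarrow> ell2 \<Rightarrow>\<^sub>L ell2" and e0 V u where "colligation P e0 V u \<phi> \<tau>"
    using schur_agler_colligation[OF assms] by blast
  then interpret colligation P e0 V u \<phi> \<tau> .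
  show ?thesis
  proof (intro exI[of _ M] exI[of _ um] exI[of _ I] exI[of _ Y] conjI allI ballI impI)
    show "desingularized_model \<phi> \<tau> M um I"
      by (rule desingularized_model[OF separable_hilbert_subspace[OF M_subspace]])
    show "positive_op M (Y j)" "contraction M (Y j)" for j by (rule Y_positive_contraction)+
    show "(\<Sum>j\<in>UNIV. Y j) = op_one M" by (rule sum_Y)
    show "op_invertible M (op_combination (\<chi> j. 1 / (1 - cnj (\<tau> $ j) * z $ j)) Y)" if "z \<in> polydisc" for z
      using invertible_comb[OF that] by (simp add: zet_def)
    show "I z = op_one M - op_inverse M (op_combination (\<chi> j. 1 / (1 - cnj (\<tau> $ j) * z $ j)) Y)" for z
      by (simp add: I_def B_def zet_def)
    show "\<exists>A. extends_analytically_with_value M I p A \<and> norm A = 1"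
      if "p \<in> torus" "\<forall>j. p $ j \<noteq> \<tau> $ j" for p
      using I_extends[of p] that by blast
  qed
qed

end
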